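(* Let $p,q\ge1$, $n=p+q$, and let $\gamma$ be a $(p,q)$-clan. The following are equivalent: (1) the orbit closure $Y_\gamma$ is smooth at the point $V^{v_\gamma}_\bullet$; (2) $\gamma$ has exactly one BPD fragment; (3) $\gamma$ avoids the following five patterns: the $4$-node clan with arc $(1,4)$, node $2$ labelled $+$, node $3$ labelled $-$; the $5$-node clan with arcs $(1,5),(3,4)$ and node $2$ labelled $+$; the $5$-node clan with arcs $(1,5),(2,3)$ and node $4$ labelled $-$; the $6$-node clan with arcs $(1,6),(2,3),(4,5)$; the $6$-node clan with arcs $(1,6),(2,4),(3,5)$.
   Context: Clans: a $(p,q)$-clan has nodes $1,\ldots,n$, a set of pairwise disjoint pairs $(i,j)$, $i<j$ (arcs; $i$ left endpoint, $j$ right endpoint), and a sign $\pm$ on each node not on an arc, with $\#\{+\}-\#\{-\}=p-q$. A clan $\gamma$ contains a clan $\sigma$ as a pattern if there is a set $S$ of nodes of $\gamma$, containing either both or neither endpoint of each arc of $\gamma$, such that the nodes of $S$, in order and with the arcs and signs of $\gamma$ among them, form $\sigma$; otherwise $\gamma$ avoids $\sigma$. $v_\gamma\in S_n$: label nodes that are $+$ or left endpoints by $1,\ldots,p$ left to right, and nodes that are $-$ or right endpoints by $p+1,\ldots,n$ left to right; $v_\gamma(i)$ = label of node $i$. Geometry: $Fl_n=GL_n/B$ ($B$ upper triangular), $K=GL_p\times GL_q$ block-diagonal in $GL_n$. For $u\in S_n$, $V^u_\bullet$ is the flag with $V^u_i=\mathrm{span}(e_{u(1)},\ldots,e_{u(i)})$.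 For $\gamma$, the flag $V^\gamma_\bullet$ has $V^\gamma_i=V^\gamma_{i-1}\oplus\mathbb{C}\mathbf{v}_i$ with $\mathbf{v}_i=e_{v_\gamma(i)}+e_{v_\gamma(j)}$ if $(i,j)$ is an arc and $\mathbf{v}_i=e_{v_\gamma(i)}$ otherwise; $Y_\gamma$ is the closure of the $K$-orbit of $V^\gamma_\bullet$. BPD fragments: boxes $(i,j)$ of the $p\times q$ rectangle, row $i$ from top, column $j$ from left. Take the lattice path from the NE to the SW corner whose $k$-th step is down if node $k$ is $+$ or a left endpoint and left otherwise; $\lambda(\gamma)$ is the set of boxes northwest of it, and its $k$-th step is the $k$-th boundary edge. A BPD fragment of $\gamma$ fills each box of $\lambda(\gamma)$ with one of six tiles (empty; horizontal segment; vertical segment; cross; elbow joining west and north edges; elbow joining south and east edges) so that segments match across edges shared by boxes of $\lambda(\gamma)$; no segment touches the north edge of a row-1 box or the west edge of a column-1 box; hence each pipe joins two boundary edges, entering through a horizontal edge and leaving through a vertical one; any two pipes cross at most once; and boundary edges $k<l$ are joined by a pipe iff $(k,l)$ is an arc of $\gamma$. *)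

theory Defs
  imports
    "HOL-Analysis.Abstract_Topology"
    "HOL-Library.Extended_Nat"
    "HOL-Library.Function_Algebras"
    "Jordan_Normal_Form.VS_Connect"
begin

section \<open>Clans\<close>

record clan =
  nodes :: nat
  arcs :: "(nat \<times> nat) set"
  pluses :: "nat set"
  minuses :: "nat set"

definition left_ends :: "clan \<Rightarrow> nat set" where
  "left_ends \<gamma> = fst ` arcs \<gamma>"

definition right_ends :: "clan \<Rightarrow> nat set" where
  "right_ends \<gamma> = snd ` arcs \<gamma>"

definition is_clan :: "nat \<Rightarrow> nat \<Rightarrow> clan \<Rightarrow> bool" where
  "is_clan p q \<gamma> \<longleftrightarrow>
     nodes \<gamma> = p + q \<and>
     (\<forall>(i, j)\<in>arcs \<gamma>. 1 \<le> i \<and> i < j \<and> j \<le> nodes \<gamma>) \<and>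
     pairwise (\<lambda>a b. disjnt {fst a, snd a} {fst b, snd b}) (arcs \<gamma>) \<and>
     pluses \<gamma> \<inter> minuses \<gamma> = {} \<and>
     pluses \<gamma> \<union> minuses \<gamma> = {1..nodes \<gamma>} - (left_ends \<gamma> \<union> right_ends \<gamma>) \<and>
     int (card (pluses \<gamma>)) - int (card (minuses \<gamma>)) = int p - int q"

definition rank_in :: "nat set \<Rightarrow> nat \<Rightarrow> nat" where
  "rank_in S x = card {y\<in>S. y \<le> x}"

text \<open>The clan formed by the nodes in \<open>S\<close>, renumbered increasingly as \<open>1, \<dots>, card S\<close>.\<close>

definition induced_clan :: "clan \<Rightarrow> nat set \<Rightarrow> clan" where
  "induced_clan \<gamma> S =
     \<lparr> nodes = card S,
       arcs = {(rank_in S i, rank_in S j) | i j. (i, j) \<in> arcs \<gamma> \<and> i \<in> S \<and> j \<in> S},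
       pluses = rank_in S ` (pluses \<gamma> \<inter> S),
       minuses = rank_in S ` (minuses \<gamma> \<inter> S) \<rparr>"

definition contains_pattern :: "clan \<Rightarrow> clan \<Rightarrow> bool" where
  "contains_pattern \<gamma> \<sigma> \<longleftrightarrow>
     (\<exists>S \<subseteq> {1..nodes \<gamma>}.
        (\<forall>(i, j)\<in>arcs \<gamma>. i \<in> S \<longleftrightarrow> j \<in> S) \<and> induced_clan \<gamma> S = \<sigma>)"

abbreviation avoids :: "clan \<Rightarrow> clan \<Rightarrow> bool" where
  "avoids \<gamma> \<sigma> \<equiv> \<not> contains_pattern \<gamma> \<sigma>"

definition five_patterns :: "clan set" where
  "five_patterns =
     { \<lparr> nodes = 4, arcs = {(1, 4)}, pluses = {2}, minuses = {3} \<rparr>,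
       \<lparr> nodes = 5, arcs = {(1, 5), (3, 4)}, pluses = {2}, minuses = {} \<rparr>,
       \<lparr> nodes = 5, arcs = {(1, 5), (2, 3)}, pluses = {}, minuses = {4} \<rparr>,
       \<lparr> nodes = 6, arcs = {(1, 6), (2, 3), (4, 5)}, pluses = {}, minuses = {} \<rparr>,
       \<lparr> nodes = 6, arcs = {(1, 6), (2, 4), (3, 5)}, pluses = {}, minuses = {} \<rparr> }"

text \<open>In a \<open>(p, q)\<close>-clan there are \<open>p\<close> nodes that are \<open>+\<close> or left endpoints
  and \<open>q\<close> nodes that are \<open>-\<close> or right endpoints.\<close>

definition down_nodes :: "clan \<Rightarrow> nat set" where
  "down_nodes \<gamma> = pluses \<gamma> \<union> left_ends \<gamma>"

definition clan_perm :: "nat \<Rightarrow> clan \<Rightarrow> nat \<Rightarrow> nat" where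
  "clan_perm p \<gamma> i =
     (if i \<in> down_nodes \<gamma> then card {k \<in> down_nodes \<gamma>. k \<le> i}
      else p + card {k \<in> {1..nodes \<gamma>} - down_nodes \<gamma>. k \<le> i})"


section \<open>Affine varieties and smoothness\<close>

text \<open>The affine space with coordinates indexed by a (finite) set \<open>I\<close> consists of the functions
  vanishing off \<open>I\<close>. As the ground field is infinite, polynomials are identified with
  polynomial functions.\<close>

definition affine_space :: "'i set \<Rightarrow> ('i \<Rightarrow> complex) set" where
  "affine_space I = {x. \<forall>i. i \<notin> I \<longrightarrow> x i = 0}"

inductive_set poly_funs :: "'i set \<Rightarrow> (('i \<Rightarrow> complex) \<Rightarrow> complex) set" for I :: "'i set" where
  const: "(\<lambda>x. c) \<in> poly_funs I"
| coord: "i \<in> I \<Longrightarrow> (\<lambda>x. x i) \<in> poly_funs I"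
| add: "f \<in> poly_funs I \<Longrightarrow> g \<in> poly_funs I \<Longrightarrow> (\<lambda>x. f x + g x) \<in> poly_funs I"
| mult: "f \<in> poly_funs I \<Longrightarrow> g \<in> poly_funs I \<Longrightarrow> (\<lambda>x. f x * g x) \<in> poly_funs I"

definition zariski :: "'i set \<Rightarrow> ('i \<Rightarrow> complex) topology" where
  "zariski I = topology (\<lambda>U. \<exists>F \<subseteq> poly_funs I. U = {x \<in> affine_space I. \<exists>f\<in>F. f x \<noteq> 0})"

lemma istopology_zariski:
  "istopology (\<lambda>U. \<exists>F \<subseteq> poly_funs I. U = {x \<in> affine_space I. \<exists>f\<in>F. f x \<noteq> 0})"
proof -
  define D where "D F = {x \<in> affine_space I. \<exists>f\<in>F. f x \<noteq> 0}"
    for F :: "(('a \<Rightarrow> complex) \<Rightarrow> complex) set"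
  have Int: "\<exists>H \<subseteq> poly_funs I. D F \<inter> D G = D H"
    if "F \<subseteq> poly_funs I" "G \<subseteq> poly_funs I" for F G
  proof (intro exI conjI)
    let ?H = "(\<lambda>(f, g) x. f x * g x) ` (F \<times> G)"
    show "?H \<subseteq> poly_funs I"
      using that by (auto intro!: poly_funs.mult)
    have "(\<exists>h\<in>?H. h x \<noteq> 0) \<longleftrightarrow> (\<exists>f\<in>F. f x \<noteq> 0) \<and> (\<exists>g\<in>G. g x \<noteq> 0)" for x
      unfolding bex_simps(7) by force
    then show "D F \<inter> D G = D ?H"
      unfolding D_def by auto
  qed
  have Union: "\<exists>H \<subseteq> poly_funs I. \<Union>\<K> = D H"
    if \<K>: "\<forall>K\<in>\<K>. \<exists>F \<subseteq> poly_funs I. K = D F" for \<K>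
  proof (intro exI conjI)
    let ?H = "\<Union>{F. F \<subseteq> poly_funs I \<and> D F \<in> \<K>}"
    show "?H \<subseteq> poly_funs I"
      by blast
    have "D ?H = \<Union>(D ` {F. F \<subseteq> poly_funs I \<and> D F \<in> \<K>})"
      unfolding D_def by blast
    also have "D ` {F. F \<subseteq> poly_funs I \<and> D F \<in> \<K>} = \<K>"
    proof (rule Set.set_eqI, rule iffI)
      fix K assume "K \<in> \<K>"
      then obtain F where "F \<subseteq> poly_funs I" "K = D F"
        using bspec[OF \<K>, of K] by auto
      with \<open>K \<in> \<K>\<close> show "K \<in> D ` {F. F \<subseteq> poly_funs I \<and> D F \<in> \<K>}"
        by simp
    qed auto
    finally show "\<Union>\<K> = D ?H" ..
  qed
  show ?thesis
    unfolding istopology_def D_def[symmetric]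
  proof (intro conjI allI impI)
    fix S T
    assume "\<exists>F \<subseteq> poly_funs I. S = D F" "\<exists>F \<subseteq> poly_funs I. T = D F"
    then show "\<exists>F \<subseteq> poly_funs I. S \<inter> T = D F"
      by (elim exE conjE) (simp only: Int)
  qed (rule Union)
qed

lemma openin_zariski:
  "openin (zariski I) U \<longleftrightarrow>
     (\<exists>F \<subseteq> poly_funs I. U = {x \<in> affine_space I. \<exists>f\<in>F. f x \<noteq> 0})"
  by (simp add: zariski_def istopology_zariski)

lemma topspace_zariski: "topspace (zariski I) = affine_space I"
proof -
  have "openin (zariski I) (affine_space I)"
    unfolding openin_zariski
    by (rule exI[of _ "{\<lambda>x. 1}"]) (auto intro: poly_funs.const)
  moreover have "U \<subseteq> affine_space I" if "openin (zariski I) U" for U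
    using that unfolding openin_zariski by blast
  ultimately show ?thesis
    by (metis openin_subset openin_topspace subset_antisym)
qed

definition irreducible_in :: "'a topology \<Rightarrow> 'a set \<Rightarrow> bool" where
  "irreducible_in T Z \<longleftrightarrow>
     Z \<noteq> {} \<and> (\<forall>A B. closedin T A \<and> closedin T B \<and> Z \<subseteq> A \<union> B \<longrightarrow> Z \<subseteq> A \<or> Z \<subseteq> B)"

text \<open>The supremum of the lengths of chains of irreducible closed sets through \<open>x\<close>, i.e. the
  Krull dimension of the local ring at \<open>x\<close>.\<close>

definition local_dim :: "'a topology \<Rightarrow> 'a \<Rightarrow> enat" where
  "local_dim T x =
     (SUP d \<in> {d. \<exists>Z. (\<forall>i\<le>d. closedin T (Z i) \<and> irreducible_in T (Z i) \<and> x \<in> Z i) \<and>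
                      (\<forall>i<d. Z i \<subset> Z (Suc i))}. enat d)"

text \<open>The Zariski tangent space of \<open>X\<close> at \<open>x\<close>: the common kernel of the differentials at \<open>x\<close>
  (here expressed by directional derivatives) of all polynomials vanishing on \<open>X\<close>.\<close>

definition tangent_space :: "'i set \<Rightarrow> ('i \<Rightarrow> complex) set \<Rightarrow> ('i \<Rightarrow> complex) \<Rightarrow> ('i \<Rightarrow> complex) set" where
  "tangent_space I X x =
     {d \<in> affine_space I. \<forall>f \<in> poly_funs I. (\<forall>y\<in>X. f y = 0) \<longrightarrow>
        ((\<lambda>t. f (\<lambda>i. x i + t * d i)) has_field_derivative 0) (at 0)}"

definition fun_scale :: "complex \<Rightarrow> ('i \<Rightarrow> complex) \<Rightarrow> 'i \<Rightarrow> complex" where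
  "fun_scale c x = (\<lambda>i. c * x i)"

lemma vector_space_fun_scale: "vector_space fun_scale"
  by unfold_locales (auto simp: fun_scale_def algebra_simps)

definition affine_smooth_at :: "'i set \<Rightarrow> ('i \<Rightarrow> complex) set \<Rightarrow> ('i \<Rightarrow> complex) \<Rightarrow> bool" where
  "affine_smooth_at I X x \<longleftrightarrow>
     x \<in> X \<and>
     enat (vector_space.dim fun_scale (tangent_space I X x)) =
       local_dim (subtopology (zariski I) X) x"


section \<open>The flag variety\<close>

definition vspan :: "nat \<Rightarrow> complex vec set \<Rightarrow> complex vec set" where
  "vspan n S = LinearCombinations.module.span class_ring (module_vec TYPE(complex) n) S"

text \<open>The flag \<open>V\<^sub>0 \<subseteq> V\<^sub>1 \<subseteq> \<dots> \<subseteq> V\<^sub>n\<close> whose \<open>i\<close>-th space is spanned by the first \<open>i\<close> vectors of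
  a basis (constant from index \<open>n\<close> on).\<close>

definition flag_of_basis :: "nat \<Rightarrow> complex vec list \<Rightarrow> nat \<Rightarrow> complex vec set" where
  "flag_of_basis n vs i = vspan n (set (take i vs))"

definition GL :: "nat \<Rightarrow> complex mat set" where
  "GL n = {g \<in> carrier_mat n n. invertible_mat g}"

text \<open>The quotient map from \<open>GL n\<close> to \<open>GL n / B\<close>: the fibres of \<open>flag_of n\<close> are the cosets \<open>g B\<close>.\<close>

definition flag_of :: "nat \<Rightarrow> complex mat \<Rightarrow> nat \<Rightarrow> complex vec set" where
  "flag_of n g = flag_of_basis n (cols g)"

definition Fl :: "nat \<Rightarrow> (nat \<Rightarrow> complex vec set) set" where
  "Fl n = flag_of n ` GL n"

definition entries :: "nat \<Rightarrow> complex mat \<Rightarrow> nat \<times> nat \<Rightarrow> complex" where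
  "entries n g = (\<lambda>(i, j). if i < n \<and> j < n then g $$ (i, j) else 0)"

definition GL_topology :: "nat \<Rightarrow> complex mat topology" where
  "GL_topology n = pullback_topology (GL n) (entries n) (zariski ({..<n} \<times> {..<n}))"

text \<open>The Zariski topology of the flag variety is the quotient topology.\<close>

definition flag_topology :: "nat \<Rightarrow> (nat \<Rightarrow> complex vec set) topology" where
  "flag_topology n =
     topology (\<lambda>U. U \<subseteq> Fl n \<and> openin (GL_topology n) {g \<in> GL n. flag_of n g \<in> U})"

lemma istopology_flag_topology:
  "istopology (\<lambda>U. U \<subseteq> Fl n \<and> openin (GL_topology n) {g \<in> GL n. flag_of n g \<in> U})"
  unfolding istopology_def
proof (intro conjI allI impI; (elim conjE)?)
  fix S T
  assume "openin (GL_topology n) {g \<in> GL n. flag_of n g \<in> S}"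
    and "openin (GL_topology n) {g \<in> GL n. flag_of n g \<in> T}"
  then have "openin (GL_topology n)
      ({g \<in> GL n. flag_of n g \<in> S} \<inter> {g \<in> GL n. flag_of n g \<in> T})"
    by (rule openin_Int)
  moreover have "{g \<in> GL n. flag_of n g \<in> S} \<inter> {g \<in> GL n. flag_of n g \<in> T} =
      {g \<in> GL n. flag_of n g \<in> S \<inter> T}"
    by blast
  ultimately show "openin (GL_topology n) {g \<in> GL n. flag_of n g \<in> S \<inter> T}"
    by simp
next
  fix \<K>
  assume "\<forall>K\<in>\<K>. K \<subseteq> Fl n \<and> openin (GL_topology n) {g \<in> GL n. flag_of n g \<in> K}"
  then have "openin (GL_topology n) (\<Union>K\<in>\<K>. {g \<in> GL n. flag_of n g \<in> K})"
    by (intro openin_Union) blast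
  moreover have "(\<Union>K\<in>\<K>. {g \<in> GL n. flag_of n g \<in> K}) = {g \<in> GL n. flag_of n g \<in> \<Union>\<K>}"
    by blast
  ultimately show "openin (GL_topology n) {g \<in> GL n. flag_of n g \<in> \<Union>\<K>}"
    by simp
qed blast+

lemma openin_flag_topology:
  "openin (flag_topology n) U \<longleftrightarrow>
     U \<subseteq> Fl n \<and> openin (GL_topology n) {g \<in> GL n. flag_of n g \<in> U}"
  by (simp add: flag_topology_def istopology_flag_topology)

text \<open>Lower unitriangular matrices parametrize, by \<open>x \<mapsto> g U(x) B\<close>, an open neighbourhood of
  \<open>g B\<close> in the flag variety which is isomorphic to an affine space (a translate of the opposite
  big cell). A closed subset is smooth at \<open>g B\<close> if its intersection with this affine chart is a
  smooth affine variety at the origin. The choice of the coset representative \<open>g\<close> is immaterial.\<close>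

definition chart_indices :: "nat \<Rightarrow> (nat \<times> nat) set" where
  "chart_indices n = {(i, j). j < i \<and> i < n}"

definition unilower :: "nat \<Rightarrow> (nat \<times> nat \<Rightarrow> complex) \<Rightarrow> complex mat" where
  "unilower n x = mat n n (\<lambda>(i, j). if i = j then 1 else if j < i then x (i, j) else 0)"

definition smooth_at :: "nat \<Rightarrow> (nat \<Rightarrow> complex vec set) set \<Rightarrow> (nat \<Rightarrow> complex vec set) \<Rightarrow> bool" where
  "smooth_at n Y V \<longleftrightarrow>
     (\<exists>g \<in> GL n. flag_of n g = V \<and>
        affine_smooth_at (chart_indices n)
          {x \<in> affine_space (chart_indices n). flag_of n (g * unilower n x) \<in> Y} (\<lambda>_. 0))"


section \<open>Orbit closures\<close>

text \<open>The library numbers coordinates from \<open>0\<close>.\<close>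

definition basis_vec :: "nat \<Rightarrow> nat \<Rightarrow> complex vec" where
  "basis_vec n k = unit_vec n (k - 1)"

definition perm_flag :: "nat \<Rightarrow> (nat \<Rightarrow> nat) \<Rightarrow> nat \<Rightarrow> complex vec set" where
  "perm_flag n u = flag_of_basis n (map (\<lambda>i. basis_vec n (u i)) [1..<Suc n])"

definition clan_vec :: "nat \<Rightarrow> nat \<Rightarrow> clan \<Rightarrow> nat \<Rightarrow> complex vec" where
  "clan_vec p q \<gamma> i =
     (if i \<in> left_ends \<gamma>
      then basis_vec (p + q) (clan_perm p \<gamma> i) +
           basis_vec (p + q) (clan_perm p \<gamma> (THE j. (i, j) \<in> arcs \<gamma>))
      else basis_vec (p + q) (clan_perm p \<gamma> i))"

definition clan_flag :: "nat \<Rightarrow> nat \<Rightarrow> clan \<Rightarrow> nat \<Rightarrow> complex vec set" where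
  "clan_flag p q \<gamma> = flag_of_basis (p + q) (map (clan_vec p q \<gamma>) [1..<Suc (p + q)])"

definition block_diag_group :: "nat \<Rightarrow> nat \<Rightarrow> complex mat set" where
  "block_diag_group p q =
     {four_block_mat a (0\<^sub>m p q) (0\<^sub>m q p) d | a d. a \<in> GL p \<and> d \<in> GL q}"

definition flag_act :: "complex mat \<Rightarrow> (nat \<Rightarrow> complex vec set) \<Rightarrow> nat \<Rightarrow> complex vec set" where
  "flag_act k V i = (\<lambda>v. k *\<^sub>v v) ` V i"

definition orbit_closure :: "nat \<Rightarrow> nat \<Rightarrow> clan \<Rightarrow> (nat \<Rightarrow> complex vec set) set" where
  "orbit_closure p q \<gamma> =
     flag_topology (p + q) closure_of
       {flag_act k (clan_flag p q \<gamma>) | k. k \<in> block_diag_group p q}"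


section \<open>BPD fragments\<close>

text \<open>After \<open>k\<close> steps the lattice path has reached the lattice point \<open>path_row \<gamma> k\<close> units below the
  north side and \<open>path_col q \<gamma> k\<close> units right of the west side of the rectangle.\<close>

definition path_row :: "clan \<Rightarrow> nat \<Rightarrow> nat" where
  "path_row \<gamma> k = card {m \<in> {1..k}. m \<in> down_nodes \<gamma>}"

definition path_col :: "nat \<Rightarrow> clan \<Rightarrow> nat \<Rightarrow> nat" where
  "path_col q \<gamma> k = q - card {m \<in> {1..k}. m \<notin> down_nodes \<gamma>}"

text \<open>A box is northwest of the path iff its SE corner is weakly northwest of a point of the path.\<close>

definition clan_shape :: "nat \<Rightarrow> nat \<Rightarrow> clan \<Rightarrow> (nat \<times> nat) set" where
  "clan_shape p q \<gamma> =
     {(i, j). 1 \<le> i \<and> i \<le> p \<and> 1 \<le> j \<and> j \<le> q \<and>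
        (\<exists>k \<le> p + q. i \<le> path_row \<gamma> k \<and> j \<le> path_col q \<gamma> k)}"

text \<open>\<open>HEdge i j\<close> is the south edge of box \<open>(i, j)\<close>, and \<open>VEdge i j\<close> is its east edge.\<close>

datatype edge = HEdge nat nat | VEdge nat nat

datatype side = North | East | South | West

fun side_edge :: "nat \<times> nat \<Rightarrow> side \<Rightarrow> edge" where
  "side_edge (i, j) South = HEdge i j"
| "side_edge (i, j) North = HEdge (i - 1) j"
| "side_edge (i, j) East = VEdge i j"
| "side_edge (i, j) West = VEdge i (j - 1)"

definition boundary_edge :: "nat \<Rightarrow> clan \<Rightarrow> nat \<Rightarrow> edge" where
  "boundary_edge q \<gamma> k =
     (if k \<in> down_nodes \<gamma> then VEdge (path_row \<gamma> k) (path_col q \<gamma> k)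
      else HEdge (path_row \<gamma> k) (Suc (path_col q \<gamma> k)))"

datatype tile = Blank | Horizontal | Vertical | Cross | Elbow_WN | Elbow_SE

text \<open>The strands of a tile, directed as pipes are traversed: coming from the south or west and
  going to the north or east.\<close>

fun strands :: "tile \<Rightarrow> (side \<times> side) set" where
  "strands Blank = {}"
| "strands Horizontal = {(West, East)}"
| "strands Vertical = {(South, North)}"
| "strands Cross = {(West, East), (South, North)}"
| "strands Elbow_WN = {(West, North)}"
| "strands Elbow_SE = {(South, East)}"

definition touches :: "tile \<Rightarrow> side \<Rightarrow> bool" where
  "touches t s \<longleftrightarrow> (\<exists>s'. (s, s') \<in> strands t \<or> (s', s) \<in> strands t)"

type_synonym filling = "nat \<times> nat \<Rightarrow> tile option"

definition pipe_step :: "filling \<Rightarrow> (edge \<times> edge) set" where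
  "pipe_step T =
     {(side_edge b s, side_edge b s') | b t s s'. T b = Some t \<and> (s, s') \<in> strands t}"

text \<open>The edges on the pipe that enters at boundary edge \<open>l\<close> (only \<open>l\<close> itself if there is none).\<close>

definition pipe_edges :: "nat \<Rightarrow> clan \<Rightarrow> filling \<Rightarrow> nat \<Rightarrow> edge set" where
  "pipe_edges q \<gamma> T l = (pipe_step T)\<^sup>* `` {boundary_edge q \<gamma> l}"

definition crossings :: "nat \<Rightarrow> clan \<Rightarrow> filling \<Rightarrow> nat \<Rightarrow> nat \<Rightarrow> (nat \<times> nat) set" where
  "crossings q \<gamma> T l m =
     {b. T b = Some Cross \<and>
         (side_edge b West \<in> pipe_edges q \<gamma> T l \<and> side_edge b South \<in> pipe_edges q \<gamma> T m \<or>
          side_edge b West \<in> pipe_edges q \<gamma> T m \<and> side_edge b South \<in> pipe_edges q \<gamma> T l)}"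

definition bpd_fragment :: "nat \<Rightarrow> nat \<Rightarrow> clan \<Rightarrow> filling \<Rightarrow> bool" where
  "bpd_fragment p q \<gamma> T \<longleftrightarrow>
     dom T = clan_shape p q \<gamma> \<and>
     (\<forall>i j t t'. T (i, j) = Some t \<and> T (i, Suc j) = Some t' \<longrightarrow>
        (touches t East \<longleftrightarrow> touches t' West)) \<and>
     (\<forall>i j t t'. T (i, j) = Some t \<and> T (Suc i, j) = Some t' \<longrightarrow>
        (touches t South \<longleftrightarrow> touches t' North)) \<and>
     (\<forall>j t. T (1, j) = Some t \<longrightarrow> \<not> touches t North) \<and>
     (\<forall>i t. T (i, 1) = Some t \<longrightarrow> \<not> touches t West) \<and>
     (\<forall>l m. 1 \<le> l \<and> l < m \<and> m \<le> p + q \<longrightarrow> card (crossings q \<gamma> T l m) \<le> 1) \<and>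
     (\<forall>k l. 1 \<le> k \<and> k < l \<and> l \<le> p + q \<longrightarrow>
        (boundary_edge q \<gamma> k \<in> pipe_edges q \<gamma> T l \<longleftrightarrow> (k, l) \<in> arcs \<gamma>))"

end

theory Submission
  imports Defs
begin

text \<open>After conjugation by the permutation matrix of \<open>v\<^sub>\<gamma>\<close>, the group \<open>GL\<^sub>p \<times> GL\<^sub>q\<close> consists of the
  matrices whose entries between a node that is \<open>+\<close> or a left endpoint and a node that is \<open>-\<close> or
  a right endpoint vanish. In the affine chart at the flag of \<open>v\<^sub>\<gamma>\<close>, splitting off the entries inside
  the two blocks leaves the closure of the orbit of the partial permutation matrix of the arcs under
  upper triangular row and column operations. Its tangent space at the origin is spanned by the
  coordinates \<open>(r, c)\<close> with \<open>a \<le> c\<close> and \<open>r \<le> b\<close> for some arc \<open>(a, b)\<close>, whereas the dimension only counts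
  those among them that lie on the hook of an arc. So the point is singular iff there is a bad pair
  \<open>c < r\<close>: it is strictly enclosed by an arc, but lies on no hook.

  The hooks of the arcs also form a BPD fragment. A bad pair is a box into which one of the hooks can
  droop, which gives a second fragment; conversely an elbow joining west and north edges, without
  which a fragment consists of hooks, produces a bad pair. Finally, distinguishing whether \<open>c\<close> is \<open>+\<close>
  or a left endpoint and whether \<open>r\<close> is \<open>-\<close> or a right endpoint turns a bad pair, together with the
  enclosing arc, into one of the five patterns.\<close>


section \<open>Polynomial functions\<close>

text \<open>Local dimension is a supremum over chains of irreducible closed sets. It is bounded
  above by transcendence: a chain of length \<open>d\<close> yields \<open>d\<close> algebraically
  independent functions on its largest member, and counting monomials shows that a parametrization
  by \<open>m\<close> coordinates leaves room for at most \<open>m\<close> of them. The exact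
  dimension at a singular point is never computed: a determinant that vanishes on the closure, but
  not on the space of all coordinates counted by the tangent space, costs one independent function,
  and this contradicts smoothness. At a smooth point the closure has to fill that whole space; to
  see this, functions vanishing on the orbit are expanded along curves through the partial
  permutation matrix of the arcs that leave in every allowed direction. Smoothness asks for some
  representative \<open>g\<close> of the flag. It is proved with the permutation matrix itself, but
  singularity must be shown for every \<open>g\<close>, and for this the charts at \<open>g\<close>
  and at the permutation matrix are compared through minors and rational functions.\<close>

lemma poly_funs_cmult: "f \<in> poly_funs I \<Longrightarrow> (\<lambda>x. c * f x) \<in> poly_funs I"
  by (intro poly_funs.mult poly_funs.const)

lemma poly_funs_diff:
  assumes "f \<in> poly_funs I" "g \<in> poly_funs I"
  shows "(\<lambda>x. f x - g x) \<in> poly_funs I"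
  using poly_funs.add[OF assms(1) poly_funs_cmult[OF assms(2), of "-1"]] by simp

lemma poly_funs_sum:
  assumes "\<And>k. k \<in> K \<Longrightarrow> f k \<in> poly_funs I"
  shows "(\<lambda>x. \<Sum>k\<in>K. f k x) \<in> poly_funs I"
  using assms
  by (induction K rule: infinite_finite_induct) (auto intro: poly_funs.const poly_funs.add)

lemma poly_funs_prod:
  assumes "\<And>k. k \<in> K \<Longrightarrow> f k \<in> poly_funs I"
  shows "(\<lambda>x. \<Prod>k\<in>K. f k x) \<in> poly_funs I"
  using assms
  by (induction K rule: infinite_finite_induct) (auto intro: poly_funs.const poly_funs.mult)

lemma poly_funs_power: "f \<in> poly_funs I \<Longrightarrow> (\<lambda>x. f x ^ k) \<in> poly_funs I"
  by (induction k) (auto intro: poly_funs.const poly_funs.mult)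

lemma poly_funs_compose:
  assumes "f \<in> poly_funs I" "\<And>i. i \<in> I \<Longrightarrow> (\<lambda>x. \<phi> x i) \<in> poly_funs J"
  shows "(\<lambda>x. f (\<phi> x)) \<in> poly_funs J"
  using assms by (induction f) (auto intro: poly_funs.intros)

lemma poly_funs_cong:
  assumes "f \<in> poly_funs I" "\<And>i. i \<in> I \<Longrightarrow> x i = y i"
  shows "f x = f y"
  using assms by (induction f) auto

text \<open>Restriction to curves turns identities between polynomial functions of many variables
  into statements about one-variable polynomials, which are zero as soon as they have infinitely
  many zeros.\<close>

lemma poly_funs_curve:
  assumes "f \<in> poly_funs I" "\<And>i. i \<in> I \<Longrightarrow> \<exists>P. \<forall>t. c t i = poly P t"
  shows "\<exists>P. \<forall>t. f (c t) = poly P t"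
  using assms
proof (induction f)
  case (const a)
  show ?case by (rule exI[of _ "[:a:]"]) simp
next
  case (coord i)
  then show ?case by auto
next
  case (add f g)
  then obtain P Q where "\<forall>t. f (c t) = poly P t" "\<forall>t. g (c t) = poly Q t" by blast
  then show ?case by (intro exI[of _ "P + Q"]) simp
next
  case (mult f g)
  then obtain P Q where "\<forall>t. f (c t) = poly P t" "\<forall>t. g (c t) = poly Q t" by blast
  then show ?case by (intro exI[of _ "P * Q"]) simp
qed

lemma poly_funs_line:
  assumes "f \<in> poly_funs I"
  shows "\<exists>P. \<forall>t. f (\<lambda>i. x i + t * d i) = poly P t"
proof (rule poly_funs_curve[OF assms])
  fix i show "\<exists>P. \<forall>t. x i + t * d i = poly P t"
    by (rule exI[of _ "[:x i, d i:]"]) simp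
qed

lemma affine_space_add:
  "x \<in> affine_space I \<Longrightarrow> y \<in> affine_space I \<Longrightarrow> (\<lambda>i. x i + t * y i) \<in> affine_space I"
  by (auto simp: affine_space_def)

text \<open>Otherwise join a point where \<open>f\<close> is nonzero to one where \<open>g\<close>
  is nonzero: on this line both restrict to nonzero one-variable polynomials with product
  zero.\<close>

lemma poly_funs_domain:
  assumes f: "f \<in> poly_funs I" and g: "g \<in> poly_funs I"
    and fg: "\<And>y. y \<in> affine_space K \<Longrightarrow> f y * g y = 0"
  shows "(\<forall>y\<in>affine_space K. f y = 0) \<or> (\<forall>y\<in>affine_space K. g y = 0)"
proof (rule ccontr)
  assume "\<not> ?thesis"
  then obtain y1 y2 where y: "y1 \<in> affine_space K" "f y1 \<noteq> 0" "y2 \<in> affine_space K" "g y2 \<noteq> 0"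
    by blast
  define d where "d = (\<lambda>i. y2 i - y1 i)"
  obtain P where P: "\<And>t. f (\<lambda>i. y1 i + t * d i) = poly P t" using poly_funs_line[OF f] by blast
  obtain Q where Q: "\<And>t. g (\<lambda>i. y1 i + t * d i) = poly Q t" using poly_funs_line[OF g] by blast
  have "d \<in> affine_space K" using y by (auto simp: d_def affine_space_def)
  then have "poly (P * Q) t = 0" for t
    using fg[OF affine_space_add[OF y(1)], of d t] by (simp add: P[symmetric] Q[symmetric])
  then have "P * Q = 0" using poly_all_0_iff_0 by blast
  moreover have "poly P 0 \<noteq> 0" using y P[of 0] by simp
  moreover have "poly Q 1 \<noteq> 0" using y Q[of 1] by (simp add: d_def)
  ultimately show False by auto
qed

text \<open>The chain rule along arbitrary differentiable curves is built into the notion, so that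
  gradients apply to curves that are not lines, such as curves inside a variety or images of lines
  under a polynomial automorphism.\<close>

definition gradient_at :: "'i set \<Rightarrow> (('i \<Rightarrow> complex) \<Rightarrow> complex) \<Rightarrow> ('i \<Rightarrow> complex) \<Rightarrow> ('i \<Rightarrow> complex) \<Rightarrow> bool" where
  "gradient_at I f x G \<longleftrightarrow>
     (\<forall>c d. (\<forall>i\<in>I. c 0 i = x i \<and> ((\<lambda>t. c t i) has_field_derivative d i) (at 0)) \<longrightarrow>
           ((\<lambda>t. f (c t)) has_field_derivative (\<Sum>i\<in>I. G i * d i)) (at 0))"

lemma gradient_atD:
  assumes "gradient_at I f x G"
    and "\<And>i. i \<in> I \<Longrightarrow> c 0 i = x i" "\<And>i. i \<in> I \<Longrightarrow> ((\<lambda>t. c t i) has_field_derivative d i) (at 0)"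
  shows "((\<lambda>t. f (c t)) has_field_derivative (\<Sum>i\<in>I. G i * d i)) (at 0)"
  using assms unfolding gradient_at_def by blast

lemma poly_funs_gradient:
  assumes "finite I" "f \<in> poly_funs I"
  shows "\<exists>G. gradient_at I f x G"
  using assms(2)
proof (induction f)
  case (const a)
  show ?case by (rule exI[of _ "\<lambda>_. 0"]) (simp add: gradient_at_def)
next
  case (coord i)
  then show ?case using assms(1)
    by (intro exI[of _ "\<lambda>j. if j = i then 1 else 0"])
       (simp add: gradient_at_def if_distrib[of "\<lambda>a. a * _"] cong: if_cong)
next
  case (add f g)
  then obtain G H where G: "gradient_at I f x G" and H: "gradient_at I g x H" by blast
  have "gradient_at I (\<lambda>x. f x + g x) x (\<lambda>i. G i + H i)"
    unfolding gradient_at_def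
  proof (intro allI impI)
    fix c d assume "\<forall>i\<in>I. c 0 i = x i \<and> ((\<lambda>t. c t i) has_field_derivative d i) (at 0)"
    then show "((\<lambda>t. f (c t) + g (c t)) has_field_derivative (\<Sum>i\<in>I. (G i + H i) * d i)) (at 0)"
      using DERIV_add[OF gradient_atD[OF G, of c d] gradient_atD[OF H, of c d]]
      by (simp add: distrib_right sum.distrib)
  qed
  then show ?case by blast
next
  case (mult f g)
  then obtain G H where G: "gradient_at I f x G" and H: "gradient_at I g x H" by blast
  have "gradient_at I (\<lambda>x. f x * g x) x (\<lambda>i. G i * g x + H i * f x)"
    unfolding gradient_at_def
  proof (intro allI impI)
    fix c d assume *: "\<forall>i\<in>I. c 0 i = x i \<and> ((\<lambda>t. c t i) has_field_derivative d i) (at 0)"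
    have "f (c 0) = f x" "g (c 0) = g x"
      using * by (auto intro!: poly_funs_cong[OF mult.hyps(1)] poly_funs_cong[OF mult.hyps(2)])
    then show "((\<lambda>t. f (c t) * g (c t)) has_field_derivative (\<Sum>i\<in>I. (G i * g x + H i * f x) * d i)) (at 0)"
      using DERIV_mult[OF gradient_atD[OF G, of c d] gradient_atD[OF H, of c d]] *
      by (simp add: algebra_simps sum.distrib sum_distrib_left)
  qed
  then show ?case by blast
qed

section \<open>The Zariski topology\<close>

lemma closedin_zariski_subtopology:
  assumes "X \<subseteq> affine_space I"
  shows "closedin (subtopology (zariski I) X) Z \<longleftrightarrow>
           (\<exists>F \<subseteq> poly_funs I. Z = {x \<in> X. \<forall>f\<in>F. f x = 0})"
proof -
  have "closedin (zariski I) A \<longleftrightarrow> (\<exists>F \<subseteq> poly_funs I. A = {x \<in> affine_space I. \<forall>f\<in>F. f x = 0})" for A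
  proof
    assume "closedin (zariski I) A"
    then have "A \<subseteq> affine_space I" "openin (zariski I) (affine_space I - A)"
      by (auto simp: closedin_def topspace_zariski)
    then obtain F where "F \<subseteq> poly_funs I" "affine_space I - A = {x \<in> affine_space I. \<exists>f\<in>F. f x \<noteq> 0}"
      unfolding openin_zariski by blast
    then show "\<exists>F \<subseteq> poly_funs I. A = {x \<in> affine_space I. \<forall>f\<in>F. f x = 0}"
      using \<open>A \<subseteq> affine_space I\<close> by (intro exI[of _ F]) blast
  next
    assume "\<exists>F \<subseteq> poly_funs I. A = {x \<in> affine_space I. \<forall>f\<in>F. f x = 0}"
    then obtain F where F: "F \<subseteq> poly_funs I" "A = {x \<in> affine_space I. \<forall>f\<in>F. f x = 0}" by blast
    then have "affine_space I - A = {x \<in> affine_space I. \<exists>f\<in>F. f x \<noteq> 0}" by blast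
    with F show "closedin (zariski I) A"
      unfolding closedin_def topspace_zariski openin_zariski by blast
  qed
  note cl = this
  show ?thesis
    unfolding closedin_subtopology cl
  proof safe
    fix F assume "F \<subseteq> poly_funs I"
    then show "\<exists>F'\<subseteq>poly_funs I. {x \<in> affine_space I. \<forall>f\<in>F. f x = 0} \<inter> X = {x \<in> X. \<forall>f\<in>F'. f x = 0}"
      using assms by (intro exI[of _ F]) auto
  next
    fix F assume "F \<subseteq> poly_funs I"
    then show "\<exists>T. (\<exists>F\<subseteq>poly_funs I. T = {x \<in> affine_space I. \<forall>f\<in>F. f x = 0}) \<and>
             {x \<in> X. \<forall>f\<in>F. f x = 0} = T \<inter> X"
      using assms by (intro exI[of _ "{x \<in> affine_space I. \<forall>f\<in>F. f x = 0}"]) auto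
  qed
qed

lemma closedin_zero_set:
  assumes "X \<subseteq> affine_space I" "f \<in> poly_funs I"
  shows "closedin (subtopology (zariski I) X) {x \<in> X. f x = 0}"
  unfolding closedin_zariski_subtopology[OF assms(1)]
  using assms(2) by (intro exI[of _ "{f}"]) auto

text \<open>The zero sets of \<open>f\<close> and \<open>g\<close> are closed and cover
  \<open>Z\<close>, so one of them contains it: polynomial functions on an irreducible set have no
  zero divisors.\<close>

lemma irreducible_in_domain:
  assumes X: "X \<subseteq> affine_space I" and Z: "irreducible_in (subtopology (zariski I) X) Z" "Z \<subseteq> X"
    and f: "f \<in> poly_funs I" and g: "g \<in> poly_funs I" and fg: "\<And>z. z \<in> Z \<Longrightarrow> f z * g z = 0"
  shows "(\<forall>z\<in>Z. f z = 0) \<or> (\<forall>z\<in>Z. g z = 0)"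
proof -
  have "Z \<subseteq> {x \<in> X. f x = 0} \<union> {x \<in> X. g x = 0}" using fg Z(2) by auto
  then have "Z \<subseteq> {x \<in> X. f x = 0} \<or> Z \<subseteq> {x \<in> X. g x = 0}"
    using Z(1) closedin_zero_set[OF X f] closedin_zero_set[OF X g]
    unfolding irreducible_in_def by blast
  then show ?thesis by blast
qed

section \<open>Algebraic independence of functions on a set\<close>

text \<open>A relation is a polynomial with all exponents below \<open>L\<close>, indexed by
  extensional exponent vectors so that the index set is finite with \<open>L ^ e\<close> elements.
  The \<open>f i\<close> are arbitrary functions, since both polynomials and quotients of
  polynomials are tested.\<close>

definition alg_indep :: "nat \<Rightarrow> (nat \<Rightarrow> 'a \<Rightarrow> complex) \<Rightarrow> 'a set \<Rightarrow> bool" where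
  "alg_indep e f Z \<longleftrightarrow>
     (\<forall>(L::nat) c. (\<forall>z\<in>Z. (\<Sum>a\<in>{..<e} \<rightarrow>\<^sub>E {..<L}. c a * (\<Prod>i<e. f i z ^ a i)) = 0) \<longrightarrow>
            (\<forall>a\<in>{..<e} \<rightarrow>\<^sub>E {..<L}. c a = 0))"

lemma alg_indepD:
  assumes "alg_indep e f Z" "a \<in> {..<e} \<rightarrow>\<^sub>E {..<L}"
    and "\<And>z. z \<in> Z \<Longrightarrow> (\<Sum>a\<in>{..<e} \<rightarrow>\<^sub>E {..<L}. c a * (\<Prod>i<e. f i z ^ a i)) = 0"
  shows "c a = 0"
  using assms unfolding alg_indep_def by blast

text \<open>Serves to pull functions back along a parametrization: it is enough that relations
  between the pulled back functions come from relations between the original ones.\<close>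

lemma alg_indep_transfer:
  assumes "alg_indep e f Z"
    and "\<And>c L. (\<And>w. w \<in> W \<Longrightarrow> (\<Sum>a\<in>{..<e} \<rightarrow>\<^sub>E {..<L}. c a * (\<Prod>i<e. g i w ^ a i)) = 0) \<Longrightarrow>
           \<forall>z\<in>Z. (\<Sum>a\<in>{..<e} \<rightarrow>\<^sub>E {..<L}. c a * (\<Prod>i<e. f i z ^ a i)) = 0"
  shows "alg_indep e g W"
  unfolding alg_indep_def
proof (intro allI impI ballI)
  fix L c a
  assume "\<forall>w\<in>W. (\<Sum>a\<in>{..<e} \<rightarrow>\<^sub>E {..<L}. c a * (\<Prod>i<e. g i w ^ a i)) = 0" and a: "a \<in> {..<e} \<rightarrow>\<^sub>E {..<L}"
  then have "\<forall>z\<in>Z. (\<Sum>a\<in>{..<e} \<rightarrow>\<^sub>E {..<L}. c a * (\<Prod>i<e. f i z ^ a i)) = 0"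
    using assms(2)[of c L] by blast
  then show "c a = 0" using alg_indepD[OF assms(1) a, of c] by blast
qed

lemma alg_indep_0: "Z \<noteq> {} \<Longrightarrow> alg_indep 0 f Z"
  by (auto simp: alg_indep_def)

lemma sum_PiE_Suc:
  "(\<Sum>a\<in>{..<Suc e} \<rightarrow>\<^sub>E {..<L::nat}. h a) = (\<Sum>b<L. \<Sum>a\<in>{..<e} \<rightarrow>\<^sub>E {..<L}. h (a(e := b)))"
proof -
  have "{..<Suc e} \<rightarrow>\<^sub>E {..<L} = (\<lambda>(b, a). a(e := b)) ` ({..<L} \<times> ({..<e} \<rightarrow>\<^sub>E {..<L}))"
    by (simp add: lessThan_Suc PiE_insert_eq)
  moreover have "inj_on (\<lambda>(b, a). a(e := b)) ({..<L} \<times> ({..<e} \<rightarrow>\<^sub>E {..<L}))"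
    using inj_combinator[of e "{..<e}" "\<lambda>_. {..<L}"] by simp
  ultimately have "(\<Sum>a\<in>{..<Suc e} \<rightarrow>\<^sub>E {..<L}. h a) =
      (\<Sum>(b, a)\<in>{..<L} \<times> ({..<e} \<rightarrow>\<^sub>E {..<L}). h (a(e := b)))"
    by (simp add: sum.reindex case_prod_unfold)
  then show ?thesis by (simp add: sum.cartesian_product)
qed

text \<open>A relation between \<open>f\<close> and \<open>g\<close> may be divided by the highest possible power of \<open>g\<close>; restricting
  to the zeros of \<open>g\<close> then leaves a nontrivial relation between the \<open>f\<close>.\<close>

lemma alg_indep_Suc:
  assumes ind: "alg_indep e f Z" and ZZ: "Z \<subseteq> Z'" and g0: "\<And>z. z \<in> Z \<Longrightarrow> g z = 0"
    and const: "\<And>c. (\<lambda>_. c) \<in> R" and add: "\<And>F G. F \<in> R \<Longrightarrow> G \<in> R \<Longrightarrow> (\<lambda>z. F z + G z) \<in> R"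
    and mult: "\<And>F G. F \<in> R \<Longrightarrow> G \<in> R \<Longrightarrow> (\<lambda>z. F z * G z) \<in> R"
    and f: "\<And>i. i < e \<Longrightarrow> f i \<in> R" and g: "g \<in> R"
    and dom: "\<And>F. F \<in> R \<Longrightarrow> (\<And>z. z \<in> Z' \<Longrightarrow> g z * F z = 0) \<Longrightarrow> \<forall>z\<in>Z'. F z = 0"
  shows "alg_indep (Suc e) (f(e := g)) Z'"
  unfolding alg_indep_def
proof (intro allI impI)
  fix L :: nat and c
  assume rel: "\<forall>z\<in>Z'. (\<Sum>a\<in>{..<Suc e} \<rightarrow>\<^sub>E {..<L}. c a * (\<Prod>i<Suc e. (f(e := g)) i z ^ a i)) = 0"
  define G where "G b z = (\<Sum>a\<in>{..<e} \<rightarrow>\<^sub>E {..<L}. c (a(e := b)) * (\<Prod>i<e. f i z ^ a i))" for b z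
  have rsum: "(\<lambda>z. \<Sum>k\<in>K. F k z) \<in> R" if "\<And>k. k \<in> K \<Longrightarrow> F k \<in> R" for K :: "nat set" and F
    using that by (induction K rule: infinite_finite_induct) (auto intro: const add)
  have rsum': "(\<lambda>z. \<Sum>k\<in>K. F k z) \<in> R" if "\<And>k. k \<in> K \<Longrightarrow> F k \<in> R" for K :: "(nat \<Rightarrow> nat) set" and F
    using that by (induction K rule: infinite_finite_induct) (auto intro: const add)
  have rprod: "(\<lambda>z. \<Prod>k\<in>K. F k z) \<in> R" if "\<And>k. k \<in> K \<Longrightarrow> F k \<in> R" for K :: "nat set" and F
    using that by (induction K rule: infinite_finite_induct) (auto intro: const mult)
  have rpow: "(\<lambda>z. F z ^ k) \<in> R" if "F \<in> R" for F and k :: nat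
    using that by (induction k) (auto intro: const mult)
  have GR: "G b \<in> R" for b
    unfolding G_def by (intro rsum' mult const rprod rpow f) auto
  have relG: "(\<Sum>b<L. g z ^ b * G b z) = 0" if "z \<in> Z'" for z
  proof -
    have "(\<Prod>i<Suc e. (f(e := g)) i z ^ (a(e := b)) i) = g z ^ b * (\<Prod>i<e. f i z ^ a i)" for a :: "nat \<Rightarrow> nat" and b
      by (simp add: lessThan_Suc)
    then have "(\<Sum>a\<in>{..<Suc e} \<rightarrow>\<^sub>E {..<L}. c a * (\<Prod>i<Suc e. (f(e := g)) i z ^ a i)) = (\<Sum>b<L. g z ^ b * G b z)"
      unfolding sum_PiE_Suc G_def sum_distrib_left by (simp add: mult_ac del: prod.lessThan_Suc)
    then show ?thesis using rel that by simp
  qed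
  have coeff0: "\<forall>a\<in>{..<e} \<rightarrow>\<^sub>E {..<L}. c (a(e := b)) = 0" if "b < L" for b
    using that
  proof (induction b rule: less_induct)
    case (less b)
    have G0: "G b' z = 0" if "b' < b" for b' z
      using less.IH[OF that] that less.prems unfolding G_def by (intro sum.neutral) (simp del: fun_upd_apply)
    define F where "F z = (\<Sum>b'\<in>{b..<L}. g z ^ (b' - b) * G b' z)" for z
    have FR: "F \<in> R" unfolding F_def by (intro rsum mult rpow g GR)
    have gF: "g z ^ b * F z = 0" if "z \<in> Z'" for z
    proof -
      have "{..<L} = {..<b} \<union> {b..<L}" using less.prems by auto
      then have "(\<Sum>b<L. g z ^ b * G b z) = (\<Sum>b'<b. g z ^ b' * G b' z) + (\<Sum>b'\<in>{b..<L}. g z ^ b' * G b' z)"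
        by (simp add: sum.union_disjoint[symmetric] ivl_disj_int)
      moreover have "(\<Sum>b'<b. g z ^ b' * G b' z) = 0" using G0 by (auto intro!: sum.neutral)
      moreover have "(\<Sum>b'\<in>{b..<L}. g z ^ b' * G b' z) = g z ^ b * F z"
        unfolding F_def sum_distrib_left
        by (rule sum.cong) (auto simp: mult.assoc[symmetric] power_add[symmetric])
      ultimately show ?thesis using relG[OF that] by simp
    qed
    \<comment> \<open>The power of \<open>g\<close> is cancelled factor by factor, because
      \<open>dom\<close> removes a single \<open>g\<close>.\<close>
    have "\<forall>z\<in>Z'. g z ^ k * F z = 0 \<Longrightarrow> \<forall>z\<in>Z'. F z = 0" for k
    proof (induction k)
      case (Suc k)
      have "\<forall>z\<in>Z'. g z ^ k * F z = 0"
      proof (rule dom)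
        show "(\<lambda>z. g z ^ k * F z) \<in> R" by (intro mult rpow g FR)
        show "g z * (g z ^ k * F z) = 0" if "z \<in> Z'" for z
          using Suc.prems that by (simp add: mult.assoc)
      qed
      then show ?case by (rule Suc.IH)
    qed simp
    then have F0: "\<forall>z\<in>Z'. F z = 0" using gF by blast
    \<comment> \<open>On \<open>Z\<close> the function \<open>g\<close> is zero, so of the sum
      \<open>F\<close> only the summand with exponent zero, \<open>b' = b\<close>, survives.\<close>
    have "G b z = 0" if "z \<in> Z" for z
    proof -
      have "F z = (\<Sum>b'\<in>{b..<L}. if b' = b then G b z else 0)"
        unfolding F_def using g0[OF that] by (intro sum.cong) auto
      then show ?thesis using F0 ZZ that less.prems by auto
    qed
    then show ?case
      using alg_indepD[OF ind, of _ L "\<lambda>a. c (a(e := b))"] unfolding G_def by blast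
  qed
  show "\<forall>a\<in>{..<Suc e} \<rightarrow>\<^sub>E {..<L}. c a = 0"
  proof
    fix a assume a: "a \<in> {..<Suc e} \<rightarrow>\<^sub>E {..<L}"
    then have "a \<in> (\<lambda>(b, a). a(e := b)) ` ({..<L} \<times> ({..<e} \<rightarrow>\<^sub>E {..<L}))"
      by (simp add: lessThan_Suc PiE_insert_eq)
    then show "c a = 0" using coeff0 by auto
  qed
qed

section \<open>Counting monomials: too many rational functions are algebraically dependent\<close>

lemma underdetermined_system:
  fixes M :: "'b \<Rightarrow> 'a \<Rightarrow> 'c::field"
  assumes "finite B" "finite A" "card B < card A"
  shows "\<exists>c. (\<exists>a\<in>A. c a \<noteq> 0) \<and> (\<forall>b\<in>B. (\<Sum>a\<in>A. M b a * c a) = 0)"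
  using assms
proof (induction B arbitrary: A M rule: finite_induct)
  case empty
  then have "A \<noteq> {}" by auto
  then show ?case by (intro exI[of _ "\<lambda>_. 1"]) auto
next
  case (insert b B)
  show ?case
  proof (cases "\<forall>a\<in>A. M b a = 0")
    case True
    have "card B < card A" using insert by simp
    then obtain c where "\<exists>a\<in>A. c a \<noteq> 0" "\<forall>b\<in>B. (\<Sum>a\<in>A. M b a * c a) = 0"
      using insert.IH[OF insert.prems(1)] by blast
    then show ?thesis using True by (intro exI[of _ c]) auto
  next
    case False
    \<comment> \<open>Gaussian elimination: equation \<open>b\<close> has a nonzero coefficient at
      \<open>a0\<close> and expresses this unknown through the others. Substitution changes the
      coefficients of the remaining equations to those given to the induction hypothesis.\<close>
    then obtain a0 where a0: "a0 \<in> A" "M b a0 \<noteq> 0" by blast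
    define A' where "A' = A - {a0}"
    have A': "finite A'" "a0 \<notin> A'" "A = insert a0 A'" using insert.prems a0 by (auto simp: A'_def)
    have "card B < card A'" using insert A' by simp
    then obtain c where c: "\<exists>a\<in>A'. c a \<noteq> 0"
      "\<forall>b'\<in>B. (\<Sum>a\<in>A'. (M b' a - M b' a0 * M b a / M b a0) * c a) = 0"
      using insert.IH[OF A'(1), of "\<lambda>b' a. M b' a - M b' a0 * M b a / M b a0"] by blast
    define c' where "c' = c(a0 := - (\<Sum>a\<in>A'. M b a * c a) / M b a0)"
    have eq: "(\<Sum>a\<in>A. M b' a * c' a) = M b' a0 * c' a0 + (\<Sum>a\<in>A'. M b' a * c a)" for b'
      using A' by (auto simp: c'_def intro!: sum.cong)
    have "(\<Sum>a\<in>A. M b a * c' a) = 0" unfolding eq using a0 by (simp add: c'_def)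
    moreover have "(\<Sum>a\<in>A. M b' a * c' a) = 0" if "b' \<in> B" for b'
    proof -
      have "M b' a0 * c' a0 = (\<Sum>a\<in>A'. - (M b' a0 * M b a / M b a0) * c a)"
        by (simp add: c'_def sum_distrib_left sum_divide_distrib sum_negf mult_ac)
      then have "(\<Sum>a\<in>A. M b' a * c' a) = (\<Sum>a\<in>A'. (M b' a - M b' a0 * M b a / M b a0) * c a)"
        unfolding eq by (simp add: sum.distrib[symmetric] algebra_simps)
      then show ?thesis using c(2) that by simp
    qed
    moreover have "\<exists>a\<in>A. c' a \<noteq> 0" using c(1) A' by (auto simp: c'_def)
    ultimately show ?thesis by blast
  qed
qed

text \<open>The degree is bounded in each variable separately, so that the admissible monomials are
  the elements of \<open>J \<rightarrow>\<^sub>E {..k}\<close> and their number is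
  \<open>(k + 1) ^ card J\<close>.\<close>

definition deg_le :: "'j set \<Rightarrow> nat \<Rightarrow> (('j \<Rightarrow> complex) \<Rightarrow> complex) \<Rightarrow> bool" where
  "deg_le J k f \<longleftrightarrow> (\<exists>C. \<forall>y. f y = (\<Sum>m\<in>J \<rightarrow>\<^sub>E {..k}. C m * (\<Prod>j\<in>J. y j ^ m j)))"

lemma deg_le_add: "deg_le J k f \<Longrightarrow> deg_le J k g \<Longrightarrow> deg_le J k (\<lambda>y. f y + g y)"
  unfolding deg_le_def
  apply (elim exE)
  subgoal for C C' by (rule exI[of _ "\<lambda>m. C m + C' m"]) (simp add: distrib_right sum.distrib)
  done

lemma deg_le_cmult: "deg_le J k f \<Longrightarrow> deg_le J k (\<lambda>y. c * f y)"
  unfolding deg_le_def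
  apply (elim exE)
  subgoal for C by (rule exI[of _ "\<lambda>m. c * C m"]) (simp add: mult.assoc sum_distrib_left)
  done

lemma deg_le_0: "deg_le J k (\<lambda>y. 0)"
  unfolding deg_le_def by (rule exI[of _ "\<lambda>_. 0"]) simp

lemma deg_le_sum: "(\<And>a. a \<in> A \<Longrightarrow> deg_le J k (f a)) \<Longrightarrow> deg_le J k (\<lambda>y. \<Sum>a\<in>A. f a y)"
  by (induction A rule: infinite_finite_induct) (auto intro: deg_le_0 deg_le_add)

lemma deg_le_monomial:
  assumes "finite J" "\<And>j. j \<in> J \<Longrightarrow> m j \<le> k"
  shows "deg_le J k (\<lambda>y. \<Prod>j\<in>J. y j ^ m j)"
  unfolding deg_le_def
proof (intro exI allI)
  fix y :: "'a \<Rightarrow> complex"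
  have fin: "finite (J \<rightarrow>\<^sub>E {..k})" using assms(1) by (simp add: finite_PiE)
  have mem: "restrict m J \<in> J \<rightarrow>\<^sub>E {..k}" using assms(2) by auto
  have "(\<Sum>m'\<in>J \<rightarrow>\<^sub>E {..k}. (if m' = restrict m J then 1 else 0) * (\<Prod>j\<in>J. y j ^ m' j))
      = (\<Sum>m'\<in>J \<rightarrow>\<^sub>E {..k}. if m' = restrict m J then (\<Prod>j\<in>J. y j ^ m' j) else 0)"
    by (intro sum.cong) auto
  also have "\<dots> = (\<Prod>j\<in>J. y j ^ m j)" using fin mem by simp
  finally show "(\<Prod>j\<in>J. y j ^ m j) =
     (\<Sum>m'\<in>J \<rightarrow>\<^sub>E {..k}. (if m' = restrict m J then 1 else 0) * (\<Prod>j\<in>J. y j ^ m' j))" by simp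
qed

lemma deg_le_mult:
  assumes "finite J" "deg_le J k f" "deg_le J l g"
  shows "deg_le J (k + l) (\<lambda>y. f y * g y)"
proof -
  obtain C D where C: "\<And>y. f y = (\<Sum>m\<in>J \<rightarrow>\<^sub>E {..k}. C m * (\<Prod>j\<in>J. y j ^ m j))"
    and D: "\<And>y. g y = (\<Sum>m\<in>J \<rightarrow>\<^sub>E {..l}. D m * (\<Prod>j\<in>J. y j ^ m j))"
    using assms unfolding deg_le_def by blast
  have "(\<lambda>y. f y * g y) = (\<lambda>y. \<Sum>m\<in>J \<rightarrow>\<^sub>E {..k}. \<Sum>m'\<in>J \<rightarrow>\<^sub>E {..l}. (C m * D m') * (\<Prod>j\<in>J. y j ^ (m j + m' j)))"
    by (auto simp: C D sum_product power_add prod.distrib mult_ac intro!: sum.cong)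
  moreover have "deg_le J (k + l) \<dots>"
    by (intro deg_le_sum deg_le_cmult deg_le_monomial assms(1)) (auto intro!: add_mono)
  ultimately show ?thesis by simp
qed

lemma deg_le_const:
  assumes "finite J" shows "deg_le J k (\<lambda>y. c)"
  using deg_le_cmult[OF deg_le_monomial[OF assms, of "\<lambda>_. 0"], of k c] by simp

lemma deg_le_mono:
  assumes "finite J" "deg_le J k f" "k \<le> l"
  shows "deg_le J l f"
  using deg_le_mult[OF assms(1,2) deg_le_const[OF assms(1), of "l - k" 1]] assms(3) by simp

lemma deg_le_power:
  assumes "finite J" "deg_le J k f"
  shows "deg_le J (k * e) (\<lambda>y. f y ^ e)"
  by (induction e) (use assms in \<open>auto intro: deg_le_const deg_le_mult\<close>)

lemma deg_le_prod:
  assumes "finite J" "\<And>a. a \<in> A \<Longrightarrow> deg_le J k (f a)" "finite A"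
  shows "deg_le J (k * card A) (\<lambda>y. \<Prod>a\<in>A. f a y)"
  using assms(3,2)
  by (induction A rule: finite_induct) (auto intro: deg_le_const deg_le_mult assms(1))

lemma poly_funs_deg_le:
  assumes "finite J" "f \<in> poly_funs J"
  shows "\<exists>k. deg_le J k f"
  using assms(2)
proof (induction f)
  case (const c)
  then show ?case using deg_le_const[OF assms(1)] by blast
next
  case (coord i)
  have "deg_le J 1 (\<lambda>y. \<Prod>j\<in>J. y j ^ (if j = i then 1 else 0))"
    by (intro deg_le_monomial assms) auto
  also have "(\<lambda>y. \<Prod>j\<in>J. y j ^ (if j = i then 1 else 0)) = (\<lambda>y :: _ \<Rightarrow> complex. y i)"
    using coord assms(1) by (auto simp: if_distrib[of "\<lambda>k. _ ^ k"] cong: if_cong)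
  finally show ?case by blast
next
  case (add f g)
  then obtain k l where "deg_le J k f" "deg_le J l g" by blast
  then have "deg_le J (max k l) f" "deg_le J (max k l) g"
    using deg_le_mono[OF assms(1)] by simp_all
  then show ?case using deg_le_add by blast
next
  case (mult f g)
  then show ?case using deg_le_mult[OF assms(1)] by blast
qed

text \<open>Monomials of bounded degree in more than \<open>card J\<close> rational functions eventually outnumber
  the monomials in the coordinates that are needed to express them.\<close>

lemma alg_indep_card_le:
  fixes \<delta> :: "('j \<Rightarrow> complex) \<Rightarrow> complex"
  assumes J: "finite J" and \<delta>: "\<delta> \<in> poly_funs J" "\<And>y. y \<in> \<Omega> \<Longrightarrow> \<delta> y \<noteq> 0"
    and t: "\<And>i. i < r \<Longrightarrow> \<exists>N. \<exists>T\<in>poly_funs J. \<forall>y\<in>\<Omega>. t i y * \<delta> y ^ N = T y"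
    and ind: "alg_indep r t \<Omega>"
  shows "r \<le> card J"
proof (rule ccontr)
  assume "\<not> r \<le> card J"
  obtain N0 T0 where T0: "\<And>i. i < r \<Longrightarrow> T0 i \<in> poly_funs J"
    "\<And>i y. i < r \<Longrightarrow> y \<in> \<Omega> \<Longrightarrow> t i y * \<delta> y ^ N0 i = T0 i y"
    using t by metis
  \<comment> \<open>A common exponent for the denominators of all \<open>t i\<close>.\<close>
  define N where "N = (\<Sum>i<r. N0 i)"
  have N0: "N0 i \<le> N" if "i < r" for i
    unfolding N_def using that by (intro member_le_sum) auto
  define T where "T i y = T0 i y * \<delta> y ^ (N - N0 i)" for i y
  have Tp: "T i \<in> poly_funs J" if "i < r" for i
    unfolding T_def using that T0 \<delta> by (intro poly_funs.mult poly_funs_power) auto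
  have Tt: "T i y = t i y * \<delta> y ^ N" if "i < r" "y \<in> \<Omega>" for i y
    using T0(2)[OF that] N0[OF that(1)] by (simp add: T_def power_add[symmetric] mult.assoc flip: T0(2)[OF that])
  have "\<exists>k. deg_le J k (T i)" if "i < r" for i using poly_funs_deg_le[OF J Tp[OF that]] .
  then obtain k0 where k0: "\<And>i. i < r \<Longrightarrow> deg_le J (k0 i) (T i)" by metis
  obtain kd where kd: "deg_le J kd \<delta>" using poly_funs_deg_le[OF J \<delta>(1)] by blast
  define k where "k = kd + (\<Sum>i<r. k0 i)"
  have kT: "deg_le J k (T i)" if "i < r" for i
  proof (rule deg_le_mono[OF J k0[OF that]])
    have "k0 i \<le> (\<Sum>i<r. k0 i)" using that by (intro member_le_sum) auto
    then show "k0 i \<le> k" by (simp add: k_def)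
  qed
  have kd: "deg_le J k \<delta>" using deg_le_mono[OF J kd] by (simp add: k_def)
  \<comment> \<open>Chosen so that clearing denominators in a monomial with exponents below
    \<open>L\<close> gives a polynomial of degree at most \<open>\<kappa> * L\<close>.\<close>
  define \<kappa> where "\<kappa> = k * (N + 1) * r"
  define m where "m = card J"
  \<comment> \<open>Large enough for \<open>(\<kappa> * L + 1) ^ m \<le> (\<kappa> + 1) ^ m * L ^ m
    < L ^ Suc m \<le> L ^ r\<close>. The left end counts the monomials in the coordinates, the right
    end those in the \<open>r\<close> functions.\<close>
  define L where "L = (\<kappa> + 1) ^ m + 1"
  \<comment> \<open>The power of \<open>\<delta>\<close> is adjusted to the exponents
    \<open>a\<close>, so that each \<open>F a\<close> is the monomial in the \<open>t i\<close>
    times the same power \<open>\<delta> y ^ (N * L * r)\<close>, which cancels from a linear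
    relation.\<close>
  define F where "F a y = (\<Prod>i<r. T i y ^ a i * \<delta> y ^ (N * (L - a i)))" for a y
  have deg: "deg_le J (\<kappa> * L) (F a)" if a: "a \<in> {..<r} \<rightarrow>\<^sub>E {..<L}" for a
  proof -
    have "deg_le J (k * (N + 1) * L) (\<lambda>y. T i y ^ a i * \<delta> y ^ (N * (L - a i)))" if "i \<in> {..<r}" for i
    proof (rule deg_le_mono[OF J])
      show "deg_le J (k * a i + k * (N * (L - a i))) (\<lambda>y. T i y ^ a i * \<delta> y ^ (N * (L - a i)))"
        using that by (intro deg_le_mult deg_le_power J kT kd) auto
      have "a i \<le> L" using PiE_mem[OF a that] by simp
      then have "a i + N * (L - a i) \<le> L + N * L" by (intro add_mono mult_le_mono) auto
      then have "k * (a i + N * (L - a i)) \<le> k * (L + N * L)" by (rule mult_le_mono2)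
      then show "k * a i + k * (N * (L - a i)) \<le> k * (N + 1) * L"
        by (simp add: algebra_simps)
    qed
    from deg_le_prod[OF J this finite_lessThan] have "deg_le J (k * (N + 1) * L * r) (F a)"
      unfolding F_def by simp
    then show ?thesis unfolding \<kappa>_def by (simp add: mult_ac)
  qed
  define A where "A = {..<r} \<rightarrow>\<^sub>E {..<L}"
  define B where "B = J \<rightarrow>\<^sub>E {..\<kappa> * L}"
  have "\<exists>C. \<forall>y. F a y = (\<Sum>b\<in>B. C b * (\<Prod>j\<in>J. y j ^ b j))" if "a \<in> A" for a
    using deg[of a] that unfolding deg_le_def A_def B_def by blast
  then have "\<forall>a\<in>A. \<exists>C. \<forall>y. F a y = (\<Sum>b\<in>B. C b * (\<Prod>j\<in>J. y j ^ b j))" by simp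
  from bchoice[OF this] obtain M where M: "\<forall>a\<in>A. \<forall>y. F a y = (\<Sum>b\<in>B. M a b * (\<Prod>j\<in>J. y j ^ b j))" ..
  have fin: "finite A" "finite B"
    unfolding A_def B_def by (intro finite_PiE J finite_lessThan finite_atMost)+
  have L: "(\<kappa> + 1) ^ m < L" "1 \<le> L" by (simp_all add: L_def)
  have "card B = (\<Prod>j\<in>J. card {..\<kappa> * L})" unfolding B_def by (rule card_PiE[OF J])
  also have "\<dots> = (\<kappa> * L + 1) ^ m" by (simp only: card_atMost prod_constant m_def Suc_eq_plus1)
  also have "\<dots> \<le> ((\<kappa> + 1) * L) ^ m"
  proof (rule power_mono)
    show "\<kappa> * L + 1 \<le> (\<kappa> + 1) * L" using L(2) by (simp only: distrib_right mult_1 add_left_mono)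
  qed simp
  also have "\<dots> = (\<kappa> + 1) ^ m * L ^ m" by (rule power_mult_distrib)
  also have "\<dots> < L * L ^ m" using L by (intro mult_strict_right_mono) auto
  also have "\<dots> = L ^ Suc m" by (simp only: power_Suc)
  also have "\<dots> \<le> L ^ r"
    using \<open>\<not> r \<le> card J\<close> L(2) by (intro power_increasing) (simp_all only: m_def Suc_le_eq not_le)
  also have "\<dots> = (\<Prod>i<r. card {..<L})" by (simp only: prod_constant card_lessThan)
  also have "\<dots> = card A" unfolding A_def by (rule card_PiE[symmetric]) (rule finite_lessThan)
  finally have "card B < card A" .
  then obtain c where c: "\<exists>a\<in>A. c a \<noteq> 0" "\<forall>b\<in>B. (\<Sum>a\<in>A. M a b * c a) = 0"
    using underdetermined_system[OF fin(2,1), of "\<lambda>b a. M a b"] by blast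
  have "(\<Sum>a\<in>A. c a * (\<Prod>i<r. t i y ^ a i)) = 0" if y: "y \<in> \<Omega>" for y
  proof -
    have Ft: "F a y = (\<Prod>i<r. t i y ^ a i) * \<delta> y ^ (N * L * r)" if a: "a \<in> A" for a
    proof -
      have "T i y ^ a i * \<delta> y ^ (N * (L - a i)) = t i y ^ a i * \<delta> y ^ (N * L)" if "i \<in> {..<r}" for i
      proof -
        have "a i \<le> L" using PiE_mem[OF a[unfolded A_def] that] by simp
        then have "N * a i + N * (L - a i) = N * L" by (simp add: distrib_left[symmetric])
        then show ?thesis
          using that y by (simp add: Tt power_mult_distrib power_mult[symmetric] mult.assoc power_add[symmetric])
      qed
      then show ?thesis unfolding F_def by (simp add: prod.distrib power_mult)
    qed
    have "(\<Sum>a\<in>A. c a * F a y) = (\<Sum>a\<in>A. \<Sum>b\<in>B. M a b * c a * (\<Prod>j\<in>J. y j ^ b j))"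
      by (simp add: M sum_distrib_left mult_ac)
    also have "\<dots> = (\<Sum>b\<in>B. (\<Sum>a\<in>A. M a b * c a) * (\<Prod>j\<in>J. y j ^ b j))"
      unfolding sum_distrib_right by (rule sum.swap)
    also have "\<dots> = 0" using c(2) by simp
    finally have "(\<Sum>a\<in>A. c a * (\<Prod>i<r. t i y ^ a i)) * \<delta> y ^ (N * L * r) = 0"
      by (simp add: Ft sum_distrib_right mult.assoc)
    then show ?thesis using \<delta>(2)[OF y] by simp
  qed
  then have "\<forall>a\<in>A. c a = 0" using alg_indepD[OF ind, of _ L c] unfolding A_def by blast
  then show False using c(1) by blast
qed

section \<open>Bounds for the local dimension\<close>

text \<open>At each strict inclusion some polynomial vanishes on the smaller set but not on the
  larger one. Irreducibility of the larger set makes it cancellable there, so it can be adjoined to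
  the functions found so far.\<close>

lemma chain_alg_indep:
  assumes X: "X \<subseteq> affine_space I"
    and Z: "\<And>i. i \<le> d \<Longrightarrow> closedin (subtopology (zariski I) X) (Z i)"
      "\<And>i. i \<le> d \<Longrightarrow> irreducible_in (subtopology (zariski I) X) (Z i)"
    and inc: "\<And>i. i < d \<Longrightarrow> Z i \<subset> Z (Suc i)"
  shows "\<exists>f. (\<forall>i<d. f i \<in> poly_funs I) \<and> alg_indep d f (Z d)"
  using assms(2-)
proof (induction d)
  case 0
  then have "Z 0 \<noteq> {}" by (simp add: irreducible_in_def)
  then show ?case using alg_indep_0[of "Z 0" undefined] by auto
next
  case (Suc d)
  then obtain f where f: "\<And>i. i < d \<Longrightarrow> f i \<in> poly_funs I" "alg_indep d f (Z d)" by force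
  obtain F where F: "F \<subseteq> poly_funs I" "Z d = {x \<in> X. \<forall>f\<in>F. f x = 0}"
    using Suc.prems(1)[of d] unfolding closedin_zariski_subtopology[OF X] by auto
  have "Z (Suc d) \<subseteq> X"
    using Suc.prems(1)[of "Suc d"] unfolding closedin_zariski_subtopology[OF X] by auto
  then obtain g where g: "g \<in> F" "\<exists>z\<in>Z (Suc d). g z \<noteq> 0"
    using Suc.prems(3)[of d] F by blast
  have "alg_indep (Suc d) (f(d := g)) (Z (Suc d))"
  proof (rule alg_indep_Suc[where R = "poly_funs I"])
    fix h assume "h \<in> poly_funs I" "\<And>z. z \<in> Z (Suc d) \<Longrightarrow> g z * h z = 0"
    then show "\<forall>z\<in>Z (Suc d). h z = 0"
      using irreducible_in_domain[OF X Suc.prems(2)[of "Suc d"] \<open>Z (Suc d) \<subseteq> X\<close>, of g h] g F by auto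
  qed (use f g F Suc.prems(3)[of d] in \<open>auto intro: poly_funs.intros\<close>)
  moreover have "(f(d := g)) i \<in> poly_funs I" if "i < Suc d" for i
    using that f(1) g(1) F(1) by (cases "i = d") auto
  ultimately show ?case by blast
qed

text \<open>A chain is replaced by the independent functions that it produces on its largest member,
  which is irreducible and contains \<open>x\<close>.\<close>

lemma local_dim_leI:
  assumes X: "X \<subseteq> affine_space I"
    and le: "\<And>d f Z. Z \<subseteq> X \<Longrightarrow> x \<in> Z \<Longrightarrow> irreducible_in (subtopology (zariski I) X) Z \<Longrightarrow>
       (\<And>i. i < d \<Longrightarrow> f i \<in> poly_funs I) \<Longrightarrow> alg_indep d f Z \<Longrightarrow> d \<le> k"
  shows "local_dim (subtopology (zariski I) X) x \<le> enat k"
  unfolding local_dim_def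
proof (rule SUP_least, elim CollectE exE conjE)
  fix d Z
  assume Z: "\<forall>i\<le>d. closedin (subtopology (zariski I) X) (Z i) \<and>
      irreducible_in (subtopology (zariski I) X) (Z i) \<and> x \<in> Z i" and inc: "\<forall>i<d. Z i \<subset> Z (Suc i)"
  obtain f where f: "\<forall>i<d. f i \<in> poly_funs I" "alg_indep d f (Z d)"
    using chain_alg_indep[OF X, of d Z] Z inc by blast
  have "Z d \<subseteq> X" using Z closedin_subset topspace_subtopology by fastforce
  then have "d \<le> k" using le[of "Z d" d f] Z f by auto
  then show "enat d \<le> enat k" by simp
qed

lemma poly_funs_relation:
  assumes "\<And>i. i < e \<Longrightarrow> f i \<in> poly_funs I"
  shows "(\<lambda>x. \<Sum>a\<in>{..<e} \<rightarrow>\<^sub>E {..<L}. c a * (\<Prod>i<e. f i x ^ a i)) \<in> poly_funs I"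
  using assms by (intro poly_funs_sum poly_funs_cmult poly_funs_prod poly_funs_power) auto

text \<open>Functions that are independent on a subset of the image stay independent after
  composition with \<open>\<phi>\<close>, and at most \<open>card J\<close> polynomials in the
  coordinates from \<open>J\<close> can be independent.\<close>

lemma local_dim_image_le:
  assumes J: "finite J" and X: "X = \<phi> ` affine_space J" "X \<subseteq> affine_space I"
    and \<phi>: "\<And>i. i \<in> I \<Longrightarrow> (\<lambda>y. \<phi> y i) \<in> poly_funs J"
  shows "local_dim (subtopology (zariski I) X) x \<le> enat (card J)"
proof (rule local_dim_leI[OF X(2)])
  fix d f Z
  assume Z: "Z \<subseteq> X" and f: "\<And>i. i < d \<Longrightarrow> f i \<in> poly_funs I" and ind: "alg_indep d f Z"
  have "alg_indep d (\<lambda>i y. f i (\<phi> y)) (affine_space J)"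
    using ind by (rule alg_indep_transfer) (use Z X in blast)
  then show "d \<le> card J"
    by (rule alg_indep_card_le[OF J, of "\<lambda>_. 1", rotated -1])
       (auto intro!: poly_funs.const poly_funs_compose[OF f \<phi>] bexI)
qed

text \<open>The localization of the polynomial functions at \<open>\<delta>\<close>. Values at the
  zeros of \<open>\<delta>\<close> are arbitrary, so that the value of a quotient by zero does not
  matter.\<close>

definition rational_funs :: "'j set \<Rightarrow> (('j \<Rightarrow> complex) \<Rightarrow> complex) \<Rightarrow> (('j \<Rightarrow> complex) \<Rightarrow> complex) set" where
  "rational_funs J \<delta> = {F. \<exists>k. \<exists>T\<in>poly_funs J. \<forall>y. \<delta> y \<noteq> 0 \<longrightarrow> F y * \<delta> y ^ k = T y}"

lemma rational_funsI:
  "T \<in> poly_funs J \<Longrightarrow> (\<And>y. \<delta> y \<noteq> 0 \<Longrightarrow> F y * \<delta> y ^ k = T y) \<Longrightarrow> F \<in> rational_funs J \<delta>"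
  unfolding rational_funs_def by blast

lemma rational_funs_poly: "f \<in> poly_funs J \<Longrightarrow> f \<in> rational_funs J \<delta>"
  by (rule rational_funsI[where k = 0]) auto

lemma rational_funs_add:
  assumes "F \<in> rational_funs J \<delta>" "G \<in> rational_funs J \<delta>" "\<delta> \<in> poly_funs J"
  shows "(\<lambda>y. F y + G y) \<in> rational_funs J \<delta>"
proof -
  obtain T k where T: "T \<in> poly_funs J" "\<forall>y. \<delta> y \<noteq> 0 \<longrightarrow> F y * \<delta> y ^ k = T y"
    using assms(1) unfolding rational_funs_def by blast
  obtain S l where S: "S \<in> poly_funs J" "\<forall>y. \<delta> y \<noteq> 0 \<longrightarrow> G y * \<delta> y ^ l = S y"
    using assms(2) unfolding rational_funs_def by blast
  show ?thesis
  proof (rule rational_funsI)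
    show "(\<lambda>y. T y * \<delta> y ^ l + S y * \<delta> y ^ k) \<in> poly_funs J"
      by (intro poly_funs.add poly_funs.mult poly_funs_power assms T S)
    fix y assume y: "\<delta> y \<noteq> 0"
    have "(F y + G y) * \<delta> y ^ (k + l) = (F y * \<delta> y ^ k) * \<delta> y ^ l + (G y * \<delta> y ^ l) * \<delta> y ^ k"
      by (simp add: power_add algebra_simps)
    then show "(F y + G y) * \<delta> y ^ (k + l) = T y * \<delta> y ^ l + S y * \<delta> y ^ k"
      by (simp only: T(2)[rule_format, OF y] S(2)[rule_format, OF y])
  qed
qed

lemma rational_funs_mult:
  assumes "F \<in> rational_funs J \<delta>" "G \<in> rational_funs J \<delta>"
  shows "(\<lambda>y. F y * G y) \<in> rational_funs J \<delta>"
proof -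
  obtain T k where T: "T \<in> poly_funs J" "\<forall>y. \<delta> y \<noteq> 0 \<longrightarrow> F y * \<delta> y ^ k = T y"
    using assms(1) unfolding rational_funs_def by blast
  obtain S l where S: "S \<in> poly_funs J" "\<forall>y. \<delta> y \<noteq> 0 \<longrightarrow> G y * \<delta> y ^ l = S y"
    using assms(2) unfolding rational_funs_def by blast
  show ?thesis
  proof (rule rational_funsI)
    show "(\<lambda>y. T y * S y) \<in> poly_funs J" by (intro poly_funs.mult T S)
    fix y assume y: "\<delta> y \<noteq> 0"
    have "(F y * G y) * \<delta> y ^ (k + l) = (F y * \<delta> y ^ k) * (G y * \<delta> y ^ l)"
      by (simp add: power_add algebra_simps)
    then show "(F y * G y) * \<delta> y ^ (k + l) = T y * S y"
      by (simp only: T(2)[rule_format, OF y] S(2)[rule_format, OF y])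
  qed
qed

lemma rational_funs_compose:
  assumes "f \<in> poly_funs I" "\<delta> \<in> poly_funs J" "\<And>i. i \<in> I \<Longrightarrow> N i \<in> poly_funs J"
  shows "(\<lambda>y. f (\<lambda>i. N i y / \<delta> y)) \<in> rational_funs J \<delta>"
  using assms(1)
proof (induction f)
  case (const c)
  show ?case by (intro rational_funs_poly poly_funs.const)
next
  case (coord i)
  then show ?case by (intro rational_funsI[where k = 1 and T = "N i"] assms(3)) auto
qed (use assms(2) in \<open>auto intro: rational_funs_add rational_funs_mult\<close>)

text \<open>Near \<open>x\<close> the set is covered by the image of the hypersurface
  \<open>h = 0\<close> under a rational map. Functions independent on an irreducible set through
  \<open>x\<close> therefore pull back to functions independent on this hypersurface. On the whole
  parameter space \<open>h\<close> can be adjoined to them, so there are fewer than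
  \<open>card J\<close>. The function \<open>\<epsilon>\<close> marks out the neighbourhood of
  \<open>x\<close> on which parameters are available.\<close>

lemma local_dim_rational_image_less:
  assumes J: "finite J" and X: "X \<subseteq> affine_space I" "x \<in> X"
    and \<delta>: "\<delta> \<in> poly_funs J" and N: "\<And>i. i \<in> I \<Longrightarrow> N i \<in> poly_funs J"
    and h: "h \<in> poly_funs J" "\<exists>y\<in>affine_space J. h y \<noteq> 0"
    and \<epsilon>: "\<epsilon> \<in> poly_funs I" "\<epsilon> x \<noteq> 0"
    and param: "\<And>z. z \<in> X \<Longrightarrow> \<epsilon> z \<noteq> 0 \<Longrightarrow>
      \<exists>y\<in>affine_space J. h y = 0 \<and> \<delta> y \<noteq> 0 \<and> (\<forall>i\<in>I. z i = N i y / \<delta> y)"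
  shows "local_dim (subtopology (zariski I) X) x < enat (card J)"
proof -
  \<comment> \<open>Makes \<open>card J - 1\<close> a true predecessor: without coordinates
    \<open>h\<close> would be a nonzero constant, but it vanishes at a parameter of
    \<open>x\<close>.\<close>
  have "J \<noteq> {}"
  proof
    assume "J = {}"
    then have "h y = h y'" for y y' using poly_funs_cong[OF h(1)] by simp
    then show False using param[OF X(2) \<epsilon>(2)] h(2) by metis
  qed
  then have "0 < card J" using J by (simp add: card_gt_0_iff)
  define \<phi> where "\<phi> = (\<lambda>y i. N i y / \<delta> y)"
  define \<Omega> where "\<Omega> = {y \<in> affine_space J. \<delta> y \<noteq> 0}"
  have "local_dim (subtopology (zariski I) X) x \<le> enat (card J - 1)"
  proof (rule local_dim_leI[OF X(1)])
    fix d f Z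
    assume Z: "Z \<subseteq> X" "x \<in> Z" and irr: "irreducible_in (subtopology (zariski I) X) Z"
      and f: "\<And>i. i < d \<Longrightarrow> f i \<in> poly_funs I" and ind: "alg_indep d f Z"
    have ind0: "alg_indep d (\<lambda>i y. f i (\<phi> y)) {y \<in> \<Omega>. h y = 0}"
      using ind
    proof (rule alg_indep_transfer)
      fix c L
      define rel where "rel = (\<lambda>x. \<Sum>a\<in>{..<d} \<rightarrow>\<^sub>E {..<L}. c a * (\<Prod>i<d. f i x ^ a i))"
      assume "\<And>w. w \<in> {y \<in> \<Omega>. h y = 0} \<Longrightarrow>
        (\<Sum>a\<in>{..<d} \<rightarrow>\<^sub>E {..<L}. c a * (\<Prod>i<d. f i (\<phi> w) ^ a i)) = 0"
      then have *: "rel (\<phi> w) = 0" if "w \<in> \<Omega>" "h w = 0" for w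
        using that by (simp add: rel_def)
      have rel: "rel \<in> poly_funs I"
        unfolding rel_def by (rule poly_funs_relation) (rule f)
      \<comment> \<open>Points with \<open>\<epsilon> z = 0\<close> may have no parameter.
        Multiplication by \<open>\<epsilon>\<close> discards them, and irreducibility of
        \<open>Z\<close> removes the factor again, since \<open>\<epsilon> x \<noteq> 0\<close> and
        \<open>x\<close> is in \<open>Z\<close>.\<close>
      have "\<epsilon> z * rel z = 0" if "z \<in> Z" for z
      proof (cases "\<epsilon> z = 0")
        case False
        have "z \<in> X" using that Z(1) by blast
        from param[OF this False]
        obtain y where y: "y \<in> affine_space J" "h y = 0" "\<delta> y \<noteq> 0" "\<forall>i\<in>I. z i = N i y / \<delta> y"
          by (elim bexE conjE)
        then have "rel z = rel (\<phi> y)"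
          by (intro poly_funs_cong[OF rel]) (simp add: \<phi>_def)
        then show ?thesis using *[of y] y by (simp add: \<Omega>_def)
      qed simp
      then have "\<forall>z\<in>Z. rel z = 0"
        using irreducible_in_domain[OF X(1) irr Z(1) \<epsilon>(1) rel] \<epsilon>(2) Z(2) by blast
      then show "\<forall>z\<in>Z. (\<Sum>a\<in>{..<d} \<rightarrow>\<^sub>E {..<L}. c a * (\<Prod>i<d. f i z ^ a i)) = 0"
        unfolding rel_def .
    qed
    have fR: "(\<lambda>y. f i (\<phi> y)) \<in> rational_funs J \<delta>" if "i < d" for i
      unfolding \<phi>_def by (rule rational_funs_compose[OF f[OF that] \<delta> N])
    have "alg_indep (Suc d) ((\<lambda>i y. f i (\<phi> y))(d := h)) \<Omega>"
    proof (rule alg_indep_Suc[OF ind0, where R = "rational_funs J \<delta>"])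
      fix F assume F: "F \<in> rational_funs J \<delta>" "\<And>z. z \<in> \<Omega> \<Longrightarrow> h z * F z = 0"
      obtain T k where T: "T \<in> poly_funs J" "\<forall>y. \<delta> y \<noteq> 0 \<longrightarrow> F y * \<delta> y ^ k = T y"
        using F(1) unfolding rational_funs_def by blast
      \<comment> \<open>The factor \<open>\<delta>\<close> extends the identity to the zeros of
        \<open>\<delta>\<close>, where nothing is known about \<open>T\<close>; now \<open>h\<close>
        can be cancelled as a polynomial.\<close>
      have "h y * (T y * \<delta> y) = 0" if "y \<in> affine_space J" for y
      proof (cases "\<delta> y = 0")
        case False
        then have "h y * F y = 0" using F(2) that by (simp add: \<Omega>_def)
        then show ?thesis using T(2) False by auto
      qed simp
      then have "\<forall>y\<in>affine_space J. T y * \<delta> y = 0"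
        using poly_funs_domain[OF h(1) poly_funs.mult[OF T(1) \<delta>], of J] h(2) by blast
      then show "\<forall>z\<in>\<Omega>. F z = 0"
        using T(2) unfolding \<Omega>_def by force
    qed (use fR in \<open>auto intro: rational_funs_add rational_funs_mult rational_funs_poly poly_funs.const \<delta> h(1)\<close>)
    then have "Suc d \<le> card J"
    proof (rule alg_indep_card_le[OF J \<delta>, rotated -1])
      show "\<delta> y \<noteq> 0" if "y \<in> \<Omega>" for y using that by (simp add: \<Omega>_def)
      fix i assume "i < Suc d"
      then have "((\<lambda>i y. f i (\<phi> y))(d := h)) i \<in> rational_funs J \<delta>"
        using fR rational_funs_poly[OF h(1)] by (cases "i = d") auto
      then show "\<exists>k. \<exists>T\<in>poly_funs J. \<forall>y\<in>\<Omega>. ((\<lambda>i y. f i (\<phi> y))(d := h)) i y * \<delta> y ^ k = T y"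
        unfolding rational_funs_def \<Omega>_def by blast
    qed
    then show "d \<le> card J - 1" by simp
  qed
  also have "\<dots> < enat (card J)" using \<open>0 < card J\<close> by simp
  finally show ?thesis .
qed

section \<open>Tangent spaces and smoothness\<close>

text \<open>The directional derivatives in the definition are values of gradients, so the tangent
  space is the solution set of linear equations.\<close>

lemma tangent_space_eq_gradient:
  assumes "finite I" and G: "\<And>f. f \<in> poly_funs I \<Longrightarrow> gradient_at I f x (G f)"
  shows "tangent_space I X x =
     {d \<in> affine_space I. \<forall>f \<in> poly_funs I. (\<forall>y\<in>X. f y = 0) \<longrightarrow> (\<Sum>i\<in>I. G f i * d i) = 0}"
proof -
  have "((\<lambda>t. f (\<lambda>i. x i + t * d i)) has_field_derivative 0) (at 0) \<longleftrightarrow> (\<Sum>i\<in>I. G f i * d i) = 0"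
    if "f \<in> poly_funs I" for f d
  proof -
    have *: "((\<lambda>t. f (\<lambda>i. x i + t * d i)) has_field_derivative (\<Sum>i\<in>I. G f i * d i)) (at 0)"
      by (rule gradient_atD[OF G[OF that]]) (auto intro!: derivative_eq_intros)
    then show ?thesis using DERIV_unique[OF *, of 0] by metis
  qed
  then show ?thesis unfolding tangent_space_def by (intro Collect_cong conj_cong ball_cong imp_cong refl) auto
qed

lemma gradients_exist:
  assumes "finite I"
  obtains G where "\<And>f. f \<in> poly_funs I \<Longrightarrow> gradient_at I f x (G f)"
proof -
  have "\<forall>f\<in>poly_funs I. \<exists>G. gradient_at I f x G"
    using poly_funs_gradient[OF assms] by blast
  then obtain G where "\<forall>f\<in>poly_funs I. gradient_at I f x (G f)"
    by (rule bchoice[THEN exE])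
  then show thesis using that by blast
qed

text \<open>A function that vanishes on \<open>X\<close> is zero along the curve near parameter
  \<open>0\<close>, so its gradient annihilates the velocity \<open>d\<close>.\<close>

lemma tangent_curve:
  assumes "finite I" "d \<in> affine_space I" "\<And>i. i \<in> I \<Longrightarrow> c 0 i = x i"
    and "\<And>i. i \<in> I \<Longrightarrow> ((\<lambda>t. c t i) has_field_derivative d i) (at 0)"
    and "eventually (\<lambda>t. c t \<in> X) (nhds (0::complex))"
  shows "d \<in> tangent_space I X x"
proof -
  obtain G where G: "\<And>f. f \<in> poly_funs I \<Longrightarrow> gradient_at I f x (G f)"
    using gradients_exist[OF assms(1)] by blast
  have "(\<Sum>i\<in>I. G f i * d i) = 0" if f: "f \<in> poly_funs I" "\<forall>y\<in>X. f y = 0" for f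
  proof -
    have *: "((\<lambda>t. f (c t)) has_field_derivative (\<Sum>i\<in>I. G f i * d i)) (at 0)"
      by (rule gradient_atD[OF G[OF f(1)]]) (use assms in auto)
    have "eventually (\<lambda>t. f (c t) = 0) (nhds 0)"
      using assms(5) by (rule eventually_mono) (use f in auto)
    then have "((\<lambda>t. f (c t)) has_field_derivative (\<Sum>i\<in>I. G f i * d i)) (at 0) \<longleftrightarrow>
        ((\<lambda>t. 0) has_field_derivative (\<Sum>i\<in>I. G f i * d i)) (at (0::complex))"
      by (intro DERIV_cong_ev) auto
    then show ?thesis using * DERIV_unique[OF _ DERIV_const] by blast
  qed
  moreover have "tangent_space I X x =
     {d \<in> affine_space I. \<forall>f \<in> poly_funs I. (\<forall>y\<in>X. f y = 0) \<longrightarrow> (\<Sum>i\<in>I. G f i * d i) = 0}"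
    by (rule tangent_space_eq_gradient[OF assms(1)]) (rule G)
  ultimately show ?thesis using assms(2) by blast
qed

interpretation fs: vector_space fun_scale
  by (rule vector_space_fun_scale)

lemma sum_fun_scale_apply: "(\<Sum>a\<in>A. fun_scale (r a) (v a)) i = (\<Sum>a\<in>A. r a * v a i)"
  by (induction A rule: infinite_finite_induct) (auto simp: fun_scale_def)

lemma affine_space_subset_span:
  assumes "finite I"
  shows "affine_space I \<subseteq> fs.span ((\<lambda>i j. if j = i then 1 else 0) ` I)"
proof
  fix x assume "x \<in> affine_space I"
  then have "x = (\<Sum>i\<in>I. fun_scale (x i) (\<lambda>j. if j = i then 1 else 0))"
    using assms unfolding fun_eq_iff sum_fun_scale_apply
    by (auto simp: affine_space_def if_distrib[of "\<lambda>a. _ * a"] cong: if_cong)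
  then show "x \<in> fs.span ((\<lambda>i j. if j = i then 1 else 0) ` I)"
    by (metis (no_types, lifting) fs.span_sum fs.span_scale fs.span_base imageI)
qed

text \<open>A basis of \<open>T\<close> is finite because the ambient space is spanned by finitely
  many unit vectors; the dimension is then an honest upper bound.\<close>

lemma card_le_dim:
  assumes I: "finite I" and T: "T \<subseteq> affine_space I" and S: "S \<subseteq> T" "fs.independent S"
  shows "card S \<le> fs.dim T"
proof -
  obtain B where B: "B \<subseteq> T" "fs.independent B" "T \<subseteq> fs.span B" "card B = fs.dim T"
    using fs.basis_exists[of T] by blast
  have "finite B"
    using fs.independent_span_bound[OF _ B(2), of "(\<lambda>i j. if j = i then 1 else 0) ` I"]
      affine_space_subset_span[OF I] I B(1) T by blast
  then show ?thesis
    using fs.independent_span_bound[OF _ S(2), of B] S(1) B by (metis subset_trans)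
qed

text \<open>In a vanishing linear combination, take an index \<open>i\<close> of maximal weight
  among those with nonzero coefficient: no other vector that occurs has a nonzero entry at
  \<open>i\<close>.\<close>

lemma card_le_dim_triangular:
  fixes m :: "'i \<Rightarrow> int"
  assumes I: "finite I" and T: "T \<subseteq> affine_space I" and J: "finite J" and v: "\<And>j. j \<in> J \<Longrightarrow> v j \<in> T"
    and diag: "\<And>j. j \<in> J \<Longrightarrow> v j j \<noteq> 0"
    and tri: "\<And>i j. i \<in> J \<Longrightarrow> j \<in> J \<Longrightarrow> i \<noteq> j \<Longrightarrow> v j i \<noteq> 0 \<Longrightarrow> m i < m j"
  shows "card J \<le> fs.dim T"
proof -
  have lin: "\<forall>j\<in>J. r j = 0" if r: "(\<Sum>j\<in>J. fun_scale (r j) (v j)) = 0" for r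
  proof (rule ccontr)
    assume neg: "\<not> (\<forall>j\<in>J. r j = 0)"
    define K where "K = {j \<in> J. r j \<noteq> 0}"
    have K: "finite K" "K \<noteq> {}" using J neg by (auto simp: K_def)
    then have "Max (m ` K) \<in> m ` K" by simp
    then obtain i where i: "i \<in> K" "m i = Max (m ` K)" by force
    have le: "m j \<le> m i" if "j \<in> K" for j using that K i by simp
    have "r j * v j i = 0" if "j \<in> J - {i}" for j
    proof (cases "r j = 0")
      case False
      then have "m j \<le> m i" using le that by (simp add: K_def)
      then have "v j i = 0" using tri[of i j] that i by (force simp: K_def)
      then show ?thesis by simp
    qed simp
    then have "(\<Sum>j\<in>J. r j * v j i) = r i * v i i"
      using J i by (subst sum.remove[of J i]) (auto simp: K_def simp del: mult_eq_0_iff intro!: sum.neutral)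
    moreover have "(\<Sum>j\<in>J. r j * v j i) = 0" using r sum_fun_scale_apply[of r v J i] by simp
    ultimately show False using diag i by (auto simp: K_def)
  qed
  have inj: "inj_on v J"
  proof (rule inj_onI)
    fix a b assume ab: "a \<in> J" "b \<in> J" "v a = v b"
    show "a = b"
    proof (rule ccontr)
      assume "a \<noteq> b"
      have "m a < m b" using tri[of a b] ab diag \<open>a \<noteq> b\<close> by metis
      moreover have "m b < m a" using tri[of b a] ab diag \<open>a \<noteq> b\<close> by metis
      ultimately show False by simp
    qed
  qed
  have "fs.independent (v ` J)"
  proof (rule ccontr)
    assume "\<not> fs.independent (v ` J)"
    then obtain u where u: "\<exists>w\<in>v ` J. u w \<noteq> 0" "(\<Sum>w\<in>v ` J. fun_scale (u w) w) = 0"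
      using fs.dependent_finite[of "v ` J"] J by auto
    then have "(\<Sum>j\<in>J. fun_scale (u (v j)) (v j)) = 0"
      using sum.reindex[OF inj, of "\<lambda>w. fun_scale (u w) w"] by (simp only: comp_def)
    then show False using lin[of "\<lambda>j. u (v j)"] u(1) by blast
  qed
  then show ?thesis
    using card_le_dim[OF I T, of "v ` J"] v card_image[OF inj] by auto
qed

lemma dim_affine_space:
  assumes J: "finite J"
  shows "fs.dim (affine_space J) = card J"
proof (rule antisym)
  show "card J \<le> fs.dim (affine_space J)"
    by (rule card_le_dim_triangular[OF J _ J, where v = "\<lambda>i j. if j = i then 1 else 0" and m = "\<lambda>_. 0"])
       (auto simp: affine_space_def)
  show "fs.dim (affine_space J) \<le> card J"
  proof -
    obtain B where B: "B \<subseteq> affine_space J" "fs.independent B" "affine_space J \<subseteq> fs.span B"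
      "card B = fs.dim (affine_space J)"
      by (rule fs.basis_exists[of "affine_space J"])
    let ?E = "(\<lambda>i j. if j = i then 1 else 0 :: complex) ` J"
    have "card B \<le> card ?E"
      using fs.independent_span_bound[OF finite_imageI[OF J] B(2)]
        subset_trans[OF B(1) affine_space_subset_span[OF J]] by simp
    also have "\<dots> \<le> card J" by (rule card_image_le[OF J])
    finally show ?thesis using B(4) by simp
  qed
qed

lemma affine_space_mono: "J \<subseteq> I \<Longrightarrow> affine_space J \<subseteq> affine_space I"
  by (auto simp: affine_space_def)

text \<open>A polynomial automorphism tangent to the identity at the origin carries a coordinate
  subspace to a variety smooth there. The components of the inverse \<open>\<rho>\<close> outside
  \<open>J\<close> are equations for the image, which bound its tangent space. The images of a
  growing sequence of coordinate subspaces form a chain of length \<open>card J\<close>, and the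
  parametrization by \<open>J\<close> gives the matching upper bound.\<close>

lemma smooth_coordinate_image:
  assumes I: "finite I" and J: "J \<subseteq> I"
    and \<phi>: "\<And>i. i \<in> I \<Longrightarrow> (\<lambda>y. \<phi> y i) \<in> poly_funs I" "\<And>y. y \<in> affine_space I \<Longrightarrow> \<phi> y \<in> affine_space I"
    and \<rho>: "\<And>i. i \<in> I \<Longrightarrow> (\<lambda>y. \<rho> y i) \<in> poly_funs I" "\<And>y. y \<in> affine_space I \<Longrightarrow> \<rho> y \<in> affine_space I"
    and inv: "\<And>y. y \<in> affine_space I \<Longrightarrow> \<rho> (\<phi> y) = y" "\<And>y. y \<in> affine_space I \<Longrightarrow> \<phi> (\<rho> y) = y"
    and \<phi>0: "\<phi> (\<lambda>_. 0) = (\<lambda>_. 0)"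
    and d\<phi>: "\<And>d i. i \<in> I \<Longrightarrow> d \<in> affine_space I \<Longrightarrow>
       ((\<lambda>t. \<phi> (\<lambda>j. t * d j) i) has_field_derivative d i) (at 0)"
    and X: "X = \<phi> ` affine_space J"
  shows "affine_smooth_at I X (\<lambda>_. 0)"
proof -
  have finJ: "finite J" using I J by (rule finite_subset[rotated])
  have AJ: "affine_space J \<subseteq> affine_space I" using J by (rule affine_space_mono)
  have XI: "X \<subseteq> affine_space I" using X \<phi>(2) AJ by blast
  have scale: "(\<lambda>j. t * d j) \<in> affine_space K" if "d \<in> affine_space K" for d t and K :: "'a set"
    using that by (auto simp: affine_space_def)
  have 0: "(\<lambda>_. 0) \<in> affine_space K" for K :: "'a set" by (simp add: affine_space_def)
  have "tangent_space I X (\<lambda>_. 0) = affine_space J"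
  proof
    show "affine_space J \<subseteq> tangent_space I X (\<lambda>_. 0)"
    proof
      fix d assume d: "d \<in> affine_space J"
      show "d \<in> tangent_space I X (\<lambda>_. 0)"
        by (rule tangent_curve[OF I, where c = "\<lambda>t. \<phi> (\<lambda>j. t * d j)"])
           (use d AJ d\<phi> \<phi>0 scale[OF d] X in auto)
    qed
    obtain G where G: "\<And>f. f \<in> poly_funs I \<Longrightarrow> gradient_at I f (\<lambda>_. 0) (G f)"
      using gradients_exist[OF I] by blast
    have Teq: "tangent_space I X (\<lambda>_. 0) =
       {d \<in> affine_space I. \<forall>f \<in> poly_funs I. (\<forall>y\<in>X. f y = 0) \<longrightarrow> (\<Sum>i\<in>I. G f i * d i) = 0}"
      by (rule tangent_space_eq_gradient[OF I]) (rule G)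
    show "tangent_space I X (\<lambda>_. 0) \<subseteq> affine_space J"
    proof
      fix d assume d: "d \<in> tangent_space I X (\<lambda>_. 0)"
      then have dI: "d \<in> affine_space I" by (simp add: tangent_space_def)
      have "d j = 0" if j: "j \<in> I" "j \<notin> J" for j
      proof -
        have "\<forall>y\<in>X. \<rho> y j = 0"
          using X inv(1) AJ j by (auto simp: affine_space_def)
        then have "(\<Sum>i\<in>I. G (\<lambda>y. \<rho> y j) i * d i) = 0"
          using d \<rho>(1)[OF j(1)] unfolding Teq by simp
        \<comment> \<open>Differentiating \<open>\<rho> (\<phi> (t d)) = t d\<close> at
          \<open>0\<close> shows that the gradient of the component \<open>j\<close> of
          \<open>\<rho>\<close> evaluates to \<open>d j\<close>.\<close>
        moreover have "((\<lambda>t. \<rho> (\<phi> (\<lambda>i. t * d i)) j) has_field_derivative (\<Sum>i\<in>I. G (\<lambda>y. \<rho> y j) i * d i)) (at 0)"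
          by (rule gradient_atD[OF G[OF \<rho>(1)[OF j(1)]]]) (use d\<phi> dI \<phi>0 in auto)
        moreover have "((\<lambda>t. \<rho> (\<phi> (\<lambda>i. t * d i)) j) has_field_derivative d j) (at 0)"
          unfolding inv(1)[OF scale[OF dI]] by (auto intro!: derivative_eq_intros)
        ultimately show ?thesis using DERIV_unique by metis
      qed
      then show "d \<in> affine_space J" using dI by (auto simp: affine_space_def)
    qed
  qed
  then have dim: "fs.dim (tangent_space I X (\<lambda>_. 0)) = card J"
    using dim_affine_space[OF finJ] by simp
  have "local_dim (subtopology (zariski I) X) (\<lambda>_. 0) \<le> enat (card J)"
  proof (rule local_dim_image_le[OF finJ, where \<phi> = "\<lambda>y. \<phi> (\<lambda>j. if j \<in> J then y j else 0)"])
    show "X = (\<lambda>y. \<phi> (\<lambda>j. if j \<in> J then y j else 0)) ` affine_space J"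
    proof -
      have "(\<lambda>j. if j \<in> J then y j else 0) = y" if "y \<in> affine_space J" for y :: "'a \<Rightarrow> complex"
        using that by (auto simp: affine_space_def)
      then show ?thesis using X by auto
    qed
    show "(\<lambda>y. \<phi> (\<lambda>j. if j \<in> J then y j else 0) i) \<in> poly_funs J" if "i \<in> I" for i
    proof (rule poly_funs_compose[OF \<phi>(1)[OF that]])
      fix j show "(\<lambda>y. if j \<in> J then y j else 0) \<in> poly_funs J"
        by (cases "j \<in> J") (auto intro: poly_funs.intros)
    qed
  qed (rule XI)
  moreover have "enat (card J) \<le> local_dim (subtopology (zariski I) X) (\<lambda>_. 0)"
  proof -
    obtain e where e: "bij_betw e {0..<card J} J" using ex_bij_betw_nat_finite[OF finJ] by blast
    define Jk where "Jk k = e ` {..<k}" for k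
    have Jk: "Jk k \<subseteq> J" if "k \<le> card J" for k
      using e that by (auto simp: Jk_def bij_betw_def)
    define Z where "Z k = \<phi> ` affine_space (Jk k)" for k
    have Zeq: "Z k = {x \<in> X. \<forall>f\<in>(\<lambda>j y. \<rho> y j) ` (I - Jk k). f x = 0}" if k: "k \<le> card J" for k
    proof -
      have *: "\<rho> x j = 0" if x: "x \<in> Z k" "j \<in> I - Jk k" for x j
      proof -
        obtain y where y: "y \<in> affine_space (Jk k)" "x = \<phi> y" using x(1) unfolding Z_def by blast
        then have "\<rho> x = y" using inv(1) affine_space_mono[OF Jk[OF k]] AJ by blast
        then show ?thesis using y x by (auto simp: affine_space_def)
      qed
      have **: "x \<in> Z k" if "x \<in> X" "\<forall>j\<in>I - Jk k. \<rho> x j = 0" for x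
      proof -
        have "\<rho> x \<in> affine_space (Jk k)" using that \<rho>(2) XI by (auto simp: affine_space_def)
        moreover have "\<phi> (\<rho> x) = x" using inv(2) that(1) XI by blast
        ultimately show ?thesis unfolding Z_def by (metis imageI)
      qed
      have "Z k \<subseteq> X" unfolding X Z_def using affine_space_mono[OF Jk[OF k]] by blast
      show ?thesis
      proof (intro Set.equalityI subsetI CollectI conjI ballI)
        fix x f assume "x \<in> Z k" "f \<in> (\<lambda>j y. \<rho> y j) ` (I - Jk k)"
        then show "f x = 0" using * by auto
      qed (use ** \<open>Z k \<subseteq> X\<close> in auto)
    qed
    have cl: "closedin (subtopology (zariski I) X) (Z k)" if "k \<le> card J" for k
      unfolding closedin_zariski_subtopology[OF XI] Zeq[OF that]
      using \<rho>(1) by (intro exI[of _ "(\<lambda>j y. \<rho> y j) ` (I - Jk k)"]) auto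
    have irr: "irreducible_in (subtopology (zariski I) X) (Z k)" if k: "k \<le> card J" for k
      unfolding irreducible_in_def
    proof (intro conjI allI impI)
      show "Z k \<noteq> {}" using 0 by (auto simp: Z_def)
      fix A B
      assume AB: "closedin (subtopology (zariski I) X) A \<and> closedin (subtopology (zariski I) X) B \<and> Z k \<subseteq> A \<union> B"
      obtain F where F: "F \<subseteq> poly_funs I" "A = {x \<in> X. \<forall>f\<in>F. f x = 0}"
        using AB unfolding closedin_zariski_subtopology[OF XI] by blast
      obtain G where G: "G \<subseteq> poly_funs I" "B = {x \<in> X. \<forall>f\<in>G. f x = 0}"
        using AB unfolding closedin_zariski_subtopology[OF XI] by blast
      have ZX: "Z k \<subseteq> X" using Zeq[OF k] by blast
      show "Z k \<subseteq> A \<or> Z k \<subseteq> B"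
      proof (rule ccontr)
        assume "\<not> ?thesis"
        then obtain f g where fg: "f \<in> F" "\<exists>z\<in>Z k. f z \<noteq> 0" "g \<in> G" "\<exists>z\<in>Z k. g z \<noteq> 0"
          using F G ZX by blast
        then have p: "f \<in> poly_funs I" "g \<in> poly_funs I" using F G by auto
        have "f (\<phi> y) * g (\<phi> y) = 0" if "y \<in> affine_space (Jk k)" for y
        proof -
          have "\<phi> y \<in> A \<union> B" using AB that by (auto simp: Z_def)
          then show ?thesis using F G fg by auto
        qed
        from poly_funs_domain[OF poly_funs_compose[OF p(1) \<phi>(1)] poly_funs_compose[OF p(2) \<phi>(1)] this]
        show False using fg by (auto simp: Z_def)
      qed
    qed
    have inc: "Z k \<subset> Z (Suc k)" if k: "k < card J" for k
    proof -
      have "Jk k \<subseteq> Jk (Suc k)" by (auto simp: Jk_def)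
      then have "Z k \<subseteq> Z (Suc k)" unfolding Z_def using affine_space_mono by blast
      moreover have "e k \<notin> Jk k"
      proof
        assume "e k \<in> Jk k"
        then obtain l where "l < k" "e l = e k" by (auto simp: Jk_def)
        then show False using e k unfolding bij_betw_def inj_on_def
          by (metis atLeast0LessThan lessThan_iff less_trans nat_neq_iff)
      qed
      define u where "u = (\<lambda>j. if j = e k then 1 else 0 :: complex)"
      have u: "u \<in> affine_space (Jk (Suc k))" by (auto simp: u_def affine_space_def Jk_def)
      then have uI: "u \<in> affine_space I" using affine_space_mono[OF Jk[of "Suc k"]] AJ k by auto
      have "\<phi> u \<notin> Z k"
      proof
        assume "\<phi> u \<in> Z k"
        then obtain w where w: "w \<in> affine_space (Jk k)" "\<phi> u = \<phi> w" by (auto simp: Z_def)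
        have "w \<in> affine_space I" using w(1) affine_space_mono[OF Jk[of k]] AJ k by auto
        then have "u = w" using inv(1) w(2) uI by metis
        then show False using w(1) \<open>e k \<notin> Jk k\<close> by (auto simp: u_def affine_space_def)
      qed
      ultimately show ?thesis using u by (auto simp: Z_def)
    qed
    have "(\<lambda>_. 0) \<in> Z k" for k using 0 \<phi>0 by (force simp: Z_def)
    then show ?thesis
      unfolding local_dim_def using cl irr inc
      by (intro SUP_upper CollectI exI[of _ Z]) auto
  qed
  moreover have "(\<lambda>_. 0) \<in> X" using X 0 \<phi>0 by force
  ultimately show ?thesis unfolding affine_smooth_at_def dim by auto
qed

text \<open>Let \<open>F\<^sub>s\<close> be the lowest nonzero homogeneous part of \<open>F\<close> at \<open>w\<close>; dividing by \<open>t\<^sup>s\<close> and letting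
  \<open>t\<close> tend to \<open>0\<close> shows \<open>F\<^sub>s = 0\<close> on \<open>V\<close>.\<close>

lemma poly_funs_vanish_by_tangent:
  assumes F: "F \<in> poly_funs I" and Q: "\<And>y. y \<in> V \<Longrightarrow> Q y \<in> V"
    and V: "\<And>x y t. x \<in> V \<Longrightarrow> y \<in> V \<Longrightarrow> (\<lambda>i. x i + t * y i) \<in> V"
    and F0: "\<And>y t. y \<in> V \<Longrightarrow> F (\<lambda>i. w i + t * (y i + t * Q y i)) = 0" and y: "y \<in> V"
  shows "F (\<lambda>i. w i + y i) = 0"
proof -
  \<comment> \<open>On the rays from \<open>w\<close> the function is a polynomial in
    \<open>t\<close> whose coefficients \<open>H s\<close> are polynomial functions of the
    direction.\<close>
  have "\<exists>N::nat. \<exists>H. (\<forall>s. H s \<in> poly_funs I) \<and> (\<forall>y t. F (\<lambda>i. w i + t * y i) = (\<Sum>s<N. t ^ s * H s y))"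
    using F
  proof (induction F)
    case (const c)
    show ?case by (rule exI[of _ 1], rule exI[of _ "\<lambda>_ _. c"]) (auto intro: poly_funs.const)
  next
    case (coord i)
    have mem: "(\<lambda>y. if s = 0 then w i else y i) \<in> poly_funs I" for s :: nat
      by (cases "s = 0") (simp_all add: poly_funs.const poly_funs.coord coord)
    show ?case
      apply (rule exI[of _ 2], rule exI[of _ "\<lambda>s y. if s = 0 then w i else y i"])
      apply (intro conjI allI)
       apply (rule mem)
      apply (simp add: numeral_2_eq_2)
      done
  next
    case (add f g)
    from add.IH(1) obtain N :: nat and H
      where H: "\<forall>s. H s \<in> poly_funs I" "\<forall>y t. f (\<lambda>i. w i + t * y i) = (\<Sum>s<N. t ^ s * H s y)"
      by (elim exE conjE) (rule that)
    from add.IH(2) obtain M :: nat and K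
      where K: "\<forall>s. K s \<in> poly_funs I" "\<forall>y t. g (\<lambda>i. w i + t * y i) = (\<Sum>s<M. t ^ s * K s y)"
      by (elim exE conjE) (rule that)
    have e1: "(\<Sum>s<N. t ^ s * H s y) = (\<Sum>s<max N M. t ^ s * (if s < N then H s y else 0))" for t y
      by (rule sum.mono_neutral_cong_left) auto
    have e2: "(\<Sum>s<M. t ^ s * K s y) = (\<Sum>s<max N M. t ^ s * (if s < M then K s y else 0))" for t y
      by (rule sum.mono_neutral_cong_left) auto
    have mem: "(\<lambda>y. (if s < N then H s y else 0) + (if s < M then K s y else 0)) \<in> poly_funs I" for s
      using H(1) K(1) by (cases "s < N"; cases "s < M") (auto intro: poly_funs.intros)
    show ?case
      by (rule exI[of _ "max N M"], rule exI[of _ "\<lambda>s y. (if s < N then H s y else 0) + (if s < M then K s y else 0)"])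
         (use mem in \<open>simp only: H(2) K(2) e1 e2 distrib_left sum.distrib simp_thms\<close>)
  next
    case (mult f g)
    from mult.IH(1) obtain N :: nat and H
      where H: "\<forall>s. H s \<in> poly_funs I" "\<forall>y t. f (\<lambda>i. w i + t * y i) = (\<Sum>s<N. t ^ s * H s y)"
      by (elim exE conjE) (rule that)
    from mult.IH(2) obtain M :: nat and K
      where K: "\<forall>s. K s \<in> poly_funs I" "\<forall>y t. g (\<lambda>i. w i + t * y i) = (\<Sum>s<M. t ^ s * K s y)"
      by (elim exE conjE) (rule that)
    define S where "S s = {(a, b). a < N \<and> b < M \<and> a + b = s}" for s
    have finS: "finite (S s)" for s
      by (rule finite_subset[of _ "{..<N} \<times> {..<M}"]) (auto simp: S_def)
    have "(\<Sum>s<N. t ^ s * H s y) * (\<Sum>s<M. t ^ s * K s y) =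
        (\<Sum>s<N + M. t ^ s * (\<Sum>(a, b)\<in>S s. H a y * K b y))" for t y
    proof -
      have "(\<Sum>s<N. t ^ s * H s y) * (\<Sum>s<M. t ^ s * K s y) =
         (\<Sum>(a, b)\<in>{..<N} \<times> {..<M}. t ^ (a + b) * (H a y * K b y))"
        unfolding sum_product sum.cartesian_product by (intro sum.cong) (auto simp: power_add)
      also have "{..<N} \<times> {..<M} = (\<Union>s\<in>{..<N + M}. S s)" by (auto simp: S_def)
      also have "(\<Sum>(a, b)\<in>(\<Union>s\<in>{..<N + M}. S s). t ^ (a + b) * (H a y * K b y)) =
         (\<Sum>s<N + M. \<Sum>(a, b)\<in>S s. t ^ (a + b) * (H a y * K b y))"
        by (rule sum.UNION_disjoint) (use finS in \<open>auto simp: S_def\<close>)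
      also have "\<dots> = (\<Sum>s<N + M. t ^ s * (\<Sum>(a, b)\<in>S s. H a y * K b y))"
        unfolding sum_distrib_left by (intro sum.cong) (auto simp: S_def)
      finally show ?thesis .
    qed
    moreover have "(\<lambda>y. \<Sum>(a, b)\<in>S s. H a y * K b y) \<in> poly_funs I" for s
      unfolding case_prod_unfold using H(1) K(1) by (intro poly_funs_sum poly_funs.mult) auto
    ultimately show ?case
      by (intro exI[of _ "N + M"] exI[of _ "\<lambda>s y. \<Sum>(a, b)\<in>S s. H a y * K b y"]) (simp add: H(2) K(2))
  qed
  then obtain N :: nat and H where H': "\<forall>s. H s \<in> poly_funs I"
    "\<forall>y t. F (\<lambda>i. w i + t * y i) = (\<Sum>s<N. t ^ s * H s y)" by (elim exE conjE) (rule that)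
  note H = H'[rule_format]
  have H0: "\<forall>y\<in>V. H s y = 0" if "s < N" for s
    using that
  proof (induction s rule: less_induct)
    case (less s)
    show ?case
    proof
      fix y assume y: "y \<in> V"
      \<comment> \<open>For fixed \<open>y\<close> this is a line in \<open>t\<close>, so each
        \<open>H s'\<close> becomes a one-variable polynomial along it.\<close>
      define z where "z t = (\<lambda>i. y i + t * Q y i)" for t
      have zV: "z t \<in> V" for t unfolding z_def by (intro V y Q)
      define g where "g t = (\<Sum>s'\<in>{s..<N}. t ^ (s' - s) * H s' (z t))" for t
      have "\<exists>P. \<forall>t. H s' (z t) = poly P t" for s'
        unfolding z_def by (rule poly_funs_line[OF H(1)])
      then obtain P where P: "\<And>s' t. H s' (z t) = poly (P s') t" by metis
      have gp: "g t = poly (\<Sum>s'\<in>{s..<N}. monom 1 (s' - s) * P s') t" for t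
        by (simp add: g_def P poly_sum poly_monom)
      \<comment> \<open>Below \<open>s\<close> the coefficients vanish on \<open>V\<close> by
        induction, and \<open>z t\<close> lies in \<open>V\<close>, so \<open>t ^ s\<close> can be
        split off.\<close>
      have g0: "t ^ s * g t = 0" for t
      proof -
        have "0 = (\<Sum>s'<N. t ^ s' * H s' (z t))"
          using F0[OF y, of t] H(2)[of t "z t"] by (simp add: z_def)
        also have "\<dots> = (\<Sum>s'\<in>{s..<N}. t ^ s' * H s' (z t))"
          using less.IH zV less.prems by (intro sum.mono_neutral_right) auto
        also have "\<dots> = t ^ s * g t"
          unfolding g_def sum_distrib_left
          by (intro sum.cong) (auto simp: mult.assoc[symmetric] power_add[symmetric])
        finally show ?thesis by simp
      qed
      have "poly (monom 1 s * (\<Sum>s'\<in>{s..<N}. monom 1 (s' - s) * P s')) t = 0" for t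
        using g0[of t] by (simp add: gp poly_monom)
      then have "monom 1 s * (\<Sum>s'\<in>{s..<N}. monom 1 (s' - s) * P s') = 0"
        using poly_all_0_iff_0 by blast
      then have "(\<Sum>s'\<in>{s..<N}. monom 1 (s' - s) * P s') = 0" by (simp add: monom_eq_0_iff)
      then have "g 0 = 0" by (simp add: gp)
      moreover have "g 0 = (\<Sum>s'\<in>{s..<N}. if s' = s then H s (z 0) else 0)"
        unfolding g_def by (intro sum.cong) auto
      ultimately show "H s y = 0" using less.prems by (simp add: z_def)
    qed
  qed
  have "F (\<lambda>i. w i + 1 * y i) = (\<Sum>s<N. 1 ^ s * H s y)" by (rule H(2))
  then show ?thesis using H0 y by simp
qed

section \<open>Invertible and triangular matrices\<close>

lemma index_mult_mat_sum:
  assumes "A \<in> carrier_mat n m" "B \<in> carrier_mat m k" "i < n" "j < k"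
  shows "(A * B) $$ (i, j) = (\<Sum>l<m. A $$ (i, l) * B $$ (l, j))"
  using assms by (simp add: scalar_prod_def lessThan_atLeast0)

lemma index_mult_vec_sum:
  assumes "A \<in> carrier_mat n m" "v \<in> carrier_vec m" "i < n"
  shows "(A *\<^sub>v v) $ i = (\<Sum>l<m. A $$ (i, l) * v $ l)"
  using assms by (simp add: scalar_prod_def lessThan_atLeast0)

lemma GL_iff:
  "g \<in> GL n \<longleftrightarrow> g \<in> carrier_mat n n \<and> (\<exists>h\<in>carrier_mat n n. g * h = 1\<^sub>m n \<and> h * g = 1\<^sub>m n)"
proof
  assume "g \<in> GL n"
  then have g: "g \<in> carrier_mat n n" "invertible_mat g" by (auto simp: GL_def)
  then obtain h where h: "g * h = 1\<^sub>m n" "h * g = 1\<^sub>m (dim_row h)"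
    by (auto simp: invertible_mat_def inverts_mat_def)
  have "dim_row h = n" using arg_cong[OF h(2), of dim_col] g by simp
  moreover have "dim_col h = n" using arg_cong[OF h(1), of dim_col] by simp
  ultimately show "g \<in> carrier_mat n n \<and> (\<exists>h\<in>carrier_mat n n. g * h = 1\<^sub>m n \<and> h * g = 1\<^sub>m n)"
    using g h by (auto intro!: bexI[of _ h])
next
  assume "g \<in> carrier_mat n n \<and> (\<exists>h\<in>carrier_mat n n. g * h = 1\<^sub>m n \<and> h * g = 1\<^sub>m n)"
  then show "g \<in> GL n" by (auto simp: GL_def invertible_mat_def inverts_mat_def)
qed

lemma GL_carrier: "g \<in> GL n \<Longrightarrow> g \<in> carrier_mat n n"
  by (simp add: GL_def)

lemma GL_inverse:
  assumes "g \<in> GL n"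
  obtains h where "h \<in> GL n" "g * h = 1\<^sub>m n" "h * g = 1\<^sub>m n"
  using assms unfolding GL_iff by blast

lemma one_GL: "1\<^sub>m n \<in> GL n"
  unfolding GL_iff by (auto intro!: bexI[of _ "1\<^sub>m n"])

lemma mult_GL:
  assumes "g \<in> GL n" "h \<in> GL n"
  shows "g * h \<in> GL n"
proof -
  obtain g' where g': "g' \<in> GL n" "g * g' = 1\<^sub>m n" "g' * g = 1\<^sub>m n" using GL_inverse[OF assms(1)] .
  obtain h' where h': "h' \<in> GL n" "h * h' = 1\<^sub>m n" "h' * h = 1\<^sub>m n" using GL_inverse[OF assms(2)] .
  note c = GL_carrier[OF assms(1)] GL_carrier[OF assms(2)] GL_carrier[OF g'(1)] GL_carrier[OF h'(1)]
  have "(g * h) * (h' * g') = g * (h * h') * g'"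
    using c by (simp add: assoc_mult_mat[where n\<^sub>2 = n and n\<^sub>3 = n and n\<^sub>4 = n])
  then have 1: "(g * h) * (h' * g') = 1\<^sub>m n" using c g' h' by simp
  have "(h' * g') * (g * h) = h' * (g' * g) * h"
    using c by (simp add: assoc_mult_mat[where n\<^sub>2 = n and n\<^sub>3 = n and n\<^sub>4 = n])
  then have 2: "(h' * g') * (g * h) = 1\<^sub>m n" using c g' h' by simp
  show ?thesis unfolding GL_iff using c 1 2 by (intro conjI bexI[of _ "h' * g'"]) auto
qed

lemma GL_det:
  assumes "g \<in> carrier_mat n n" "det g \<noteq> 0"
  shows "g \<in> GL n"
proof -
  have "\<exists>h\<in>carrier_mat n n. h * g = 1\<^sub>m n"
    using det_non_zero_imp_unit[OF assms, of "()"] unfolding Units_def ring_mat_def by auto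
  then show ?thesis
    unfolding GL_iff using assms(1) mat_mult_left_right_inverse by blast
qed

lemma upper_triangular_entry:
  "upper_triangular b \<Longrightarrow> b \<in> carrier_mat n n \<Longrightarrow> j < i \<Longrightarrow> i < n \<Longrightarrow> b $$ (i, j) = 0"
  by auto

lemma upper_triangular_mult:
  assumes "upper_triangular a" "upper_triangular b" "a \<in> carrier_mat n n" "b \<in> carrier_mat n n"
  shows "upper_triangular (a * b)"
proof (rule upper_triangularI)
  fix i j assume "j < i" "i < dim_row (a * b)"
  then have ij: "j < i" "i < n" "j < n" using assms by auto
  have "a $$ (i, l) * b $$ (l, j) = 0" if "l < n" for l
    using upper_triangular_entry[OF assms(1,3), of l i] upper_triangular_entry[OF assms(2,4), of j l] that ij
    by (cases "l < i") auto
  then show "(a * b) $$ (i, j) = 0"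
    using ij by (simp add: index_mult_mat_sum[OF assms(3,4)])
qed

text \<open>Columns are treated from left to right: once the entries of row \<open>i\<close> of
  \<open>c\<close> to the left of column \<open>j\<close> are known to be zero, the entry
  \<open>(i, j)\<close> of \<open>c * b\<close> is the single product
  \<open>c $$ (i, j) * b $$ (j, j)\<close>.\<close>

lemma upper_triangular_inverse:
  fixes b c :: "complex mat"
  assumes b: "upper_triangular b" "b \<in> carrier_mat n n"
    and c: "c \<in> carrier_mat n n" "c * b = 1\<^sub>m n"
  shows "upper_triangular c" "\<And>i. i < n \<Longrightarrow> c $$ (i, i) * b $$ (i, i) = 1"
proof -
  have eq: "(\<Sum>l<n. c $$ (i, l) * b $$ (l, j)) = (if i = j then 1 else 0)" if "i < n" "j < n" for i j
    using arg_cong[OF c(2), of "\<lambda>m. m $$ (i, j)"] that index_mult_mat_sum[OF c(1) b(2), of i j] by auto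
  have sum: "(\<Sum>l<n. c $$ (i, l) * b $$ (l, j)) = c $$ (i, j) * b $$ (j, j)"
    if "i < n" "j < n" "\<And>l. l < j \<Longrightarrow> c $$ (i, l) = 0" for i j
  proof -
    have "(\<Sum>l<n. c $$ (i, l) * b $$ (l, j)) = (\<Sum>l<n. if l = j then c $$ (i, j) * b $$ (j, j) else 0)"
    proof (rule sum.cong)
      fix l assume "l \<in> {..<n}"
      then show "c $$ (i, l) * b $$ (l, j) = (if l = j then c $$ (i, j) * b $$ (j, j) else 0)"
        using that upper_triangular_entry[OF b, of j l] by (cases l j rule: linorder_cases) auto
    qed simp
    then show ?thesis using that by simp
  qed
  have low: "c $$ (i, j) = 0" if "j < i" "i < n" for i j
    using that
  proof (induction j arbitrary: i rule: less_induct)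
    case (less j)
    have "c $$ (j, j) * b $$ (j, j) = 1"
      using eq[of j j] sum[of j j] less by simp
    moreover have "c $$ (i, j) * b $$ (j, j) = 0"
      using eq[of i j] sum[of i j] less by simp
    ultimately show ?case by auto
  qed
  show "upper_triangular c" using low c(1) by (intro upper_triangularI) auto
  fix i assume "i < n"
  then show "c $$ (i, i) * b $$ (i, i) = 1" using eq[of i i] sum[of i i] low by simp
qed

text \<open>A predicate that is closed under products and inverses, whereas \<open>unilower\<close>
  supplies coordinates; \<open>unitlower_obtain\<close> passes from the former to the
  latter.\<close>

definition unitlower :: "nat \<Rightarrow> complex mat \<Rightarrow> bool" where
  "unitlower n L \<longleftrightarrow> L \<in> carrier_mat n n \<and>
     (\<forall>i<n. \<forall>j<n. i \<le> j \<longrightarrow> L $$ (i, j) = (if i = j then 1 else 0))"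

lemma unitlowerD:
  assumes "unitlower n L"
  shows "L \<in> carrier_mat n n" "\<And>i. i < n \<Longrightarrow> L $$ (i, i) = 1" "\<And>i j. i < j \<Longrightarrow> j < n \<Longrightarrow> L $$ (i, j) = 0"
  using assms unfolding unitlower_def by simp_all

lemma det_unitlower: "unitlower n L \<Longrightarrow> det L = 1"
  by (subst det_lower_triangular[of n]) (auto simp: unitlower_def prod_list_diag_prod)

lemma unitlower_GL: "unitlower n L \<Longrightarrow> L \<in> GL n"
  by (intro GL_det unitlowerD) (simp_all add: det_unitlower)

text \<open>Transposition reduces this to upper triangular matrices.\<close>

lemma unitlower_inverse:
  assumes L: "unitlower n L" and M: "M \<in> carrier_mat n n" "L * M = 1\<^sub>m n"
  shows "unitlower n M"
proof -
  note c = unitlowerD(1)[OF L] M(1)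
  have ut: "upper_triangular (transpose_mat L)"
    using L by (intro upper_triangularI) (auto simp: unitlower_def)
  have "transpose_mat M * transpose_mat L = 1\<^sub>m n"
    using transpose_mult[OF c] M(2) by simp
  note inv = upper_triangular_inverse[OF ut _ _ this]
  have "upper_triangular (transpose_mat M)" using inv(1) c by simp
  moreover have "M $$ (i, i) = 1" if "i < n" for i
    using inv(2)[OF _ _ that] c that unitlowerD(2)[OF L that] by simp
  ultimately show ?thesis using c unfolding unitlower_def upper_triangular_def by auto
qed

lemma unitlower_mult:
  assumes "unitlower n L" "unitlower n M"
  shows "unitlower n (L * M)"
  unfolding unitlower_def
proof (intro conjI allI impI)
  note c = unitlowerD(1)[OF assms(1)] unitlowerD(1)[OF assms(2)]
  show "L * M \<in> carrier_mat n n" using c by simp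
  fix i j assume ij: "i < n" "j < n" "i \<le> j"
  have "(\<Sum>l<n. L $$ (i, l) * M $$ (l, j)) = (\<Sum>l<n. if l = i then (if i = j then 1 else 0) else 0)"
  proof (rule sum.cong)
    fix l assume "l \<in> {..<n}"
    then show "L $$ (i, l) * M $$ (l, j) = (if l = i then (if i = j then 1 else 0) else 0)"
      using unitlowerD(2,3)[OF assms(1), of i] unitlowerD(2,3)[OF assms(2), of l] unitlowerD(2)[OF assms(2), of j]
        unitlowerD(3)[OF assms(2), of i j] unitlowerD(3)[OF assms(1), of i l] ij
      by (cases l i rule: linorder_cases) auto
  qed simp
  then show "(L * M) $$ (i, j) = (if i = j then 1 else 0)"
    using ij by (simp add: index_mult_mat_sum[OF c])
qed

lemma unitlower_unilower: "unitlower n (unilower n x)"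
  by (auto simp: unitlower_def unilower_def)

lemma unilower_carrier: "unilower n x \<in> carrier_mat n n"
  by (simp add: unilower_def)

lemma unilower_GL: "unilower n x \<in> GL n"
  by (rule unitlower_GL[OF unitlower_unilower])

lemma unitlower_obtain:
  assumes "unitlower n L"
  obtains x where "x \<in> affine_space (chart_indices n)" "L = unilower n x"
proof
  show "(\<lambda>(i, j). if j < i \<and> i < n then L $$ (i, j) else 0) \<in> affine_space (chart_indices n)"
    by (auto simp: affine_space_def chart_indices_def)
  show "L = unilower n (\<lambda>(i, j). if j < i \<and> i < n then L $$ (i, j) else 0)"
    using assms by (intro eq_matI) (auto simp: unilower_def unitlower_def)
qed

lemma unilower_inj:
  assumes "unilower n x = unilower n y" "x \<in> affine_space (chart_indices n)" "y \<in> affine_space (chart_indices n)"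
  shows "x = y"
proof
  fix p :: "nat \<times> nat"
  obtain i j where p: "p = (i, j)" by (cases p)
  show "x p = y p"
  proof (cases "j < i \<and> i < n")
    case True
    then show ?thesis using arg_cong[OF assms(1), of "\<lambda>m. m $$ (i, j)"] by (simp add: unilower_def p)
  next
    case False
    then show ?thesis using assms(2,3) by (auto simp: affine_space_def chart_indices_def p)
  qed
qed

section \<open>Flags as cosets\<close>

text \<open>Spans of the first columns become images of the vectors supported on the first
  \<open>i\<close> coordinates, a description on which matrices act directly. It also covers
  \<open>i > n\<close>, where the flag is constant.\<close>

lemma flag_of_eq:
  assumes g: "g \<in> carrier_mat n n"
  shows "flag_of n g i = {g *\<^sub>v c | c. c \<in> carrier_vec n \<and> (\<forall>k<n. i \<le> k \<longrightarrow> c $ k = 0)}"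
proof -
  interpret vec_space "TYPE(complex)" n .
  let ?vs = "take i (cols g)"
  have vs: "set ?vs \<subseteq> carrier_vec n" using g set_take_subset[of i "cols g"] cols_dim[of g] by auto
  have len: "length ?vs = min i n" using g by (simp add: min.commute)
  have "flag_of n g i = span_list ?vs"
    unfolding flag_of_def flag_of_basis_def vspan_def span_list_as_span[OF vs] ..
  also have "\<dots> = range (\<lambda>c. lincomb_list c ?vs)" by (auto simp: span_list_def)
  also have "\<dots> = range (\<lambda>c. mat_of_cols n ?vs *\<^sub>v vec (min i n) c)"
  proof (intro image_cong refl)
    fix c
    have "\<forall>w\<in>set ?vs. dim_vec w = n" using vs by auto
    from lincomb_list_as_mat_mult[OF this, of c]
    show "lincomb_list c ?vs = mat_of_cols n ?vs *\<^sub>v vec (min i n) c" unfolding len .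
  qed
  also have "\<dots> = range (\<lambda>c. g *\<^sub>v vec n (\<lambda>k. if k < i then c k else 0))"
  proof (intro image_cong refl)
    fix c :: "nat \<Rightarrow> complex"
    show "mat_of_cols n ?vs *\<^sub>v vec (min i n) c = g *\<^sub>v vec n (\<lambda>k. if k < i then c k else 0)"
    proof (rule eq_vecI)
      fix r assume "r < dim_vec (g *\<^sub>v vec n (\<lambda>k. if k < i then c k else 0))"
      then have r: "r < n" using g by simp
      have "mat_of_cols n ?vs $$ (r, l) = g $$ (r, l)" if "l < min i n" for l
        using r that g len by (simp add: mat_of_cols_index)
      then have "(mat_of_cols n ?vs *\<^sub>v vec (min i n) c) $ r = (\<Sum>l<min i n. g $$ (r, l) * c l)"
        using r len by (subst index_mult_vec_sum[of _ n "min i n"]) auto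
      also have "\<dots> = (\<Sum>l<n. g $$ (r, l) * (if l < i then c l else 0))"
        by (rule sum.mono_neutral_cong_left) auto
      also have "\<dots> = (g *\<^sub>v vec n (\<lambda>k. if k < i then c k else 0)) $ r"
        using r g by (subst index_mult_vec_sum[of _ n n]) auto
      finally show "(mat_of_cols n ?vs *\<^sub>v vec (min i n) c) $ r = (g *\<^sub>v vec n (\<lambda>k. if k < i then c k else 0)) $ r" .
    qed (use g in simp)
  qed
  also have "\<dots> = {g *\<^sub>v c | c. c \<in> carrier_vec n \<and> (\<forall>k<n. i \<le> k \<longrightarrow> c $ k = 0)}"
  proof safe
    fix c :: "nat \<Rightarrow> complex"
    show "\<exists>c'. g *\<^sub>v vec n (\<lambda>k. if k < i then c k else 0) = g *\<^sub>v c' \<and> c' \<in> carrier_vec n \<and> (\<forall>k<n. i \<le> k \<longrightarrow> c' $ k = 0)"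
      by (rule exI[of _ "vec n (\<lambda>k. if k < i then c k else 0)"]) auto
  next
    fix c :: "complex vec" assume c: "c \<in> carrier_vec n" "\<forall>k<n. i \<le> k \<longrightarrow> c $ k = 0"
    then have "c = vec n (\<lambda>k. if k < i then c $ k else 0)" by (intro eq_vecI) auto
    then have eq: "g *\<^sub>v c = g *\<^sub>v vec n (\<lambda>k. if k < i then c $ k else 0)" by (rule arg_cong)
    show "g *\<^sub>v c \<in> range (\<lambda>c. g *\<^sub>v vec n (\<lambda>k. if k < i then c k else 0))"
      by (subst eq) (rule rangeI[where x = "\<lambda>k. c $ k"])
  qed
  finally show ?thesis .
qed

lemma flag_act_flag_of:
  assumes "k \<in> carrier_mat n n" "g \<in> carrier_mat n n"
  shows "flag_act k (flag_of n g) = flag_of n (k * g)"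
proof
  fix i
  have "k *\<^sub>v (g *\<^sub>v c) = (k * g) *\<^sub>v c" if "c \<in> carrier_vec n" for c
    using assms that by (simp add: assoc_mult_mat_vec)
  moreover have "k * g \<in> carrier_mat n n" using assms by simp
  ultimately show "flag_act k (flag_of n g) i = flag_of n (k * g) i"
    unfolding flag_act_def flag_of_eq[OF assms(2)] flag_of_eq[OF \<open>k * g \<in> carrier_mat n n\<close>] image_Collect
    by (intro Collect_cong) metis
qed

lemma upper_triangular_mult_vec:
  fixes b :: "complex mat"
  assumes "upper_triangular b" "b \<in> carrier_mat n n" "c \<in> carrier_vec n" "\<forall>k<n. i \<le> k \<longrightarrow> c $ k = 0"
  shows "\<forall>k<n. i \<le> k \<longrightarrow> (b *\<^sub>v c) $ k = 0"
proof (intro allI impI)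
  fix k assume k: "k < n" "i \<le> k"
  have "b $$ (k, l) * c $ l = 0" if "l < n" for l
    using assms(4) upper_triangular_entry[OF assms(1,2), of l k] k that by (cases "l < i") auto
  then show "(b *\<^sub>v c) $ k = 0" using k by (simp add: index_mult_vec_sum[OF assms(2,3)] sum.neutral del: mult_eq_0_iff)
qed

text \<open>An invertible upper triangular matrix maps the vectors supported on the first
  \<open>i\<close> coordinates onto themselves, because its inverse is upper triangular as
  well.\<close>

lemma flag_of_mult_upper:
  assumes g: "g \<in> carrier_mat n n" and b: "b \<in> GL n" "upper_triangular b"
  shows "flag_of n (g * b) = flag_of n g"
proof
  fix i
  obtain b' where b': "b' \<in> GL n" "b * b' = 1\<^sub>m n" "b' * b = 1\<^sub>m n" using GL_inverse[OF b(1)] .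
  note c = g GL_carrier[OF b(1)] GL_carrier[OF b'(1)]
  have ub': "upper_triangular b'" by (rule upper_triangular_inverse(1)[OF b(2) c(2,3) b'(3)])
  have gb: "g * b \<in> carrier_mat n n" using c by simp
  show "flag_of n (g * b) i = flag_of n g i"
    unfolding flag_of_eq[OF g] flag_of_eq[OF gb]
  proof safe
    fix v :: "complex vec" assume v: "v \<in> carrier_vec n" "\<forall>k<n. i \<le> k \<longrightarrow> v $ k = 0"
    show "\<exists>w. g * b *\<^sub>v v = g *\<^sub>v w \<and> w \<in> carrier_vec n \<and> (\<forall>k<n. i \<le> k \<longrightarrow> w $ k = 0)"
      using upper_triangular_mult_vec[OF b(2) c(2) v] v c by (intro exI[of _ "b *\<^sub>v v"]) auto
    have "g * b *\<^sub>v (b' *\<^sub>v v) = g *\<^sub>v ((b * b') *\<^sub>v v)" using c v by (simp add: assoc_mult_mat_vec)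
    then show "\<exists>w. g *\<^sub>v v = g * b *\<^sub>v w \<and> w \<in> carrier_vec n \<and> (\<forall>k<n. i \<le> k \<longrightarrow> w $ k = 0)"
      using upper_triangular_mult_vec[OF ub' c(3) v] v c b'(2) by (intro exI[of _ "b' *\<^sub>v v"]) auto
  qed
qed

text \<open>Column \<open>j\<close> of \<open>h\<close> lies in the span of the first
  \<open>j + 1\<close> columns of \<open>g\<close>, so multiplying \<open>h\<close> by the inverse
  of \<open>g\<close> leaves zeros below the diagonal.\<close>

lemma flag_of_eqD:
  assumes g: "g \<in> GL n" and h: "h \<in> GL n" and eq: "flag_of n g = flag_of n h"
  obtains b where "b \<in> GL n" "upper_triangular b" "h = g * b"
proof -
  obtain g' where g': "g' \<in> GL n" "g * g' = 1\<^sub>m n" "g' * g = 1\<^sub>m n" using GL_inverse[OF g] .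
  note c = GL_carrier[OF g] GL_carrier[OF h] GL_carrier[OF g'(1)]
  have 1: "g' * h \<in> GL n" by (rule mult_GL[OF g'(1) h])
  have "g * (g' * h) = (g * g') * h" using c by (simp add: assoc_mult_mat[where n\<^sub>2 = n and n\<^sub>3 = n and n\<^sub>4 = n])
  then have 2: "h = g * (g' * h)" using g'(2) c by simp
  have "upper_triangular (g' * h)"
  proof (rule upper_triangularI)
    fix i j assume "j < i" "i < dim_row (g' * h)"
    then have ij: "j < i" "i < n" "j < n" using c by auto
    have "h *\<^sub>v unit_vec n j \<in> flag_of n h (Suc j)"
      unfolding flag_of_eq[OF c(2)] using ij by (auto intro!: exI[of _ "unit_vec n j"])
    then obtain v where v: "h *\<^sub>v unit_vec n j = g *\<^sub>v v" "v \<in> carrier_vec n" "\<forall>k<n. Suc j \<le> k \<longrightarrow> v $ k = 0"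
      unfolding eq[symmetric] flag_of_eq[OF c(1)] by blast
    have "(g' * h) *\<^sub>v unit_vec n j = g' *\<^sub>v (g *\<^sub>v v)" using c v by (simp add: assoc_mult_mat_vec)
    also have "\<dots> = (g' * g) *\<^sub>v v" using c v(2) by (simp add: assoc_mult_mat_vec)
    also have "\<dots> = v" using g'(3) v(2) by simp
    finally have *: "(g' * h) *\<^sub>v unit_vec n j = v" .
    have c2: "g' * h \<in> carrier_mat n n" using c by simp
    have "(g' * h) $$ (i, j) = ((g' * h) *\<^sub>v unit_vec n j) $ i"
      using ij by (subst index_mult_vec_sum[OF c2 _ ij(2)]) (auto simp: if_distrib[of "\<lambda>a. _ * a"] unit_vec_def cong: if_cong)
    then show "(g' * h) $$ (i, j) = 0" using * v(3) ij by simp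
  qed
  with 1 2 show thesis by (intro that)
qed

section \<open>LU factorization\<close>

text \<open>Rows \<open>0, ..., j - 1, i\<close> and columns \<open>0, ..., j\<close> of
  \<open>e\<close>; for \<open>i = j\<close> a leading principal minor. The entries of the lower
  factor of an LU factorization are quotients of such minors.\<close>

definition minor :: "(nat \<times> nat \<Rightarrow> complex) \<Rightarrow> nat \<Rightarrow> nat \<Rightarrow> complex" where
  "minor e i j = det (mat (Suc j) (Suc j) (\<lambda>(r, c). e (if r = j then i else r, c)))"

text \<open>As \<open>R\<close> is upper triangular, only the first \<open>j + 1\<close> columns of
  \<open>L\<close> enter, and the minor is a product of two triangular determinants. Row
  \<open>i\<close>, put in the last place, contributes \<open>L i j\<close> as the last diagonal
  entry.\<close>

lemma minor_LU:
  assumes e: "\<And>r c. r < n \<Longrightarrow> c < n \<Longrightarrow> e (r, c) = (\<Sum>k<n. L r k * R k c)"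
    and L: "\<And>r. r < n \<Longrightarrow> L r r = 1" "\<And>r c. r < c \<Longrightarrow> c < n \<Longrightarrow> L r c = 0"
    and R: "\<And>r c. c < r \<Longrightarrow> r < n \<Longrightarrow> R r c = 0"
    and ij: "j \<le> i" "i < n"
  shows "minor e i j = L i j * (\<Prod>k\<le>j. R k k)"
proof -
  have jn: "j < n" using ij by simp
  define A where "A = mat (Suc j) (Suc j) (\<lambda>(r, c). L (if r = j then i else r) c)"
  define B where "B = mat (Suc j) (Suc j) (\<lambda>(r, c). R r c)"
  have AB: "A \<in> carrier_mat (Suc j) (Suc j)" "B \<in> carrier_mat (Suc j) (Suc j)" by (auto simp: A_def B_def)
  have "mat (Suc j) (Suc j) (\<lambda>(r, c). e (if r = j then i else r, c)) = A * B"
  proof (rule eq_matI)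
    fix r c assume "r < dim_row (A * B)" "c < dim_col (A * B)"
    then have rc: "r < Suc j" "c < Suc j" using AB by auto
    define r' where "r' = (if r = j then i else r)"
    have r': "r' < n" using rc ij by (auto simp: r'_def)
    have "e (r', c) = (\<Sum>k<n. L r' k * R k c)" using e[of r' c] r' rc ij by simp
    also have "\<dots> = (\<Sum>k<Suc j. L r' k * R k c)"
      using ij rc R by (intro sum.mono_neutral_right) auto
    also have "\<dots> = (A * B) $$ (r, c)"
      using rc by (subst index_mult_mat_sum[OF AB]) (auto simp: A_def B_def r'_def)
    finally show "mat (Suc j) (Suc j) (\<lambda>(r, c). e (if r = j then i else r, c)) $$ (r, c) = (A * B) $$ (r, c)"
      using rc by (simp add: r'_def)
  qed (use AB in auto)
  then have "minor e i j = det A * det B" unfolding minor_def by (simp add: det_mult[OF AB])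
  also have "det A = (\<Prod>k\<in>{0..<Suc j}. A $$ (k, k))"
    using AB jn by (subst det_lower_triangular[of "Suc j"]) (auto simp: A_def prod_list_diag_prod L)
  also have "\<dots> = L i j" using ij by (simp add: A_def L)
  also have "det B = (\<Prod>k\<in>{0..<Suc j}. B $$ (k, k))"
    using AB R jn by (subst det_upper_triangular[of _ "Suc j"]) (auto simp: B_def prod_list_diag_prod)
  also have "\<dots> = (\<Prod>k\<le>j. R k k)" by (intro prod.cong) (auto simp: B_def)
  finally show ?thesis .
qed

lemma triangular_solve:
  fixes R :: "nat \<Rightarrow> nat \<Rightarrow> complex"
  assumes "\<And>k. k < n \<Longrightarrow> R k k \<noteq> 0"
  shows "\<exists>l. \<forall>c<n. (\<Sum>k\<le>c. l k * R k c) = w c"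
  using assms
proof (induction n)
  case (Suc n)
  then obtain l where l: "\<And>c. c < n \<Longrightarrow> (\<Sum>k\<le>c. l k * R k c) = w c" by auto
  define l' where "l' = l(n := (w n - (\<Sum>k<n. l k * R k n)) / R n n)"
  have "(\<Sum>k\<le>c. l' k * R k c) = w c" if "c < Suc n" for c
  proof (cases "c = n")
    case True
    then show ?thesis using Suc.prems[of n] by (simp add: l'_def lessThan_Suc_atMost[symmetric] del: lessThan_Suc_atMost)
  next
    case False
    then have "(\<Sum>k\<le>c. l' k * R k c) = (\<Sum>k\<le>c. l k * R k c)"
      using that by (intro sum.cong) (auto simp: l'_def)
    then show ?thesis using l[of c] that False by simp
  qed
  then show ?case by blast
qed simp

text \<open>Bordering: the new row and the new column are found from triangular systems, and the
  last pivot is what remains in the corner. It is nonzero because the leading minor of order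
  \<open>n + 1\<close> is the product of the pivots.\<close>

lemma LU_exists_fun:
  assumes "\<forall>j<n. minor e j j \<noteq> 0"
  shows "\<exists>L R. (\<forall>r<n. L r r = 1) \<and> (\<forall>r c. r < c \<longrightarrow> c < n \<longrightarrow> L r c = 0) \<and>
     (\<forall>r c. c < r \<longrightarrow> r < n \<longrightarrow> R r c = 0) \<and> (\<forall>r<n. R r r \<noteq> 0) \<and>
     (\<forall>r<n. \<forall>c<n. e (r, c) = (\<Sum>k<n. L r k * R k c))"
  using assms
proof (induction n)
  case (Suc n)
  then have "\<forall>j<n. minor e j j \<noteq> 0" by simp
  from Suc.IH[OF this] obtain L R where LR:
    "\<forall>r<n. L r r = 1" "\<forall>r c. r < c \<longrightarrow> c < n \<longrightarrow> L r c = 0"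
    "\<forall>r c. c < r \<longrightarrow> r < n \<longrightarrow> R r c = 0" "\<forall>r<n. R r r \<noteq> 0"
    "\<forall>r<n. \<forall>c<n. e (r, c) = (\<Sum>k<n. L r k * R k c)"
    by (elim exE conjE) (rule that)
  note L = LR(1,2)[rule_format] and R = LR(3,4)[rule_format] and e = LR(5)[rule_format]
  obtain l where l: "\<And>c. c < n \<Longrightarrow> (\<Sum>k\<le>c. l k * R k c) = e (n, c)"
    using triangular_solve[of n R "\<lambda>c. e (n, c)"] R(2) by blast
  have "\<And>k. k < n \<Longrightarrow> (\<lambda>k c. L c k) k k \<noteq> 0" using L by simp
  then obtain u where u: "\<And>r. r < n \<Longrightarrow> (\<Sum>k\<le>r. u k * L r k) = e (r, n)"
    using triangular_solve[of n "\<lambda>k c. L c k" "\<lambda>r. e (r, n)"] by blast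
  define L' where "L' r c = (if r = n then (if c < n then l c else if c = n then 1 else 0) else if c < n then L r c else 0)" for r c
  define R' where "R' r c = (if r < n \<and> c < n then R r c else if c = n then (if r < n then u r else e (n, n) - (\<Sum>k<n. l k * u k)) else 0)" for r c
  have L': "\<And>r. r < Suc n \<Longrightarrow> L' r r = 1" "\<And>r c. r < c \<Longrightarrow> c < Suc n \<Longrightarrow> L' r c = 0"
    using L by (auto simp: L'_def less_Suc_eq)
  have R': "\<And>r c. c < r \<Longrightarrow> r < Suc n \<Longrightarrow> R' r c = 0"
    using R by (auto simp: R'_def less_Suc_eq)
  have e': "e (r, c) = (\<Sum>k<Suc n. L' r k * R' k c)" if rc: "r < Suc n" "c < Suc n" for r c
  proof -
    consider "r < n" "c < n" | "r < n" "c = n" | "r = n" "c < n" | "r = n" "c = n"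
      using rc by linarith
    then show ?thesis
    proof cases
      case 1
      then show ?thesis by (simp add: L'_def R'_def e)
    next
      case 2
      have "(\<Sum>k<n. L r k * u k) = (\<Sum>k\<le>r. u k * L r k)"
        using 2 L(2) by (intro sum.mono_neutral_cong_right) auto
      then show ?thesis using 2 u[of r] by (simp add: L'_def R'_def)
    next
      case 3
      have "(\<Sum>k<n. l k * R k c) = (\<Sum>k\<le>c. l k * R k c)"
        using 3 R(1) by (intro sum.mono_neutral_cong_right) auto
      then show ?thesis using 3 l[of c] by (simp add: L'_def R'_def)
    next
      case 4
      then show ?thesis by (simp add: L'_def R'_def)
    qed
  qed
  have "minor e n n = L' n n * (\<Prod>k\<le>n. R' k k)"
    by (rule minor_LU[OF e' L' R']) auto
  then have "(\<Prod>k\<le>n. R' k k) \<noteq> 0" using Suc.prems by auto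
  then have "\<forall>r<Suc n. R' r r \<noteq> 0" by (auto simp: less_Suc_eq_le)
  show ?case
  proof (rule exI[of _ L'], rule exI[of _ R'], intro conjI allI impI)
    fix r c assume "r < Suc n" "c < Suc n"
    then show "e (r, c) = (\<Sum>k<Suc n. L' r k * R' k c)" by (rule e')
  next
    fix r assume "r < Suc n"
    then show "R' r r \<noteq> 0" using \<open>\<forall>r<Suc n. R' r r \<noteq> 0\<close> by blast
  next
    fix r assume "r < Suc n"
    then show "L' r r = 1" by (rule L')
  next
    fix r c assume "r < c" "c < Suc n"
    then show "L' r c = 0" by (rule L')
  next
    fix r c assume "c < r" "r < Suc n"
    then show "R' r c = 0" by (rule R')
  qed
qed simp

definition mat_entry :: "complex mat \<Rightarrow> nat \<times> nat \<Rightarrow> complex" where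
  "mat_entry m = (\<lambda>(r, c). m $$ (r, c))"

lemma LU_minor:
  assumes b: "b \<in> GL n" "upper_triangular b" and m: "m = unilower n x * b"
  shows "\<And>j. j < n \<Longrightarrow> minor (mat_entry m) j j \<noteq> 0"
    and "\<And>i j. j < i \<Longrightarrow> i < n \<Longrightarrow> minor (mat_entry m) i j = x (i, j) * minor (mat_entry m) j j"
proof -
  obtain b' where b': "b' \<in> GL n" "b' * b = 1\<^sub>m n" using GL_inverse[OF b(1)] by metis
  have bb: "b $$ (i, i) \<noteq> 0" if "i < n" for i
    using upper_triangular_inverse(2)[OF b(2) GL_carrier[OF b(1)] GL_carrier[OF b'(1)] b'(2) that] by auto
  have min: "minor (mat_entry m) i j = unilower n x $$ (i, j) * (\<Prod>k\<le>j. b $$ (k, k))" if "j \<le> i" "i < n" for i j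
  proof (rule minor_LU[where L = "\<lambda>r c. unilower n x $$ (r, c)" and R = "\<lambda>r c. b $$ (r, c)"])
    fix r c assume "r < n" "c < n"
    then show "mat_entry m (r, c) = (\<Sum>k<n. unilower n x $$ (r, k) * b $$ (k, c))"
      unfolding m mat_entry_def using index_mult_mat_sum[OF unilower_carrier GL_carrier[OF b(1)]] by simp
  qed (use that upper_triangular_entry[OF b(2) GL_carrier[OF b(1)]] in \<open>auto simp: unilower_def\<close>)
  show "minor (mat_entry m) j j \<noteq> 0" if "j < n" for j
    using min[of j j] bb that by (auto simp: unilower_def)
  show "minor (mat_entry m) i j = x (i, j) * minor (mat_entry m) j j" if "j < i" "i < n" for i j
    using min[of j i] min[of j j] that by (simp add: unilower_def)
qed

lemma LU_exists:
  assumes m: "m \<in> GL n" and min: "\<forall>j<n. minor (mat_entry m) j j \<noteq> 0"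
  obtains x b where "x \<in> affine_space (chart_indices n)" "b \<in> GL n" "upper_triangular b" "m = unilower n x * b"
proof -
  from LU_exists_fun[OF min] obtain L R where LR:
    "\<forall>r<n. L r r = 1" "\<forall>r c. r < c \<longrightarrow> c < n \<longrightarrow> L r c = 0"
    "\<forall>r c. c < r \<longrightarrow> r < n \<longrightarrow> R r c = 0" "\<forall>r<n. R r r \<noteq> 0"
    "\<forall>r<n. \<forall>c<n. mat_entry m (r, c) = (\<Sum>k<n. L r k * R k c)"
    by (elim exE conjE) (rule that)
  note L = LR(1,2)[rule_format] and R = LR(3,4)[rule_format] and e = LR(5)[rule_format]
  define L' where "L' = mat n n (\<lambda>(r, c). L r c)"
  define b where "b = mat n n (\<lambda>(r, c). R r c)"
  have "unitlower n L'" using L by (auto simp: unitlower_def L'_def)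
  then obtain x where x: "x \<in> affine_space (chart_indices n)" "L' = unilower n x"
    by (rule unitlower_obtain)
  have bc: "b \<in> carrier_mat n n" by (simp add: b_def)
  have ub: "upper_triangular b" using R by (intro upper_triangularI) (auto simp: b_def)
  have "det b \<noteq> 0"
    using upper_triangular_imp_det_eq_0_iff[OF bc ub] R(2) by (auto simp: b_def diag_mat_def)
  then have "b \<in> GL n" by (rule GL_det[OF bc])
  moreover have "m = unilower n x * b"
  proof (rule eq_matI)
    fix i j assume "i < dim_row (unilower n x * b)" "j < dim_col (unilower n x * b)"
    then have "i < n" "j < n" using bc unilower_carrier[of n x] by auto
    then show "m $$ (i, j) = (unilower n x * b) $$ (i, j)"
      using e[of i j] unfolding x(2)[symmetric]
      by (subst index_mult_mat_sum[of _ n n b n]) (auto simp: L'_def b_def mat_entry_def)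
  qed (use bc GL_carrier[OF m] unilower_carrier[of n x] in auto)
  ultimately show ?thesis using that x(1) ub by blast
qed

lemma poly_funs_det:
  assumes "\<And>r c. r < k \<Longrightarrow> c < k \<Longrightarrow> (\<lambda>x. F x r c) \<in> poly_funs I"
  shows "(\<lambda>x. det (mat k k (\<lambda>(r, c). F x r c))) \<in> poly_funs I"
proof -
  have "(\<lambda>x. \<Sum>p | p permutes {0..<k}. signof p * (\<Prod>i = 0..<k. F x i (p i))) \<in> poly_funs I"
  proof (intro poly_funs_sum poly_funs_cmult poly_funs_prod assms)
    fix p i assume "p \<in> {p. p permutes {0..<k}}" "i \<in> {0..<k}"
    then show "i < k" "p i < k" using permutes_in_image[of p "{0..<k}" i] by auto
  qed
  moreover have "det (mat k k (\<lambda>(r, c). F x r c)) = (\<Sum>p | p permutes {0..<k}. signof p * (\<Prod>i = 0..<k. F x i (p i)))" for x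
    unfolding det_def'[OF mat_carrier]
  proof (intro sum.cong refl arg_cong2[of _ _ _ _ "(*)"] prod.cong)
    fix p i assume "p \<in> {p. p permutes {0..<k}}" "i \<in> {0..<k}"
    then show "mat k k (\<lambda>(r, c). F x r c) $$ (i, p i) = F x i (p i)"
      using permutes_in_image[of p "{0..<k}" i] by auto
  qed
  ultimately show ?thesis by simp
qed

lemma poly_funs_minor:
  assumes "\<And>r c. r < n \<Longrightarrow> c < n \<Longrightarrow> (\<lambda>x. E x (r, c)) \<in> poly_funs I" "j \<le> i" "i < n"
  shows "(\<lambda>x. minor (E x) i j) \<in> poly_funs I"
  unfolding minor_def
proof (rule poly_funs_det)
  fix r c assume "r < Suc j" "c < Suc j"
  then show "(\<lambda>x. E x (if r = j then i else r, c)) \<in> poly_funs I"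
    using assms(2,3) by (intro assms(1)) auto
qed

section \<open>Closures in the charts of the flag variety\<close>

definition chart_preimage :: "nat \<Rightarrow> complex mat \<Rightarrow> (nat \<Rightarrow> complex vec set) set \<Rightarrow> (nat \<times> nat \<Rightarrow> complex) set" where
  "chart_preimage n g Y = {x \<in> affine_space (chart_indices n). flag_of n (g * unilower n x) \<in> Y}"

text \<open>The product of all leading minors is a common denominator of all chart coordinates, so
  that one function describes where they are defined; the numerators \<open>lu_num\<close> are
  scaled accordingly.\<close>

definition lu_den :: "nat \<Rightarrow> (nat \<times> nat \<Rightarrow> complex) \<Rightarrow> complex" where
  "lu_den n e = (\<Prod>j<n. minor e j j)"

definition lu_num :: "nat \<Rightarrow> nat \<times> nat \<Rightarrow> (nat \<times> nat \<Rightarrow> complex) \<Rightarrow> complex" where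
  "lu_num n p e = minor e (fst p) (snd p) * (\<Prod>l\<in>{..<n} - {snd p}. minor e l l)"

lemma finite_chart_indices: "finite (chart_indices n)"
  by (rule finite_subset[of _ "{..<n} \<times> {..<n}"]) (auto simp: chart_indices_def)

lemma minor_cong:
  assumes "\<And>r c. r < n \<Longrightarrow> c < n \<Longrightarrow> e (r, c) = e' (r, c)" "j \<le> i" "i < n"
  shows "minor e i j = minor e' i j"
  unfolding minor_def
  by (intro arg_cong[of _ _ det] cong_mat refl) (use assms in auto)

lemma lu_den_cong:
  assumes "\<And>r c. r < n \<Longrightarrow> c < n \<Longrightarrow> e (r, c) = e' (r, c)"
  shows "lu_den n e = lu_den n e'"
  unfolding lu_den_def by (intro prod.cong minor_cong[where n = n and e = e and e' = e'] assms) auto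

lemma lu_num_cong:
  assumes "\<And>r c. r < n \<Longrightarrow> c < n \<Longrightarrow> e (r, c) = e' (r, c)" "p \<in> chart_indices n"
  shows "lu_num n p e = lu_num n p e'"
  unfolding lu_num_def using assms(2)
  by (intro arg_cong2[of _ _ _ _ "(*)"] prod.cong minor_cong[where n = n and e = e and e' = e'] assms(1))
     (auto simp: chart_indices_def)

lemma poly_funs_lu:
  assumes "\<And>r c. r < n \<Longrightarrow> c < n \<Longrightarrow> (\<lambda>x. E x (r, c)) \<in> poly_funs I"
  shows "(\<lambda>x. lu_den n (E x)) \<in> poly_funs I"
    and "p \<in> chart_indices n \<Longrightarrow> (\<lambda>x. lu_num n p (E x)) \<in> poly_funs I"
  unfolding lu_den_def lu_num_def
  by (intro poly_funs_prod poly_funs_minor[where n = n and E = E] poly_funs.mult assms;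
      auto simp: chart_indices_def)+

lemma lu_coordinates:
  assumes b: "b \<in> GL n" "upper_triangular b" and m: "m = unilower n x * b"
  shows "lu_den n (mat_entry m) \<noteq> 0"
    and "p \<in> chart_indices n \<Longrightarrow> x p = lu_num n p (mat_entry m) / lu_den n (mat_entry m)"
proof -
  note LU = LU_minor[OF b m]
  show den: "lu_den n (mat_entry m) \<noteq> 0" unfolding lu_den_def using LU(1) by simp
  assume p: "p \<in> chart_indices n"
  obtain i j where ij: "p = (i, j)" "j < i" "i < n" using p by (auto simp: chart_indices_def)
  have "lu_den n (mat_entry m) = minor (mat_entry m) j j * (\<Prod>l\<in>{..<n} - {j}. minor (mat_entry m) l l)"
    unfolding lu_den_def using ij by (subst prod.remove[of _ j]) auto
  then have "lu_num n p (mat_entry m) = x p * lu_den n (mat_entry m)"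
    using LU(2)[OF ij(2,3)] unfolding lu_num_def by (simp add: ij)
  then show "x p = lu_num n p (mat_entry m) / lu_den n (mat_entry m)" using den by simp
qed

lemma lu_den_nonzero_iff:
  assumes m: "m \<in> GL n"
  shows "lu_den n (mat_entry m) \<noteq> 0 \<longleftrightarrow>
    (\<exists>x\<in>affine_space (chart_indices n). \<exists>b\<in>GL n. upper_triangular b \<and> m = unilower n x * b)"
proof
  assume "lu_den n (mat_entry m) \<noteq> 0"
  then have "\<forall>j<n. minor (mat_entry m) j j \<noteq> 0" by (simp add: lu_den_def)
  from LU_exists[OF m this]
  show "\<exists>x\<in>affine_space (chart_indices n). \<exists>b\<in>GL n. upper_triangular b \<and> m = unilower n x * b"
    by blast
next
  assume "\<exists>x\<in>affine_space (chart_indices n). \<exists>b\<in>GL n. upper_triangular b \<and> m = unilower n x * b"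
  then show "lu_den n (mat_entry m) \<noteq> 0" using lu_coordinates(1) by blast
qed

lemma entries_affine_space: "entries n m \<in> affine_space ({..<n} \<times> {..<n})"
  by (auto simp: affine_space_def entries_def)

lemma openin_GL_topology:
  "openin (GL_topology n) S \<longleftrightarrow>
     (\<exists>F \<subseteq> poly_funs ({..<n} \<times> {..<n}). S = {m \<in> GL n. \<exists>f\<in>F. f (entries n m) \<noteq> 0})"
proof -
  have "entries n -` {x \<in> affine_space ({..<n} \<times> {..<n}). \<exists>f\<in>F. f x \<noteq> 0} \<inter> GL n =
      {m \<in> GL n. \<exists>f\<in>F. f (entries n m) \<noteq> 0}" for F
    using entries_affine_space by auto
  note * = this
  show ?thesis
    unfolding GL_topology_def openin_pullback_topology openin_zariski
  proof
    assume "\<exists>U. (\<exists>F\<subseteq>poly_funs ({..<n} \<times> {..<n}). U = {x \<in> affine_space ({..<n} \<times> {..<n}). \<exists>f\<in>F. f x \<noteq> 0}) \<and>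
      S = entries n -` U \<inter> GL n"
    then show "\<exists>F\<subseteq>poly_funs ({..<n} \<times> {..<n}). S = {m \<in> GL n. \<exists>f\<in>F. f (entries n m) \<noteq> 0}"
      by (elim exE conjE) (simp only: *, blast)
  next
    assume "\<exists>F\<subseteq>poly_funs ({..<n} \<times> {..<n}). S = {m \<in> GL n. \<exists>f\<in>F. f (entries n m) \<noteq> 0}"
    then obtain F where "F \<subseteq> poly_funs ({..<n} \<times> {..<n})" "S = {m \<in> GL n. \<exists>f\<in>F. f (entries n m) \<noteq> 0}"
      by blast
    then show "\<exists>U. (\<exists>F\<subseteq>poly_funs ({..<n} \<times> {..<n}). U = {x \<in> affine_space ({..<n} \<times> {..<n}). \<exists>f\<in>F. f x \<noteq> 0}) \<and>
      S = entries n -` U \<inter> GL n"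
      by (intro exI[of _ "{x \<in> affine_space ({..<n} \<times> {..<n}). \<exists>f\<in>F. f x \<noteq> 0}"] conjI exI[of _ F])
         (simp_all only: *)
  qed
qed

lemma topspace_flag_topology: "topspace (flag_topology n) = Fl n"
proof -
  have "{m \<in> GL n. flag_of n m \<in> Fl n} = {m \<in> GL n. \<exists>f\<in>{\<lambda>_. 1}. f (entries n m) \<noteq> (0::complex)}"
    by (auto simp: Fl_def)
  moreover have "{\<lambda>_. 1} \<subseteq> poly_funs ({..<n} \<times> {..<n})" by (auto intro: poly_funs.const)
  ultimately have "openin (flag_topology n) (Fl n)"
    unfolding openin_flag_topology openin_GL_topology by blast
  moreover have "U \<subseteq> Fl n" if "openin (flag_topology n) U" for U
    using that unfolding openin_flag_topology by blast
  ultimately show ?thesis by (meson openin_subset openin_topspace subset_antisym)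
qed

lemma mult_unilower_GL: "g \<in> GL n \<Longrightarrow> g * unilower n x \<in> GL n"
  by (intro mult_GL unilower_GL)

lemma poly_funs_mult_unilower:
  assumes g: "g \<in> carrier_mat n n" and "r < n" "c < n"
  shows "(\<lambda>x. (g * unilower n x) $$ (r, c)) \<in> poly_funs (chart_indices n)"
proof -
  have "(\<lambda>x. \<Sum>l<n. g $$ (r, l) * unilower n x $$ (l, c)) \<in> poly_funs (chart_indices n)"
  proof (intro poly_funs_sum poly_funs_cmult)
    fix l assume "l \<in> {..<n}"
    then show "(\<lambda>x. unilower n x $$ (l, c)) \<in> poly_funs (chart_indices n)"
      using \<open>c < n\<close> unfolding unilower_def
      by (cases l c rule: linorder_cases) (auto intro: poly_funs.intros simp: chart_indices_def)
  qed
  then show ?thesis using assms(2,3) by (simp only: index_mult_mat_sum[OF g unilower_carrier])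
qed

text \<open>An open set of the flag variety pulls back to the nonvanishing locus of polynomials in
  the chart coordinates. If it contains the point \<open>x\<close>, one of these polynomials is
  nonzero at \<open>x\<close>, hence also somewhere on the part of \<open>O'\<close> inside the
  chart.\<close>

lemma chart_closureI:
  assumes g: "g \<in> GL n" and x: "x \<in> affine_space (chart_indices n)"
    and van: "\<And>f. f \<in> poly_funs (chart_indices n) \<Longrightarrow>
       (\<And>x'. x' \<in> chart_preimage n g O' \<Longrightarrow> f x' = 0) \<Longrightarrow> f x = 0"
  shows "x \<in> chart_preimage n g (flag_topology n closure_of O')"
proof -
  have "flag_of n (g * unilower n x) \<in> flag_topology n closure_of O'"
    unfolding in_closure_of topspace_flag_topology
  proof (intro conjI allI impI)
    show "flag_of n (g * unilower n x) \<in> Fl n"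
      using mult_unilower_GL[OF g] by (auto simp: Fl_def)
    fix T assume T: "flag_of n (g * unilower n x) \<in> T \<and> openin (flag_topology n) T"
    then obtain F where F: "F \<subseteq> poly_funs ({..<n} \<times> {..<n})"
      "{m \<in> GL n. flag_of n m \<in> T} = {m \<in> GL n. \<exists>f\<in>F. f (entries n m) \<noteq> 0}"
      unfolding openin_flag_topology openin_GL_topology by blast
    then obtain f where f: "f \<in> F" "f (entries n (g * unilower n x)) \<noteq> 0"
      using T mult_unilower_GL[OF g, of x] by blast
    have "(\<lambda>x. f (entries n (g * unilower n x))) \<in> poly_funs (chart_indices n)"
    proof (rule poly_funs_compose[where I = "{..<n} \<times> {..<n}" and \<phi> = "\<lambda>x. entries n (g * unilower n x)"])
      show "f \<in> poly_funs ({..<n} \<times> {..<n})" using f F by auto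
      fix p assume "p \<in> {..<n} \<times> {..<n}"
      then show "(\<lambda>x. entries n (g * unilower n x) p) \<in> poly_funs (chart_indices n)"
        using poly_funs_mult_unilower[OF GL_carrier[OF g]] by (auto simp: entries_def)
    qed
    from van[OF this] f(2) obtain x' where x': "x' \<in> chart_preimage n g O'" "f (entries n (g * unilower n x')) \<noteq> 0"
      by blast
    then have "flag_of n (g * unilower n x') \<in> T"
      using F f mult_unilower_GL[OF g, of x'] by blast
    then show "\<exists>y. y \<in> O' \<and> y \<in> T" using x'(1) by (auto simp: chart_preimage_def)
  qed
  then show ?thesis using x by (simp add: chart_preimage_def)
qed

text \<open>Here the nonvanishing locus of \<open>f\<close> in the chart must be shown to be open in
  the whole flag variety. On \<open>GL\<close> the chart coordinates are quotients of minors, and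
  the numerator of \<open>f\<close>, multiplied by the denominator, has a nonvanishing locus that is
  stable under right multiplication by upper triangular matrices.\<close>

lemma chart_closureD:
  assumes g: "g \<in> GL n" and O': "O' \<subseteq> Fl n"
    and f: "f \<in> poly_funs (chart_indices n)" "\<And>x'. x' \<in> chart_preimage n g O' \<Longrightarrow> f x' = 0"
    and x: "x \<in> chart_preimage n g (flag_topology n closure_of O')"
  shows "f x = 0"
proof (rule ccontr)
  assume fx: "f x \<noteq> 0"
  obtain g' where g': "g' \<in> GL n" "g * g' = 1\<^sub>m n" "g' * g = 1\<^sub>m n" using GL_inverse[OF g] .
  note c = GL_carrier[OF g] GL_carrier[OF g'(1)]
  define E where "E e = (\<lambda>(r, c). \<Sum>l<n. g' $$ (r, l) * e (l, c))" for e :: "nat \<times> nat \<Rightarrow> complex"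
  have EM: "E (entries n m) (r, c) = mat_entry (g' * m) (r, c)" if "m \<in> carrier_mat n n" "r < n" "c < n" for m r c
    using that by (simp add: E_def mat_entry_def entries_def index_mult_mat_sum[OF c(2)])
  have Ep: "(\<lambda>e. E e (r, c)) \<in> poly_funs ({..<n} \<times> {..<n})" if "r < n" "c < n" for r c
    unfolding E_def using that by (auto intro!: poly_funs_sum poly_funs_cmult poly_funs.coord)
  define \<delta> where "\<delta> e = lu_den n (E e)" for e
  define N where "N p e = lu_num n p (E e)" for p e
  have \<delta>: "\<delta> \<in> poly_funs ({..<n} \<times> {..<n})" unfolding \<delta>_def by (rule poly_funs_lu(1)[where E = E]) (rule Ep)
  have N: "N p \<in> poly_funs ({..<n} \<times> {..<n})" if "p \<in> chart_indices n" for p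
    unfolding N_def by (rule poly_funs_lu(2)[where E = E, OF _ that]) (rule Ep)
  have "(\<lambda>e. f (\<lambda>p. N p e / \<delta> e)) \<in> rational_funs ({..<n} \<times> {..<n}) \<delta>"
    by (rule rational_funs_compose[OF f(1) \<delta> N])
  then obtain k T where T: "T \<in> poly_funs ({..<n} \<times> {..<n})"
    "\<forall>e. \<delta> e \<noteq> 0 \<longrightarrow> f (\<lambda>p. N p e / \<delta> e) * \<delta> e ^ k = T e"
    unfolding rational_funs_def by blast
  \<comment> \<open>The extra factor \<open>\<delta>\<close> lets nonvanishing of \<open>F\<close>
    include membership in the chart.\<close>
  define F where "F e = T e * \<delta> e" for e
  have F: "F \<in> poly_funs ({..<n} \<times> {..<n})" unfolding F_def by (intro poly_funs.mult T \<delta>)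
  have key: "F (entries n m) \<noteq> 0 \<longleftrightarrow> f y \<noteq> 0"
    if m: "m \<in> GL n" and b: "b \<in> GL n" "upper_triangular b" and yb: "g' * m = unilower n y * b" for m y b
  proof -
    note mc = GL_carrier[OF m]
    have den: "\<delta> (entries n m) = lu_den n (mat_entry (g' * m))"
      unfolding \<delta>_def by (rule lu_den_cong) (rule EM[OF mc])
    then have "\<delta> (entries n m) \<noteq> 0" using lu_coordinates(1)[OF b yb] by simp
    moreover have "f (\<lambda>p. N p (entries n m) / \<delta> (entries n m)) = f y"
    proof (rule poly_funs_cong[OF f(1)])
      fix p assume p: "p \<in> chart_indices n"
      have "N p (entries n m) = lu_num n p (mat_entry (g' * m))"
        unfolding N_def by (rule lu_num_cong[OF _ p]) (rule EM[OF mc])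
      then show "N p (entries n m) / \<delta> (entries n m) = y p"
        using lu_coordinates(2)[OF b yb p] den by simp
    qed
    ultimately show ?thesis using T(2) unfolding F_def by (metis mult_eq_0_iff power_not_zero)
  qed
  have key2: "\<exists>y\<in>affine_space (chart_indices n). \<exists>b\<in>GL n. upper_triangular b \<and> g' * m = unilower n y * b"
    if m: "m \<in> GL n" and "F (entries n m) \<noteq> 0" for m
  proof -
    have "\<delta> (entries n m) \<noteq> 0" using that by (auto simp: F_def)
    moreover have "\<delta> (entries n m) = lu_den n (mat_entry (g' * m))"
      unfolding \<delta>_def by (rule lu_den_cong) (rule EM[OF GL_carrier[OF m]])
    ultimately show ?thesis using lu_den_nonzero_iff[OF mult_GL[OF g'(1) m]] by simp
  qed
  \<comment> \<open>Matrices with the same flag have the same chart coordinates, and nonvanishing of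
    \<open>F\<close> depends on these alone; so the locus descends to the quotient.\<close>
  have inv: "F (entries n m') \<noteq> 0" if m: "m \<in> GL n" "F (entries n m) \<noteq> 0" and m': "m' \<in> GL n" "flag_of n m = flag_of n m'" for m m'
  proof -
    obtain y b where y: "b \<in> GL n" "upper_triangular b" "g' * m = unilower n y * b"
      using key2[OF m] by blast
    obtain b' where b': "b' \<in> GL n" "upper_triangular b'" "m' = m * b'" using flag_of_eqD[OF m(1) m'(1,2)] .
    have "g' * m' = g' * m * b'"
      unfolding b'(3) using c GL_carrier[OF m(1)] GL_carrier[OF b'(1)]
      by (simp add: assoc_mult_mat[where n\<^sub>2 = n and n\<^sub>3 = n and n\<^sub>4 = n])
    also have "\<dots> = unilower n y * (b * b')"
      unfolding y(3) using unilower_carrier GL_carrier[OF y(1)] GL_carrier[OF b'(1)]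
      by (rule assoc_mult_mat)
    finally have eq: "g' * m' = unilower n y * (b * b')" .
    have "upper_triangular (b * b')"
      by (rule upper_triangular_mult[OF y(2) b'(2) GL_carrier[OF y(1)] GL_carrier[OF b'(1)]])
    from key[OF m'(1) mult_GL[OF y(1) b'(1)] this eq] key[OF m(1) y] m(2) show ?thesis by simp
  qed
  define T' where "T' = flag_of n ` {m \<in> GL n. F (entries n m) \<noteq> 0}"
  have "{m \<in> GL n. flag_of n m \<in> T'} = {m \<in> GL n. \<exists>f\<in>{F}. f (entries n m) \<noteq> 0}"
  proof -
    have "flag_of n m \<in> T' \<longleftrightarrow> F (entries n m) \<noteq> 0" if m: "m \<in> GL n" for m
    proof
      assume "flag_of n m \<in> T'"
      then obtain m0 where "m0 \<in> GL n" "F (entries n m0) \<noteq> 0" "flag_of n m = flag_of n m0"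
        unfolding T'_def by blast
      then show "F (entries n m) \<noteq> 0" using inv[of m0 m] m by simp
    qed (use m in \<open>simp add: T'_def\<close>)
    then show ?thesis by (intro Collect_cong) auto
  qed
  then have "openin (flag_topology n) T'"
    unfolding openin_flag_topology openin_GL_topology using F by (auto simp: T'_def Fl_def)
  moreover have "flag_of n (g * unilower n x) \<in> T'"
  proof -
    have "g' * (g * unilower n x) = (g' * g) * unilower n x"
      using c(2,1) unilower_carrier by (rule assoc_mult_mat[symmetric])
    also have "\<dots> = unilower n x * 1\<^sub>m n" using g'(3) unilower_carrier[of n x] by simp
    finally have "F (entries n (g * unilower n x)) \<noteq> 0"
      using key[OF mult_unilower_GL[OF g] one_GL upper_triangular_one] fx by simp
    then show ?thesis unfolding T'_def using mult_unilower_GL[OF g] by blast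
  qed
  ultimately obtain V where V: "V \<in> O'" "V \<in> T'"
    using x unfolding chart_preimage_def in_closure_of by blast
  then obtain m where m: "m \<in> GL n" "F (entries n m) \<noteq> 0" "V = flag_of n m" unfolding T'_def by blast
  then obtain y b where y: "y \<in> affine_space (chart_indices n)" "b \<in> GL n" "upper_triangular b" "g' * m = unilower n y * b"
    using key2 by blast
  have "m = (g * g') * m" using g'(2) GL_carrier[OF m(1)] by simp
  also have "\<dots> = g * (unilower n y * b)"
    unfolding y(4)[symmetric] using c GL_carrier[OF m(1)] by (rule assoc_mult_mat)
  also have "\<dots> = g * unilower n y * b"
    using c(1) unilower_carrier GL_carrier[OF y(2)] by (rule assoc_mult_mat[symmetric])
  finally have "flag_of n m = flag_of n (g * unilower n y)"
    using flag_of_mult_upper[OF _ y(2,3), of "g * unilower n y"] GL_carrier[OF mult_unilower_GL[OF g]] by simp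
  then have "y \<in> chart_preimage n g O'" using V m y(1) by (simp add: chart_preimage_def)
  then have "f y = 0" by (rule f(2))
  then show False using key[OF m(1) y(2-4)] m(2) by simp
qed

lemma smooth_at_iff:
  "smooth_at n Y V \<longleftrightarrow>
     (\<exists>g\<in>GL n. flag_of n g = V \<and> affine_smooth_at (chart_indices n) (chart_preimage n g Y) (\<lambda>_. 0))"
  unfolding smooth_at_def chart_preimage_def ..

section \<open>The local structure of orbit closures\<close>

lemma upper_triangular_GL:
  assumes "b \<in> carrier_mat n n" "upper_triangular b" "\<And>i. i < n \<Longrightarrow> b $$ (i, i) \<noteq> 0"
  shows "b \<in> GL n"
proof (rule GL_det[OF assms(1)])
  show "det b \<noteq> 0"
    using upper_triangular_imp_det_eq_0_iff[OF assms(1,2)] assms(1,3) by (auto simp: diag_mat_def)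
qed

text \<open>Nodes are numbered from \<open>0\<close>; \<open>dn\<close> marks the nodes that are \<open>+\<close> or left endpoints and
  \<open>A\<close> is the set of arcs. Coordinates of the ambient space are indexed by nodes, so that
  \<open>GL\<^sub>p \<times> GL\<^sub>q\<close> becomes the group \<open>block_group\<close>, and \<open>P\<close> is an arbitrary change of basis.\<close>

locale clan_chart =
  fixes n :: nat and dn :: "nat \<Rightarrow> bool" and A :: "(nat \<times> nat) set" and P :: "complex mat"
  assumes arcs: "\<And>a b. (a, b) \<in> A \<Longrightarrow> a < b \<and> b < n \<and> dn a \<and> \<not> dn b"
    and arcs_left: "\<And>a b b'. (a, b) \<in> A \<Longrightarrow> (a, b') \<in> A \<Longrightarrow> b = b'"
    and arcs_right: "\<And>a a' b. (a, b) \<in> A \<Longrightarrow> (a', b) \<in> A \<Longrightarrow> a = a'"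
    and P: "P \<in> GL n"
begin

lemma finite_arcs: "finite A"
  by (rule finite_subset[of _ "{..<n} \<times> {..<n}"]) (use arcs in fastforce)+

definition block :: "complex mat \<Rightarrow> bool" where
  "block m \<longleftrightarrow> m \<in> carrier_mat n n \<and> (\<forall>r<n. \<forall>c<n. dn r \<noteq> dn c \<longrightarrow> m $$ (r, c) = 0)"

definition block_group :: "complex mat set" where
  "block_group = {k \<in> GL n. block k}"

definition clan_matrix :: "complex mat" where
  "clan_matrix = mat n n (\<lambda>(r, c). if r = c \<or> (c, r) \<in> A then 1 else 0)"

definition clan_orbit :: "(nat \<Rightarrow> complex vec set) set" where
  "clan_orbit = {flag_of n (P * (k * clan_matrix)) | k. k \<in> block_group}"

definition clan_closure :: "(nat \<Rightarrow> complex vec set) set" where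
  "clan_closure = flag_topology n closure_of clan_orbit"

text \<open>Of the two off-diagonal blocks only this one can be nonzero in the chart of the orbit;
  the opposite one is shown to vanish there.\<close>

definition mixed :: "nat \<Rightarrow> nat \<Rightarrow> bool" where
  "mixed r c \<longleftrightarrow> dn c \<and> \<not> dn r \<and> c < r \<and> r < n"

definition dominated :: "nat \<Rightarrow> nat \<Rightarrow> bool" where
  "dominated r c \<longleftrightarrow> mixed r c \<and> (\<exists>(a, b)\<in>A. a \<le> c \<and> r \<le> b)"

definition tangent_indices :: "(nat \<times> nat) set" where
  "tangent_indices = {(r, c) \<in> chart_indices n. dn r = dn c \<or> dominated r c}"

text \<open>The hook of an arc \<open>(a, b)\<close> consists of the positions \<open>(r, a)\<close>
  with \<open>r \<le> b\<close> and \<open>(b, c)\<close> with \<open>a \<le> c\<close>; the last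
  two conjuncts exclude the hooks.\<close>

definition bad :: "nat \<Rightarrow> nat \<Rightarrow> bool" where
  "bad r c \<longleftrightarrow> mixed r c \<and> (\<exists>(a, b)\<in>A. a < c \<and> r < b) \<and>
     (\<forall>b\<ge>r. (c, b) \<notin> A) \<and> (\<forall>a\<le>c. (a, r) \<notin> A)"

lemma tangent_indices_subset: "tangent_indices \<subseteq> chart_indices n"
  by (auto simp: tangent_indices_def)

lemma finite_tangent_indices: "finite tangent_indices"
  using finite_subset[OF tangent_indices_subset finite_chart_indices] .

text \<open>The matrix \<open>unilower n (\<phi> y)\<close> is the product of the block diagonal part of \<open>unilower n y\<close>
  with the matrix of its mixed entries.\<close>

definition \<phi> :: "(nat \<times> nat \<Rightarrow> complex) \<Rightarrow> nat \<times> nat \<Rightarrow> complex" where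
  "\<phi> y = (\<lambda>(r, c). y (r, c) + (if mixed r c then \<Sum>s | c < s \<and> s < r \<and> \<not> dn s. y (r, s) * y (s, c) else 0))"

text \<open>Solves \<open>\<phi> y = x\<close> from top to bottom: a mixed entry in row
  \<open>r\<close> involves mixed entries in rows \<open>s < r\<close> only, besides entries inside
  a block, which \<open>\<phi>\<close> leaves unchanged.\<close>

fun \<rho>' :: "(nat \<times> nat \<Rightarrow> complex) \<Rightarrow> nat \<Rightarrow> nat \<Rightarrow> complex" where
  "\<rho>' x r c = x (r, c) - (if mixed r c then \<Sum>s\<in>{c<..<r}. if dn s then 0 else x (r, s) * \<rho>' x s c else 0)"

declare \<rho>'.simps [simp del]

definition \<rho> :: "(nat \<times> nat \<Rightarrow> complex) \<Rightarrow> nat \<times> nat \<Rightarrow> complex" where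
  "\<rho> x = (\<lambda>(r, c). \<rho>' x r c)"

lemma sum_undn: "(\<Sum>s\<in>{c<..<r}. if dn s then 0 else f s) = (\<Sum>s | c < s \<and> s < r \<and> \<not> dn s. f s)"
  for f :: "nat \<Rightarrow> complex"
  by (rule sum.mono_neutral_cong_right) auto

lemma \<rho>_eq: "\<rho> x (r, c) = x (r, c) - (if mixed r c then \<Sum>s | c < s \<and> s < r \<and> \<not> dn s. x (r, s) * \<rho> x (s, c) else 0)"
  unfolding \<rho>_def by (simp add: \<rho>'.simps[of x r c] sum_undn)

lemma \<phi>_mixed: "mixed r c \<Longrightarrow> \<phi> y (r, c) = y (r, c) + (\<Sum>s | c < s \<and> s < r \<and> \<not> dn s. y (r, s) * y (s, c))"
  by (simp add: \<phi>_def)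

lemma \<rho>_mixed: "mixed r c \<Longrightarrow> \<rho> x (r, c) = x (r, c) - (\<Sum>s | c < s \<and> s < r \<and> \<not> dn s. x (r, s) * \<rho> x (s, c))"
  by (simp add: \<rho>_eq)

lemma \<phi>_not_mixed: "\<not> mixed r c \<Longrightarrow> \<phi> y (r, c) = y (r, c)"
  by (simp add: \<phi>_def)

lemma \<rho>_not_mixed: "\<not> mixed r c \<Longrightarrow> \<rho> y (r, c) = y (r, c)"
  by (simp add: \<rho>_eq)

lemma \<phi>_\<rho>: "\<phi> (\<rho> x) = x"
proof
  fix p :: "nat \<times> nat"
  obtain r c where p: "p = (r, c)" by (cases p)
  show "\<phi> (\<rho> x) p = x p"
  proof (cases "mixed r c")
    case True
    have "(\<Sum>s | c < s \<and> s < r \<and> \<not> dn s. \<rho> x (r, s) * \<rho> x (s, c)) =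
        (\<Sum>s | c < s \<and> s < r \<and> \<not> dn s. x (r, s) * \<rho> x (s, c))"
      by (intro sum.cong) (auto simp: \<rho>_not_mixed mixed_def)
    then show ?thesis using True by (simp add: p \<phi>_mixed \<rho>_mixed[of r c x])
  qed (simp add: p \<phi>_not_mixed \<rho>_not_mixed)
qed

lemma \<rho>_\<phi>: "\<rho> (\<phi> y) = y"
proof
  fix p :: "nat \<times> nat"
  obtain r c where p: "p = (r, c)" by (cases p)
  have "\<rho> (\<phi> y) (r, c) = y (r, c)"
  proof (induction r rule: less_induct)
    case (less r)
    show ?case
    proof (cases "mixed r c")
      case True
      have "(\<Sum>s | c < s \<and> s < r \<and> \<not> dn s. \<phi> y (r, s) * \<rho> (\<phi> y) (s, c)) =
          (\<Sum>s | c < s \<and> s < r \<and> \<not> dn s. y (r, s) * y (s, c))"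
        by (intro sum.cong) (auto simp: \<phi>_not_mixed mixed_def less.IH)
      then show ?thesis using True by (simp add: \<phi>_mixed \<rho>_mixed[of r c "\<phi> y"])
    qed (simp add: \<phi>_not_mixed \<rho>_not_mixed)
  qed
  then show "\<rho> (\<phi> y) p = y p" by (simp add: p)
qed

lemma chart_indices_iff: "(r, c) \<in> chart_indices n \<longleftrightarrow> c < r \<and> r < n"
  by (auto simp: chart_indices_def)

lemma \<phi>_affine: "y \<in> affine_space (chart_indices n) \<Longrightarrow> \<phi> y \<in> affine_space (chart_indices n)"
  by (auto simp: affine_space_def \<phi>_def chart_indices_iff mixed_def)

lemma \<rho>_affine:
  assumes "x \<in> affine_space (chart_indices n)"
  shows "\<rho> x \<in> affine_space (chart_indices n)"
proof -
  have "\<rho> x (r, c) = 0" if "(r, c) \<notin> chart_indices n" for r c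
    using that assms by (subst \<rho>_not_mixed) (auto simp: affine_space_def chart_indices_iff mixed_def)
  then show ?thesis by (auto simp: affine_space_def)
qed

lemma poly_\<phi>:
  assumes "p \<in> chart_indices n"
  shows "(\<lambda>y. \<phi> y p) \<in> poly_funs (chart_indices n)"
proof -
  obtain r c where p: "p = (r, c)" by (cases p)
  have rc: "c < r" "r < n" using assms by (auto simp: p chart_indices_iff)
  show ?thesis
  proof (cases "mixed r c")
    case True
    show ?thesis unfolding p \<phi>_def using True rc
      by (auto intro!: poly_funs.intros poly_funs_sum simp: chart_indices_iff)
  next
    case False
    then show ?thesis using assms unfolding p \<phi>_def by (auto intro!: poly_funs.intros)
  qed
qed

lemma poly_\<rho>:
  assumes "p \<in> chart_indices n"
  shows "(\<lambda>y. \<rho> y p) \<in> poly_funs (chart_indices n)"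
proof -
  obtain r c where p: "p = (r, c)" by (cases p)
  have "c < r \<Longrightarrow> r < n \<Longrightarrow> (\<lambda>y. \<rho> y (r, c)) \<in> poly_funs (chart_indices n)"
  proof (induction r rule: less_induct)
    case (less r)
    have co: "(\<lambda>y. y (r, c)) \<in> poly_funs (chart_indices n)"
      using less.prems by (intro poly_funs.coord) (simp add: chart_indices_iff)
    show ?case
    proof (cases "mixed r c")
      case True
      have "(\<lambda>y. \<rho> y (s, c)) \<in> poly_funs (chart_indices n)" if "c < s" "s < r" for s
        using less.IH[OF that(2,1)] less.prems that by simp
      then have "(\<lambda>y. y (r, c) - (\<Sum>s | c < s \<and> s < r \<and> \<not> dn s. y (r, s) * \<rho> y (s, c))) \<in> poly_funs (chart_indices n)"
        using less.prems
        by (intro poly_funs_diff co poly_funs_sum poly_funs.mult poly_funs.coord) (auto simp: chart_indices_iff)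
      then show ?thesis by (simp only: \<rho>_mixed[OF True])
    qed (simp add: \<rho>_not_mixed co)
  qed
  then show ?thesis using assms by (auto simp: p chart_indices_iff)
qed

lemma \<phi>_0: "\<phi> (\<lambda>_. 0) = (\<lambda>_. 0)"
  by (auto simp: \<phi>_def fun_eq_iff)

text \<open>\<open>\<phi>\<close> differs from the identity by terms quadratic in the
  coordinates.\<close>

lemma \<phi>_deriv: "((\<lambda>t. \<phi> (\<lambda>j. t * d j) i) has_field_derivative d i) (at 0)"
proof -
  obtain r c where i: "i = (r, c)" by (cases i)
  define S where "S = (if mixed r c then \<Sum>s | c < s \<and> s < r \<and> \<not> dn s. d (r, s) * d (s, c) else 0)"
  have "\<phi> (\<lambda>j. t * d j) i = t * d i + t ^ 2 * S" for t
    unfolding S_def \<phi>_def i by (auto simp: sum_distrib_left power2_eq_square mult_ac intro!: sum.cong)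
  then show ?thesis by (auto intro!: derivative_eq_intros)
qed

text \<open>The mixed factor leads from down columns to the other rows, so it can only be followed
  by a block entry between two nodes outside \<open>dn\<close>; this is the restriction on the
  summation index \<open>s\<close> in \<open>\<phi>\<close>.\<close>

lemma unilower_\<phi>:
  assumes y: "\<And>r c. dn r \<Longrightarrow> \<not> dn c \<Longrightarrow> y (r, c) = 0"
  shows "unilower n (\<phi> y) =
    unilower n (\<lambda>(r, c). if dn r = dn c then y (r, c) else 0) *
    unilower n (\<lambda>(r, c). if mixed r c then y (r, c) else 0)" (is "_ = ?B * ?M")
proof (rule eq_matI)
  fix r c assume "r < dim_row (?B * ?M)" "c < dim_col (?B * ?M)"
  then have rc: "r < n" "c < n" by (simp_all add: unilower_def)
  have "unilower n (\<phi> y) $$ (r, c) = (\<Sum>l<n. ?B $$ (r, l) * ?M $$ (l, c))"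
  proof (cases "mixed r c")
    case True
    have "(\<Sum>l<n. ?B $$ (r, l) * ?M $$ (l, c)) = (\<Sum>l\<in>insert r {s. c < s \<and> s < r \<and> \<not> dn s}. ?B $$ (r, l) * ?M $$ (l, c))"
      using True rc by (intro sum.mono_neutral_right) (auto simp: unilower_def mixed_def)
    also have "\<dots> = y (r, c) + (\<Sum>s | c < s \<and> s < r \<and> \<not> dn s. ?B $$ (r, s) * ?M $$ (s, c))"
      using True rc by (subst sum.insert) (auto simp: unilower_def mixed_def)
    also have "(\<Sum>s | c < s \<and> s < r \<and> \<not> dn s. ?B $$ (r, s) * ?M $$ (s, c)) =
        (\<Sum>s | c < s \<and> s < r \<and> \<not> dn s. y (r, s) * y (s, c))"
      using True rc by (intro sum.cong) (auto simp: unilower_def mixed_def)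
    finally show ?thesis using True rc by (simp add: \<phi>_def unilower_def mixed_def)
  next
    case False
    have "(\<Sum>l<n. ?B $$ (r, l) * ?M $$ (l, c)) = (\<Sum>l\<in>{c}. ?B $$ (r, l) * ?M $$ (l, c))"
      using False rc by (intro sum.mono_neutral_right) (auto simp: unilower_def mixed_def)
    also have "\<dots> = unilower n (\<phi> y) $$ (r, c)"
      using False rc y[of r c] by (auto simp: unilower_def \<phi>_not_mixed mixed_def)
    finally show ?thesis by simp
  qed
  then show "unilower n (\<phi> y) $$ (r, c) = (?B * ?M) $$ (r, c)"
    using rc by (simp only: index_mult_mat_sum[OF unilower_carrier unilower_carrier])
qed (simp_all add: unilower_def)

section \<open>Block matrices and the orbit in the chart\<close>

lemma block_mult:
  assumes "block a" "block b"
  shows "block (a * b)"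
proof -
  have c: "a \<in> carrier_mat n n" "b \<in> carrier_mat n n" using assms by (simp_all add: block_def)
  have "(a * b) $$ (i, j) = 0" if "i < n" "j < n" "dn i \<noteq> dn j" for i j
  proof -
    have "a $$ (i, l) * b $$ (l, j) = 0" if "l < n" for l
      using assms that \<open>i < n\<close> \<open>j < n\<close> \<open>dn i \<noteq> dn j\<close> unfolding block_def by (cases "dn i = dn l") auto
    then show ?thesis using that by (simp add: index_mult_mat_sum[OF c] sum.neutral del: mult_eq_0_iff)
  qed
  then show ?thesis using c by (simp add: block_def)
qed

text \<open>A matrix respects the blocks exactly when it commutes with the projection
  \<open>\<pi>\<close> onto the down coordinates, and commuting passes to inverses.\<close>

lemma block_inverse:
  assumes a: "block a" and h: "h \<in> carrier_mat n n" "a * h = 1\<^sub>m n" "h * a = 1\<^sub>m n"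
  shows "block h"
proof -
  define \<pi> where "\<pi> = mat n n (\<lambda>(r, c). if r = c \<and> dn r then 1 else 0 :: complex)"
  have \<pi>: "\<pi> \<in> carrier_mat n n" by (simp add: \<pi>_def)
  have ac: "a \<in> carrier_mat n n" using a by (simp add: block_def)
  have l: "(\<pi> * m) $$ (r, c) = (if dn r then m $$ (r, c) else 0)"
    if "m \<in> carrier_mat n n" "r < n" "c < n" for m r c
  proof -
    have "(\<Sum>l<n. \<pi> $$ (r, l) * m $$ (l, c)) = (\<Sum>l<n. if l = r then if dn r then m $$ (r, c) else 0 else 0)"
      using that by (intro sum.cong) (auto simp: \<pi>_def)
    then show ?thesis using that by (simp add: index_mult_mat_sum[OF \<pi>])
  qed
  have r: "(m * \<pi>) $$ (r, c) = (if dn c then m $$ (r, c) else 0)"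
    if "m \<in> carrier_mat n n" "r < n" "c < n" for m r c
  proof -
    have "(\<Sum>l<n. m $$ (r, l) * \<pi> $$ (l, c)) = (\<Sum>l<n. if l = c then if dn c then m $$ (r, c) else 0 else 0)"
      using that by (intro sum.cong) (auto simp: \<pi>_def)
    then show ?thesis using that by (simp add: index_mult_mat_sum[OF _ \<pi>])
  qed
  have "\<pi> * a = a * \<pi>"
    using a ac \<pi> by (intro eq_matI) (auto simp: l r block_def simp del: index_mult_mat(1))
  then have "h * (\<pi> * a) * h = h * (a * \<pi>) * h" by simp
  then have "h * \<pi> * (a * h) = (h * a) * \<pi> * h"
    using ac h(1) \<pi> by (simp add: assoc_mult_mat[where n\<^sub>2 = n and n\<^sub>3 = n and n\<^sub>4 = n])
  then have eq: "h * \<pi> = \<pi> * h" using h \<pi> by simp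
  have "h $$ (i, j) = 0" if "i < n" "j < n" "dn i \<noteq> dn j" for i j
    using arg_cong[OF eq, of "\<lambda>m. m $$ (i, j)"] l[OF h(1) that(1,2)] r[OF h(1) that(1,2)] that(3)
    by (auto split: if_splits)
  then show ?thesis using h(1) by (simp add: block_def)
qed

abbreviation orbit_chart :: "(nat \<times> nat \<Rightarrow> complex) set" where
  "orbit_chart \<equiv> chart_preimage n P clan_orbit"

abbreviation closure_chart :: "(nat \<times> nat \<Rightarrow> complex) set" where
  "closure_chart \<equiv> chart_preimage n P clan_closure"

lemma clan_matrix_carrier: "clan_matrix \<in> carrier_mat n n"
  by (simp add: clan_matrix_def)

lemma clan_matrix_GL: "clan_matrix \<in> GL n"
proof (rule unitlower_GL)
  show "unitlower n clan_matrix"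
    using arcs by (fastforce simp: unitlower_def clan_matrix_def)
qed

lemma clan_orbit_subset: "clan_orbit \<subseteq> Fl n"
  unfolding clan_orbit_def Fl_def block_group_def
  using mult_GL[OF P mult_GL[OF _ clan_matrix_GL]] by blast

lemma arc_less: "(a, b) \<in> A \<Longrightarrow> a < n" "(a, b) \<in> A \<Longrightarrow> b < n"
  using arcs by fastforce+

lemma clan_matrix_mult:
  assumes b: "b \<in> carrier_mat n n" and rc: "r < n" "c < n"
  shows "(clan_matrix * b) $$ (r, c) = b $$ (r, c) + (\<Sum>a | (a, r) \<in> A. b $$ (a, c))"
proof -
  have fin: "finite {a. (a, r) \<in> A}"
    by (rule finite_subset[of _ "{..<n}"]) (use arcs in fastforce)+
  have "(clan_matrix * b) $$ (r, c) = (\<Sum>l<n. clan_matrix $$ (r, l) * b $$ (l, c))"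
    by (rule index_mult_mat_sum[OF clan_matrix_carrier b rc])
  also have "\<dots> = (\<Sum>l\<in>insert r {a. (a, r) \<in> A}. b $$ (l, c))"
  proof (rule sum.mono_neutral_cong_right)
    show "insert r {a. (a, r) \<in> A} \<subseteq> {..<n}" using rc arcs by fastforce
  qed (use rc arc_less(1)[of _ r] in \<open>auto simp: clan_matrix_def\<close>)
  also have "\<dots> = b $$ (r, c) + (\<Sum>a | (a, r) \<in> A. b $$ (a, c))"
  proof -
    have "r \<notin> {a. (a, r) \<in> A}" using arcs by blast
    then show ?thesis using fin by simp
  qed
  finally show ?thesis .
qed

text \<open>In the chart, the orbit consists of the matrices \<open>\<phi> y\<close> with arbitrary entries inside the two
  blocks and mixed entries as on the orbit of the partial permutation matrix of the arcs under
  upper triangular row and column operations.\<close>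

lemma orbit_chart_param:
  assumes x: "x \<in> orbit_chart"
  obtains y \<kappa> \<beta> where "y \<in> affine_space tangent_indices" "x = \<phi> y"
    and "\<forall>r b. b < r \<longrightarrow> r < n \<longrightarrow> \<kappa> r b = 0" "\<forall>a c. c < a \<longrightarrow> a < n \<longrightarrow> \<beta> a c = (0 :: complex)"
    and "\<forall>r c. mixed r c \<longrightarrow> y (r, c) = (\<Sum>(a, b)\<in>A. \<kappa> r b * \<beta> a c)"
proof -
  define L where "L = unilower n x"
  have xI: "x \<in> affine_space (chart_indices n)" using x by (simp add: chart_preimage_def)
  obtain k where k: "k \<in> block_group" "flag_of n (P * L) = flag_of n (P * (k * clan_matrix))"
    using x by (auto simp: chart_preimage_def clan_orbit_def L_def)
  have kG: "k \<in> GL n" "block k" using k(1) by (simp_all add: block_group_def)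
  have LU: "unitlower n L" unfolding L_def by (rule unitlower_unilower)
  have kW: "k * clan_matrix \<in> GL n" by (rule mult_GL[OF kG(1) clan_matrix_GL])
  obtain b where b: "b \<in> GL n" "upper_triangular b" "P * L = P * (k * clan_matrix) * b"
    using flag_of_eqD[OF mult_GL[OF P kW] mult_GL[OF P unitlower_GL[OF LU]] k(2)[symmetric]] .
  obtain P' where P': "P' \<in> GL n" "P * P' = 1\<^sub>m n" "P' * P = 1\<^sub>m n" using GL_inverse[OF P] .
  note Bc = GL_carrier[OF b(1)] and Lc = unitlowerD(1)[OF LU]
  note cs = GL_carrier[OF P] GL_carrier[OF P'(1)] GL_carrier[OF b(1)] GL_carrier[OF kW] unitlowerD(1)[OF LU]
    GL_carrier[OF kG(1)] clan_matrix_carrier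
  note assoc = assoc_mult_mat[where n\<^sub>1 = n and n\<^sub>2 = n and n\<^sub>3 = n and n\<^sub>4 = n]
  have "P' * (P * L) = (P' * P) * (k * clan_matrix * b)"
    unfolding b(3) using cs by (simp add: assoc)
  moreover have "P' * (P * L) = (P' * P) * L" using cs by (simp add: assoc)
  ultimately have L: "L = k * (clan_matrix * b)" using P'(3) cs by (simp add: assoc)
  \<comment> \<open>The part of \<open>L\<close> inside the blocks respects them and can be absorbed
    into \<open>k\<close>. What is left is a unitriangular \<open>L'\<close> that is the identity
    inside the blocks.\<close>
  define B where "B = unilower n (\<lambda>(r, c). if dn r = dn c then x (r, c) else 0)"
  have B: "unitlower n B" unfolding B_def by (rule unitlower_unilower)
  have Bb: "block B" unfolding block_def B_def by (auto simp: unilower_def)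
  obtain B' where B': "B' \<in> GL n" "B * B' = 1\<^sub>m n" "B' * B = 1\<^sub>m n" using GL_inverse[OF unitlower_GL[OF B]] .
  note cs = cs unitlowerD(1)[OF B] GL_carrier[OF B'(1)]
  have B'l: "unitlower n B'" by (rule unitlower_inverse[OF B GL_carrier[OF B'(1)] B'(2)])
  have B'b: "block B'" by (rule block_inverse[OF Bb GL_carrier[OF B'(1)] B'(2,3)])
  note B1c = unitlowerD(1)[OF B] and B2c = GL_carrier[OF B'(1)]
  define k' where "k' = B' * k"
  have k'G: "k' \<in> GL n" unfolding k'_def by (rule mult_GL[OF B'(1) kG(1)])
  have k'b: "block k'" unfolding k'_def by (rule block_mult[OF B'b kG(2)])
  define L' where "L' = B' * L"
  have L'u: "unitlower n L'" unfolding L'_def by (rule unitlower_mult[OF B'l LU])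
  note cs = cs GL_carrier[OF k'G] unitlowerD(1)[OF L'u]
  have BL': "L = B * L'"
    using B'(2) cs unfolding L'_def by (simp add: assoc[symmetric])
  have L'eq: "L' = k' * (clan_matrix * b)" unfolding L'_def k'_def L using cs by (simp add: assoc)
  obtain \<kappa> where \<kappa>: "\<kappa> \<in> GL n" "k' * \<kappa> = 1\<^sub>m n" "\<kappa> * k' = 1\<^sub>m n" using GL_inverse[OF k'G] .
  note cs = cs GL_carrier[OF \<kappa>(1)]
  have \<kappa>b: "block \<kappa>" by (rule block_inverse[OF k'b GL_carrier[OF \<kappa>(1)] \<kappa>(2,3)])
  \<comment> \<open>With the block matrix moved to the other side, both sides can be compared block
    by block: the arcs contribute only to rows outside \<open>dn\<close>.\<close>
  have \<kappa>L: "\<kappa> * L' = clan_matrix * b"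
  proof -
    have Wb: "clan_matrix * b \<in> carrier_mat n n" using cs by simp
    have "\<kappa> * L' = (\<kappa> * k') * (clan_matrix * b)"
      unfolding L'eq by (rule assoc_mult_mat[OF GL_carrier[OF \<kappa>(1)] GL_carrier[OF k'G] Wb, symmetric])
    then show ?thesis unfolding \<kappa>(3) left_mult_one_mat[OF Wb] .
  qed
  have diag: "L' $$ (r, c) = (if r = c then 1 else 0)" if rc: "r < n" "c < n" "dn r = dn c" for r c
  proof -
    have "L' $$ (r, c) = (\<Sum>l<n. B' $$ (r, l) * L $$ (l, c))"
      unfolding L'_def by (rule index_mult_mat_sum[OF B2c Lc rc(1,2)])
    also have "\<dots> = (\<Sum>l<n. B' $$ (r, l) * B $$ (l, c))"
      using B'b rc unfolding block_def by (intro sum.cong) (auto simp: B_def L_def unilower_def)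
    also have "\<dots> = (B' * B) $$ (r, c)" by (rule index_mult_mat_sum[OF B2c B1c rc(1,2), symmetric])
    finally show ?thesis using B'(3) rc by simp
  qed
  have eq: "(\<Sum>l<n. \<kappa> $$ (r, l) * L' $$ (l, c)) = b $$ (r, c) + (\<Sum>a | (a, r) \<in> A. b $$ (a, c))"
    if "r < n" "c < n" for r c
    using arg_cong[OF \<kappa>L, of "\<lambda>m. m $$ (r, c)"] clan_matrix_mult[OF cs(3) that]
      index_mult_mat_sum[OF GL_carrier[OF \<kappa>(1)] unitlowerD(1)[OF L'u] that] by simp
  have noarc: "{a. (a, r) \<in> A} = {}" if "dn r" for r using arcs that by auto
  have same: "(\<Sum>l<n. \<kappa> $$ (r, l) * L' $$ (l, c)) = \<kappa> $$ (r, c)" if "r < n" "c < n" "dn r = dn c" for r c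
  proof -
    have "(\<Sum>l<n. \<kappa> $$ (r, l) * L' $$ (l, c)) = (\<Sum>l<n. if l = c then \<kappa> $$ (r, c) else 0)"
    proof (intro sum.cong refl)
      fix l assume "l \<in> {..<n}"
      then have l: "l < n" by simp
      show "\<kappa> $$ (r, l) * L' $$ (l, c) = (if l = c then \<kappa> $$ (r, c) else 0)"
      proof (cases "dn l = dn c")
        case True
        then show ?thesis using diag[OF l that(2)] by simp
      next
        case False
        then show ?thesis using \<kappa>b l that unfolding block_def by auto
      qed
    qed
    then show ?thesis using that by simp
  qed
  \<comment> \<open>No arc ends in a row of \<open>dn\<close>, so on the down block
    \<open>\<kappa>\<close> inherits its entries, and with them triangularity, from
    \<open>b\<close>.\<close>
  have \<kappa>dn: "\<kappa> $$ (r, c) = b $$ (r, c)" if "r < n" "c < n" "dn r" "dn c" for r c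
    using eq[OF that(1,2)] same[OF that(1,2)] that noarc by simp
  have bupper: "b $$ (r, c) = 0" if "c < r" "r < n" for r c
    using upper_triangular_entry[OF b(2) cs(3)] that by simp
  obtain b' where b': "b' \<in> GL n" "b' * b = 1\<^sub>m n" using GL_inverse[OF b(1)] by metis
  have bdiag: "b $$ (i, i) \<noteq> 0" if "i < n" for i
    using upper_triangular_inverse(2)[OF b(2) cs(3) GL_carrier[OF b'(1)] b'(2) that] by auto
  \<comment> \<open>Let row \<open>m\<close> hold the lowest nonzero entry of column
    \<open>c\<close> among the down rows. The terms with \<open>l < m\<close> drop out by
    triangularity of \<open>\<kappa>\<close> on the down block, and \<open>b $$ (m, c)\<close> is
    below the diagonal, hence zero. So the entry is killed by the nonzero
    \<open>\<kappa> $$ (m, m) = b $$ (m, m)\<close>.\<close>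
  have L'0: "L' $$ (l, c) = 0" if l: "l < n" "dn l" and c: "c < n" "\<not> dn c" for l c
  proof (rule ccontr)
    assume "L' $$ (l, c) \<noteq> 0"
    define S where "S = {l. l < n \<and> dn l \<and> L' $$ (l, c) \<noteq> 0}"
    have "finite S" "l \<in> S" using l \<open>L' $$ (l, c) \<noteq> 0\<close> by (auto simp: S_def)
    define m where "m = Max S"
    have m: "m \<in> S" "\<And>l. l \<in> S \<Longrightarrow> l \<le> m"
      using \<open>finite S\<close> \<open>l \<in> S\<close> by (auto simp: m_def intro: Max_in)
    then have mS: "m < n" "dn m" "L' $$ (m, c) \<noteq> 0" by (auto simp: S_def)
    have "m \<noteq> c" using mS c by auto
    moreover have "\<not> m < c" using unitlowerD(3)[OF L'u, of m c] mS c by auto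
    ultimately have "c < m" by simp
    have "(\<Sum>l<n. \<kappa> $$ (m, l) * L' $$ (l, c)) = (\<Sum>l<n. if l = m then \<kappa> $$ (m, m) * L' $$ (m, c) else 0)"
    proof (intro sum.cong refl)
      fix l assume "l \<in> {..<n}"
      then have l: "l < n" by simp
      consider "l = m" | "\<not> dn l" | "dn l" "l < m" | "dn l" "m < l" by linarith
      then show "\<kappa> $$ (m, l) * L' $$ (l, c) = (if l = m then \<kappa> $$ (m, m) * L' $$ (m, c) else 0)"
      proof cases
        case 2
        then show ?thesis using \<kappa>b mS l unfolding block_def by auto
      next
        case 3
        then show ?thesis using \<kappa>dn[OF mS(1) l mS(2)] bupper mS by auto
      next
        case 4
        then have "l \<notin> S" using m(2)[of l] by auto
        then show ?thesis using 4 l by (auto simp: S_def)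
      qed simp
    qed
    then have "\<kappa> $$ (m, m) * L' $$ (m, c) = b $$ (m, c)"
      using eq[of m c] mS c noarc by simp
    then show False using bupper[OF \<open>c < m\<close>] mS \<kappa>dn[of m m] bdiag[of m] by simp
  qed
  have b0: "b $$ (a, c) = 0" if "a < n" "dn a" "c < n" "\<not> dn c" for a c
  proof -
    have "\<kappa> $$ (a, l) * L' $$ (l, c) = 0" if "l < n" for l
      using L'0[of l c] \<kappa>b that \<open>a < n\<close> \<open>dn a\<close> \<open>c < n\<close> \<open>\<not> dn c\<close> unfolding block_def by (cases "dn l") auto
    then have "(\<Sum>l<n. \<kappa> $$ (a, l) * L' $$ (l, c)) = 0" by (intro sum.neutral ballI) (simp only: lessThan_iff)
    then show ?thesis using eq[of a c] noarc[of a] that by simp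
  qed
  have \<kappa>up: "upper_triangular \<kappa>"
  proof (rule upper_triangularI)
    fix i j assume "j < i" "i < dim_row \<kappa>"
    then have ij: "j < i" "i < n" "j < n" using cs by auto
    consider "dn i \<noteq> dn j" | "dn i" "dn j" | "\<not> dn i" "\<not> dn j" by blast
    then show "\<kappa> $$ (i, j) = 0"
    proof cases
      case 1
      then show ?thesis using \<kappa>b ij unfolding block_def by auto
    next
      case 2
      then show ?thesis using \<kappa>dn[OF ij(2,3)] bupper[OF ij(1,2)] by simp
    next
      case 3
      have "(\<Sum>a | (a, i) \<in> A. b $$ (a, j)) = 0"
        using b0 arcs ij 3 by (intro sum.neutral) fastforce
      then show ?thesis using eq[OF ij(2,3)] same[OF ij(2,3)] 3 bupper[OF ij(1,2)] by simp
    qed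
  qed
  have k'up: "upper_triangular k'"
    by (rule upper_triangular_inverse(1)[OF \<kappa>up GL_carrier[OF \<kappa>(1)] GL_carrier[OF k'G] \<kappa>(2)])
  \<comment> \<open>Below the diagonal the product of the upper triangular \<open>k'\<close> and
    \<open>b\<close> contributes nothing; only the arcs in \<open>clan_matrix\<close>
    remain.\<close>
  have mix: "L' $$ (r, c) = (\<Sum>(a, b')\<in>A. k' $$ (r, b') * b $$ (a, c))" if m: "mixed r c" for r c
  proof -
    have rc: "r < n" "c < n" "c < r" using m by (auto simp: mixed_def)
    have cb: "clan_matrix * b \<in> carrier_mat n n" using cs by simp
    have "L' $$ (r, c) = (\<Sum>l<n. k' $$ (r, l) * (clan_matrix * b) $$ (l, c))"
      unfolding L'eq by (rule index_mult_mat_sum[OF GL_carrier[OF k'G] cb rc(1,2)])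
    also have "\<dots> = (\<Sum>l<n. \<Sum>a | (a, l) \<in> A. k' $$ (r, l) * b $$ (a, c))"
    proof (intro sum.cong refl)
      fix l assume "l \<in> {..<n}"
      then have l: "l < n" by simp
      have "k' $$ (r, l) * b $$ (l, c) = 0"
        using upper_triangular_entry[OF k'up GL_carrier[OF k'G], of l r] bupper[of c l] rc l
        by (cases "l < r") auto
      then show "k' $$ (r, l) * (clan_matrix * b) $$ (l, c) = (\<Sum>a | (a, l) \<in> A. k' $$ (r, l) * b $$ (a, c))"
        unfolding clan_matrix_mult[OF cs(3) l rc(2)] by (simp add: distrib_left sum_distrib_left)
    qed
    also have "\<dots> = (\<Sum>(l, a)\<in>(SIGMA l:{..<n}. {a. (a, l) \<in> A}). k' $$ (r, l) * b $$ (a, c))"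
    proof (rule sum.Sigma)
      show "\<forall>l\<in>{..<n}. finite {a. (a, l) \<in> A}"
        by (intro ballI finite_subset[of "{a. (a, _) \<in> A}" "fst ` A"] finite_imageI finite_arcs) force
    qed simp
    also have "\<dots> = (\<Sum>(a, b')\<in>A. k' $$ (r, b') * b $$ (a, c))"
      by (rule sum.reindex_bij_witness[of _ prod.swap prod.swap]) (use arcs in auto)
    finally show ?thesis .
  qed
  define y where "y = (\<lambda>(r, c). if (r, c) \<in> chart_indices n then
      if dn r = dn c then x (r, c) else if mixed r c then L' $$ (r, c) else 0 else 0)"
  have yy: "\<And>r c. dn r \<Longrightarrow> \<not> dn c \<Longrightarrow> y (r, c) = 0" by (auto simp: y_def mixed_def)
  have "unilower n (\<lambda>(r, c). if dn r = dn c then y (r, c) else 0) = B"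
    unfolding B_def unilower_def by (intro eq_matI) (auto simp: y_def chart_indices_iff)
  moreover have "unilower n (\<lambda>(r, c). if mixed r c then y (r, c) else 0) = L'"
  proof (rule eq_matI)
    fix r c assume "r < dim_row L'" "c < dim_col L'"
    then have rc: "r < n" "c < n" using cs by auto
    consider "r < c" | "r = c" | "c < r" "dn r = dn c" | "c < r" "dn r" "\<not> dn c" | "mixed r c"
      using rc unfolding mixed_def by (meson linorder_neqE_nat)
    then show "unilower n (\<lambda>(r, c). if mixed r c then y (r, c) else 0) $$ (r, c) = L' $$ (r, c)"
    proof cases
      case 1
      then show ?thesis using unitlowerD(3)[OF L'u] rc by (simp add: unilower_def)
    next
      case 4
      then show ?thesis using L'0[of r c] rc by (simp add: unilower_def mixed_def)
    next
      case 5
      then show ?thesis using rc by (simp add: unilower_def mixed_def y_def chart_indices_iff)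
    qed (use diag rc in \<open>auto simp: unilower_def mixed_def\<close>)
  qed (use cs in \<open>auto simp: unilower_def\<close>)
  ultimately have "unilower n (\<phi> y) = unilower n x"
    using unilower_\<phi>[of y, OF yy] BL' unfolding L_def by simp
  moreover have yI: "y \<in> affine_space (chart_indices n)" by (auto simp: affine_space_def y_def)
  ultimately have xy: "x = \<phi> y" using unilower_inj[of n "\<phi> y" x] xI \<phi>_affine by simp
  have ymix: "y (r, c) = (\<Sum>(a, b')\<in>A. k' $$ (r, b') * b $$ (a, c))" if "mixed r c" for r c
    using mix[OF that] that by (auto simp: y_def mixed_def chart_indices_iff)
  have k'0: "k' $$ (r, b') = 0" if "b' < r" "r < n" for r b'
    using upper_triangular_entry[OF k'up GL_carrier[OF k'G]] that by simp
  have "y p = 0" if "p \<notin> tangent_indices" for p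
  proof -
    obtain r c where p: "p = (r, c)" by (cases p)
    show ?thesis
    proof (cases "mixed r c")
      case True
      have nd: "\<not> dominated r c" "r < n" using True that by (auto simp: p tangent_indices_def mixed_def chart_indices_iff)
      \<comment> \<open>By triangularity a nonzero summand needs \<open>r \<le> b'\<close> and
        \<open>a \<le> c\<close>, that is, an arc that dominates the position.\<close>
      have "k' $$ (r, b') * b $$ (a, c) = 0" if ab: "(a, b') \<in> A" for a b'
      proof (cases "b' < r")
        case True
        then show ?thesis using k'0[OF _ nd(2)] by simp
      next
        case False
        have "c < a"
        proof (rule ccontr)
          assume "\<not> c < a"
          then have "dominated r c"
            unfolding dominated_def using ab \<open>mixed r c\<close> False by (intro conjI bexI[of _ "(a, b')"]) auto
          with nd(1) show False ..
        qed
        then show ?thesis using bupper arc_less(1)[OF ab] by simp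
      qed
      then show ?thesis unfolding p ymix[OF True] by (intro sum.neutral) auto
    next
      case False
      then show ?thesis using that by (auto simp: p y_def tangent_indices_def)
    qed
  qed
  then have "y \<in> affine_space tangent_indices" by (simp add: affine_space_def)
  moreover have "\<forall>r b'. b' < r \<longrightarrow> r < n \<longrightarrow> k' $$ (r, b') = 0" using k'0 by blast
  moreover have "\<forall>a c. c < a \<longrightarrow> a < n \<longrightarrow> b $$ (a, c) = 0" using bupper by blast
  moreover have "\<forall>r c. mixed r c \<longrightarrow> y (r, c) = (\<Sum>(a, b')\<in>A. k' $$ (r, b') * b $$ (a, c))" using ymix by blast
  ultimately show thesis using xy by (intro that[of y "\<lambda>r b'. k' $$ (r, b')" "\<lambda>a c. b $$ (a, c)"])
qed

end

context clan_chart
begin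

text \<open>Row operations \<open>\<kappa>\<close> outside \<open>dn\<close> and column operations
  \<open>\<beta>\<close> inside \<open>dn\<close> extend by the identity to matrices
  \<open>K\<close> and \<open>B\<close> that are upper triangular and also respect the blocks. The
  sum over the arcs may be nonzero above the diagonal too, but that part goes into an upper
  unitriangular \<open>U\<close>, which does not change the flag.\<close>

lemma orbit_chartI:
  assumes yI: "y \<in> affine_space (chart_indices n)" and y0: "\<And>r c. dn r \<Longrightarrow> \<not> dn c \<Longrightarrow> y (r, c) = 0"
    and \<kappa>: "\<And>r b. b < r \<Longrightarrow> r < n \<Longrightarrow> \<kappa> r b = (0 :: complex)" "\<And>r. r < n \<Longrightarrow> \<kappa> r r \<noteq> 0"
    and \<beta>: "\<And>a c. c < a \<Longrightarrow> a < n \<Longrightarrow> \<beta> a c = (0 :: complex)" "\<And>c. c < n \<Longrightarrow> \<beta> c c \<noteq> 0"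
    and ymix: "\<And>r c. mixed r c \<Longrightarrow> y (r, c) = (\<Sum>(a, b)\<in>A. \<kappa> r b * \<beta> a c)"
  shows "\<phi> y \<in> orbit_chart"
proof -
  note assoc = assoc_mult_mat[where n\<^sub>1 = n and n\<^sub>2 = n and n\<^sub>3 = n and n\<^sub>4 = n]
  define K where "K = mat n n (\<lambda>(r, c). if \<not> dn r \<and> \<not> dn c then \<kappa> r c else if r = c then 1 else 0)"
  define B where "B = mat n n (\<lambda>(r, c). if dn r \<and> dn c then \<beta> r c else if r = c then 1 else 0)"
  define N where "N r c = (if dn c \<and> \<not> dn r then \<Sum>(a, b)\<in>A. \<kappa> r b * \<beta> a c else 0)" for r c
  define M where "M = mat n n (\<lambda>(r, c). (if r = c then 1 else 0) + N r c)"
  define U where "U = mat n n (\<lambda>(r, c). (if r = c then 1 else 0) + (if r < c then N r c else 0))"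
  define D where "D = unilower n (\<lambda>(r, c). if dn r = dn c then y (r, c) else 0)"
  define L where "L = unilower n (\<lambda>(r, c). if mixed r c then y (r, c) else 0)"
  have Kc: "K \<in> carrier_mat n n" and Bc: "B \<in> carrier_mat n n" and Mc: "M \<in> carrier_mat n n"
    and Uc: "U \<in> carrier_mat n n" and Dc: "D \<in> carrier_mat n n" and Lc: "L \<in> carrier_mat n n"
    by (auto simp: K_def B_def M_def U_def D_def L_def unilower_def)
  have Kut: "upper_triangular K" by (intro upper_triangularI) (use \<kappa> in \<open>auto simp: K_def\<close>)
  have KG: "K \<in> GL n" by (rule upper_triangular_GL[OF Kc Kut]) (use \<kappa> in \<open>auto simp: K_def\<close>)
  have But: "upper_triangular B" by (intro upper_triangularI) (use \<beta> in \<open>auto simp: B_def\<close>)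
  have BG: "B \<in> GL n" by (rule upper_triangular_GL[OF Bc But]) (use \<beta> in \<open>auto simp: B_def\<close>)
  have Uut: "upper_triangular U" by (intro upper_triangularI) (auto simp: U_def)
  have UG: "U \<in> GL n" by (rule upper_triangular_GL[OF Uc Uut]) (auto simp: U_def N_def)
  have DG: "D \<in> GL n" unfolding D_def by (rule unilower_GL)
  have Kb: "block K" and Bb: "block B" and Db: "block D"
    by (auto simp: block_def K_def B_def D_def unilower_def)
  obtain B' where B': "B' \<in> GL n" "B * B' = 1\<^sub>m n" "B' * B = 1\<^sub>m n" using GL_inverse[OF BG] .
  have B'b: "block B'" by (rule block_inverse[OF Bb GL_carrier[OF B'(1)] B'(2,3)])
  note B'c = GL_carrier[OF B'(1)]
  note Wc = clan_matrix_carrier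
  text \<open>\<open>K W B = B (1 + N) K\<close>\<close>
  have WB: "(clan_matrix * B) $$ (r, c) = B $$ (r, c) + (\<Sum>a | (a, r) \<in> A. B $$ (a, c))" if "r < n" "c < n" for r c
    by (rule clan_matrix_mult[OF Bc that])
  have KWB: "(K * (clan_matrix * B)) $$ (r, c) = (B * (M * K)) $$ (r, c)" if rc: "r < n" "c < n" for r c
  proof -
    have WBc: "clan_matrix * B \<in> carrier_mat n n" and MKc: "M * K \<in> carrier_mat n n" using Wc Bc Mc Kc by simp_all
    have Krow: "(K * X) $$ (r, c) = (if dn r then X $$ (r, c) else \<Sum>l | l < n \<and> \<not> dn l. \<kappa> r l * X $$ (l, c))"
      if X: "X \<in> carrier_mat n n" and "r < n" "c < n" for X r c
    proof -
      have "(\<Sum>l<n. K $$ (r, l) * X $$ (l, c)) = (if dn r then X $$ (r, c) else \<Sum>l | l < n \<and> \<not> dn l. \<kappa> r l * X $$ (l, c))"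
      proof (cases "dn r")
        case True
        have "(\<Sum>l<n. K $$ (r, l) * X $$ (l, c)) = (\<Sum>l<n. if l = r then X $$ (r, c) else 0)"
          using True that by (intro sum.cong) (auto simp: K_def)
        then show ?thesis using True that by simp
      next
        case False
        have "(\<Sum>l<n. K $$ (r, l) * X $$ (l, c)) = (\<Sum>l | l < n \<and> \<not> dn l. \<kappa> r l * X $$ (l, c))"
          using False that by (intro sum.mono_neutral_cong_right) (auto simp: K_def)
        then show ?thesis using False by simp
      qed
      then show ?thesis using index_mult_mat_sum[OF Kc X that(2,3)] by simp
    qed
    have Brow: "(B * X) $$ (r, c) = (if \<not> dn r then X $$ (r, c) else \<Sum>l | l < n \<and> dn l. \<beta> r l * X $$ (l, c))"
      if X: "X \<in> carrier_mat n n" and "r < n" "c < n" for X r c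
    proof -
      have "(\<Sum>l<n. B $$ (r, l) * X $$ (l, c)) = (if \<not> dn r then X $$ (r, c) else \<Sum>l | l < n \<and> dn l. \<beta> r l * X $$ (l, c))"
      proof (cases "dn r")
        case False
        have "(\<Sum>l<n. B $$ (r, l) * X $$ (l, c)) = (\<Sum>l<n. if l = r then X $$ (r, c) else 0)"
          using False that by (intro sum.cong) (auto simp: B_def)
        then show ?thesis using False that by simp
      next
        case True
        have "(\<Sum>l<n. B $$ (r, l) * X $$ (l, c)) = (\<Sum>l | l < n \<and> dn l. \<beta> r l * X $$ (l, c))"
          using True that by (intro sum.mono_neutral_cong_right) (auto simp: B_def)
        then show ?thesis using True by simp
      qed
      then show ?thesis using index_mult_mat_sum[OF Bc X that(2,3)] by simp
    qed
    have noarc: "{a. (a, r) \<in> A} = {}" if "dn r" for r using arcs that by auto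
    have MK: "(M * K) $$ (r, c) = (if dn c then (if r = c then 1 else 0) + N r c else K $$ (r, c))" if rc: "r < n" "c < n" for r c
    proof -
      have "(M * K) $$ (r, c) = (\<Sum>l<n. M $$ (r, l) * K $$ (l, c))" by (rule index_mult_mat_sum[OF Mc Kc rc])
      also have "\<dots> = (\<Sum>l<n. (if l = r then K $$ (r, c) else 0) + N r l * K $$ (l, c))"
        using rc by (intro sum.cong) (auto simp: M_def distrib_right)
      also have "\<dots> = K $$ (r, c) + (\<Sum>l<n. N r l * K $$ (l, c))" using rc by (simp add: sum.distrib)
      also have "(\<Sum>l<n. N r l * K $$ (l, c)) = (\<Sum>l<n. if l = c then N r c else 0)"
        using rc by (intro sum.cong) (auto simp: N_def K_def)
      also have "\<dots> = N r c" using rc by simp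
      finally show ?thesis using rc by (auto simp: K_def N_def)
    qed
    consider "dn r" "dn c" | "dn r" "\<not> dn c" | "\<not> dn r" "\<not> dn c" | "\<not> dn r" "dn c" by blast
    then show ?thesis
    proof cases
      case 1
      have "(K * (clan_matrix * B)) $$ (r, c) = \<beta> r c"
        using 1 rc noarc[of r] by (simp add: Krow[OF WBc] WB) (simp add: B_def)
      moreover have "(B * (M * K)) $$ (r, c) = (\<Sum>l | l < n \<and> dn l. \<beta> r l * (if l = c then 1 else 0))"
        unfolding Brow[OF MKc rc] using 1 rc by (simp add: MK N_def cong: conj_cong)
      moreover have "\<dots> = (\<Sum>l | l < n \<and> dn l. if l = c then \<beta> r c else 0)" by (intro sum.cong) auto
      ultimately show ?thesis using 1 rc by (simp add: sum.delta)
    next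
      case 2
      have "(K * (clan_matrix * B)) $$ (r, c) = 0"
        using 2 rc noarc[of r] by (simp add: Krow[OF WBc] WB) (auto simp: B_def)
      moreover have "(B * (M * K)) $$ (r, c) = (\<Sum>l | l < n \<and> dn l. \<beta> r l * K $$ (l, c))"
        unfolding Brow[OF MKc rc] using 2 rc by (simp add: MK cong: conj_cong)
      moreover have "\<dots> = 0" using 2 rc by (intro sum.neutral) (auto simp: K_def)
      ultimately show ?thesis by simp
    next
      case 3
      have "(\<Sum>a | (a, l) \<in> A. B $$ (a, c)) = 0" if "l < n" for l
        using 3 rc arcs arc_less by (intro sum.neutral ballI) (force simp: B_def)
      then have "(K * (clan_matrix * B)) $$ (r, c) = (\<Sum>l | l < n \<and> \<not> dn l. \<kappa> r l * B $$ (l, c))"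
        unfolding Krow[OF WBc rc] using 3 rc by (simp add: WB cong: conj_cong)
      also have "\<dots> = (\<Sum>l | l < n \<and> \<not> dn l. if l = c then \<kappa> r c else 0)"
        using 3 rc by (intro sum.cong) (auto simp: B_def)
      also have "\<dots> = \<kappa> r c" using 3 rc by (simp add: sum.delta)
      finally show ?thesis using 3 rc by (simp add: Brow[OF MKc] MK) (simp add: K_def)
    next
      case 4
      have t: "\<kappa> r l * (clan_matrix * B) $$ (l, c) = \<kappa> r l * (\<Sum>a | (a, l) \<in> A. \<beta> a c)"
        if l: "l \<in> {l. l < n \<and> \<not> dn l}" for l
      proof -
        have "(\<Sum>a | (a, l) \<in> A. B $$ (a, c)) = (\<Sum>a | (a, l) \<in> A. \<beta> a c)"
        proof (intro sum.cong refl)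
          fix a assume "a \<in> {a. (a, l) \<in> A}"
          then have "a < n" "dn a" using arcs[of a l] by auto
          then show "B $$ (a, c) = \<beta> a c" using 4 rc by (simp add: B_def)
        qed
        moreover have "B $$ (l, c) = 0" using l 4 rc by (auto simp: B_def)
        ultimately show ?thesis using l rc by (simp add: WB)
      qed
      have "(K * (clan_matrix * B)) $$ (r, c) = (\<Sum>l | l < n \<and> \<not> dn l. \<kappa> r l * (clan_matrix * B) $$ (l, c))"
        unfolding Krow[OF WBc rc] using 4 by simp
      also have "\<dots> = (\<Sum>l | l < n \<and> \<not> dn l. \<kappa> r l * (\<Sum>a | (a, l) \<in> A. \<beta> a c))"
        by (intro sum.cong refl t)
      also have "\<dots> = (\<Sum>(l, a)\<in>(SIGMA l:{l. l < n \<and> \<not> dn l}. {a. (a, l) \<in> A}). \<kappa> r l * \<beta> a c)"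
        unfolding sum_distrib_left
      proof (rule sum.Sigma)
        show "\<forall>l\<in>{l. l < n \<and> \<not> dn l}. finite {a. (a, l) \<in> A}"
          by (intro ballI finite_subset[of "{a. (a, _) \<in> A}" "fst ` A"] finite_imageI finite_arcs) force
      qed simp
      also have "\<dots> = (\<Sum>(a, b)\<in>A. \<kappa> r b * \<beta> a c)"
        by (rule sum.reindex_bij_witness[of _ prod.swap prod.swap]) (use arcs arc_less in auto)
      also have "\<dots> = (B * (M * K)) $$ (r, c)"
        using 4 rc by (auto simp add: Brow[OF MKc] MK N_def)
      finally show ?thesis .
    qed
  qed
  have KWB: "K * (clan_matrix * B) = B * (M * K)"
    by (rule eq_matI) (use KWB Kc Bc Mc Wc in auto)
  \<comment> \<open>The strictly lower and the strictly upper part of \<open>M\<close> both lead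
    from down columns to the other rows, so their product is zero and \<open>L * U\<close> is the
    identity plus both parts.\<close>
  have M: "M = L * U"
  proof (rule eq_matI)
    fix r c assume "r < dim_row (L * U)" "c < dim_col (L * U)"
    then have rc: "r < n" "c < n" using Lc Uc by auto
    have "(L * U) $$ (r, c) = (\<Sum>l<n. L $$ (r, l) * U $$ (l, c))" by (rule index_mult_mat_sum[OF Lc Uc rc])
    also have "\<dots> = (\<Sum>l<n. (if l = r then U $$ (r, c) else 0) + (if l = c \<and> mixed r c then y (r, c) else 0))"
      using rc by (intro sum.cong) (auto simp: L_def U_def N_def unilower_def mixed_def)
    also have "\<dots> = U $$ (r, c) + (if mixed r c then y (r, c) else 0)"
      using rc by (cases "mixed r c") (simp_all add: sum.distrib)
    also have "\<dots> = M $$ (r, c)"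
    proof (cases "mixed r c")
      case True
      then show ?thesis using rc ymix[OF True] by (auto simp: U_def M_def N_def mixed_def)
    next
      case False
      then show ?thesis using rc by (auto simp: U_def M_def N_def mixed_def)
    qed
    finally show "M $$ (r, c) = (L * U) $$ (r, c)" by simp
  qed (use Mc Lc Uc in auto)
  define k where "k = D * (B' * K)"
  have k: "k \<in> block_group"
    unfolding block_group_def k_def
    by (intro CollectI conjI mult_GL DG B'(1) KG block_mult Db B'b Kb)
  have kW: "k * clan_matrix * B = D * L * (U * K)"
  proof -
    have "k * clan_matrix * B = D * (B' * (K * (clan_matrix * B)))"
      unfolding k_def using Dc B'c Kc Wc Bc by (simp add: assoc)
    also have "B' * (K * (clan_matrix * B)) = (B' * B) * (M * K)"
      unfolding KWB using B'c Bc Mc Kc by (simp add: assoc)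
    also have "D * \<dots> = D * L * (U * K)"
      unfolding B'(3) M using Dc Lc Uc Kc by (simp add: assoc)
    finally show ?thesis .
  qed
  have "D * L = unilower n (\<phi> y)" unfolding D_def L_def by (rule unilower_\<phi>[of y, OF y0, symmetric])
  then have eq: "P * (k * clan_matrix) * B = P * unilower n (\<phi> y) * (U * K)"
    using kW GL_carrier[OF P] GL_carrier[OF mult_GL[OF DG mult_GL[OF B'(1) KG]]] Wc Bc Uc Kc unilower_carrier[of n "\<phi> y"]
    unfolding k_def[symmetric] by (simp add: assoc)
  have kc: "k \<in> carrier_mat n n" using k by (simp add: block_group_def block_def)
  have "flag_of n (P * (k * clan_matrix)) = flag_of n (P * (k * clan_matrix) * B)"
    by (rule flag_of_mult_upper[OF _ BG But, symmetric]) (use GL_carrier[OF P] kc Wc in simp)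
  also have "\<dots> = flag_of n (P * unilower n (\<phi> y))"
    unfolding eq
  proof (rule flag_of_mult_upper)
    show "P * unilower n (\<phi> y) \<in> carrier_mat n n" using GL_carrier[OF P] unilower_carrier[of n "\<phi> y"] by simp
    show "U * K \<in> GL n" by (rule mult_GL[OF UG KG])
    show "upper_triangular (U * K)" by (rule upper_triangular_mult[OF Uut Kut Uc Kc])
  qed
  finally have feq: "flag_of n (P * (k * clan_matrix)) = flag_of n (P * unilower n (\<phi> y))" .
  have "flag_of n (P * unilower n (\<phi> y)) \<in> clan_orbit"
    unfolding clan_orbit_def using k by (intro CollectI exI[of _ k]) (simp only: feq simp_thms)
  then show ?thesis using \<phi>_affine[OF yI] by (simp add: chart_preimage_def)
qed

text \<open>Singular row and column operations are limits of invertible ones.\<close>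

lemma vanish_orbit:
  assumes f: "f \<in> poly_funs (chart_indices n)" "\<And>x. x \<in> orbit_chart \<Longrightarrow> f x = 0"
    and yI: "y \<in> affine_space (chart_indices n)" and y0: "\<And>r c. dn r \<Longrightarrow> \<not> dn c \<Longrightarrow> y (r, c) = 0"
    and \<kappa>: "\<And>r b. b < r \<Longrightarrow> r < n \<Longrightarrow> \<kappa> r b = (0 :: complex)"
    and \<beta>: "\<And>a c. c < a \<Longrightarrow> a < n \<Longrightarrow> \<beta> a c = (0 :: complex)"
    and ymix: "\<And>r c. mixed r c \<Longrightarrow> y (r, c) = (\<Sum>(a, b)\<in>A. \<kappa> r b * \<beta> a c)"
  shows "f (\<phi> y) = 0"
proof -
  \<comment> \<open>Adding \<open>t\<close> to the diagonals of \<open>\<kappa>\<close> and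
    \<open>\<beta>\<close> makes both invertible for all but finitely many \<open>t\<close>, and
    \<open>t = 0\<close> gives back \<open>y\<close>.\<close>
  define z where "z t = (\<lambda>(r, c). if mixed r c
      then \<Sum>(a, b)\<in>A. (\<kappa> r b + (if r = b then t else 0)) * (\<beta> a c + (if a = c then t else 0)) else y (r, c))" for t
  have "z 0 = y" using ymix by (auto simp: z_def fun_eq_iff)
  have zI: "z t \<in> affine_space (chart_indices n)" for t
    using yI by (auto simp: affine_space_def z_def mixed_def chart_indices_iff)
  have "\<exists>Q. \<forall>t. f (\<phi> (z t)) = poly Q t"
  proof (rule poly_funs_curve[OF poly_funs_compose[OF f(1) poly_\<phi>]])
    fix p :: "nat \<times> nat"
    obtain r c where p: "p = (r, c)" by (cases p)
    show "\<exists>Q. \<forall>t. z t p = poly Q t"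
    proof (cases "mixed r c")
      case True
      have "z t p = poly (\<Sum>(a, b)\<in>A. [:\<kappa> r b, if r = b then 1 else 0:] * [:\<beta> a c, if a = c then 1 else 0:]) t" for t
      proof -
        have lin: "poly [:v, if C then 1 else 0:] t = v + (if C then t else 0)" for v t :: complex and C by simp
        show ?thesis unfolding z_def p using True
          by (simp only: case_prod_unfold fst_conv snd_conv if_True poly_sum poly_mult lin)
      qed
      then show ?thesis by blast
    next
      case False
      then show ?thesis unfolding z_def p by (intro exI[of _ "[:y (r, c):]"]) simp
    qed
  qed
  then obtain Q where Q: "\<And>t. f (\<phi> (z t)) = poly Q t" by blast
  define S where "S = (\<lambda>i. - \<kappa> i i) ` {..<n} \<union> (\<lambda>i. - \<beta> i i) ` {..<n}"
  have "poly Q t = 0" if t: "t \<notin> S" for t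
  proof -
    have "\<phi> (z t) \<in> orbit_chart"
    proof (rule orbit_chartI[OF zI, where \<kappa> = "\<lambda>r b. \<kappa> r b + (if r = b then t else 0)"
          and \<beta> = "\<lambda>a c. \<beta> a c + (if a = c then t else 0)"])
      fix i assume "i < n"
      then have "t \<noteq> - \<kappa> i i" "t \<noteq> - \<beta> i i" using t by (auto simp: S_def)
      then show "\<kappa> i i + (if i = i then t else 0) \<noteq> 0" "\<beta> i i + (if i = i then t else 0) \<noteq> 0"
        by (auto simp: add_eq_0_iff)
    qed (use \<kappa> \<beta> y0 in \<open>auto simp: z_def mixed_def\<close>)
    then show ?thesis using f(2) Q[of t] by simp
  qed
  then have "- S \<subseteq> {t. poly Q t = 0}" by auto
  moreover have "infinite (- S)"
    using infinite_UNIV_char_0[where 'a = complex] by (simp add: S_def Compl_eq_Diff_UNIV Diff_infinite_finite)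
  ultimately have "Q = 0" using poly_roots_finite finite_subset by blast
  then show ?thesis using Q[of 0] \<open>z 0 = y\<close> by simp
qed

lemma closure_chartI:
  assumes "y \<in> affine_space (chart_indices n)" "\<And>r c. dn r \<Longrightarrow> \<not> dn c \<Longrightarrow> y (r, c) = 0"
    and "\<And>r b. b < r \<Longrightarrow> r < n \<Longrightarrow> \<kappa> r b = (0 :: complex)"
    and "\<And>a c. c < a \<Longrightarrow> a < n \<Longrightarrow> \<beta> a c = (0 :: complex)"
    and "\<And>r c. mixed r c \<Longrightarrow> y (r, c) = (\<Sum>(a, b)\<in>A. \<kappa> r b * \<beta> a c)"
  shows "\<phi> y \<in> closure_chart"
  unfolding clan_closure_def
proof (rule chart_closureI[OF P \<phi>_affine[OF assms(1)]])
  fix f assume f: "f \<in> poly_funs (chart_indices n)" "\<And>x'. x' \<in> orbit_chart \<Longrightarrow> f x' = 0"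
  show "f (\<phi> y) = 0"
    by (rule vanish_orbit[OF f assms])
qed

lemma closure_chartD:
  assumes "f \<in> poly_funs (chart_indices n)" "\<And>x. x \<in> orbit_chart \<Longrightarrow> f x = 0" "x \<in> closure_chart"
  shows "f x = 0"
  using chart_closureD[OF P clan_orbit_subset assms(1,2)] assms(3) unfolding clan_closure_def by simp

text \<open>The components of \<open>\<rho>\<close> outside \<open>tangent_indices\<close> are
  polynomials that vanish on the orbit, hence on its closure.\<close>

lemma closure_chart_subset:
  assumes x: "x \<in> closure_chart"
  shows "\<rho> x \<in> affine_space tangent_indices"
proof -
  have xI: "x \<in> affine_space (chart_indices n)" using x by (simp add: chart_preimage_def)
  have "\<rho> x p = 0" if p: "p \<in> chart_indices n" "p \<notin> tangent_indices" for p
  proof (rule closure_chartD[OF poly_\<rho>[OF p(1)] _ x])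
    fix x assume "x \<in> orbit_chart"
    then obtain y where "y \<in> affine_space tangent_indices" "x = \<phi> y" by (rule orbit_chart_param)
    then show "\<rho> x p = 0" using p(2) unfolding affine_space_def by (simp only: \<rho>_\<phi>) blast
  qed
  then show ?thesis using \<rho>_affine[OF xI] unfolding affine_space_def by blast
qed

section \<open>Smooth points\<close>

text \<open>If every dominated position lies on a hook, then row and column operations applied to
  the partial permutation matrix of the arcs move the mixed entries, to first order, in all
  dominated directions. A function that vanishes on the orbit then vanishes on the whole coordinate
  space.\<close>

lemma closure_chart_eq:
  assumes good: "\<And>r c. \<not> bad r c"
  shows "closure_chart = \<phi> ` affine_space tangent_indices"
proof
  show "closure_chart \<subseteq> \<phi> ` affine_space tangent_indices"
  proof
    fix x assume "x \<in> closure_chart"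
    from imageI[OF closure_chart_subset[OF this], of \<phi>]
    show "x \<in> \<phi> ` affine_space tangent_indices" by (simp only: \<phi>_\<rho>)
  qed
  show "\<phi> ` affine_space tangent_indices \<subseteq> closure_chart"
  proof safe
    fix y assume y: "y \<in> affine_space tangent_indices"
    have yI: "y \<in> affine_space (chart_indices n)"
      using y affine_space_mono[OF tangent_indices_subset] by blast
    have y0: "y (r, c) = 0" if "dn r" "\<not> dn c" for r c
      using y that by (auto simp: affine_space_def tangent_indices_def dominated_def mixed_def)
    define V where "V = affine_space {(r, c). dominated r c}"
    \<comment> \<open>The base point agrees with the target \<open>y\<close> inside the blocks, so
      that \<open>y\<close> differs from it by an element of \<open>V\<close>; its mixed part is the
      partial permutation matrix.\<close>
    define w where "w = (\<lambda>(r, c). if mixed r c then if (c, r) \<in> A then 1 else 0 else y (r, c))"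
    define lft where "lft b = (THE a. (a, b) \<in> A)" for b
    define rgt where "rgt a = (THE b. (a, b) \<in> A)" for a
    have lft: "lft b = a" and rgt: "rgt a = b" if "(a, b) \<in> A" for a b
      using that arcs_left arcs_right by (auto simp: lft_def rgt_def)
    \<comment> \<open>A prescribed entry \<open>C (r, c)\<close> on a hook is produced by a row
      operation through the arc starting at \<open>c\<close>, or else by a column operation through
      the arc ending at \<open>r\<close>. The condition in \<open>z2\<close> skips the positions
      already served by \<open>z1\<close>.\<close>
    define z1 where "z1 C r b = (if r \<le> b then C (r, lft b) else 0)" for C :: "nat \<times> nat \<Rightarrow> complex" and r b
    define z2 where "z2 C a c = (if a \<le> c \<and> \<not> (\<exists>b\<ge>rgt a. (c, b) \<in> A) then C (rgt a, c) else 0)"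
      for C :: "nat \<times> nat \<Rightarrow> complex" and a c
    \<comment> \<open>The second-order term that arises because both kinds of operations act on
      \<open>w\<close> together.\<close>
    define Q where "Q C = (\<lambda>(r, c). if mixed r c then \<Sum>(a, b)\<in>A. z1 C r b * z2 C a c else 0)" for C
    show "\<phi> y \<in> closure_chart"
      unfolding clan_closure_def
    proof (rule chart_closureI[OF P \<phi>_affine[OF yI]])
      fix f assume f: "f \<in> poly_funs (chart_indices n)" "\<And>x'. x' \<in> orbit_chart \<Longrightarrow> f x' = 0"
      have "f (\<phi> (\<lambda>i. w i + (y i - w i))) = 0"
      proof (rule poly_funs_vanish_by_tangent[where V = V and Q = Q, OF poly_funs_compose[OF f(1) poly_\<phi>]])
        show "Q C \<in> V" for C
        proof -
          have "Q C (r, c) = 0" if nd: "\<not> dominated r c" for r c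
          proof (cases "mixed r c")
            case True
            have "z1 C r b * z2 C a c = 0" if "(a, b) \<in> A" for a b
              using True nd that by (auto simp: z1_def z2_def dominated_def)
            then show ?thesis by (auto simp: Q_def intro!: sum.neutral simp del: mult_eq_0_iff)
          qed (simp add: Q_def)
          then show ?thesis by (auto simp: V_def affine_space_def)
        qed
        show "(\<lambda>i. C i + t * C' i) \<in> V" if "C \<in> V" "C' \<in> V" for C C' t
          using that by (auto simp: V_def affine_space_def)
        show "(\<lambda>i. y i - w i) \<in> V"
          using y unfolding V_def affine_space_def
          by (auto simp: w_def dominated_def tangent_indices_def mixed_def)
      next
        fix C t assume C: "C \<in> V"
        define u where "u = (\<lambda>i. w i + t * (C i + t * Q C i))"
        have C0: "C (r, c) = 0" if "\<not> dominated r c" for r c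
          using C that by (auto simp: V_def affine_space_def)
        have nm: "u (r, c) = y (r, c)" if "\<not> mixed r c" for r c
          using that C0[of r c] by (simp add: u_def w_def Q_def dominated_def)
        have "f (\<phi> u) = 0"
        proof (rule vanish_orbit[OF f, where \<kappa> = "\<lambda>r b. (if r = b then 1 else 0) + t * z1 C r b"
              and \<beta> = "\<lambda>a c. (if a = c then 1 else 0) + t * z2 C a c"])
          show "u \<in> affine_space (chart_indices n)"
          proof -
            have "u (r, c) = 0" if "(r, c) \<notin> chart_indices n" for r c
            proof -
              have "\<not> mixed r c" using that by (auto simp: mixed_def chart_indices_iff)
              then show ?thesis using nm yI that by (auto simp: affine_space_def)
            qed
            then show ?thesis by (auto simp: affine_space_def)
          qed
          show "u (r, c) = 0" if "dn r" "\<not> dn c" for r c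
            using nm[of r c] y0[OF that] that by (simp add: mixed_def)
          show "(if r = b then 1 else 0) + t * z1 C r b = 0" if "b < r" "r < n" for r b
            using that by (simp add: z1_def)
          show "(if a = c then 1 else 0) + t * z2 C a c = 0" if "c < a" "a < n" for a c
            using that by (simp add: z2_def)
          fix r c assume m: "mixed r c"
          have s0: "(\<Sum>(a, b)\<in>A. (if r = b then 1 else 0) * (if a = c then 1 else 0 :: complex)) = (if (c, r) \<in> A then 1 else 0)"
          proof -
            have "(\<Sum>(a, b)\<in>A. (if r = b then 1 else 0) * (if a = c then 1 else 0 :: complex)) =
                (\<Sum>p\<in>A. if p = (c, r) then 1 else 0)"
              by (intro sum.cong) (auto split: if_splits)
            then show ?thesis using finite_arcs by simp
          qed
          have "(\<Sum>(a, b)\<in>A. (if a = c then z1 C r b else 0) + (if r = b then z2 C a c else 0)) = C (r, c)"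
          proof -
            have split_or: "(if F then v else 0) + (if G \<and> \<not> F then v else 0) = v"
              if "F \<or> G \<or> v = 0" for F G and v :: complex
              using that by auto
            have 1: "(\<Sum>(a, b)\<in>A. if a = c then z1 C r b else 0) = (if \<exists>b\<ge>r. (c, b) \<in> A then C (r, c) else 0)"
            proof (cases "\<exists>b. (c, b) \<in> A")
              case True
              then obtain b where b: "(c, b) \<in> A" by blast
              have "(\<Sum>(a, b)\<in>A. if a = c then z1 C r b else 0) = (\<Sum>p\<in>A. if p = (c, b) then z1 C r b else 0)"
                using arcs_left[OF b] by (intro sum.cong) (auto split: if_splits)
              also have "\<dots> = z1 C r b" using b finite_arcs by simp
              also have "\<dots> = (if \<exists>b\<ge>r. (c, b) \<in> A then C (r, c) else 0)"
              proof -
                have "(\<exists>b\<ge>r. (c, b) \<in> A) \<longleftrightarrow> r \<le> b" using b arcs_left[OF b] by blast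
                then show ?thesis by (simp add: z1_def lft[OF b])
              qed
              finally show ?thesis .
            next
              case False
              then have "(\<Sum>(a, b)\<in>A. if a = c then z1 C r b else 0) = 0" by (intro sum.neutral) auto
              moreover have "\<not> (\<exists>b\<ge>r. (c, b) \<in> A)" using False by blast
              ultimately show ?thesis by (simp only: if_False simp_thms)
            qed
            have 2: "(\<Sum>(a, b)\<in>A. if r = b then z2 C a c else 0) =
                (if (\<exists>a\<le>c. (a, r) \<in> A) \<and> \<not> (\<exists>b\<ge>r. (c, b) \<in> A) then C (r, c) else 0)"
            proof (cases "\<exists>a. (a, r) \<in> A")
              case True
              then obtain a where a: "(a, r) \<in> A" by blast
              have "(\<Sum>(a, b)\<in>A. if r = b then z2 C a c else 0) = (\<Sum>p\<in>A. if p = (a, r) then z2 C a c else 0)"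
                using arcs_right[OF a] by (intro sum.cong) (auto split: if_splits)
              also have "\<dots> = z2 C a c" using a finite_arcs by simp
              also have "\<dots> = (if (\<exists>a\<le>c. (a, r) \<in> A) \<and> \<not> (\<exists>b\<ge>r. (c, b) \<in> A) then C (r, c) else 0)"
              proof -
                have "(\<exists>a\<le>c. (a, r) \<in> A) \<longleftrightarrow> a \<le> c" using a arcs_right[OF a] by blast
                then show ?thesis by (simp only: z2_def rgt[OF a])
              qed
              finally show ?thesis .
            next
              case False
              then have "(\<Sum>(a, b)\<in>A. if r = b then z2 C a c else 0) = 0" by (intro sum.neutral) auto
              moreover have "\<not> (\<exists>a\<le>c. (a, r) \<in> A)" using False by blast
              ultimately show ?thesis by (simp only: if_False simp_thms)
            qed
            \<comment> \<open>Here the absence of bad positions enters: a dominated position on no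
              hook would be strictly enclosed by an arc.\<close>
            have "(\<exists>b\<ge>r. (c, b) \<in> A) \<or> (\<exists>a\<le>c. (a, r) \<in> A)" if dom: "dominated r c"
            proof (rule ccontr)
              assume n: "\<not> ?thesis"
              obtain a b where ab: "(a, b) \<in> A" "a \<le> c" "r \<le> b" using dom by (auto simp: dominated_def)
              then have "a \<noteq> c" "r \<noteq> b" using n by auto
              then have "a < c" "r < b" using ab by auto
              then have "\<exists>(a, b)\<in>A. a < c \<and> r < b" using ab(1) by blast
              then have "bad r c" unfolding bad_def using n m by blast
              then show False using good by blast
            qed
            moreover have "C (r, c) = 0" if "\<not> dominated r c" using C0 that .
            ultimately have "(if \<exists>b\<ge>r. (c, b) \<in> A then C (r, c) else 0) +
                (if (\<exists>a\<le>c. (a, r) \<in> A) \<and> \<not> (\<exists>b\<ge>r. (c, b) \<in> A) then C (r, c) else 0) = C (r, c)"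
              by (intro split_or) blast
            moreover have "(\<Sum>(a, b)\<in>A. (if a = c then z1 C r b else 0) + (if r = b then z2 C a c else 0)) =
                (\<Sum>(a, b)\<in>A. if a = c then z1 C r b else 0) + (\<Sum>(a, b)\<in>A. if r = b then z2 C a c else 0)"
              by (simp only: case_prod_unfold sum.distrib)
            ultimately show ?thesis unfolding 1 2 by simp
          qed
          note s1 = this
          have "u (r, c) = (if (c, r) \<in> A then 1 else 0) + t * C (r, c) + t * t * (\<Sum>(a, b)\<in>A. z1 C r b * z2 C a c)"
            using m by (simp add: u_def w_def Q_def algebra_simps)
          also have "\<dots> = (\<Sum>(a, b)\<in>A. ((if r = b then 1 else 0) + t * z1 C r b) * ((if a = c then 1 else 0) + t * z2 C a c))"
            unfolding s0[symmetric] s1[symmetric] sum_distrib_left sum.distrib[symmetric]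
            by (intro sum.cong) (auto simp: algebra_simps)
          finally show "u (r, c) = (\<Sum>(a, b)\<in>A. ((if r = b then 1 else 0) + t * z1 C r b) * ((if a = c then 1 else 0) + t * z2 C a c))" .
        qed
        then show "f (\<phi> (\<lambda>i. w i + t * (C i + t * Q C i))) = 0" unfolding u_def .
      qed
      then show "f (\<phi> y) = 0" by simp
    qed
  qed
qed

lemma smooth_if_good:
  assumes "\<And>r c. \<not> bad r c"
  shows "smooth_at n clan_closure (flag_of n P)"
  unfolding smooth_at_iff
proof (intro bexI[of _ P] conjI refl P)
  show "affine_smooth_at (chart_indices n) closure_chart (\<lambda>_. 0)"
    by (rule smooth_coordinate_image[OF finite_chart_indices tangent_indices_subset poly_\<phi> \<phi>_affine
          poly_\<rho> \<rho>_affine \<rho>_\<phi> \<phi>_\<rho> \<phi>_0 \<phi>_deriv closure_chart_eq[OF assms]])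
qed

end

section \<open>Singular points\<close>

text \<open>Padded by zeros to square matrices, the right factor acquires a zero row.\<close>

lemma det_low_rank:
  fixes X Z :: "nat \<Rightarrow> nat \<Rightarrow> complex"
  shows "det (mat (Suc s) (Suc s) (\<lambda>(k, l). \<Sum>m<s. X k m * Z m l)) = 0"
proof -
  define A where "A = mat (Suc s) (Suc s) (\<lambda>(k, m). if m < s then X k m else 0)"
  define B where "B = mat (Suc s) (Suc s) (\<lambda>(m, l). if m < s then Z m l else 0)"
  have AB: "A \<in> carrier_mat (Suc s) (Suc s)" "B \<in> carrier_mat (Suc s) (Suc s)" by (simp_all add: A_def B_def)
  have "mat (Suc s) (Suc s) (\<lambda>(k, l). \<Sum>m<s. X k m * Z m l) = A * B"
  proof (rule eq_matI)
    fix k l assume "k < dim_row (A * B)" "l < dim_col (A * B)"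
    then have kl: "k < Suc s" "l < Suc s" using AB by auto
    have "(A * B) $$ (k, l) = (\<Sum>m<Suc s. A $$ (k, m) * B $$ (m, l))" by (rule index_mult_mat_sum[OF AB kl])
    also have "\<dots> = (\<Sum>m<s. X k m * Z m l)"
      using kl by (simp add: A_def B_def)
    finally show "mat (Suc s) (Suc s) (\<lambda>(k, l). \<Sum>m<s. X k m * Z m l) $$ (k, l) = (A * B) $$ (k, l)"
      using kl by simp
  qed (use AB in auto)
  moreover have "det B = 0"
    unfolding det_def'[OF AB(2)]
  proof (intro sum.neutral ballI)
    fix p assume "p \<in> {p. p permutes {0..<Suc s}}"
    then have "p s < Suc s" using permutes_in_image[of p "{0..<Suc s}" s] by simp
    then have "B $$ (s, p s) = 0" by (simp add: B_def)
    then have "(\<Prod>i = 0..<Suc s. B $$ (i, p i)) = 0" by simp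
    then show "signof p * (\<Prod>i = 0..<Suc s. B $$ (i, p i)) = 0" by simp
  qed
  ultimately show ?thesis by (simp add: det_mult[OF AB])
qed

text \<open>\<open>D k\<close> is the leading principal minor of order \<open>k\<close> of this rank
  one perturbation of the identity, and the entries of both factors are quotients of its
  minors.\<close>

lemma rank_one_LU:
  fixes u w :: "nat \<Rightarrow> complex" and t :: complex
  defines "D \<equiv> \<lambda>k. 1 + t * (\<Sum>l<k. u l * w l)"
  assumes D: "\<And>k. k \<le> n \<Longrightarrow> D k \<noteq> 0"
  obtains R where "R \<in> GL n" "upper_triangular R"
    "mat n n (\<lambda>(i, j). (if i = j then 1 else 0) + t * u i * w j) =
     unilower n (\<lambda>(i, j). if j < i \<and> i < n then t * u i * w j / D (Suc j) else 0) * R"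
proof
  let ?x = "\<lambda>(i, j). if j < i \<and> i < n then t * u i * w j / D (Suc j) else 0"
  define R where "R = mat n n (\<lambda>(i, j). if i < j then t * u i * w j / D i else if i = j then D (Suc i) / D i else 0)"
  have Rc: "R \<in> carrier_mat n n" by (simp add: R_def)
  show Ru: "upper_triangular R" by (intro upper_triangularI) (auto simp: R_def)
  show "R \<in> GL n" by (rule upper_triangular_GL[OF Rc Ru]) (use D in \<open>auto simp: R_def\<close>)
  have DS: "D (Suc k) = D k + t * u k * w k" for k by (simp add: D_def algebra_simps)
  \<comment> \<open>Telescopes, since \<open>1 / D k - 1 / D (Suc k)\<close> equals
    \<open>t * u k * w k / (D k * D (Suc k))\<close>.\<close>
  have tele: "(\<Sum>k<m. (t * u i * w k / D (Suc k)) * (t * u k * w j / D k)) = t * u i * w j * (1 - 1 / D m)"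
    if "m \<le> n" for m i j
    using that
  proof (induction m)
    case 0
    then show ?case by (simp add: D_def)
  next
    case (Suc m)
    have nz: "D m \<noteq> 0" "D (Suc m) \<noteq> 0" using D Suc.prems by auto
    have "(t * u i * w m / D (Suc m)) * (t * u m * w j / D m) = t * u i * w j * ((t * u m * w m) / (D m * D (Suc m)))"
      by (simp add: mult_ac)
    also have "(t * u m * w m) / (D m * D (Suc m)) = 1 / D m - 1 / D (Suc m)"
      using nz by (simp add: DS field_simps)
    finally have step: "(t * u i * w m / D (Suc m)) * (t * u m * w j / D m) = t * u i * w j * (1 / D m - 1 / D (Suc m))" .
    have "m \<le> n" using Suc.prems by simp
    show ?case unfolding sum.lessThan_Suc Suc.IH[OF \<open>m \<le> n\<close>] step by (simp add: right_diff_distrib)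
  qed
  show "mat n n (\<lambda>(i, j). (if i = j then 1 else 0) + t * u i * w j) = unilower n ?x * R"
  proof (rule eq_matI)
    fix i j assume "i < dim_row (unilower n ?x * R)" "j < dim_col (unilower n ?x * R)"
    then have ij: "i < n" "j < n" using Rc unilower_carrier[of n ?x] by auto
    define m where "m = min i j"
    have m: "m < n" "m \<le> i" "m \<le> j" using ij by (auto simp: m_def)
    have nz: "D m \<noteq> 0" "D (Suc m) \<noteq> 0" using D[of m] D[of "Suc m"] m by auto
    have "(unilower n ?x * R) $$ (i, j) = (\<Sum>k<n. unilower n ?x $$ (i, k) * R $$ (k, j))"
      by (rule index_mult_mat_sum[OF unilower_carrier Rc ij])
    also have "\<dots> = (\<Sum>k\<in>insert m {..<m}. unilower n ?x $$ (i, k) * R $$ (k, j))"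
      using ij m by (intro sum.mono_neutral_right) (auto simp: unilower_def R_def m_def)
    also have "\<dots> = unilower n ?x $$ (i, m) * R $$ (m, j) + (\<Sum>k<m. unilower n ?x $$ (i, k) * R $$ (k, j))"
      by simp
    also have "(\<Sum>k<m. unilower n ?x $$ (i, k) * R $$ (k, j)) =
        (\<Sum>k<m. (t * u i * w k / D (Suc k)) * (t * u k * w j / D k))"
      using ij m by (intro sum.cong) (auto simp: unilower_def R_def)
    also have "\<dots> = t * u i * w j * (1 - 1 / D m)" using m by (intro tele) simp
    also have "unilower n ?x $$ (i, m) * R $$ (m, j) = (if i = j then 1 else 0) + t * u i * w j / D m"
    proof -
      consider "i < j" | "j < i" | "i = j" by linarith
      then show ?thesis
      proof cases
        case 1
        then have "m = i" by (simp add: m_def)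
        then show ?thesis using 1 ij by (simp add: unilower_def R_def)
      next
        case 2
        then have "m = j" by (simp add: m_def)
        then show ?thesis using 2 ij nz by (simp add: unilower_def R_def)
      next
        case 3
        then have "m = i" by (simp add: m_def)
        then show ?thesis using 3 ij nz by (simp add: unilower_def R_def DS add_divide_distrib)
      qed
    qed
    finally show "mat n n (\<lambda>(i, j). (if i = j then 1 else 0) + t * u i * w j) $$ (i, j) = (unilower n ?x * R) $$ (i, j)"
      using ij by (simp add: algebra_simps)
  qed (use Rc unilower_carrier[of n ?x] in auto)
qed

context clan_chart
begin

text \<open>Positions inside the blocks are free coordinates. A dominated position is reached
  through a dominating arc by operations with one nonzero entry each. \<open>\<phi>\<close> fixes
  the line pointwise, as its quadratic terms need two different nonzero coordinates.\<close>

lemma coordinate_line_in_closure: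
  assumes rc: "(r, c) \<in> tangent_indices"
  shows "(\<lambda>p. if p = (r, c) then t else 0) \<in> closure_chart"
proof -
  define y where "y = (\<lambda>p. if p = (r, c) then t else 0 :: complex)"
  have crn: "c < r" "r < n" using rc by (auto simp: tangent_indices_def chart_indices_iff)
  have "\<phi> y = y"
  proof
    fix p :: "nat \<times> nat"
    obtain r' c' where p: "p = (r', c')" by (cases p)
    have "(\<Sum>s | c' < s \<and> s < r' \<and> \<not> dn s. y (r', s) * y (s, c')) = 0"
      using crn by (intro sum.neutral) (auto simp: y_def)
    then show "\<phi> y p = y p" by (simp add: \<phi>_def p)
  qed
  moreover have "\<phi> y \<in> closure_chart"
  proof (cases "dn r = dn c")
    case True
    show ?thesis
      by (rule closure_chartI[where \<kappa> = "\<lambda>_ _. 0" and \<beta> = "\<lambda>_ _. 0"])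
         (use True crn in \<open>auto simp: y_def affine_space_def chart_indices_iff mixed_def\<close>)
  next
    case False
    then have "dominated r c" using rc by (simp add: tangent_indices_def)
    then obtain a0 b0 where ab: "(a0, b0) \<in> A" "a0 \<le> c" "r \<le> b0" and m: "mixed r c"
      by (auto simp: dominated_def)
    show ?thesis
    proof (rule closure_chartI[where \<kappa> = "\<lambda>r' b. if r' = r \<and> b = b0 then 1 else 0"
          and \<beta> = "\<lambda>a c'. if a = a0 \<and> c' = c then t else 0"])
      fix r' c' assume "mixed r' c'"
      have "(\<Sum>(a, b)\<in>A. (if r' = r \<and> b = b0 then 1 else 0) * (if a = a0 \<and> c' = c then t else 0)) =
          (\<Sum>p\<in>A. if p = (a0, b0) then if r' = r \<and> c' = c then t else 0 else 0)"
        by (intro sum.cong) (auto split: if_splits)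
      then show "y (r', c') = (\<Sum>(a, b)\<in>A. (if r' = r \<and> b = b0 then 1 else 0) * (if a = a0 \<and> c' = c then t else 0))"
        using ab(1) finite_arcs by (simp add: y_def)
    qed (use ab m crn in \<open>auto simp: y_def affine_space_def chart_indices_iff mixed_def\<close>)
  qed
  ultimately show ?thesis unfolding y_def by simp
qed

text \<open>Seen from \<open>g\<close>, the coordinate line in direction \<open>(r, c)\<close> of
  the chart at \<open>P\<close> is the perturbation of the identity by \<open>t\<close> times a
  column of \<open>\<beta>\<close> times a row of its inverse. Its LU factorization gives a curve in
  the closure with velocity \<open>v (r, c)\<close>. As \<open>\<beta>\<close> is upper triangular,
  these velocities are triangular with respect to the weight \<open>i - j\<close>.\<close>

lemma card_le_dim_tangent_space:
  assumes g: "g \<in> GL n" and gP: "flag_of n g = flag_of n P"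
  shows "card tangent_indices \<le> fs.dim (tangent_space (chart_indices n) (chart_preimage n g clan_closure) (\<lambda>_. 0))"
proof -
  obtain \<beta> where \<beta>: "\<beta> \<in> GL n" "upper_triangular \<beta>" "P = g * \<beta>" using flag_of_eqD[OF g P gP] .
  obtain \<beta>' where \<beta>': "\<beta>' \<in> GL n" "\<beta> * \<beta>' = 1\<^sub>m n" "\<beta>' * \<beta> = 1\<^sub>m n" using GL_inverse[OF \<beta>(1)] .
  note \<beta>c = GL_carrier[OF \<beta>(1)] and \<beta>'c = GL_carrier[OF \<beta>'(1)] and gc = GL_carrier[OF g]
  note inv = upper_triangular_inverse[OF \<beta>(2) \<beta>c \<beta>'c \<beta>'(3)]
  have diag: "\<beta> $$ (i, i) \<noteq> 0" "\<beta>' $$ (i, i) \<noteq> 0" if "i < n" for i using inv(2)[OF that] by auto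
  define v where "v = (\<lambda>(r, c) (i, j). if j < i \<and> i < n then \<beta> $$ (i, r) * \<beta>' $$ (c, j) else 0)"
  show ?thesis
  proof (rule card_le_dim_triangular[OF finite_chart_indices _ finite_tangent_indices, where v = v
        and m = "\<lambda>(i, j). int i - int j"])
    show "tangent_space (chart_indices n) (chart_preimage n g clan_closure) (\<lambda>_. 0) \<subseteq> affine_space (chart_indices n)"
      by (auto simp: tangent_space_def)
  next
    fix p assume p: "p \<in> tangent_indices"
    then obtain r c where rc: "p = (r, c)" "c < r" "r < n" by (auto simp: tangent_indices_def chart_indices_iff)
    show "v p p \<noteq> 0" using rc diag by (simp add: v_def)
    define u where "u i = \<beta> $$ (i, r)" for i
    define w where "w j = \<beta>' $$ (c, j)" for j
    define D where "D k t = 1 + t * (\<Sum>l<k. u l * w l)" for k and t :: complex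
    define x where "x t = (\<lambda>(i, j). if j < i \<and> i < n then t * u i * w j / D (Suc j) t else 0)" for t
    show "v p \<in> tangent_space (chart_indices n) (chart_preimage n g clan_closure) (\<lambda>_. 0)"
    proof (rule tangent_curve[OF finite_chart_indices, where c = x])
      show "v p \<in> affine_space (chart_indices n)"
        by (auto simp: affine_space_def v_def rc chart_indices_iff)
      show "x 0 i = 0" for i by (cases i) (simp add: x_def)
      fix i assume "i \<in> chart_indices n"
      then obtain a b where i: "i = (a, b)" "b < a" "a < n" by (auto simp: chart_indices_def)
      have "((\<lambda>t. t * u a * w b / D (Suc b) t) has_field_derivative (u a * w b)) (at 0)"
        unfolding D_def by (auto intro!: derivative_eq_intros)
      then show "((\<lambda>t. x t i) has_field_derivative v p i) (at 0)"
        using i rc by (simp add: x_def v_def u_def w_def)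
    next
      \<comment> \<open>All the minors are \<open>1\<close> at \<open>t = 0\<close>, so the
        factorization exists for small \<open>t\<close>.\<close>
      have "eventually (\<lambda>t. \<forall>k\<in>{..n}. D k t \<noteq> 0) (nhds 0)"
      proof (rule eventually_ball_finite)
        show "\<forall>k\<in>{..n}. eventually (\<lambda>t. D k t \<noteq> 0) (nhds 0)"
        proof
          fix k
          have "((\<lambda>t. D k t) \<longlongrightarrow> 1 + 0 * (\<Sum>l<k. u l * w l)) (nhds 0)"
            unfolding D_def by (intro tendsto_intros filterlim_ident)
          then show "eventually (\<lambda>t. D k t \<noteq> 0) (nhds 0)"
            by (rule tendsto_imp_eventually_ne) simp
        qed
      qed simp
      then show "eventually (\<lambda>t. x t \<in> chart_preimage n g clan_closure) (nhds 0)"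
      proof (rule eventually_mono)
        fix t assume Dt: "\<forall>k\<in>{..n}. D k t \<noteq> 0"
        obtain R where R: "R \<in> GL n" "upper_triangular R"
          "mat n n (\<lambda>(i, j). (if i = j then 1 else 0) + t * u i * w j) = unilower n (x t) * R"
          using rank_one_LU[where n = n and t = t and u = u and w = w] Dt unfolding x_def D_def by auto
        define e where "e = (\<lambda>p. if p = (r, c) then t else 0 :: complex)"
        define U where "U = unilower n e"
        have Uc: "U \<in> carrier_mat n n" unfolding U_def by (rule unilower_carrier)
        have Uent: "U $$ (i, j) = (if i = j then 1 else 0) + (if i = r \<and> j = c then t else 0)"
          if "i < n" "j < n" for i j
          using that rc by (auto simp: U_def unilower_def e_def)
        have "mat n n (\<lambda>(i, j). (if i = j then 1 else 0) + t * u i * w j) = \<beta> * (U * \<beta>')"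
        proof (rule eq_matI)
          fix i j assume "i < dim_row (\<beta> * (U * \<beta>'))" "j < dim_col (\<beta> * (U * \<beta>'))"
          then have ij: "i < n" "j < n" using \<beta>c \<beta>'c by auto
          have U\<beta>: "(U * \<beta>') $$ (k, j) = \<beta>' $$ (k, j) + (if k = r then t * \<beta>' $$ (c, j) else 0)" if k: "k < n" for k
          proof -
            have "(U * \<beta>') $$ (k, j) = (\<Sum>l<n. U $$ (k, l) * \<beta>' $$ (l, j))"
              by (rule index_mult_mat_sum[OF Uc \<beta>'c k ij(2)])
            also have "\<dots> = (\<Sum>l<n. (if l = k then \<beta>' $$ (k, j) else 0) + (if l = c then if k = r then t * \<beta>' $$ (c, j) else 0 else 0))"
              using k by (intro sum.cong) (auto simp: Uent distrib_right)
            also have "\<dots> = \<beta>' $$ (k, j) + (if k = r then t * \<beta>' $$ (c, j) else 0)"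
              using k rc by (simp add: sum.distrib)
            finally show ?thesis .
          qed
          have "(\<beta> * (U * \<beta>')) $$ (i, j) = (\<Sum>k<n. \<beta> $$ (i, k) * (U * \<beta>') $$ (k, j))"
            by (rule index_mult_mat_sum[of _ n n _ n]) (use \<beta>c \<beta>'c Uc ij in auto)
          also have "\<dots> = (\<Sum>k<n. \<beta> $$ (i, k) * \<beta>' $$ (k, j) + (if k = r then \<beta> $$ (i, r) * (t * \<beta>' $$ (c, j)) else 0))"
            by (intro sum.cong) (auto simp: U\<beta> distrib_left)
          also have "\<dots> = (\<Sum>k<n. \<beta> $$ (i, k) * \<beta>' $$ (k, j)) + \<beta> $$ (i, r) * (t * \<beta>' $$ (c, j))"
            using rc by (simp add: sum.distrib)
          also have "(\<Sum>k<n. \<beta> $$ (i, k) * \<beta>' $$ (k, j)) = (\<beta> * \<beta>') $$ (i, j)"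
            by (rule index_mult_mat_sum[OF \<beta>c \<beta>'c ij, symmetric])
          finally show "mat n n (\<lambda>(i, j). (if i = j then 1 else 0) + t * u i * w j) $$ (i, j) = (\<beta> * (U * \<beta>')) $$ (i, j)"
            using ij \<beta>'(2) by (simp add: u_def w_def)
        qed (use \<beta>c \<beta>'c in auto)
        then have eq: "unilower n (x t) * R = \<beta> * (U * \<beta>')" using R(3) by simp
        note assoc = assoc_mult_mat[where n\<^sub>1 = n and n\<^sub>2 = n and n\<^sub>3 = n and n\<^sub>4 = n]
        have eq': "g * unilower n (x t) * R = P * U * \<beta>'"
        proof -
          have "g * unilower n (x t) * R = g * (unilower n (x t) * R)"
            using gc unilower_carrier GL_carrier[OF R(1)] by (rule assoc_mult_mat)
          also have "\<dots> = P * U * \<beta>'" unfolding eq \<beta>(3) using gc \<beta>c \<beta>'c Uc by (simp add: assoc)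
          finally show ?thesis .
        qed
        have "flag_of n (g * unilower n (x t)) = flag_of n (g * unilower n (x t) * R)"
          by (rule flag_of_mult_upper[OF GL_carrier[OF mult_unilower_GL[OF g]] R(1,2), symmetric])
        also have "\<dots> = flag_of n (P * U)"
          unfolding eq' U_def by (rule flag_of_mult_upper[OF GL_carrier[OF mult_unilower_GL[OF P]] \<beta>'(1) inv(1)])
        also have "\<dots> \<in> clan_closure"
          using coordinate_line_in_closure[of r c t] p rc unfolding U_def e_def by (simp add: chart_preimage_def)
        finally show "x t \<in> chart_preimage n g clan_closure"
          by (auto simp: chart_preimage_def affine_space_def x_def chart_indices_iff)
      qed
    qed
  next
    fix p q assume pq: "p \<in> tangent_indices" "q \<in> tangent_indices" "p \<noteq> q" "v q p \<noteq> 0"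
    obtain r c where q: "q = (r, c)" "c < r" "r < n" using pq by (auto simp: tangent_indices_def chart_indices_iff)
    obtain i j where p: "p = (i, j)" "j < i" "i < n" using pq by (auto simp: tangent_indices_def chart_indices_iff)
    have "\<beta> $$ (i, r) \<noteq> 0" "\<beta>' $$ (c, j) \<noteq> 0" using pq(4) p q by (auto simp: v_def)
    then have "i \<le> r" "c \<le> j"
      using upper_triangular_entry[OF \<beta>(2) \<beta>c, of r i] upper_triangular_entry[OF inv(1) \<beta>'c, of j c] p q
      by (meson not_le less_trans)+
    then show "(case p of (i, j) \<Rightarrow> int i - int j) < (case q of (i, j) \<Rightarrow> int i - int j)"
      using pq(3) p q by auto
  qed
qed

lemma singular_if_bad:
  assumes bad: "bad r0 c0"
  shows "\<not> smooth_at n clan_closure (flag_of n P)"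
proof
  assume "smooth_at n clan_closure (flag_of n P)"
  then obtain g where g: "g \<in> GL n" and gP: "flag_of n g = flag_of n P"
    and sm: "affine_smooth_at (chart_indices n) (chart_preimage n g clan_closure) (\<lambda>_. 0)"
    unfolding smooth_at_iff by blast
  obtain \<beta> where \<beta>: "\<beta> \<in> GL n" "upper_triangular \<beta>" "g = P * \<beta>" using flag_of_eqD[OF P g gP[symmetric]] .
  obtain P' where P': "P' \<in> GL n" "P * P' = 1\<^sub>m n" "P' * P = 1\<^sub>m n" using GL_inverse[OF P] .
  obtain g' where g': "g' \<in> GL n" "g * g' = 1\<^sub>m n" "g' * g = 1\<^sub>m n" using GL_inverse[OF g] .
  note cs = GL_carrier[OF P] GL_carrier[OF P'(1)] GL_carrier[OF g] GL_carrier[OF g'(1)] GL_carrier[OF \<beta>(1)]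
  note assoc = assoc_mult_mat[where n\<^sub>1 = n and n\<^sub>2 = n and n\<^sub>3 = n and n\<^sub>4 = n]
  have m0: "mixed r0 c0" using bad by (simp add: bad_def)
  have r0c0: "c0 < r0" "r0 < n" "dn c0" "\<not> dn r0" using m0 by (auto simp: mixed_def)
  \<comment> \<open>On the orbit only these arcs contribute to mixed entries in rows from
    \<open>r0\<close> on and columns up to \<open>c0\<close>. Their right and left ends, together
    with the bad position, index a square submatrix of order \<open>s + 1\<close> whose rank is at
    most \<open>s\<close> there.\<close>
  define S where "S = {(a, b) \<in> A. a \<le> c0 \<and> r0 \<le> b}"
  have "finite S" using finite_arcs by (rule finite_subset[rotated]) (auto simp: S_def)
  then obtain as where as: "set as = S" "distinct as" using finite_distinct_list by blast
  define s where "s = length as"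
  define row where "row k = (if k < s then snd (as ! k) else r0)" for k
  define col where "col k = (if k < s then fst (as ! k) else c0)" for k
  have nth: "(fst (as ! k), snd (as ! k)) \<in> A" "fst (as ! k) < c0" "r0 < snd (as ! k)" if "k < s" for k
  proof -
    have "as ! k \<in> S" using that as(1) nth_mem[of k as] by (simp add: s_def)
    moreover obtain a b where k: "as ! k = (a, b)" by fastforce
    ultimately have ab: "(a, b) \<in> A" "a \<le> c0" "r0 \<le> b" by (auto simp: S_def)
    \<comment> \<open>Badness makes the enclosing arcs strict, so that \<open>r0\<close> and
      \<open>c0\<close> are new as row and column.\<close>
    then have "a \<noteq> c0" "b \<noteq> r0" using bad unfolding bad_def by blast+
    with ab show "(fst (as ! k), snd (as ! k)) \<in> A" "fst (as ! k) < c0" "r0 < snd (as ! k)"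
      by (simp_all add: k)
  qed
  have rc: "mixed (row k) (col l)" "r0 \<le> row k" "col l \<le> c0" for k l
  proof -
    have "dn (col l) \<and> col l \<le> c0"
      using nth[of l] arcs[of "fst (as ! l)" "snd (as ! l)"] r0c0 by (cases "l < s") (auto simp: col_def)
    moreover have "\<not> dn (row k) \<and> r0 \<le> row k \<and> row k < n"
      using nth[of k] arcs[of "fst (as ! k)" "snd (as ! k)"] r0c0 by (cases "k < s") (auto simp: row_def)
    ultimately show "mixed (row k) (col l)" "r0 \<le> row k" "col l \<le> c0"
      using r0c0 by (auto simp: mixed_def)
  qed
  \<comment> \<open>Elements of \<open>poly_funs tangent_indices\<close> may only read the
    coordinates in this set; restriction enforces it and changes nothing on the parameter
    space.\<close>
  define res where "res y = (\<lambda>j. if j \<in> tangent_indices then y j else 0)" for y :: "nat \<times> nat \<Rightarrow> complex"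
  have res: "res y = y" if "y \<in> affine_space tangent_indices" for y
    using that by (auto simp: res_def affine_space_def)
  have resp: "(\<lambda>y. res y j) \<in> poly_funs tangent_indices" for j
    unfolding res_def by (cases "j \<in> tangent_indices") (auto intro: poly_funs.intros)
  define H where "H y = det (mat (Suc s) (Suc s) (\<lambda>(k, l). y (row k, col l)))" for y :: "nat \<times> nat \<Rightarrow> complex"
  have H0: "H (\<rho> x) = 0" if x: "x \<in> closure_chart" for x
  proof (rule closure_chartD[OF _ _ x])
    show "(\<lambda>x. H (\<rho> x)) \<in> poly_funs (chart_indices n)"
      unfolding H_def
    proof (rule poly_funs_det)
      show "(\<lambda>x. \<rho> x (row k, col l)) \<in> poly_funs (chart_indices n)" for k l
        using rc(1)[of k l] by (intro poly_\<rho>) (simp add: chart_indices_iff mixed_def)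
    qed
    fix x assume "x \<in> orbit_chart"
    then obtain y \<kappa> \<beta> where "y \<in> affine_space tangent_indices" and y: "x = \<phi> y"
      and \<kappa>': "\<forall>r b. b < r \<longrightarrow> r < n \<longrightarrow> \<kappa> r b = 0" and \<beta>': "\<forall>a c. c < a \<longrightarrow> a < n \<longrightarrow> \<beta> a c = (0 :: complex)"
      and ym': "\<forall>r c. mixed r c \<longrightarrow> y (r, c) = (\<Sum>(a, b)\<in>A. \<kappa> r b * \<beta> a c)"
      by (rule orbit_chart_param)
    note \<kappa> = \<kappa>'[rule_format] and \<beta> = \<beta>'[rule_format] and ym = ym'[rule_format]
    have "y (row k, col l) = (\<Sum>m<s. \<kappa> (row k) (snd (as ! m)) * \<beta> (fst (as ! m)) (col l))" for k l
    proof -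
      have "y (row k, col l) = (\<Sum>(a, b)\<in>A. \<kappa> (row k) b * \<beta> a (col l))" by (rule ym[OF rc(1)])
      also have "\<dots> = (\<Sum>(a, b)\<in>S. \<kappa> (row k) b * \<beta> a (col l))"
      proof (rule sum.mono_neutral_right[OF finite_arcs])
        show "\<forall>p\<in>A - S. (case p of (a, b) \<Rightarrow> \<kappa> (row k) b * \<beta> a (col l)) = 0"
        proof (safe, goal_cases)
          case (1 a b)
          then have "c0 < a \<or> b < r0" by (auto simp: S_def)
          then show ?case
          proof
            assume "c0 < a"
            then have "\<beta> a (col l) = 0" using rc(3)[of l] arc_less(1)[OF 1(1)] by (intro \<beta>) auto
            then show ?thesis by simp
          next
            assume "b < r0"
            then have "\<kappa> (row k) b = 0" using rc(1,2)[of k] by (intro \<kappa>) (auto simp: mixed_def)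
            then show ?thesis by simp
          qed
        qed
      qed (auto simp: S_def)
      also have "\<dots> = (\<Sum>m<s. case as ! m of (a, b) \<Rightarrow> \<kappa> (row k) b * \<beta> a (col l))"
        using bij_betw_nth[OF as(2), of "{..<s}" S] as(1)
        by (intro sum.reindex_bij_betw[symmetric]) (simp add: s_def)
      finally show ?thesis by (simp add: case_prod_unfold)
    qed
    then show "H (\<rho> x) = 0" unfolding y \<rho>_\<phi> H_def by (simp only: det_low_rank)
  qed
  define h where "h y = H (res y)" for y
  have hp: "h \<in> poly_funs tangent_indices"
    unfolding h_def H_def by (intro poly_funs_det resp)
  have h1: "\<exists>y\<in>affine_space tangent_indices. h y \<noteq> 0"
  proof
    \<comment> \<open>At the partial permutation matrix of the enclosing arcs and the bad position
      the submatrix is the identity. So \<open>h\<close> is not zero on the parameter space,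
      although it vanishes at all parameters of the closure.\<close>
    define y where "y p = (if \<exists>k\<le>s. p = (row k, col k) then 1 else 0 :: complex)" for p
    have dom: "dominated (row k) (col k)" if "k \<le> s" for k
    proof (cases "k < s")
      case True
      then show ?thesis using rc(1)[of k k] nth(1)[OF True] by (auto simp: dominated_def row_def col_def)
    next
      case False
      obtain a b where ab: "(a, b) \<in> A" "a < c0" "r0 < b" using bad by (auto simp: bad_def)
      then have "\<exists>(a, b)\<in>A. a \<le> c0 \<and> r0 \<le> b" by (intro bexI[OF _ ab(1)]) auto
      then show ?thesis using False m0 by (simp add: dominated_def row_def col_def)
    qed
    have yT: "y \<in> affine_space tangent_indices"
    proof -
      have "y p = 0" if "p \<notin> tangent_indices" for p
        using that dom rc(1) by (auto simp: y_def tangent_indices_def chart_indices_iff mixed_def)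
      then show ?thesis by (simp add: affine_space_def)
    qed
    show "y \<in> affine_space tangent_indices" by (rule yT)
    have inj_row: "k = m" if km: "k \<le> s" "m \<le> s" "row k = row m" for k m
    proof -
      consider "k < s" "m < s" | "k = s" "m = s" | "k < s" "m = s" | "k = s" "m < s" using km by linarith
      then show ?thesis
      proof cases
        case 1
        then have b: "snd (as ! k) = snd (as ! m)" using km(3) by (simp add: row_def)
        then have "fst (as ! k) = fst (as ! m)" using nth(1)[OF 1(1)] nth(1)[OF 1(2)] arcs_right by metis
        then have "as ! k = as ! m" using b by (rule prod_eqI)
        then show ?thesis using as(2) 1 by (simp add: nth_eq_iff_index_eq s_def)
      qed (use nth(3)[of k] nth(3)[of m] km in \<open>auto simp: row_def\<close>)
    qed
    have inj_col: "k = m" if km: "k \<le> s" "m \<le> s" "col k = col m" for k m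
    proof -
      consider "k < s" "m < s" | "k = s" "m = s" | "k < s" "m = s" | "k = s" "m < s" using km by linarith
      then show ?thesis
      proof cases
        case 1
        then have b: "fst (as ! k) = fst (as ! m)" using km(3) by (simp add: col_def)
        then have "snd (as ! k) = snd (as ! m)" using nth(1)[OF 1(1)] nth(1)[OF 1(2)] arcs_left by metis
        then have "as ! k = as ! m" using b by (intro prod_eqI)
        then show ?thesis using as(2) 1 by (simp add: nth_eq_iff_index_eq s_def)
      qed (use nth(2)[of k] nth(2)[of m] km in \<open>auto simp: col_def\<close>)
    qed
    have "mat (Suc s) (Suc s) (\<lambda>(k, l). y (row k, col l)) = 1\<^sub>m (Suc s)"
    proof (rule eq_matI)
      fix k l assume "k < dim_row (1\<^sub>m (Suc s))" "l < dim_col (1\<^sub>m (Suc s))"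
      then have kl: "k \<le> s" "l \<le> s" by auto
      have "(\<exists>m\<le>s. (row k, col l) = (row m, col m)) \<longleftrightarrow> k = l"
      proof
        assume "\<exists>m\<le>s. (row k, col l) = (row m, col m)"
        then obtain m where "m \<le> s" "row k = row m" "col l = col m" by auto
        then show "k = l" using inj_row[of k m] inj_col[of l m] kl by simp
      qed (use kl in auto)
      then show "mat (Suc s) (Suc s) (\<lambda>(k, l). y (row k, col l)) $$ (k, l) = 1\<^sub>m (Suc s) $$ (k, l)"
        using kl by (simp add: y_def)
    qed auto
    then show "h y \<noteq> 0" unfolding h_def res[OF yT] H_def by simp
  qed
  \<comment> \<open>The transition from the chart at \<open>P\<close> to the chart at
    \<open>g\<close>; its minors give the rational parametrization.\<close>
  define E where "E y = mat_entry ((g' * P) * unilower n (\<phi> (res y)))" for y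
  have Ep: "(\<lambda>y. E y (r, c)) \<in> poly_funs tangent_indices" if "r < n" "c < n" for r c
  proof -
    have gP: "g' * P \<in> carrier_mat n n" using cs by simp
    have "(\<lambda>x. (g' * P * unilower n x) $$ (r, c)) \<in> poly_funs (chart_indices n)"
      by (rule poly_funs_mult_unilower[OF gP that])
    then have "(\<lambda>y. (g' * P * unilower n (\<phi> y)) $$ (r, c)) \<in> poly_funs (chart_indices n)"
      by (rule poly_funs_compose[OF _ poly_\<phi>])
    then have "(\<lambda>y. (g' * P * unilower n (\<phi> (res y))) $$ (r, c)) \<in> poly_funs tangent_indices"
      by (rule poly_funs_compose[OF _ resp])
    then show ?thesis unfolding E_def mat_entry_def by simp
  qed
  \<comment> \<open>The transition in the other direction. Its denominator is nonzero exactly at the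
    points of the chart at \<open>g\<close> that also lie in the chart at \<open>P\<close>.\<close>
  define F where "F x = mat_entry ((P' * g) * unilower n x)" for x
  have Fp: "(\<lambda>x. F x (r, c)) \<in> poly_funs (chart_indices n)" if "r < n" "c < n" for r c
    unfolding F_def mat_entry_def using poly_funs_mult_unilower[of "P' * g" n, OF _ that] cs by simp
  have less: "local_dim (subtopology (zariski (chart_indices n)) (chart_preimage n g clan_closure)) (\<lambda>_. 0)
      < enat (card tangent_indices)"
  proof (rule local_dim_rational_image_less[OF finite_tangent_indices, where \<delta> = "\<lambda>y. lu_den n (E y)"
        and N = "\<lambda>p y. lu_num n p (E y)" and h = h and \<epsilon> = "\<lambda>x. lu_den n (F x)"])
    show "chart_preimage n g clan_closure \<subseteq> affine_space (chart_indices n)" by (auto simp: chart_preimage_def)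
    show "(\<lambda>_. 0) \<in> chart_preimage n g clan_closure" using sm by (simp add: affine_smooth_at_def)
    show "(\<lambda>y. lu_den n (E y)) \<in> poly_funs tangent_indices"
      by (rule poly_funs_lu(1)[where E = E]) (rule Ep)
    show "(\<lambda>y. lu_num n p (E y)) \<in> poly_funs tangent_indices" if "p \<in> chart_indices n" for p
      by (rule poly_funs_lu(2)[where E = E, OF _ that]) (rule Ep)
    show "h \<in> poly_funs tangent_indices" by (rule hp)
    show "\<exists>y\<in>affine_space tangent_indices. h y \<noteq> 0" by (rule h1)
    show "(\<lambda>x. lu_den n (F x)) \<in> poly_funs (chart_indices n)"
      by (rule poly_funs_lu(1)[where E = F]) (rule Fp)
    have U0: "unilower n (\<lambda>_. 0) = 1\<^sub>m n" by (rule eq_matI) (auto simp: unilower_def)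
    have "P' * g = (P' * P) * \<beta>" unfolding \<beta>(3) using cs by (simp add: assoc)
    then have "(P' * g) * unilower n (\<lambda>_. 0) = unilower n (\<lambda>_. 0) * \<beta>"
      using cs P'(3) by (simp add: U0)
    from lu_coordinates(1)[OF \<beta>(1,2) this] show "lu_den n (F (\<lambda>_. 0)) \<noteq> 0" unfolding F_def .
  next
    fix z assume z: "z \<in> chart_preimage n g clan_closure" and "lu_den n (F z) \<noteq> 0"
    note Uz = unilower_carrier[of n z]
    have "(P' * g) * unilower n z \<in> GL n" by (intro mult_GL P' g unilower_GL)
    then obtain y' b where y': "y' \<in> affine_space (chart_indices n)" and b: "b \<in> GL n" "upper_triangular b"
      and eq: "(P' * g) * unilower n z = unilower n y' * b"
      using \<open>lu_den n (F z) \<noteq> 0\<close> lu_den_nonzero_iff unfolding F_def by blast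
    obtain b' where b': "b' \<in> GL n" "b * b' = 1\<^sub>m n" "b' * b = 1\<^sub>m n" using GL_inverse[OF b(1)] .
    have b'u: "upper_triangular b'"
      by (rule upper_triangular_inverse(1)[OF b(2) GL_carrier[OF b(1)] GL_carrier[OF b'(1)] b'(3)])
    note Uy = unilower_carrier[of n y'] and bc = GL_carrier[OF b(1)] GL_carrier[OF b'(1)]
    have "P * unilower n y' * b = P * ((P' * g) * unilower n z)"
      unfolding eq using cs Uy bc by (simp add: assoc)
    also have "\<dots> = (P * P') * (g * unilower n z)" using cs Uz by (simp add: assoc)
    also have "\<dots> = g * unilower n z" unfolding P'(2) by (rule left_mult_one_mat[of _ n n]) (use cs Uz in simp)
    finally have eq2: "P * unilower n y' * b = g * unilower n z" .
    have "flag_of n (P * unilower n y') = flag_of n (P * unilower n y' * b)"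
      by (rule flag_of_mult_upper[OF GL_carrier[OF mult_unilower_GL[OF P]] b, symmetric])
    also have "\<dots> \<in> clan_closure" unfolding eq2 using z by (simp add: chart_preimage_def)
    finally have y'c: "y' \<in> closure_chart" using y' by (simp add: chart_preimage_def)
    define y where "y = \<rho> y'"
    have yT: "y \<in> affine_space tangent_indices" unfolding y_def by (rule closure_chart_subset[OF y'c])
    have hy: "h y = 0" unfolding h_def res[OF yT] unfolding y_def by (rule H0[OF y'c])
    have "P * unilower n y' = P * unilower n y' * (b * b')" unfolding b'(2) using cs Uy by simp
    also have "\<dots> = (P * unilower n y' * b) * b'" using cs Uy bc by (simp add: assoc)
    also have "\<dots> = g * unilower n z * b'" unfolding eq2 ..
    finally have eq3: "P * unilower n y' = g * unilower n z * b'" .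
    have "(g' * P) * unilower n y' = g' * (P * unilower n y')" using cs Uy by (simp add: assoc)
    also have "\<dots> = (g' * g) * (unilower n z * b')" unfolding eq3 using cs Uz bc by (simp add: assoc)
    also have "\<dots> = unilower n z * b'" unfolding g'(3) by (rule left_mult_one_mat[of _ n n]) (use Uz bc in simp)
    finally have eq4: "(g' * P) * unilower n y' = unilower n z * b'" .
    have Ey: "E y = mat_entry ((g' * P) * unilower n y')" unfolding E_def res[OF yT] unfolding y_def \<phi>_\<rho> ..
    have "lu_den n (E y) \<noteq> 0" "\<forall>i\<in>chart_indices n. z i = lu_num n i (E y) / lu_den n (E y)"
      unfolding Ey using lu_coordinates[OF b'(1) b'u eq4] by auto
    then show "\<exists>y\<in>affine_space tangent_indices. h y = 0 \<and> lu_den n (E y) \<noteq> 0 \<and>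
        (\<forall>i\<in>chart_indices n. z i = lu_num n i (E y) / lu_den n (E y))"
      using yT hy by blast
  qed
  have "enat (card tangent_indices) \<le> enat (fs.dim (tangent_space (chart_indices n) (chart_preimage n g clan_closure) (\<lambda>_. 0)))"
    using card_le_dim_tangent_space[OF g gP] by simp
  also have "\<dots> = local_dim (subtopology (zariski (chart_indices n)) (chart_preimage n g clan_closure)) (\<lambda>_. 0)"
    using sm by (simp add: affine_smooth_at_def)
  finally show False using less by simp
qed

theorem smooth_iff_no_bad:
  "smooth_at n clan_closure (flag_of n P) \<longleftrightarrow> (\<nexists>r c. bad r c)"
  using smooth_if_good singular_if_bad by blast

end

section \<open>Bumpless pipe dreams in a partition shape\<close>

lemma strands_cases:
  "(s, s') \<in> strands t \<Longrightarrow> (s = South \<or> s = West) \<and> (s' = North \<or> s' = East)"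
  by (cases t) auto

lemma touches_in: "touches t South \<longleftrightarrow> (\<exists>s'. (South, s') \<in> strands t)" "touches t West \<longleftrightarrow> (\<exists>s'. (West, s') \<in> strands t)"
  by (cases t; auto simp: touches_def)+

lemma touches_out: "touches t North \<longleftrightarrow> (\<exists>s. (s, North) \<in> strands t)" "touches t East \<longleftrightarrow> (\<exists>s. (s, East) \<in> strands t)"
  by (cases t; auto simp: touches_def)+

text \<open>Row \<open>i\<close> consists of the boxes \<open>(i, 1), \<dots>, (i, rl i)\<close> and column \<open>j\<close> of the boxes
  \<open>(1, j), \<dots>, (cl j, j)\<close>; pipes enter through the edges \<open>HEdge (cl j) j\<close> and leave through
  the edges \<open>VEdge i (rl i)\<close>, as prescribed by the set \<open>dots\<close>.\<close>

locale bpd_shape =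
  fixes p q :: nat and rl cl :: "nat \<Rightarrow> nat" and dots :: "(nat \<times> nat) set"
  assumes shape: "\<And>i j. 1 \<le> i \<and> i \<le> p \<and> 1 \<le> j \<and> j \<le> rl i \<longleftrightarrow> 1 \<le> j \<and> j \<le> q \<and> 1 \<le> i \<and> i \<le> cl j"
    and dots_shape: "\<And>i j. (i, j) \<in> dots \<Longrightarrow> 1 \<le> i \<and> i \<le> p \<and> 1 \<le> j \<and> j \<le> rl i"
    and dots_row: "\<And>i j j'. (i, j) \<in> dots \<Longrightarrow> (i, j') \<in> dots \<Longrightarrow> j = j'"
    and dots_col: "\<And>i i' j. (i, j) \<in> dots \<Longrightarrow> (i', j) \<in> dots \<Longrightarrow> i = i'"
begin

definition lam :: "(nat \<times> nat) set" where
  "lam = {(i, j). 1 \<le> i \<and> i \<le> p \<and> 1 \<le> j \<and> j \<le> rl i}"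

lemma lam_row: "(i, j) \<in> lam \<longleftrightarrow> 1 \<le> i \<and> i \<le> p \<and> 1 \<le> j \<and> j \<le> rl i"
  by (simp add: lam_def)

lemma lam_col: "(i, j) \<in> lam \<longleftrightarrow> 1 \<le> j \<and> j \<le> q \<and> 1 \<le> i \<and> i \<le> cl j"
  using shape[of i j] by (simp add: lam_def)

lemma lam_nw: "(i, j) \<in> lam \<Longrightarrow> 1 \<le> i' \<Longrightarrow> i' \<le> i \<Longrightarrow> 1 \<le> j' \<Longrightarrow> j' \<le> j \<Longrightarrow> (i', j') \<in> lam"
proof -
  assume a: "(i, j) \<in> lam" "1 \<le> i'" "i' \<le> i" "1 \<le> j'" "j' \<le> j"
  then have "(i, j') \<in> lam" unfolding lam_row by simp
  then show ?thesis using a unfolding lam_col by simp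
qed

definition fits :: "filling \<Rightarrow> bool" where
  "fits T \<longleftrightarrow> dom T = lam \<and>
     (\<forall>i j t t'. T (i, j) = Some t \<and> T (i, Suc j) = Some t' \<longrightarrow> (touches t East \<longleftrightarrow> touches t' West)) \<and>
     (\<forall>i j t t'. T (i, j) = Some t \<and> T (Suc i, j) = Some t' \<longrightarrow> (touches t South \<longleftrightarrow> touches t' North)) \<and>
     (\<forall>j t. T (1, j) = Some t \<longrightarrow> \<not> touches t North) \<and>
     (\<forall>i t. T (i, 1) = Some t \<longrightarrow> \<not> touches t West)"

definition pipe :: "filling \<Rightarrow> nat \<Rightarrow> edge set" where
  "pipe T j = (pipe_step T)\<^sup>* `` {HEdge (cl j) j}"

definition is_bpd :: "filling \<Rightarrow> bool" where
  "is_bpd T \<longleftrightarrow> fits T \<and>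
     (\<forall>c c'. 1 \<le> c \<and> c < c' \<and> c' \<le> q \<longrightarrow>
        card {b. T b = Some Cross \<and>
          (side_edge b West \<in> pipe T c \<and> side_edge b South \<in> pipe T c' \<or>
           side_edge b West \<in> pipe T c' \<and> side_edge b South \<in> pipe T c)} \<le> 1) \<and>
     (\<forall>(i, j)\<in>lam. VEdge i (rl i) \<in> pipe T j \<longleftrightarrow> (i, j) \<in> dots)"

text \<open>The last two conditions say that no hook, running down and to the right from a dot,
  meets the box.\<close>

definition bad_box :: "nat \<Rightarrow> nat \<Rightarrow> bool" where
  "bad_box i j \<longleftrightarrow> (i, j) \<in> lam \<and> (\<exists>(a, c)\<in>dots. a < i \<and> c < j) \<and>
     (\<forall>c\<le>j. (i, c) \<notin> dots) \<and> (\<forall>a\<le>i. (a, j) \<notin> dots)"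

lemma pipe_stepI: "T b = Some t \<Longrightarrow> (s, s') \<in> strands t \<Longrightarrow> (side_edge b s, side_edge b s') \<in> pipe_step T"
  unfolding pipe_step_def by blast

context
  fixes T assumes fits: "fits T"
begin

lemma dom_T: "(i, j) \<in> lam \<longleftrightarrow> (\<exists>t. T (i, j) = Some t)"
  using fits unfolding fits_def by blast

lemma match_EW:
  assumes "T (i, j) = Some t" "(i, Suc j) \<in> lam"
  obtains t' where "T (i, Suc j) = Some t'" "touches t East \<longleftrightarrow> touches t' West"
proof -
  obtain t' where "T (i, Suc j) = Some t'" using assms(2) dom_T by blast
  with that assms(1) fits show thesis unfolding fits_def by blast
qed

lemma match_SN:
  assumes "T (i, j) = Some t" "(Suc i, j) \<in> lam"
  obtains t' where "T (Suc i, j) = Some t'" "touches t South \<longleftrightarrow> touches t' North"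
proof -
  obtain t' where "T (Suc i, j) = Some t'" using assms(2) dom_T by blast
  with that assms(1) fits show thesis unfolding fits_def by blast
qed

lemma match_NS:
  assumes "T (Suc i, j) = Some t" "1 \<le> i"
  obtains t' where "T (i, j) = Some t'" "touches t' South \<longleftrightarrow> touches t North"
proof -
  have "(Suc i, j) \<in> lam" using assms dom_T by blast
  then have "(i, j) \<in> lam" using lam_nw[of "Suc i" j i j] assms(2) unfolding lam_row by simp
  then obtain t' where "T (i, j) = Some t'" using dom_T by blast
  with that assms(1) fits show thesis unfolding fits_def by blast
qed

lemma match_WE:
  assumes "T (i, Suc j) = Some t" "1 \<le> j"
  obtains t' where "T (i, j) = Some t'" "touches t' East \<longleftrightarrow> touches t West"
proof -
  have "(i, Suc j) \<in> lam" using assms dom_T by blast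
  then have "(i, j) \<in> lam" using assms(2) unfolding lam_row by simp
  then obtain t' where "T (i, j) = Some t'" using dom_T by blast
  with that assms(1) fits show thesis unfolding fits_def by blast
qed

lemma no_north: "T (i, j) = Some t \<Longrightarrow> touches t North \<Longrightarrow> \<exists>i'. i = Suc i' \<and> 1 \<le> i'"
  using fits dom_T[of i j] lam_row[of i j] unfolding fits_def
  by (cases i) (auto simp: Suc_le_eq, metis One_nat_def not_gr_zero)

lemma no_west: "T (i, j) = Some t \<Longrightarrow> touches t West \<Longrightarrow> \<exists>j'. j = Suc j' \<and> 1 \<le> j'"
  using fits dom_T[of i j] lam_row[of i j] unfolding fits_def
  by (cases j) (auto simp: Suc_le_eq, metis One_nat_def not_gr_zero)

text \<open>Pipes travel north and east only and cannot leave through the top side, so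
  \<open>i + (q - j)\<close> decreases with every box until the end of a row is reached.\<close>

lemma forward:
  assumes "T (i, j) = Some t" "(s, s') \<in> strands t"
  shows "\<exists>r. 1 \<le> r \<and> r \<le> i \<and> (s' = North \<longrightarrow> r < i) \<and> (side_edge (i, j) s', VEdge r (rl r)) \<in> (pipe_step T)\<^sup>*"
  using assms
proof (induction "i + (q - j)" arbitrary: i j t s s' rule: less_induct)
  case less
  have ij: "(i, j) \<in> lam" using less.prems(1) dom_T by blast
  have s': "s' = North \<or> s' = East" using strands_cases[OF less.prems(2)] by simp
  show ?case
  proof (cases "s' = North")
    case True
    then have "touches t North" using less.prems(2) by (auto simp: touches_def)
    then obtain i' where i': "i = Suc i'" "1 \<le> i'" using no_north[OF less.prems(1)] by blast
    obtain t' where t': "T (i', j) = Some t'" "touches t' South"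
      using match_NS[of i' j t] less.prems(1) i' \<open>touches t North\<close> by metis
    then obtain s'' where s'': "(South, s'') \<in> strands t'" using touches_in by blast
    obtain r where r: "1 \<le> r" "r \<le> i'" "(side_edge (i', j) s'', VEdge r (rl r)) \<in> (pipe_step T)\<^sup>*"
      using less.hyps[OF _ t'(1) s''] i' by auto
    have "(side_edge (i', j) South, side_edge (i', j) s'') \<in> pipe_step T" by (rule pipe_stepI[of T, OF t'(1) s''])
    then have "(side_edge (i, j) North, VEdge r (rl r)) \<in> (pipe_step T)\<^sup>*"
      using r(3) i' by (auto intro: converse_rtrancl_into_rtrancl)
    then show ?thesis using r i' True by (intro exI[of _ r]) auto
  next
    case False
    then have E: "s' = East" using s' by simp
    show ?thesis
    proof (cases "j < rl i")
      case True
      then have j': "(i, Suc j) \<in> lam" using ij by (simp add: lam_row)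
      have "touches t East" using less.prems(2) E by (auto simp: touches_def)
      then obtain t' where t': "T (i, Suc j) = Some t'" "touches t' West"
        using match_EW[OF less.prems(1) j'] by metis
      then obtain s'' where s'': "(West, s'') \<in> strands t'" using touches_in by blast
      have "Suc j \<le> q" using j' by (simp add: lam_col)
      then have lt: "i + (q - Suc j) < i + (q - j)" by linarith
      obtain r where r: "1 \<le> r" "r \<le> i" "(side_edge (i, Suc j) s'', VEdge r (rl r)) \<in> (pipe_step T)\<^sup>*"
        using less.hyps[OF lt t'(1) s''] by blast
      have "(side_edge (i, Suc j) West, side_edge (i, Suc j) s'') \<in> pipe_step T" by (rule pipe_stepI[of T, OF t'(1) s''])
      then have "(side_edge (i, j) East, VEdge r (rl r)) \<in> (pipe_step T)\<^sup>*"
        using r(3) by (auto intro: converse_rtrancl_into_rtrancl)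
      then show ?thesis using r E by (intro exI[of _ r]) auto
    next
      case False
      then have "j = rl i" "1 \<le> i" using ij by (auto simp: lam_row)
      then show ?thesis using E by (intro exI[of _ i]) auto
    qed
  qed
qed

text \<open>Traced back, a pipe moves south and west and cannot leave through the west side, so it
  began at the bottom of a column.\<close>

lemma backward:
  assumes "T (i, j) = Some t" "(s, s') \<in> strands t"
  shows "\<exists>c. 1 \<le> c \<and> c \<le> j \<and> (s = West \<longrightarrow> c < j) \<and> (HEdge (cl c) c, side_edge (i, j) s) \<in> (pipe_step T)\<^sup>*"
  using assms
proof (induction "j + (p - i)" arbitrary: i j t s s' rule: less_induct)
  case less
  have ij: "(i, j) \<in> lam" using less.prems(1) dom_T by blast
  have s: "s = South \<or> s = West" using strands_cases[OF less.prems(2)] by simp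
  show ?case
  proof (cases "s = West")
    case True
    then have "touches t West" using less.prems(2) by (auto simp: touches_def)
    then obtain j' where j': "j = Suc j'" "1 \<le> j'" using no_west[OF less.prems(1)] by blast
    obtain t' where t': "T (i, j') = Some t'" "touches t' East"
      using match_WE[of i j' t] less.prems(1) j' \<open>touches t West\<close> by metis
    then obtain s'' where s'': "(s'', East) \<in> strands t'" using touches_out by blast
    obtain c where c: "1 \<le> c" "c \<le> j'" "(HEdge (cl c) c, side_edge (i, j') s'') \<in> (pipe_step T)\<^sup>*"
      using less.hyps[OF _ t'(1) s''] j' by auto
    have "(side_edge (i, j') s'', side_edge (i, j') East) \<in> pipe_step T" by (rule pipe_stepI[of T, OF t'(1) s''])
    then have "(HEdge (cl c) c, side_edge (i, j) West) \<in> (pipe_step T)\<^sup>*"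
      using c(3) j' by (auto intro: rtrancl_into_rtrancl)
    then show ?thesis using c j' True by (intro exI[of _ c]) auto
  next
    case False
    then have S: "s = South" using s by simp
    show ?thesis
    proof (cases "i < cl j")
      case True
      then have i': "(Suc i, j) \<in> lam" using ij by (simp add: lam_col)
      have "touches t South" using less.prems(2) S by (auto simp: touches_def)
      then obtain t' where t': "T (Suc i, j) = Some t'" "touches t' North"
        using match_SN[OF less.prems(1) i'] by metis
      then obtain s'' where s'': "(s'', North) \<in> strands t'" using touches_out by blast
      have "Suc i \<le> p" using i' by (simp add: lam_row)
      then have lt: "j + (p - Suc i) < j + (p - i)" by linarith
      obtain c where c: "1 \<le> c" "c \<le> j" "(HEdge (cl c) c, side_edge (Suc i, j) s'') \<in> (pipe_step T)\<^sup>*"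
        using less.hyps[OF lt t'(1) s''] by blast
      have "(side_edge (Suc i, j) s'', side_edge (Suc i, j) North) \<in> pipe_step T" by (rule pipe_stepI[of T, OF t'(1) s''])
      then have "(HEdge (cl c) c, side_edge (i, j) South) \<in> (pipe_step T)\<^sup>*"
        using c(3) by (auto intro: rtrancl_into_rtrancl)
      then show ?thesis using c S by (intro exI[of _ c]) auto
    next
      case False
      then have "i = cl j" "1 \<le> j" using ij by (auto simp: lam_col)
      then show ?thesis using S by (intro exI[of _ j]) auto
    qed
  qed
qed

end

text \<open>Pipes are controlled by invariants: a set of edges closed under all strands traps every
  pipe that starts in it.\<close>

lemma pipe_subset:
  assumes "HEdge (cl j) j \<in> I" "\<And>b t s s'. T b = Some t \<Longrightarrow> (s, s') \<in> strands t \<Longrightarrow> side_edge b s \<in> I \<Longrightarrow> side_edge b s' \<in> I"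
  shows "pipe T j \<subseteq> I"
proof
  fix e assume "e \<in> pipe T j"
  then have "(HEdge (cl j) j, e) \<in> (pipe_step T)\<^sup>*" by (simp add: pipe_def)
  then show "e \<in> I"
  proof (induction rule: rtrancl_induct)
    case (step e e')
    then show ?case using assms(2) unfolding pipe_step_def by blast
  qed (rule assms(1))
qed

text \<open>An elbow joining west and north edges in the lowest possible row sits in a bad box: a pipe
  that avoids the box below or to the right of it can only return by another such elbow.\<close>

lemma elbow_bad_box:
  assumes T: "is_bpd T" and ij: "T (i, j) = Some Elbow_WN"
    and low: "\<And>i' j'. i < i' \<Longrightarrow> T (i', j') \<noteq> Some Elbow_WN"
  shows "bad_box i j"
proof -
  have fits: "fits T" and conn: "\<And>i j. (i, j) \<in> lam \<Longrightarrow> VEdge i (rl i) \<in> pipe T j \<longleftrightarrow> (i, j) \<in> dots"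
    using T unfolding is_bpd_def by auto
  have lam: "(i, j) \<in> lam" using ij dom_T[OF fits] by blast
  have lamT: "b \<in> lam" if "T b = Some t" for b t using that dom_T[OF fits, of "fst b" "snd b"] by auto
  \<comment> \<open>The pipe that turns at the elbow ends in a higher row and began in a column
    further left; this row and column name the required dot.\<close>
  have "\<exists>(a, c)\<in>dots. a < i \<and> c < j"
  proof -
    obtain r where r: "1 \<le> r" "r < i" "(side_edge (i, j) North, VEdge r (rl r)) \<in> (pipe_step T)\<^sup>*"
      using forward[OF fits ij, of West North] by auto
    obtain c where c: "1 \<le> c" "c < j" "(HEdge (cl c) c, side_edge (i, j) West) \<in> (pipe_step T)\<^sup>*"
      using backward[OF fits ij, of West North] by auto
    have "(side_edge (i, j) West, side_edge (i, j) North) \<in> pipe_step T" by (rule pipe_stepI[of T, OF ij]) simp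
    then have "VEdge r (rl r) \<in> pipe T c"
      using c(3) r(3) unfolding pipe_def by (auto intro: rtrancl_trans rtrancl_into_rtrancl)
    moreover have "(r, c) \<in> lam" by (rule lam_nw[OF lam]) (use r c in auto)
    ultimately have "(r, c) \<in> dots" using conn by blast
    then show ?thesis using r c by blast
  qed
  moreover have "(a, j) \<notin> dots" if "a \<le> i" for a
  proof
    assume d: "(a, j) \<in> dots"
    \<comment> \<open>Below row \<open>i\<close> no pipe turns from west to north. So a pipe of
      column \<open>j\<close> that turns east there never rises again, and one that arrives at
      \<open>(i, j)\<close> from the south finds no strand to continue. It cannot leave in row
      \<open>a\<close>.\<close>
    define I where "I = {HEdge r j | r. i \<le> r} \<union> {VEdge r x | r x. i < r}"
    have "pipe T j \<subseteq> I"
    proof (rule pipe_subset)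
      show "HEdge (cl j) j \<in> I" using lam by (auto simp: I_def lam_col)
      fix b t s s' assume b: "T b = Some t" "(s, s') \<in> strands t" "side_edge b s \<in> I"
      obtain r x where rx: "b = (r, x)" by (cases b)
      have pos: "1 \<le> r" "1 \<le> x" using lamT[OF b(1)] by (simp_all add: rx lam_row)
      show "side_edge b s' \<in> I"
      proof (cases "r = i \<and> x = j")
        case True
        then have "t = Elbow_WN" using b(1) ij by (simp add: rx)
        then show ?thesis using b(2,3) True by (auto simp: I_def rx)
      next
        case False
        then have "i < r" using b(3) pos strands_cases[OF b(2)] by (auto simp: I_def rx)
        then have "t \<noteq> Elbow_WN" using low b(1) rx by blast
        then show ?thesis using b(2,3) \<open>i < r\<close> pos
          by (cases t) (auto simp: I_def rx)
      qed
    qed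
    moreover have "VEdge a (rl a) \<in> pipe T j" using conn d dots_shape[OF d] by (auto simp: lam_row)
    ultimately show False using that by (auto simp: I_def)
  qed
  moreover have "(i, c) \<notin> dots" if "c \<le> j" for c
  proof
    assume d: "(i, c) \<in> dots"
    have cj: "c < j" using that d calculation(2)[of i] by (cases "c = j") auto
    define I where "I = {HEdge r c | r. i \<le> r} \<union> {VEdge r x | r x. i < r} \<union> {VEdge i x | x. x < j}
      \<union> {VEdge r x | r x. r < i} \<union> {HEdge r x | r x. r < i}"
    have "pipe T c \<subseteq> I"
    proof (rule pipe_subset)
      have "(i, c) \<in> lam" using dots_shape[OF d] by (simp add: lam_row)
      then show "HEdge (cl c) c \<in> I" by (auto simp: I_def lam_col)
      fix b t s s' assume b: "T b = Some t" "(s, s') \<in> strands t" "side_edge b s \<in> I"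
      obtain r x where rx: "b = (r, x)" by (cases b)
      have pos: "1 \<le> r" "1 \<le> x" using lamT[OF b(1)] by (simp_all add: rx lam_row)
      have wn: "t = Elbow_WN" if "r = i" "x = j" using b(1) ij that by (simp add: rx)
      have nw: "t \<noteq> Elbow_WN" if "i < r" using low[OF that] b(1) rx by blast
      consider "r < i" | "r = i" | "i < r" by linarith
      then show "side_edge b s' \<in> I"
      proof cases
        case 1
        then show ?thesis using strands_cases[OF b(2)] pos by (auto simp: I_def rx)
      next
        case 2
        consider "s' = North" | "s' = East" using strands_cases[OF b(2)] by blast
        then show ?thesis
        proof cases
          case 1
          then show ?thesis using 2 pos by (auto simp: I_def rx)
        next
          case E: 2
          have "x < j"
          proof (rule ccontr)
            assume "\<not> x < j"
            moreover have "x \<noteq> j" using wn 2 b(2) E by auto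
            ultimately show False using b(3) strands_cases[OF b(2)] cj 2 by (auto simp: I_def rx)
          qed
          then show ?thesis using 2 E by (auto simp: I_def rx)
        qed
      next
        case 3
        then show ?thesis using nw b(2,3) pos by (cases t) (auto simp: I_def rx)
      qed
    qed
    moreover have "VEdge i (rl i) \<in> pipe T c" using conn d dots_shape[OF d] by (auto simp: lam_row)
    moreover have "j \<le> rl i" using lam by (simp add: lam_row)
    ultimately show False by (auto simp: I_def)
  qed
  ultimately show ?thesis using lam unfolding bad_box_def by blast
qed

text \<open>If there were such elbows, one in the lowest row that contains any would sit in a bad
  box.\<close>

lemma no_elbow_if_good:
  assumes T: "is_bpd T" and good: "\<And>i j. \<not> bad_box i j"
  shows "T b \<noteq> Some Elbow_WN"
proof
  assume b: "T b = Some Elbow_WN"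
  define S where "S = {i. \<exists>j. T (i, j) = Some Elbow_WN}"
  have fits: "fits T" using T by (simp add: is_bpd_def)
  have "S \<subseteq> {..p}" using dom_T[OF fits] by (auto simp: S_def lam_row)
  then have "finite S" by (rule finite_subset) simp
  moreover have "fst b \<in> S" using b by (auto simp: S_def intro: exI[of _ "snd b"])
  ultimately have M: "Max S \<in> S" and le: "\<forall>i\<in>S. i \<le> Max S" by (auto intro: Max_in)
  obtain j where j: "T (Max S, j) = Some Elbow_WN" using M unfolding S_def by blast
  have "T (i', j') \<noteq> Some Elbow_WN" if "Max S < i'" for i' j'
  proof
    assume "T (i', j') = Some Elbow_WN"
    then have "i' \<in> S" unfolding S_def by blast
    then show False using le that by auto
  qed
  from elbow_bad_box[OF T j this] good show False by blast
qed

text \<open>Without these elbows the pipes are hooks, so the filling is determined by the dots.\<close>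

lemma tile_no_elbow:
  assumes T: "is_bpd T" and nw: "\<And>b. T b \<noteq> Some Elbow_WN" and ij: "T (i, j) = Some t"
  shows "t = (if (i, j) \<in> dots then Elbow_SE else
     if \<exists>a\<le>i. (a, j) \<in> dots then if \<exists>c\<le>j. (i, c) \<in> dots then Cross else Vertical
     else if \<exists>c\<le>j. (i, c) \<in> dots then Horizontal else Blank)"
proof -
  have fits: "fits T" and conn: "\<And>i j. (i, j) \<in> lam \<Longrightarrow> VEdge i (rl i) \<in> pipe T j \<longleftrightarrow> (i, j) \<in> dots"
    using T unfolding is_bpd_def by auto
  have lamT: "(i, j) \<in> lam" if "T (i, j) = Some t" for i j t using that dom_T[OF fits] by auto
  \<comment> \<open>A pipe that crosses a south edge comes straight up from the bottom of the
    column, since only the excluded elbow could have brought it in from the west.\<close>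
  have down: "\<exists>t'. T (r, j) = Some t' \<and> touches t' South \<and> (HEdge (cl j) j, HEdge r j) \<in> (pipe_step T)\<^sup>*"
    if "(i, j) \<in> lam" "T (i, j) = Some t" "touches t South" "i \<le> r" "r \<le> cl j" for i j t r
  proof -
    have rl: "(r, j) \<in> lam" if "i \<le> r" "r \<le> cl j" for r using \<open>(i, j) \<in> lam\<close> that by (auto simp: lam_col)
    have S: "\<exists>t'. T (r, j) = Some t' \<and> touches t' South" if "i \<le> r" "r \<le> cl j" for r
      using that
    proof (induction r rule: dec_induct)
      case base
      then show ?case using \<open>T (i, j) = Some t\<close> \<open>touches t South\<close> by blast
    next
      case (step r)
      then obtain t1 where t1: "T (r, j) = Some t1" "touches t1 South" by auto
      obtain t2 where t2: "T (Suc r, j) = Some t2" "touches t2 North"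
        using match_SN[OF fits t1(1) rl[of "Suc r"]] step t1(2) by auto
      then have "touches t2 South" using nw[of "(Suc r, j)"] by (cases t2) (auto simp: touches_def)
      then show ?case using t2 by blast
    qed
    have "(HEdge (cl j) j, HEdge r j) \<in> (pipe_step T)\<^sup>*" if "i \<le> r" "r \<le> cl j" for r
      using that(2,1)
    proof (induction r rule: inc_induct)
      case (step r)
      then obtain t1 where t1: "T (r, j) = Some t1" "touches t1 South" using S[of r] by auto
      obtain t2 where t2: "T (Suc r, j) = Some t2" "touches t2 North"
        using match_SN[OF fits t1(1) rl[of "Suc r"]] step t1(2) by auto
      then have "(South, North) \<in> strands t2" using nw[of "(Suc r, j)"] by (cases t2) (auto simp: touches_def)
      from pipe_stepI[of T, OF t2(1) this] have "(HEdge (Suc r) j, HEdge r j) \<in> pipe_step T" by simp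
      then show ?case using step by (auto intro: rtrancl_into_rtrancl)
    qed simp
    then show ?thesis using S that by blast
  qed
  \<comment> \<open>Likewise a pipe that has turned east runs straight to the end of its
    row.\<close>
  have right: "\<exists>t'. T (i, x) = Some t' \<and> touches t' East \<and> (VEdge i j, VEdge i x) \<in> (pipe_step T)\<^sup>*"
    if "(i, j) \<in> lam" "T (i, j) = Some t" "touches t East" "j \<le> x" "x \<le> rl i" for i j t x
    using that(4,5)
  proof (induction x rule: dec_induct)
    case base
    then show ?case using that by blast
  next
    case (step x)
    then obtain t1 where t1: "T (i, x) = Some t1" "touches t1 East" "(VEdge i j, VEdge i x) \<in> (pipe_step T)\<^sup>*" by auto
    have "(i, Suc x) \<in> lam" using that(1) step by (auto simp: lam_row)
    then obtain t2 where t2: "T (i, Suc x) = Some t2" "touches t2 West"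
      using match_EW[OF fits t1(1)] t1(2) by auto
    then have s: "(West, East) \<in> strands t2" using nw[of "(i, Suc x)"] by (cases t2) (auto simp: touches_def)
    from pipe_stepI[of T, OF t2(1) this] have "(VEdge i x, VEdge i (Suc x)) \<in> pipe_step T" by simp
    then show ?case using t1(3) t2(1) s by (auto intro: rtrancl_into_rtrancl simp: touches_def)
  qed
  have SE: "T (i, j) = Some Elbow_SE \<longleftrightarrow> (i, j) \<in> dots" if ij: "(i, j) \<in> lam" for i j
  proof
    assume t: "T (i, j) = Some Elbow_SE"
    have ts: "touches Elbow_SE South" "touches Elbow_SE East" by (auto simp: touches_def)
    have "(HEdge (cl j) j, HEdge i j) \<in> (pipe_step T)\<^sup>*"
      using down[OF ij t ts(1), of i] ij by (auto simp: lam_col)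
    moreover have "(HEdge i j, VEdge i j) \<in> pipe_step T" using pipe_stepI[of T, OF t, of South East] by simp
    moreover have "(VEdge i j, VEdge i (rl i)) \<in> (pipe_step T)\<^sup>*"
      using right[OF ij t ts(2), of "rl i"] ij by (auto simp: lam_row)
    ultimately have "VEdge i (rl i) \<in> pipe T j"
      unfolding pipe_def by (auto intro: rtrancl_trans rtrancl_into_rtrancl)
    then show "(i, j) \<in> dots" using conn[OF ij] by simp
  next
    assume d: "(i, j) \<in> dots"
    \<comment> \<open>Without the other elbow a pipe can leave its column only at an
      \<open>Elbow_SE\<close> in that column, and then it stays in the row of this box.\<close>
    define I where "I = {HEdge r j | r. True} \<union> {VEdge r x | r x. T (r, j) = Some Elbow_SE}"
    have "pipe T j \<subseteq> I"
    proof (rule pipe_subset)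
      fix b t s s' assume b: "T b = Some t" "(s, s') \<in> strands t" "side_edge b s \<in> I"
      then show "side_edge b s' \<in> I"
        using nw[of b] by (cases b; cases t) (auto simp: I_def)
    qed (auto simp: I_def)
    then have "VEdge i (rl i) \<in> I" using conn[OF ij] d by blast
    then show "T (i, j) = Some Elbow_SE" by (auto simp: I_def)
  qed
  have South: "touches t South \<longleftrightarrow> (\<exists>a\<le>i. (a, j) \<in> dots)" if "T (i, j) = Some t" for i j t
  proof
    show "touches t South \<Longrightarrow> \<exists>a\<le>i. (a, j) \<in> dots" using that
    proof (induction i arbitrary: t)
      case 0
      then show ?case using lamT[of 0 j t] by (simp add: lam_row)
    next
      case (Suc i)
      show ?case
      proof (cases "t = Elbow_SE")
        case True
        then show ?thesis using SE[OF lamT[OF Suc.prems(2)]] Suc.prems(2) by auto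
      next
        case False
        then have N: "touches t North"
          using Suc.prems nw[of "(Suc i, j)"] by (cases t) (auto simp: touches_def)
        then have "1 \<le> i" using no_north[OF fits Suc.prems(2)] by auto
        then obtain t' where "T (i, j) = Some t'" "touches t' South"
          using match_NS[OF fits Suc.prems(2)] N by metis
        then show ?thesis using Suc.IH le_Suc_eq by blast
      qed
    qed
  next
    assume "\<exists>a\<le>i. (a, j) \<in> dots"
    then obtain a where a: "a \<le> i" "(a, j) \<in> dots" by blast
    then have al: "(a, j) \<in> lam" using dots_shape[OF a(2)] by (simp add: lam_row)
    then have "T (a, j) = Some Elbow_SE" using SE a by blast
    from down[OF al this _ a(1)] show "touches t South"
      using lamT[OF that] that by (auto simp: touches_def lam_col)
  qed
  have East: "touches t East \<longleftrightarrow> (\<exists>c\<le>j. (i, c) \<in> dots)" if "T (i, j) = Some t" for i j t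
  proof
    show "touches t East \<Longrightarrow> \<exists>c\<le>j. (i, c) \<in> dots" using that
    proof (induction j arbitrary: t)
      case 0
      then show ?case using lamT[of i 0 t] by (simp add: lam_row)
    next
      case (Suc j)
      show ?case
      proof (cases "t = Elbow_SE")
        case True
        then show ?thesis using SE[OF lamT[OF Suc.prems(2)]] Suc.prems(2) by auto
      next
        case False
        then have N: "touches t West"
          using Suc.prems nw[of "(i, Suc j)"] by (cases t) (auto simp: touches_def)
        then have "1 \<le> j" using no_west[OF fits Suc.prems(2)] by auto
        then obtain t' where "T (i, j) = Some t'" "touches t' East"
          using match_WE[OF fits Suc.prems(2)] N by metis
        then show ?thesis using Suc.IH le_Suc_eq by blast
      qed
    qed
  next
    assume "\<exists>c\<le>j. (i, c) \<in> dots"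
    then obtain c where c: "c \<le> j" "(i, c) \<in> dots" by blast
    then have cl: "(i, c) \<in> lam" using dots_shape[OF c(2)] by (simp add: lam_row)
    then have "T (i, c) = Some Elbow_SE" using SE c by blast
    from right[OF cl this _ c(1)] show "touches t East"
      using lamT[OF that] that by (auto simp: touches_def lam_row)
  qed
  have "t \<noteq> Elbow_WN" using nw[of "(i, j)"] ij by auto
  then show ?thesis
    using SE[OF lamT[OF ij]] South[OF ij] East[OF ij] ij by (cases t) (auto simp: touches_def)
qed

lemma bpd_unique_if_good:
  assumes "is_bpd T" "is_bpd T'" "\<And>i j. \<not> bad_box i j"
  shows "T = T'"
proof
  fix b :: "nat \<times> nat"
  obtain i j where b: "b = (i, j)" by (cases b)
  have fits: "fits T" "fits T'" using assms by (simp_all add: is_bpd_def)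
  show "T b = T' b"
  proof (cases "b \<in> lam")
    case True
    then obtain t t' where t: "T (i, j) = Some t" "T' (i, j) = Some t'"
      using dom_T[OF fits(1)] dom_T[OF fits(2)] b by blast
    have "t = t'"
      using tile_no_elbow[OF assms(1) no_elbow_if_good[OF assms(1,3)] t(1)]
        tile_no_elbow[OF assms(2) no_elbow_if_good[OF assms(2,3)] t(2)] by simp
    then show ?thesis using t b by simp
  next
    case False
    then have "T b = None" "T' b = None" using fits unfolding fits_def by auto
    then show ?thesis by simp
  qed
qed

end

text \<open>\<open>w\<close>, \<open>s\<close> and \<open>e\<close> tell whether the west, south and
  east edges are used. The north edge follows by conservation, and if both west and south are used,
  only a crossing is possible.\<close>

fun join_tile :: "bool \<Rightarrow> bool \<Rightarrow> bool \<Rightarrow> tile" where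
  "join_tile w s e = (if w then if s then Cross else if e then Horizontal else Elbow_WN
     else if s then if e then Elbow_SE else Vertical else Blank)"

context bpd_shape
begin

text \<open>A system of paths, one for each dot: \<open>h d i j\<close> and \<open>v d i j\<close> say that the path of \<open>d\<close> uses
  \<open>HEdge i j\<close> and \<open>VEdge i j\<close>.\<close>

definition path_filling :: "(nat \<times> nat \<Rightarrow> nat \<Rightarrow> nat \<Rightarrow> bool) \<Rightarrow> (nat \<times> nat \<Rightarrow> nat \<Rightarrow> nat \<Rightarrow> bool) \<Rightarrow> filling" where
  "path_filling h v = (\<lambda>(i, j). if (i, j) \<in> lam then
     Some (join_tile (\<exists>d\<in>dots. v d i (j - 1)) (\<exists>d\<in>dots. h d i j) (\<exists>d\<in>dots. v d i j)) else None)"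

text \<open>The hypotheses make every path pass through a box at most once, keep distinct paths
  edge-disjoint and let them meet only in straight crossings. Hence the strands of a tile are
  exactly the pieces of the paths in it, and the pipes follow the paths.\<close>

lemma is_bpd_path_filling:
  assumes in_out: "\<And>d i j. d \<in> dots \<Longrightarrow> (Suc i, Suc j) \<in> lam \<Longrightarrow>
        (v d (Suc i) j \<or> h d (Suc i) (Suc j) \<longleftrightarrow> h d i (Suc j) \<or> v d (Suc i) (Suc j)) \<and>
        \<not> (v d (Suc i) j \<and> h d (Suc i) (Suc j)) \<and> \<not> (h d i (Suc j) \<and> v d (Suc i) (Suc j))"
    and h_unique: "\<And>d d' i j. d \<in> dots \<Longrightarrow> d' \<in> dots \<Longrightarrow> h d i j \<Longrightarrow> h d' i j \<Longrightarrow> d = d'"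
    and v_unique: "\<And>d d' i j. d \<in> dots \<Longrightarrow> d' \<in> dots \<Longrightarrow> v d i j \<Longrightarrow> v d' i j \<Longrightarrow> d = d'"
    and straight: "\<And>d d' i j. d \<in> dots \<Longrightarrow> d' \<in> dots \<Longrightarrow> d \<noteq> d' \<Longrightarrow> v d (Suc i) j \<Longrightarrow> h d' (Suc i) (Suc j) \<Longrightarrow>
        v d (Suc i) (Suc j) \<and> h d' i (Suc j)"
    and outer: "\<And>d i j. d \<in> dots \<Longrightarrow> \<not> h d 0 j \<and> \<not> v d i 0"
    and start: "\<And>d j. d \<in> dots \<Longrightarrow> (cl j, j) \<in> lam \<Longrightarrow> h d (cl j) j \<longleftrightarrow> j = snd d"
    and end_: "\<And>d i. d \<in> dots \<Longrightarrow> (i, rl i) \<in> lam \<Longrightarrow> v d i (rl i) \<Longrightarrow> i = fst d"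
    and cross: "\<And>d d' i j i' j'. d \<in> dots \<Longrightarrow> d' \<in> dots \<Longrightarrow> d \<noteq> d' \<Longrightarrow>
        v d (Suc i) j \<and> h d' (Suc i) (Suc j) \<or> v d' (Suc i) j \<and> h d (Suc i) (Suc j) \<Longrightarrow>
        v d (Suc i') j' \<and> h d' (Suc i') (Suc j') \<or> v d' (Suc i') j' \<and> h d (Suc i') (Suc j') \<Longrightarrow>
        i = i' \<and> j = j'"
  shows "is_bpd (path_filling h v)"
proof -
  define T where "T = path_filling h v"
  define E where "E d = {HEdge i j | i j. h d i j} \<union> {VEdge i j | i j. v d i j}" for d
  have E_iff: "HEdge i j \<in> E d \<longleftrightarrow> h d i j" "VEdge i j \<in> E d \<longleftrightarrow> v d i j" for d i j
    by (auto simp: E_def)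
  have boxE: "\<exists>i' j'. b = (Suc i', Suc j') \<and> (Suc i', Suc j') \<in> lam" if "T b = Some t" for b t
  proof -
    obtain i j where b: "b = (i, j)" by (cases b)
    then have lam: "(i, j) \<in> lam" using that by (auto simp: T_def path_filling_def split: if_splits)
    then have "i = Suc (i - 1)" "j = Suc (j - 1)" by (auto simp: lam_row)
    with lam b show ?thesis by metis
  qed
  have T_eq: "t = join_tile (\<exists>d\<in>dots. v d (Suc i) j) (\<exists>d\<in>dots. h d (Suc i) (Suc j)) (\<exists>d\<in>dots. v d (Suc i) (Suc j))"
    if "T (Suc i, Suc j) = Some t" for i j t
    using that by (auto simp: T_def path_filling_def split: if_splits)
  \<comment> \<open>A strand joins two edges precisely when one path uses both; matching,
    connectivity and crossings are all read off from this.\<close>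
  have strands_iff: "(s, s') \<in> strands t \<longleftrightarrow> (s = South \<or> s = West) \<and> (s' = North \<or> s' = East) \<and>
      (\<exists>d\<in>dots. side_edge b s \<in> E d \<and> side_edge b s' \<in> E d)" if t: "T b = Some t" for b t s s'
  proof -
    obtain i j where ij: "b = (Suc i, Suc j)" "(Suc i, Suc j) \<in> lam" using boxE[OF t] by blast
    note io = in_out[OF _ ij(2)]
    have t': "t = join_tile (\<exists>d\<in>dots. v d (Suc i) j) (\<exists>d\<in>dots. h d (Suc i) (Suc j)) (\<exists>d\<in>dots. v d (Suc i) (Suc j))"
      using T_eq t ij by simp
    have pairs: ?thesis
      if "(West, East) \<in> strands t \<longleftrightarrow> (\<exists>d\<in>dots. v d (Suc i) j \<and> v d (Suc i) (Suc j))"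
        "(West, North) \<in> strands t \<longleftrightarrow> (\<exists>d\<in>dots. v d (Suc i) j \<and> h d i (Suc j))"
        "(South, East) \<in> strands t \<longleftrightarrow> (\<exists>d\<in>dots. h d (Suc i) (Suc j) \<and> v d (Suc i) (Suc j))"
        "(South, North) \<in> strands t \<longleftrightarrow> (\<exists>d\<in>dots. h d (Suc i) (Suc j) \<and> h d i (Suc j))"
      by (cases s; cases s'; use that impI[OF strands_cases[of s s' t]] in \<open>simp add: ij(1) E_iff\<close>)
    show ?thesis
    proof (cases "\<exists>d\<in>dots. v d (Suc i) j")
      case True
      then obtain d where d: "d \<in> dots" "v d (Suc i) j" by blast
      then have vd: "\<forall>d'\<in>dots. v d' (Suc i) j \<longrightarrow> d' = d" using v_unique[OF _ d(1)] by blast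
      show ?thesis
      proof (cases "\<exists>d\<in>dots. h d (Suc i) (Suc j)")
        case True
        then obtain d' where d': "d' \<in> dots" "h d' (Suc i) (Suc j)" by blast
        have "d \<noteq> d'" using io[OF d(1)] d d' by blast
        note st = straight[OF d(1) d'(1) this d(2) d'(2)]
        have t: "t = Cross" using t' True d by auto
        have e: "\<not> v d' (Suc i) (Suc j)" "\<not> h d i (Suc j)" using st io[OF d(1)] io[OF d'(1)] by blast+
        have hd: "\<forall>d''\<in>dots. h d'' (Suc i) (Suc j) \<longrightarrow> d'' = d'"
          using h_unique[OF _ d'(1)] d' by blast
        show ?thesis
          by (rule pairs; simp only: t strands.simps; simp; use d d' st e hd vd in blast)
      next
        case False
        then have t: "t = (if \<exists>d\<in>dots. v d (Suc i) (Suc j) then Horizontal else Elbow_WN)" using t' d by auto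
        have x: "h d i (Suc j) \<noteq> v d (Suc i) (Suc j)" using io[OF d(1)] d by blast
        have "v d (Suc i) (Suc j)" if d'': "d'' \<in> dots" "v d'' (Suc i) (Suc j)" for d''
          using io[OF d''(1)] d'' False vd by blast
        then have "t = (if v d (Suc i) (Suc j) then Horizontal else Elbow_WN)" using t d by auto
        then have "(West, East) \<in> strands t \<longleftrightarrow> v d (Suc i) (Suc j)" "(West, North) \<in> strands t \<longleftrightarrow> \<not> v d (Suc i) (Suc j)"
          "(South, East) \<notin> strands t" "(South, North) \<notin> strands t" by simp_all
        then show ?thesis
          by (intro pairs; use d vd False x in blast)
      qed
    next
      case nv: False
      show ?thesis
      proof (cases "\<exists>d\<in>dots. h d (Suc i) (Suc j)")
        case True
        then obtain d where d: "d \<in> dots" "h d (Suc i) (Suc j)" by blast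
        have hd: "\<forall>d''\<in>dots. h d'' (Suc i) (Suc j) \<longrightarrow> d'' = d"
          using h_unique[OF _ d(1)] d by blast
        have t: "t = (if \<exists>d\<in>dots. v d (Suc i) (Suc j) then Elbow_SE else Vertical)" using t' d nv by auto
        have x: "h d i (Suc j) \<noteq> v d (Suc i) (Suc j)" using io[OF d(1)] d by blast
        have "v d (Suc i) (Suc j)" if d'': "d'' \<in> dots" "v d'' (Suc i) (Suc j)" for d''
          using io[OF d''(1)] d'' nv hd by blast
        then have "t = (if v d (Suc i) (Suc j) then Elbow_SE else Vertical)" using t d by auto
        then have "(South, East) \<in> strands t \<longleftrightarrow> v d (Suc i) (Suc j)" "(South, North) \<in> strands t \<longleftrightarrow> \<not> v d (Suc i) (Suc j)"
          "(West, East) \<notin> strands t" "(West, North) \<notin> strands t" by simp_all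
        then show ?thesis
          by (intro pairs; use d hd nv x in blast)
      next
        case False
        then have "t = Blank" using t' nv by auto
        then have "strands t = {}" by simp
        then show ?thesis by (intro pairs; use nv False in blast)
      qed
    qed
  qed
  have touches_iff: "touches t s \<longleftrightarrow> (\<exists>d\<in>dots. side_edge b s \<in> E d)" if t: "T b = Some t" for b t s
  proof -
    obtain i j where ij: "b = (Suc i, Suc j)" "(Suc i, Suc j) \<in> lam" using boxE[OF t] by blast
    note io = in_out[OF _ ij(2)]
    show ?thesis
    proof
      show "touches t s \<Longrightarrow> \<exists>d\<in>dots. side_edge b s \<in> E d"
        unfolding touches_def strands_iff[OF t] by blast
    next
      assume "\<exists>d\<in>dots. side_edge b s \<in> E d"
      then obtain d where d: "d \<in> dots" "side_edge b s \<in> E d" by blast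
      have "(side_edge b West \<in> E d \<or> side_edge b South \<in> E d) = (side_edge b North \<in> E d \<or> side_edge b East \<in> E d)"
        using io[OF d(1)] by (simp add: ij E_iff)
      then show "touches t s" unfolding touches_def strands_iff[OF t] using d by (cases s) auto
    qed
  qed
  have fits: "fits T" unfolding fits_def
  proof (intro conjI allI impI)
    show "dom T = lam" by (auto simp: T_def path_filling_def dom_def split: if_splits)
  next
    fix i j t t' assume "T (i, j) = Some t \<and> T (i, Suc j) = Some t'"
    then show "touches t East = touches t' West"
      using touches_iff[of "(i, j)" t] touches_iff[of "(i, Suc j)" t'] by simp
  next
    fix i j t t' assume "T (i, j) = Some t \<and> T (Suc i, j) = Some t'"
    then show "touches t South = touches t' North"
      using touches_iff[of "(i, j)" t] touches_iff[of "(Suc i, j)" t'] by simp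
  next
    fix j t assume "T (1, j) = Some t"
    then show "\<not> touches t North" using outer touches_iff[of "(1, j)" t] by (simp add: E_iff)
  next
    fix i t assume "T (i, 1) = Some t"
    then show "\<not> touches t West" using outer touches_iff[of "(i, 1)" t] by (simp add: E_iff)
  qed
  have E_unique: "d = d'" if "d \<in> dots" "d' \<in> dots" "e \<in> E d" "e \<in> E d'" for d d' e
    using that h_unique v_unique by (cases e) (auto simp: E_iff)
  have pipe_E: "pipe T (snd d) \<subseteq> E d" if d: "d \<in> dots" for d
  proof (rule pipe_subset)
    have "(cl (snd d), snd d) \<in> lam"
      using d dots_shape[of "fst d" "snd d"] shape[of "fst d" "snd d"] by (auto simp: lam_col)
    then show "HEdge (cl (snd d)) (snd d) \<in> E d" using start[OF d] by (simp add: E_iff)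
    fix b t s s' assume a: "T b = Some t" "(s, s') \<in> strands t" "side_edge b s \<in> E d"
    then obtain d' where "d' \<in> dots" "side_edge b s \<in> E d'" "side_edge b s' \<in> E d'" unfolding strands_iff[OF a(1)] by blast
    then show "side_edge b s' \<in> E d" using E_unique[OF d _ a(3)] by blast
  qed
  have pipe_none: "pipe T j \<subseteq> {HEdge (cl j) j}" "HEdge (cl j) j \<notin> E d"
    if j: "j \<notin> snd ` dots" "(cl j, j) \<in> lam" and d: "d \<in> dots" for j d
  proof -
    have n: "HEdge (cl j) j \<notin> E d" if "d \<in> dots" for d using start[OF that j(2)] j(1) that by (auto simp: E_iff)
    then show "HEdge (cl j) j \<notin> E d" using d .
    show "pipe T j \<subseteq> {HEdge (cl j) j}"
    proof (rule pipe_subset)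
      fix b t s s' assume a: "T b = Some t" "(s, s') \<in> strands t" "side_edge b s \<in> {HEdge (cl j) j}"
      then show "side_edge b s' \<in> {HEdge (cl j) j}" using n unfolding strands_iff[OF a(1)] by auto
    qed simp
  qed
  have T_lam: "b \<in> lam" if "T b = Some t" for b t using boxE[OF that] by auto
  have "VEdge i (rl i) \<in> pipe T j \<longleftrightarrow> (i, j) \<in> dots" if ij: "(i, j) \<in> lam" for i j
  proof
    have cj: "(cl j, j) \<in> lam" using ij by (auto simp: lam_col)
    have ri: "(i, rl i) \<in> lam" using ij by (auto simp: lam_row)
    assume v: "VEdge i (rl i) \<in> pipe T j"
    show "(i, j) \<in> dots"
    proof (cases "j \<in> snd ` dots")
      case True
      then obtain a where a: "(a, j) \<in> dots" by auto
      then have "VEdge i (rl i) \<in> E (a, j)" using pipe_E[OF a] v by auto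
      then have "i = a" using end_[OF a ri] by (simp add: E_iff)
      then show ?thesis using a by simp
    next
      case False
      have "pipe T j \<subseteq> {HEdge (cl j) j}"
      proof (rule pipe_subset)
        fix b t s s' assume a: "T b = Some t" "(s, s') \<in> strands t" "side_edge b s \<in> {HEdge (cl j) j}"
        then obtain d where "d \<in> dots" "HEdge (cl j) j \<in> E d" unfolding strands_iff[OF a(1)] by auto
        then show "side_edge b s' \<in> {HEdge (cl j) j}" using pipe_none(2)[OF False cj] by blast
      qed simp
      then show ?thesis using v by auto
    qed
  next
    assume d: "(i, j) \<in> dots"
    have cj: "(cl j, j) \<in> lam" using ij by (auto simp: lam_col)
    then obtain t where t: "T (cl j, j) = Some t" using dom_T[OF fits] by blast
    have "HEdge (cl j) j \<in> E (i, j)" using start[OF d cj] by (simp add: E_iff)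
    then have "touches t South" unfolding touches_iff[OF t] using d by auto
    then obtain s' where s': "(South, s') \<in> strands t" using touches_in by blast
    \<comment> \<open>By \<open>forward\<close> the pipe leaves at the end of some row; since it
      stays on the path of its dot, \<open>end_\<close> identifies the row.\<close>
    obtain r where r: "1 \<le> r" "r \<le> cl j" "(side_edge (cl j, j) s', VEdge r (rl r)) \<in> (pipe_step T)\<^sup>*"
      using forward[OF fits t s'] by blast
    have "(side_edge (cl j, j) South, side_edge (cl j, j) s') \<in> pipe_step T"
      by (rule pipe_stepI[of T, OF t s'])
    then have v: "VEdge r (rl r) \<in> pipe T j" unfolding pipe_def
      using r(3) by (auto intro: converse_rtrancl_into_rtrancl)
    then have "VEdge r (rl r) \<in> E (i, j)" using pipe_E[OF d] by auto
    moreover have "(r, rl r) \<in> lam"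
    proof -
      have "(r, j) \<in> lam" by (rule lam_nw[OF cj]) (use r(1,2) ij in \<open>simp_all add: lam_col\<close>)
      then show ?thesis by (auto simp: lam_row)
    qed
    ultimately have "r = i" using end_[OF d] by (simp add: E_iff)
    then show "VEdge i (rl i) \<in> pipe T j" using v by simp
  qed
  moreover have "card {b. T b = Some Cross \<and>
          (side_edge b West \<in> pipe T c \<and> side_edge b South \<in> pipe T c' \<or>
           side_edge b West \<in> pipe T c' \<and> side_edge b South \<in> pipe T c)} \<le> 1" (is "card ?X \<le> 1")
    if cc: "c < c'" for c c'
  proof -
    have dot: "\<exists>d\<in>dots. snd d = c \<and> side_edge b s \<in> E d"
      if bt: "T b = Some Cross" and bs: "s = West \<or> s = South" and bp: "side_edge b s \<in> pipe T c" for b s c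
    proof -
      have t: "touches Cross s" using bs by (auto simp: touches_def)
      then obtain d where d: "d \<in> dots" "side_edge b s \<in> E d" unfolding touches_iff[OF bt] by blast
      \<comment> \<open>A pipe through a crossing belongs to a dot: from a column without a dot
        nothing but the bottom edge is reached, and no path uses that edge.\<close>
      have "c \<in> snd ` dots"
      proof (rule ccontr)
        assume c: "c \<notin> snd ` dots"
        have "pipe T c \<subseteq> {HEdge (cl c) c} \<union> (- (\<Union>d\<in>dots. E d))"
        proof (rule pipe_subset)
          fix b t s s' assume a: "T b = Some t" "(s, s') \<in> strands t"
            "side_edge b s \<in> {HEdge (cl c) c} \<union> (- (\<Union>d\<in>dots. E d))"
          obtain d where d: "d \<in> dots" "side_edge b s \<in> E d" using a(2) unfolding strands_iff[OF a(1)] by blast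
          then have e: "side_edge b s = HEdge (cl c) c" using a(3) by blast
          obtain i j where ij: "b = (Suc i, Suc j)" "(Suc i, Suc j) \<in> lam" using boxE[OF a(1)] by blast
          have "s = South" using a(2) e ij(1) unfolding strands_iff[OF a(1)] by auto
          then have "(cl c, c) \<in> lam" using e ij by auto
          from pipe_none(2)[OF c this d(1)] d(2) e show "side_edge b s' \<in> {HEdge (cl c) c} \<union> (- (\<Union>d\<in>dots. E d))" by simp
        qed simp
        then have e: "side_edge b s = HEdge (cl c) c" using bp d by blast
        obtain i j where ij: "b = (Suc i, Suc j)" "(Suc i, Suc j) \<in> lam" using boxE[OF bt] by blast
        have "s = South" using bs e ij(1) by auto
        then have "(cl c, c) \<in> lam" using e ij by auto
        from pipe_none(2)[OF c this d(1)] d(2) e show False by simp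
      qed
      then obtain d' where d': "d' \<in> dots" "snd d' = c" by auto
      then show ?thesis using pipe_E[OF d'(1)] bp by blast
    qed
    have "b = b'" if b: "b \<in> ?X" "b' \<in> ?X" for b b'
    proof -
      have *: "\<exists>d\<in>dots. \<exists>d'\<in>dots. snd d = c \<and> snd d' = c' \<and>
          (side_edge b West \<in> E d \<and> side_edge b South \<in> E d' \<or> side_edge b West \<in> E d' \<and> side_edge b South \<in> E d)"
        if "b \<in> ?X" for b
        using that dot[of b West c] dot[of b South c'] dot[of b South c] dot[of b West c'] by blast
      obtain d d' where d: "d \<in> dots" "d' \<in> dots" "snd d = c" "snd d' = c'"
          "side_edge b West \<in> E d \<and> side_edge b South \<in> E d' \<or> side_edge b West \<in> E d' \<and> side_edge b South \<in> E d"
        using *[OF b(1)] by blast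
      obtain e e' where e: "e \<in> dots" "e' \<in> dots" "snd e = c" "snd e' = c'"
          "side_edge b' West \<in> E e \<and> side_edge b' South \<in> E e' \<or> side_edge b' West \<in> E e' \<and> side_edge b' South \<in> E e"
        using *[OF b(2)] by blast
      have same: "x = y" if "x \<in> dots" "y \<in> dots" "snd x = snd y" for x y
        using that dots_col[of "fst x" "snd x" "fst y"] by (cases x; cases y) auto
      have "e = d" "e' = d'" using same[OF e(1) d(1)] same[OF e(2) d(2)] d(3,4) e(3,4) by simp_all
      obtain i j where ij: "b = (Suc i, Suc j)" using boxE b(1) by blast
      obtain i' j' where ij': "b' = (Suc i', Suc j')" using boxE b(2) by blast
      have "i = i' \<and> j = j'"
        by (rule cross[OF d(1,2)]) (use d e \<open>e = d\<close> \<open>e' = d'\<close> cc in \<open>auto simp: ij ij' E_iff\<close>)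
      then show ?thesis by (simp add: ij ij')
    qed
    then have same: "\<forall>b\<in>?X. \<forall>b'\<in>?X. b = b'" by blast
    show ?thesis
    proof (cases "?X = {}")
      case False
      then obtain b where "b \<in> ?X" by blast
      then have "?X = {b}" using same by blast
      then show ?thesis by simp
    next
      case True
      then show ?thesis unfolding True by simp
    qed
  qed
  ultimately show ?thesis using fits unfolding is_bpd_def T_def by blast
qed

section \<open>The filling by hooks and its droops\<close>

definition hook_h :: "nat \<times> nat \<Rightarrow> nat \<Rightarrow> nat \<Rightarrow> bool" where
  "hook_h d r x \<longleftrightarrow> x = snd d \<and> fst d \<le> r"

definition hook_v :: "nat \<times> nat \<Rightarrow> nat \<Rightarrow> nat \<Rightarrow> bool" where
  "hook_v d r x \<longleftrightarrow> r = fst d \<and> snd d \<le> x"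

text \<open>Two hooks cross only if one dot lies southwest of the other, and then only in the row of
  the former and the column of the latter.\<close>

lemma is_bpd_hooks: "is_bpd (path_filling hook_h hook_v)"
proof (rule is_bpd_path_filling)
  fix d assume d: "d \<in> dots"
  have pos: "1 \<le> fst d" "1 \<le> snd d" "fst d \<le> cl (snd d)"
    using d dots_shape[of "fst d" "snd d"] shape[of "fst d" "snd d"] by auto
  show "\<not> hook_h d 0 j \<and> \<not> hook_v d i 0" for i j
    using pos by (auto simp: hook_h_def hook_v_def)
  show "hook_h d (cl j) j \<longleftrightarrow> j = snd d" for j using pos by (auto simp: hook_h_def)
  show "hook_v d i (rl i) \<Longrightarrow> i = fst d" for i by (simp add: hook_v_def)
  fix d' assume d': "d' \<in> dots"
  have ne: "fst d \<noteq> fst d'" "snd d \<noteq> snd d'" if "d \<noteq> d'"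
    using that d d' dots_row[of "fst d" "snd d" "snd d'"] dots_col[of "fst d" "snd d" "fst d'"] by (auto simp: prod_eq_iff)
  show "hook_h d i j \<Longrightarrow> hook_h d' i j \<Longrightarrow> d = d'" for i j using ne by (auto simp: hook_h_def)
  show "hook_v d i j \<Longrightarrow> hook_v d' i j \<Longrightarrow> d = d'" for i j using ne by (auto simp: hook_v_def)
  show "d \<noteq> d' \<Longrightarrow> hook_v d (Suc i) j \<Longrightarrow> hook_h d' (Suc i) (Suc j) \<Longrightarrow>
      hook_v d (Suc i) (Suc j) \<and> hook_h d' i (Suc j)" for i j
    using ne by (auto simp: hook_h_def hook_v_def)
  show "d \<noteq> d' \<Longrightarrow> hook_v d (Suc i) j \<and> hook_h d' (Suc i) (Suc j) \<or> hook_v d' (Suc i) j \<and> hook_h d (Suc i) (Suc j) \<Longrightarrow>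
      hook_v d (Suc i') j' \<and> hook_h d' (Suc i') (Suc j') \<or> hook_v d' (Suc i') j' \<and> hook_h d (Suc i') (Suc j') \<Longrightarrow>
      i = i' \<and> j = j'" for i j i' j'
    using ne by (auto simp: hook_h_def hook_v_def)
qed (auto simp: hook_h_def hook_v_def)

text \<open>The droop move of bumpless pipe dreams. The path of \<open>z\<close> leaves column
  \<open>snd z\<close> already in row \<open>fst b\<close>, runs east to the box \<open>b\<close>,
  goes up column \<open>snd b\<close> and joins row \<open>fst z\<close> there; all other paths
  remain hooks.\<close>

definition droop_h :: "nat \<times> nat \<Rightarrow> nat \<times> nat \<Rightarrow> nat \<times> nat \<Rightarrow> nat \<Rightarrow> nat \<Rightarrow> bool" where
  "droop_h z b d r x \<longleftrightarrow> (if d = z then x = snd z \<and> fst b \<le> r \<or> x = snd b \<and> fst z \<le> r \<and> r < fst b else hook_h d r x)"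

definition droop_v :: "nat \<times> nat \<Rightarrow> nat \<times> nat \<Rightarrow> nat \<times> nat \<Rightarrow> nat \<Rightarrow> nat \<Rightarrow> bool" where
  "droop_v z b d r x \<longleftrightarrow> (if d = z then r = fst b \<and> snd z \<le> x \<and> x < snd b \<or> r = fst z \<and> snd b \<le> x else hook_v d r x)"

text \<open>Since no other dot lies in the rectangle between \<open>(i0, j0)\<close> and
  \<open>(i, j)\<close> and no hook meets \<open>(i, j)\<close>, the drooped path still crosses
  every other hook straight and at most once.\<close>

lemma is_bpd_droop:
  assumes z: "(i0, j0) \<in> dots" "i0 < i" "j0 < j" and lam: "(i, j) \<in> lam"
    and row: "\<And>c. c \<le> j \<Longrightarrow> (i, c) \<notin> dots" and col: "\<And>a. a \<le> i \<Longrightarrow> (a, j) \<notin> dots"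
    and empty: "\<And>a c. (a, c) \<in> dots \<Longrightarrow> i0 \<le> a \<Longrightarrow> a \<le> i \<Longrightarrow> j0 \<le> c \<Longrightarrow> c \<le> j \<Longrightarrow> (a, c) = (i0, j0)"
  shows "is_bpd (path_filling (droop_h (i0, j0) (i, j)) (droop_v (i0, j0) (i, j)))"
proof (rule is_bpd_path_filling)
  have z_pos: "1 \<le> i0" "1 \<le> j0" using dots_shape[OF z(1)] by auto
  note defs = droop_h_def droop_v_def hook_h_def hook_v_def
  fix d assume d: "d \<in> dots"
  have pos: "1 \<le> fst d" "1 \<le> snd d" "fst d \<le> cl (snd d)"
    using d dots_shape[of "fst d" "snd d"] shape[of "fst d" "snd d"] by auto
  have cl: "i \<le> cl j0" "i \<le> cl j" "j \<le> rl i"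
    using lam lam_nw[OF lam, of i j0] z z_pos unfolding lam_col by auto (use lam in \<open>simp add: lam_row\<close>)
  have rl: "j \<le> rl i0" using lam_nw[OF lam, of i0 j] z z_pos by (auto simp: lam_row)
  show "\<not> droop_h (i0, j0) (i, j) d 0 y \<and> \<not> droop_v (i0, j0) (i, j) d x 0" for x y
    using pos z z_pos by (auto simp: defs)
  show "droop_h (i0, j0) (i, j) d (cl y) y \<longleftrightarrow> y = snd d" for y using pos cl z by (auto simp: defs)
  show "droop_v (i0, j0) (i, j) d x (rl x) \<Longrightarrow> x = fst d" for x using cl by (auto simp: defs split: if_splits)
  show "(droop_v (i0, j0) (i, j) d (Suc x) y \<or> droop_h (i0, j0) (i, j) d (Suc x) (Suc y) \<longleftrightarrow>
          droop_h (i0, j0) (i, j) d x (Suc y) \<or> droop_v (i0, j0) (i, j) d (Suc x) (Suc y)) \<and>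
        \<not> (droop_v (i0, j0) (i, j) d (Suc x) y \<and> droop_h (i0, j0) (i, j) d (Suc x) (Suc y)) \<and>
        \<not> (droop_h (i0, j0) (i, j) d x (Suc y) \<and> droop_v (i0, j0) (i, j) d (Suc x) (Suc y))" for x y
  proof (cases "d = (i0, j0)")
    case True
    show ?thesis unfolding True defs using z(2,3) by simp linarith
  next
    case False
    then show ?thesis unfolding defs by simp linarith
  qed
  have other: "(fst d \<noteq> i0 \<and> snd d \<noteq> j0) \<and> (fst d = i \<longrightarrow> j < snd d) \<and> (snd d = j \<longrightarrow> i < fst d) \<and>
      \<not> (i0 \<le> fst d \<and> fst d \<le> i \<and> j0 \<le> snd d \<and> snd d \<le> j)" if "d \<in> dots" "d \<noteq> (i0, j0)" for d
  proof -
    obtain a c where ac: "d = (a, c)" by (cases d)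
    have "a \<noteq> i0" "c \<noteq> j0" using that z(1) dots_row dots_col unfolding ac by blast+
    moreover have "a = i \<longrightarrow> j < c" "c = j \<longrightarrow> i < a" using that(1) row col unfolding ac not_le[symmetric] by blast+
    moreover have "\<not> (i0 \<le> a \<and> a \<le> i \<and> j0 \<le> c \<and> c \<le> j)" using that empty unfolding ac by blast
    ultimately show ?thesis by (simp add: ac)
  qed
  fix d' assume d': "d' \<in> dots"
  have ne: "fst d \<noteq> fst d'" "snd d \<noteq> snd d'" if "d \<noteq> d'"
    using that d d' dots_row[of "fst d" "snd d" "snd d'"] dots_col[of "fst d" "snd d" "fst d'"] by (auto simp: prod_eq_iff)
  note o = other[OF d] other[OF d']
  show "droop_h (i0, j0) (i, j) d x y \<Longrightarrow> droop_h (i0, j0) (i, j) d' x y \<Longrightarrow> d = d'" for x y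
    using ne o by (cases "d = (i0, j0)"; cases "d' = (i0, j0)") (auto simp: defs)
  show "droop_v (i0, j0) (i, j) d x y \<Longrightarrow> droop_v (i0, j0) (i, j) d' x y \<Longrightarrow> d = d'" for x y
    using ne o by (cases "d = (i0, j0)"; cases "d' = (i0, j0)") (auto simp: defs)
  have ne': "fst d \<noteq> fst d' \<and> snd d \<noteq> snd d' \<and> \<not> (d = (i0, j0) \<and> d' = (i0, j0))" if "d \<noteq> d'"
    using ne that by blast
  have o': "d \<noteq> (i0, j0) \<longrightarrow> (fst d \<noteq> i0 \<and> snd d \<noteq> j0) \<and> (fst d = i \<longrightarrow> j < snd d) \<and> (snd d = j \<longrightarrow> i < fst d) \<and>
      \<not> (i0 \<le> fst d \<and> fst d \<le> i \<and> j0 \<le> snd d \<and> snd d \<le> j)"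
    "d' \<noteq> (i0, j0) \<longrightarrow> (fst d' \<noteq> i0 \<and> snd d' \<noteq> j0) \<and> (fst d' = i \<longrightarrow> j < snd d') \<and> (snd d' = j \<longrightarrow> i < fst d') \<and>
      \<not> (i0 \<le> fst d' \<and> fst d' \<le> i \<and> j0 \<le> snd d' \<and> snd d' \<le> j)"
    using o by blast+
  show "d \<noteq> d' \<Longrightarrow> droop_v (i0, j0) (i, j) d (Suc x) y \<Longrightarrow> droop_h (i0, j0) (i, j) d' (Suc x) (Suc y) \<Longrightarrow>
      droop_v (i0, j0) (i, j) d (Suc x) (Suc y) \<and> droop_h (i0, j0) (i, j) d' x (Suc y)" for x y
    using ne' o' z(2,3) unfolding defs fst_conv snd_conv by (smt (verit) Suc_leI le_SucI not_less_eq_eq le_antisym not_less le_trans less_imp_le_nat)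
  show "d \<noteq> d' \<Longrightarrow> droop_v (i0, j0) (i, j) d (Suc x) y \<and> droop_h (i0, j0) (i, j) d' (Suc x) (Suc y) \<or>
        droop_v (i0, j0) (i, j) d' (Suc x) y \<and> droop_h (i0, j0) (i, j) d (Suc x) (Suc y) \<Longrightarrow>
      droop_v (i0, j0) (i, j) d (Suc x') y' \<and> droop_h (i0, j0) (i, j) d' (Suc x') (Suc y') \<or>
        droop_v (i0, j0) (i, j) d' (Suc x') y' \<and> droop_h (i0, j0) (i, j) d (Suc x') (Suc y') \<Longrightarrow>
      x = x' \<and> y = y'" (is "_ \<Longrightarrow> ?P x y \<Longrightarrow> _ \<Longrightarrow> _") for x y x' y'
  proof (cases "d = (i0, j0) \<or> d' = (i0, j0)")
    case False
    then show "d \<noteq> d' \<Longrightarrow> ?P x y \<Longrightarrow> ?P x' y' \<Longrightarrow> x = x' \<and> y = y'"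
      using ne unfolding defs by auto
  next
    case True
    \<comment> \<open>The box in which the drooped path crosses the hook of \<open>e\<close> is a
      function of \<open>e\<close>, according to the position of \<open>e\<close> relative to the
      rectangle; uniqueness follows.\<close>
    have position: "Suc x = (if fst e < i0 then if snd e < j then i else i0 else fst e) \<and>
        Suc y = (if fst e < i0 then snd e else if i < fst e then j0 else j)"
      if e: "e \<in> dots" "e \<noteq> (i0, j0)"
        and at: "droop_v (i0, j0) (i, j) (i0, j0) (Suc x) y \<and> droop_h (i0, j0) (i, j) e (Suc x) (Suc y) \<or>
          droop_v (i0, j0) (i, j) e (Suc x) y \<and> droop_h (i0, j0) (i, j) (i0, j0) (Suc x) (Suc y)" for e x y
    proof -
      have e': "(if e = (i0, j0) then P else Q) = Q" for P Q :: bool using e by simp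
      have z': "(if (i0, j0) = (i0, j0) then P else Q) = P" for P Q :: bool by simp
      consider "Suc x = i" "j0 \<le> y" "y < j" "Suc y = snd e" "fst e \<le> Suc x"
        | "Suc x = i0" "j \<le> y" "Suc y = snd e" "fst e \<le> Suc x"
        | "Suc x = fst e" "snd e \<le> y" "Suc y = j0" "i \<le> Suc x"
        | "Suc x = fst e" "snd e \<le> y" "Suc y = j" "i0 \<le> Suc x" "Suc x < i"
        using at unfolding defs e' z' fst_conv snd_conv by blast
      then show ?thesis using other[OF e] z(2,3) by cases auto
    qed
    assume "d \<noteq> d'" "?P x y" "?P x' y'"
    then show "x = x' \<and> y = y'"
      using True position[OF d', of x y] position[OF d', of x' y'] position[OF d, of x y] position[OF d, of x' y'] by force
  qed
qed

lemma ex1_bpd_iff: "(\<exists>!T. is_bpd T) \<longleftrightarrow> (\<forall>i j. \<not> bad_box i j)"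
proof
  assume "\<forall>i j. \<not> bad_box i j"
  then show "\<exists>!T. is_bpd T" using is_bpd_hooks bpd_unique_if_good by metis
next
  assume unique: "\<exists>!T. is_bpd T"
  show "\<forall>i j. \<not> bad_box i j"
  proof (intro allI notI)
    fix i j assume bad: "bad_box i j"
    \<comment> \<open>Among the dots strictly northwest of the bad box, one with maximal coordinate
      sum has no other dot between itself and the box.\<close>
    define S where "S = {(a, c). (a, c) \<in> dots \<and> a < i \<and> c < j}"
    have "S \<subseteq> {..<i} \<times> {..<j}" by (auto simp: S_def)
    then have fin: "finite ((\<lambda>(a, c). a + c) ` S)" using finite_subset by blast
    have "S \<noteq> {}" using bad unfolding bad_box_def S_def by blast
    then have "Max ((\<lambda>(a, c). a + c) ` S) \<in> (\<lambda>(a, c). a + c) ` S" using Max_in[OF fin] by blast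
    then obtain i0 j0 where z: "(i0, j0) \<in> S" "Max ((\<lambda>(a, c). a + c) ` S) = i0 + j0" by auto
    have max: "a + c \<le> i0 + j0" if "(a, c) \<in> S" for a c
      using Max_ge[OF fin, of "a + c"] that z(2) by force
    have bad': "(i, j) \<in> lam" "\<And>c. c \<le> j \<Longrightarrow> (i, c) \<notin> dots" "\<And>a. a \<le> i \<Longrightarrow> (a, j) \<notin> dots"
      using bad unfolding bad_box_def by auto
    have z': "(i0, j0) \<in> dots" "i0 < i" "j0 < j" using z(1) by (auto simp: S_def)
    have "is_bpd (path_filling (droop_h (i0, j0) (i, j)) (droop_v (i0, j0) (i, j)))"
    proof (rule is_bpd_droop[OF z' bad'])
      fix a c assume a: "(a, c) \<in> dots" "i0 \<le> a" "a \<le> i" "j0 \<le> c" "c \<le> j"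
      have "a \<noteq> i" using a bad'(2) by blast
      moreover have "c \<noteq> j" using a bad'(3) by blast
      ultimately have "(a, c) \<in> S" using a by (simp add: S_def)
      from max[OF this] show "(a, c) = (i0, j0)" using a by simp
    qed
    \<comment> \<open>The two fillings differ at the bad box: the drooped path enters it from the
      west, whereas no hook uses its west or south edge.\<close>
    then have "path_filling (droop_h (i0, j0) (i, j)) (droop_v (i0, j0) (i, j)) (i, j) =
        path_filling hook_h hook_v (i, j)"
      using unique is_bpd_hooks by metis
    moreover have "droop_v (i0, j0) (i, j) (i0, j0) i (j - 1)" using z' by (auto simp: droop_v_def)
    moreover have "\<not> hook_v d i (j - 1)" if "d \<in> dots" for d
      using le_trans[of "snd d" "j - 1" j] bad'(2)[of "snd d"] that by (cases d) (auto simp: hook_v_def)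
    moreover have "\<not> hook_h d i j" if "d \<in> dots" for d
      using bad'(3)[of "fst d"] that by (cases d) (auto simp: hook_h_def)
    ultimately show False using z'(1) bad'(1)
      by (auto simp: path_filling_def split: if_splits)
  qed
qed

end

section \<open>From clans to shapes\<close>

locale pq_clan =
  fixes p q :: nat and \<gamma> :: clan
  assumes clan: "is_clan p q \<gamma>"
begin

abbreviation "D \<equiv> down_nodes \<gamma>"

abbreviation "U \<equiv> {1..p + q} - down_nodes \<gamma>"

lemma nodes: "nodes \<gamma> = p + q"
  using clan by (simp add: is_clan_def)

lemma arc_bounds: assumes "(a, b) \<in> arcs \<gamma>" shows "1 \<le> a \<and> a < b \<and> b \<le> p + q"
proof -
  have "\<forall>(i, j)\<in>arcs \<gamma>. 1 \<le> i \<and> i < j \<and> j \<le> p + q"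
    using clan[unfolded is_clan_def nodes] by (elim conjE)
  then show ?thesis using assms by blast
qed

lemma arcs_disjoint:
  assumes "(a, b) \<in> arcs \<gamma>" "(a', b') \<in> arcs \<gamma>" "(a, b) \<noteq> (a', b')"
  shows "a \<noteq> a' \<and> a \<noteq> b' \<and> b \<noteq> a' \<and> b \<noteq> b'"
proof -
  have "pairwise (\<lambda>a b. disjnt {fst a, snd a} {fst b, snd b}) (arcs \<gamma>)"
    using clan[unfolded is_clan_def nodes] by (elim conjE)
  from pairwiseD[OF this assms] show ?thesis by (simp add: disjnt_def)
qed

lemma arcs_left: "(a, b) \<in> arcs \<gamma> \<Longrightarrow> (a, b') \<in> arcs \<gamma> \<Longrightarrow> b = b'"
  using arcs_disjoint by blast

lemma arcs_right: "(a, b) \<in> arcs \<gamma> \<Longrightarrow> (a', b) \<in> arcs \<gamma> \<Longrightarrow> a = a'"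
  using arcs_disjoint by blast

lemma arcs_left_right: "(a, b) \<in> arcs \<gamma> \<Longrightarrow> (b, c) \<notin> arcs \<gamma>"
  using arcs_disjoint[of a b b c] arc_bounds[of a b] by auto

lemma left_ends_iff: "a \<in> left_ends \<gamma> \<longleftrightarrow> (\<exists>b. (a, b) \<in> arcs \<gamma>)"
  unfolding left_ends_def by force

lemma right_ends_iff: "b \<in> right_ends \<gamma> \<longleftrightarrow> (\<exists>a. (a, b) \<in> arcs \<gamma>)"
  unfolding right_ends_def by force

lemma signs: "pluses \<gamma> \<inter> minuses \<gamma> = {}"
  "pluses \<gamma> \<union> minuses \<gamma> = {1..p + q} - (left_ends \<gamma> \<union> right_ends \<gamma>)"
  "int (card (pluses \<gamma>)) - int (card (minuses \<gamma>)) = int p - int q"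
proof -
  note c = clan[unfolded is_clan_def nodes]
  show "pluses \<gamma> \<inter> minuses \<gamma> = {}" using c by (elim conjE)
  show "pluses \<gamma> \<union> minuses \<gamma> = {1..p + q} - (left_ends \<gamma> \<union> right_ends \<gamma>)" using c by (elim conjE)
  show "int (card (pluses \<gamma>)) - int (card (minuses \<gamma>)) = int p - int q" using c by (elim conjE)
qed

lemma ends_disjoint: "left_ends \<gamma> \<inter> right_ends \<gamma> = {}"
  using arcs_left_right left_ends_iff right_ends_iff by blast

lemma ends_bounds: "left_ends \<gamma> \<subseteq> {1..p + q}" "right_ends \<gamma> \<subseteq> {1..p + q}"
proof -
  show "left_ends \<gamma> \<subseteq> {1..p + q}"
    by (rule subsetI) (unfold left_ends_iff, elim exE, drule arc_bounds, simp)
  show "right_ends \<gamma> \<subseteq> {1..p + q}"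
    by (rule subsetI) (unfold right_ends_iff, elim exE, drule arc_bounds, simp)
qed

lemma D_bounds: "D \<subseteq> {1..p + q}"
  using signs ends_bounds unfolding down_nodes_def by blast

lemma U_eq: "U = minuses \<gamma> \<union> right_ends \<gamma>"
  using signs(1,2) ends_bounds ends_disjoint unfolding down_nodes_def by blast

lemma arc_D: "(a, b) \<in> arcs \<gamma> \<Longrightarrow> a \<in> D"
  unfolding down_nodes_def Un_iff left_ends_iff by blast

lemma arc_U: "(a, b) \<in> arcs \<gamma> \<Longrightarrow> b \<in> U"
  unfolding U_eq Un_iff right_ends_iff by blast

lemma finite_D: "finite D"
  using D_bounds finite_subset by blast

text \<open>Left and right endpoints are equally many, so \<open>card D\<close> and
  \<open>card U\<close> differ by \<open>p - q\<close>, as the numbers of signs do, and they add up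
  to \<open>p + q\<close>.\<close>

lemma card_D: "card D = p"
proof -
  have fin: "finite (pluses \<gamma>)" "finite (minuses \<gamma>)" "finite (left_ends \<gamma>)" "finite (right_ends \<gamma>)"
    using signs(2) ends_bounds finite_subset[of _ "{1..p + q}"] by blast+
  have "x = y" if "x \<in> arcs \<gamma>" "y \<in> arcs \<gamma>" "fst x = fst y" for x y
    using that arcs_left[of "fst x" "snd x" "snd y"] by (cases x; cases y) simp
  moreover have "x = y" if "x \<in> arcs \<gamma>" "y \<in> arcs \<gamma>" "snd x = snd y" for x y
    using that arcs_right[of "fst x" "snd x" "fst y"] by (cases x; cases y) simp
  ultimately have "inj_on fst (arcs \<gamma>)" "inj_on snd (arcs \<gamma>)"
    by (intro inj_onI; blast)+
  then have "card (left_ends \<gamma>) = card (right_ends \<gamma>)"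
    unfolding left_ends_def right_ends_def by (simp add: card_image)
  moreover have "card D = card (pluses \<gamma>) + card (left_ends \<gamma>)"
    unfolding down_nodes_def using signs(2) by (intro card_Un_disjoint fin) blast
  moreover have "card U = card (minuses \<gamma>) + card (right_ends \<gamma>)"
    unfolding U_eq using signs(2) by (intro card_Un_disjoint fin) blast
  moreover have "card U = p + q - card D"
    using D_bounds finite_D by (simp add: card_Diff_subset)
  moreover have "card D \<le> p + q"
    using card_mono[OF _ D_bounds] by simp
  ultimately show ?thesis using signs(3) by linarith
qed

lemma card_U: "card U = q"
  using D_bounds finite_D by (simp add: card_Diff_subset card_D)

abbreviation row :: "nat \<Rightarrow> nat" where "row \<equiv> path_row \<gamma>"

text \<open>A left step \<open>k\<close> passes below this column, and \<open>path_col\<close>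
  refers to its end point, hence the successor. Columns are numbered against the order of the
  nodes.\<close>

definition col :: "nat \<Rightarrow> nat" where "col k = Suc (path_col q \<gamma> k)"

lemma row_mono: "k \<le> m \<Longrightarrow> row k \<le> row m"
  unfolding path_row_def by (rule card_mono) (simp_all add: subset_iff)

lemma row_less: "m \<in> D \<Longrightarrow> k < m \<Longrightarrow> row k < row m"
proof -
  assume m: "m \<in> D" "k < m"
  then have "1 \<le> m" using subsetD[OF D_bounds m(1)] by simp
  then have "m \<in> {x \<in> {1..m}. x \<in> D}" "m \<notin> {x \<in> {1..k}. x \<in> D}" using m by simp_all
  moreover have "{x \<in> {1..k}. x \<in> D} \<subseteq> {x \<in> {1..m}. x \<in> D}" using m(2) by (simp add: subset_iff)
  ultimately have "{x \<in> {1..k}. x \<in> D} \<subset> {x \<in> {1..m}. x \<in> D}" by blast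
  then show "row k < row m" unfolding path_row_def by (intro psubset_card_mono) simp_all
qed

lemma row_le_iff: "k \<in> D \<Longrightarrow> row k \<le> row m \<longleftrightarrow> k \<le> m"
  using row_mono[of k m] row_less[of k m] by linarith

lemma row_pos: assumes k: "k \<in> D" shows "1 \<le> row k"
proof -
  have "0 < k" using subsetD[OF D_bounds k] by simp
  from row_less[OF k this] show ?thesis by linarith
qed

lemma row_le: "row k \<le> p"
proof -
  have "row k \<le> card D" unfolding path_row_def by (rule card_mono[OF finite_D]) blast
  then show ?thesis unfolding card_D .
qed

lemmas row_bounds = row_pos row_le

lemma bij_row: "bij_betw row D {1..p}"
proof -
  have inj: "inj_on row D"
  proof (rule inj_onI)
    fix x y assume xy: "x \<in> D" "y \<in> D" "row x = row y"
    show "x = y" using row_le_iff[OF xy(1), of y] row_le_iff[OF xy(2), of x] xy(3) by linarith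
  qed
  moreover have "row ` D = {1..p}"
  proof (rule card_subset_eq)
    show "row ` D \<subseteq> {1..p}" by (rule image_subsetI) (simp only: atLeastAtMost_iff row_bounds simp_thms)
    show "card (row ` D) = card {1..p}" unfolding card_image[OF inj] card_D by simp
  qed simp
  ultimately show ?thesis unfolding bij_betw_def by (rule conjI)
qed

text \<open>Separates the count from the truncated subtraction in \<open>path_col\<close>, so that
  monotonicity can be proved for the count itself.\<close>

definition count_U :: "nat \<Rightarrow> nat" where
  "count_U k = card {m \<in> {1..k}. m \<notin> D}"

lemma path_col_count_U: "path_col q \<gamma> k = q - count_U k"
  unfolding path_col_def count_U_def by simp

lemma count_U_le: assumes "k \<le> p + q" shows "count_U k \<le> q"
proof -
  have "count_U k \<le> card U" unfolding count_U_def by (rule card_mono) (use assms in \<open>simp_all add: subset_iff\<close>)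
  then show ?thesis by (simp only: card_U)
qed

lemma count_U_mono: "k \<le> m \<Longrightarrow> count_U k \<le> count_U m"
  unfolding count_U_def by (rule card_mono) (simp_all add: subset_iff)

lemma count_U_less: "m \<in> U \<Longrightarrow> k < m \<Longrightarrow> count_U k < count_U m"
proof -
  assume m: "m \<in> U" "k < m"
  then have "m \<in> {x \<in> {1..m}. x \<notin> D}" "m \<notin> {x \<in> {1..k}. x \<notin> D}" by simp_all
  moreover have "{x \<in> {1..k}. x \<notin> D} \<subseteq> {x \<in> {1..m}. x \<notin> D}" using m(2) by (simp add: subset_iff)
  ultimately have "{x \<in> {1..k}. x \<notin> D} \<subset> {x \<in> {1..m}. x \<notin> D}" by blast
  then show "count_U k < count_U m" unfolding count_U_def by (intro psubset_card_mono) simp_all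
qed

text \<open>After \<open>k\<close> steps the column passed by step \<open>m\<close> is still west of
  the path exactly if this step is yet to come.\<close>

lemma col_le_iff: assumes m: "m \<in> U" and k: "k \<le> p + q" shows "col m \<le> path_col q \<gamma> k \<longleftrightarrow> k < m"
proof -
  have "m \<le> p + q" "0 < m" using m by auto
  then have "count_U m \<le> q" "0 < count_U m" using count_U_le count_U_less[OF m, of 0] by simp_all
  then show ?thesis
    using count_U_mono[of m k] count_U_less[OF m, of k] count_U_le[OF k]
    unfolding col_def path_col_count_U by (cases "k < m") simp_all
qed

lemma col_pos: "1 \<le> col m"
  by (simp add: col_def)

lemma col_le: assumes m: "m \<in> U" shows "col m \<le> q"
proof -
  have "m \<le> p + q" "0 < m" using m by auto
  then have "count_U m \<le> q" "0 < count_U m" using count_U_le count_U_less[OF m, of 0] by simp_all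
  then show ?thesis unfolding col_def path_col_count_U by simp
qed

lemmas col_bounds = col_pos col_le

lemma col_less_iff: "m \<in> U \<Longrightarrow> k \<in> U \<Longrightarrow> col m < col k \<longleftrightarrow> k < m"
  using col_le_iff[of m k] by (simp add: col_def[of k] less_Suc_eq_le)

lemma bij_col: "bij_betw col U {1..q}"
proof -
  have inj: "inj_on col U"
  proof (rule inj_onI)
    fix x y assume xy: "x \<in> U" "y \<in> U" "col x = col y"
    show "x = y" using col_less_iff[OF xy(1,2)] col_less_iff[OF xy(2,1)] xy(3) by linarith
  qed
  moreover have "col ` U = {1..q}"
  proof (rule card_subset_eq)
    show "col ` U \<subseteq> {1..q}" by (rule image_subsetI) (simp only: atLeastAtMost_iff col_bounds simp_thms)
    show "card (col ` U) = card {1..q}" unfolding card_image[OF inj] card_U by simp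
  qed simp
  ultimately show ?thesis unfolding bij_betw_def by (rule conjI)
qed

section \<open>The shape and the dots of a clan\<close>

definition row_length :: "nat \<Rightarrow> nat" where
  "row_length i = path_col q \<gamma> (inv_into D row i)"

definition col_length :: "nat \<Rightarrow> nat" where
  "col_length j = row (inv_into U col j)"

definition arc_boxes :: "(nat \<times> nat) set" where
  "arc_boxes = {(row a, col b) | a b. (a, b) \<in> arcs \<gamma>}"

lemma row_length: "k \<in> D \<Longrightarrow> row_length (row k) = path_col q \<gamma> k"
  unfolding row_length_def by (simp only: inv_into_f_f[OF bij_betw_imp_inj_on[OF bij_row]])

lemma col_length: "k \<in> U \<Longrightarrow> col_length (col k) = row k"
  unfolding col_length_def by (simp only: inv_into_f_f[OF bij_betw_imp_inj_on[OF bij_col]])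

lemma row_cases: assumes "1 \<le> i" "i \<le> p" obtains k where "k \<in> D" "i = row k"
proof -
  have "i \<in> row ` D" using assms bij_betw_imp_surj_on[OF bij_row] by simp
  then show thesis by (rule imageE) (rule that)
qed

lemma col_cases: assumes "1 \<le> j" "j \<le> q" obtains k where "k \<in> U" "j = col k"
proof -
  have "j \<in> col ` U" using assms bij_betw_imp_surj_on[OF bij_col] by simp
  then show thesis by (rule imageE) (rule that)
qed

lemma D_le: "k \<in> D \<Longrightarrow> 1 \<le> k \<and> k \<le> p + q"
  using subsetD[OF D_bounds, of k] by simp

lemma row_eq_iff: "k \<in> D \<Longrightarrow> m \<in> D \<Longrightarrow> row k = row m \<longleftrightarrow> k = m"
  using inj_on_eq_iff[OF bij_betw_imp_inj_on[OF bij_row]] .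

lemma col_eq_iff: "k \<in> U \<Longrightarrow> m \<in> U \<Longrightarrow> col k = col m \<longleftrightarrow> k = m"
  using inj_on_eq_iff[OF bij_betw_imp_inj_on[OF bij_col]] .

lemma arc_boxesE:
  assumes "(i, j) \<in> arc_boxes"
  obtains a b where "(a, b) \<in> arcs \<gamma>" "i = row a" "j = col b"
  using assms unfolding arc_boxes_def mem_Collect_eq prod.inject by (elim exE conjE) (rule that)

lemma arc_boxes_iff:
  assumes k: "k \<in> D" and m: "m \<in> U"
  shows "(row k, col m) \<in> arc_boxes \<longleftrightarrow> (k, m) \<in> arcs \<gamma>"
proof
  assume "(row k, col m) \<in> arc_boxes"
  then obtain a b where ab: "(a, b) \<in> arcs \<gamma>" "row k = row a" "col m = col b" by (rule arc_boxesE)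
  have "k = a" "m = b" using row_eq_iff[OF k arc_D[OF ab(1)]] col_eq_iff[OF m arc_U[OF ab(1)]] ab(2,3) by blast+
  then show "(k, m) \<in> arcs \<gamma>" using ab by simp
next
  assume "(k, m) \<in> arcs \<gamma>"
  then show "(row k, col m) \<in> arc_boxes" unfolding arc_boxes_def by blast
qed

text \<open>For \<open>k\<close> in \<open>D\<close> and \<open>m\<close> in \<open>U\<close>, the
  row condition and the column condition on the box \<open>(row k, col m)\<close> both amount to
  \<open>k < m\<close>.\<close>

sublocale bpd_shape p q row_length col_length arc_boxes
proof
  fix i j
  show "(1 \<le> i \<and> i \<le> p \<and> 1 \<le> j \<and> j \<le> row_length i) = (1 \<le> j \<and> j \<le> q \<and> 1 \<le> i \<and> i \<le> col_length j)"
  proof (cases "1 \<le> i \<and> i \<le> p \<and> 1 \<le> j \<and> j \<le> q")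
    case True
    obtain k where k: "k \<in> D" "i = row k" using row_cases[of i] True by blast
    obtain m where m: "m \<in> U" "j = col m" using col_cases[of j] True by blast
    note km = k m
    have "j \<le> row_length i \<longleftrightarrow> k < m"
      using col_le_iff[OF km(3), of k] D_le[OF km(1)] by (simp add: km(2,4) row_length[OF km(1)])
    moreover have "i \<le> col_length j \<longleftrightarrow> k < m"
    proof -
      have "k \<noteq> m" using km by blast
      then show ?thesis using row_le_iff[OF km(1), of m] col_length[OF km(3)] by (auto simp: km(2,4))
    qed
    ultimately show ?thesis using True by blast
  next
    case False
    have "row_length i \<le> q" by (simp add: row_length_def path_col_def)
    moreover have "col_length j \<le> p" using row_bounds(2) by (simp add: col_length_def)
    ultimately show ?thesis using False by linarith
  qed
next
  fix i j assume "(i, j) \<in> arc_boxes"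
  then obtain a b where ab: "(a, b) \<in> arcs \<gamma>" "i = row a" "j = col b" by (rule arc_boxesE)
  have "col b \<le> path_col q \<gamma> a" using col_le_iff[OF arc_U[OF ab(1)], of a] arc_bounds[OF ab(1)] by auto
  then show "1 \<le> i \<and> i \<le> p \<and> 1 \<le> j \<and> j \<le> row_length i"
    using ab row_bounds row_length[OF arc_D[OF ab(1)]] col_bounds(1) arc_D[OF ab(1)] by simp
next
  fix i j j' assume ij: "(i, j) \<in> arc_boxes" "(i, j') \<in> arc_boxes"
  obtain a b where ab: "(a, b) \<in> arcs \<gamma>" "i = row a" "j = col b" using ij(1) by (rule arc_boxesE)
  obtain a' b' where ab': "(a', b') \<in> arcs \<gamma>" "i = row a'" "j' = col b'" using ij(2) by (rule arc_boxesE)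
  note ab = ab ab'
  have "a = a'" using row_eq_iff[OF arc_D[OF ab(1)] arc_D[OF ab(4)]] ab(2,5) by simp
  then show "j = j'" using ab arcs_left[of a b b'] by simp
next
  fix i i' j assume ij: "(i, j) \<in> arc_boxes" "(i', j) \<in> arc_boxes"
  obtain a b where ab: "(a, b) \<in> arcs \<gamma>" "i = row a" "j = col b" using ij(1) by (rule arc_boxesE)
  obtain a' b' where ab': "(a', b') \<in> arcs \<gamma>" "i' = row a'" "j = col b'" using ij(2) by (rule arc_boxesE)
  note ab = ab ab'
  have "b = b'" using col_eq_iff[OF arc_U[OF ab(1)] arc_U[OF ab(4)]] ab(3,6) by simp
  then show "i = i'" using ab arcs_right[of a b a'] by simp
qed

lemma lam_iff: "k \<in> D \<Longrightarrow> m \<in> U \<Longrightarrow> (row k, col m) \<in> lam \<longleftrightarrow> k < m"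
  using col_le_iff[of m k] D_le[of k] row_bounds[of k] col_bounds(1)[of m] unfolding lam_row
  by (simp add: row_length)

lemma lam_cases:
  assumes "(i, j) \<in> lam"
  obtains k m where "k \<in> D" "m \<in> U" "i = row k" "j = col m" "k < m"
proof -
  have "1 \<le> i" "i \<le> p" "1 \<le> j" "j \<le> q" using assms lam_row[of i j] lam_col[of i j] by blast+
  obtain k where k: "k \<in> D" "i = row k" using row_cases[of i] \<open>1 \<le> i\<close> \<open>i \<le> p\<close> by blast
  obtain m where m: "m \<in> U" "j = col m" using col_cases[of j] \<open>1 \<le> j\<close> \<open>j \<le> q\<close> by blast
  note km = k m
  show ?thesis by (rule that[of k m]) (use km assms lam_iff[of k m] in simp_all)
qed

lemma clan_shape_eq: "clan_shape p q \<gamma> = lam"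
proof -
  have "(i, j) \<in> clan_shape p q \<gamma> \<longleftrightarrow> (i, j) \<in> lam" for i j
  proof (cases "1 \<le> i \<and> i \<le> p \<and> 1 \<le> j \<and> j \<le> q")
    case True
    obtain k where k: "k \<in> D" "i = row k" using row_cases[of i] True by blast
    obtain m where m: "m \<in> U" "j = col m" using col_cases[of j] True by blast
    note km = k m
    have "(\<exists>x\<le>p + q. i \<le> row x \<and> j \<le> path_col q \<gamma> x) \<longleftrightarrow> (\<exists>x\<le>p + q. k \<le> x \<and> x < m)"
      using row_le_iff[OF km(1)] col_le_iff[OF km(3)] unfolding km(2,4) by auto
    also have "\<dots> \<longleftrightarrow> k < m" using D_le[OF km(1)] by auto
    finally show ?thesis using lam_iff[OF km(1,3)] True by (simp add: clan_shape_def km(2,4))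
  next
    case False
    then show ?thesis using lam_row[of i j] lam_col[of i j] by (auto simp: clan_shape_def)
  qed
  then show ?thesis by auto
qed

lemma boundary_edge_D: "k \<in> D \<Longrightarrow> boundary_edge q \<gamma> k = VEdge (row k) (row_length (row k))"
  by (simp add: boundary_edge_def row_length)

lemma boundary_edge_U: "k \<in> U \<Longrightarrow> boundary_edge q \<gamma> k = HEdge (col_length (col k)) (col k)"
  using col_length[of k] by (simp add: boundary_edge_def col_def)

text \<open>Fragments quantify over all boundary edges. The edge of a down node starts no pipe, and
  a bottom edge lies on no pipe but its own, so that for connections only a down node followed by a
  node of \<open>U\<close> matters, and for crossings only two nodes of \<open>U\<close>.\<close>

lemma bpd_fragment_iff: "bpd_fragment p q \<gamma> T \<longleftrightarrow> is_bpd T"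
proof (cases "fits T")
  case False
  then show ?thesis unfolding bpd_fragment_def is_bpd_def fits_def clan_shape_eq by argo
next
  case fits: True
  have lamT: "b \<in> lam" if "T b = Some t" for b t
    using fits that unfolding fits_def by auto
  have pipe_U: "pipe_edges q \<gamma> T l = pipe T (col l)" if "l \<in> U" for l
    using boundary_edge_U[OF that] by (simp add: pipe_edges_def pipe_def)
  have pipe_D: "pipe_edges q \<gamma> T l = {boundary_edge q \<gamma> l}" if "l \<in> D" for l
  proof -
    have "(boundary_edge q \<gamma> l, e) \<notin> pipe_step T" for e
    proof
      assume "(boundary_edge q \<gamma> l, e) \<in> pipe_step T"
      then obtain b t s s' where b: "T b = Some t" "(s, s') \<in> strands t" "side_edge b s = boundary_edge q \<gamma> l"
        unfolding pipe_step_def by fastforce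
      then show False using boundary_edge_D[OF that] strands_cases[OF b(2)] lamT[OF b(1)]
        by (cases b) (auto simp: lam_row)
    qed
    then have "e = boundary_edge q \<gamma> l" if "(boundary_edge q \<gamma> l, e) \<in> (pipe_step T)\<^sup>*" for e
      using that by (blast elim: converse_rtranclE)
    then show ?thesis unfolding pipe_edges_def by auto
  qed
  have start: "HEdge (col_length j) j \<notin> pipe T j'" if "j \<noteq> j'" for j j'
  proof -
    have "pipe T j' \<subseteq> - {HEdge (col_length j) j}"
    proof (rule pipe_subset)
      fix b t s s' assume "T b = Some t" "(s, s') \<in> strands t"
      then show "side_edge b s' \<in> - {HEdge (col_length j) j}"
        using lamT[of b t] strands_cases[of s s' t] by (cases b) (auto simp: lam_col)
    qed (use that in auto)
    then show ?thesis by auto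
  qed
  have mem: "k \<in> D \<or> k \<in> U" if "1 \<le> k" "k \<le> p + q" for k using that by auto
  define X where "X c c' = {b. T b = Some Cross \<and>
          (side_edge b West \<in> pipe T c \<and> side_edge b South \<in> pipe T c' \<or>
           side_edge b West \<in> pipe T c' \<and> side_edge b South \<in> pipe T c)}" for c c'
  have X_sym: "X c c' = X c' c" for c c' unfolding X_def by blast
  have cross_D: "crossings q \<gamma> T l m = {}" if "l \<in> D \<or> m \<in> D" for l m
  proof -
    have "side_edge b s \<notin> pipe_edges q \<gamma> T l" if "l \<in> D" "T b = Some Cross" "s = West \<or> s = South" for l b s
      using that(3) lamT[OF that(2)] unfolding pipe_D[OF that(1)] boundary_edge_D[OF that(1)]
      by (cases b) (auto simp: lam_row)
    then show ?thesis unfolding crossings_def using that by blast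
  qed
  \<comment> \<open>The arguments are swapped because later nodes have smaller columns.\<close>
  have cross_U: "crossings q \<gamma> T l m = X (col m) (col l)" if "l \<in> U" "m \<in> U" for l m
    unfolding crossings_def X_def pipe_U[OF that(1)] pipe_U[OF that(2)] by blast
  have "(\<forall>l m. 1 \<le> l \<and> l < m \<and> m \<le> p + q \<longrightarrow> card (crossings q \<gamma> T l m) \<le> 1) \<longleftrightarrow>
      (\<forall>c c'. 1 \<le> c \<and> c < c' \<and> c' \<le> q \<longrightarrow> card (X c c') \<le> 1)" (is "?A \<longleftrightarrow> ?B")
  proof
    assume A: ?A
    show ?B
    proof (intro allI impI)
      fix c c' assume c: "1 \<le> c \<and> c < c' \<and> c' \<le> q"
      then obtain m where m: "m \<in> U" "c = col m" using col_cases[of c] by auto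
      obtain l where l: "l \<in> U" "c' = col l" using c col_cases[of c'] by auto
      have "l < m" using c col_less_iff[OF m(1) l(1)] m l by simp
      then have "card (crossings q \<gamma> T l m) \<le> 1" using A l m by auto
      then show "card (X c c') \<le> 1" using cross_U[OF l(1) m(1)] m l by simp
    qed
  next
    assume B: ?B
    show ?A
    proof (intro allI impI)
      fix l m assume lm: "1 \<le> l \<and> l < m \<and> m \<le> p + q"
      show "card (crossings q \<gamma> T l m) \<le> 1"
      proof (cases "l \<in> D \<or> m \<in> D")
        case False
        then have U: "l \<in> U" "m \<in> U" using mem[of l] mem[of m] lm by auto
        then have "card (X (col m) (col l)) \<le> 1"
          using B col_less_iff[OF U(2,1)] lm col_bounds(1)[of m] col_bounds(2)[OF U(1)] by blast
        then show ?thesis by (simp only: cross_U[OF U])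
      qed (simp add: cross_D)
    qed
  qed
  moreover have "(\<forall>k l. 1 \<le> k \<and> k < l \<and> l \<le> p + q \<longrightarrow>
        (boundary_edge q \<gamma> k \<in> pipe_edges q \<gamma> T l \<longleftrightarrow> (k, l) \<in> arcs \<gamma>)) \<longleftrightarrow>
      (\<forall>(i, j)\<in>lam. VEdge i (row_length i) \<in> pipe T j \<longleftrightarrow> (i, j) \<in> arc_boxes)" (is "?A \<longleftrightarrow> ?B")
  proof
    assume A: ?A
    have "VEdge i (row_length i) \<in> pipe T j \<longleftrightarrow> (i, j) \<in> arc_boxes" if ij: "(i, j) \<in> lam" for i j
    proof -
      obtain k m where km: "k \<in> D" "m \<in> U" "i = row k" "j = col m" "k < m" using lam_cases[OF ij] .
      have "boundary_edge q \<gamma> k \<in> pipe_edges q \<gamma> T m \<longleftrightarrow> (k, m) \<in> arcs \<gamma>"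
        using A km D_le[OF km(1)] by auto
      then show ?thesis
        using arc_boxes_iff[OF km(1,2)] boundary_edge_D[OF km(1)] pipe_U[OF km(2)] km by simp
    qed
    then show ?B by blast
  next
    assume B: ?B
    show ?A
    proof (intro allI impI)
      fix k l assume kl: "1 \<le> k \<and> k < l \<and> l \<le> p + q"
      show "boundary_edge q \<gamma> k \<in> pipe_edges q \<gamma> T l \<longleftrightarrow> (k, l) \<in> arcs \<gamma>"
      proof (cases "l \<in> D")
        case True
        have "boundary_edge q \<gamma> k \<noteq> boundary_edge q \<gamma> l"
        proof (cases "k \<in> D")
          case kD: True
          then show ?thesis using row_eq_iff[OF kD True] kl
            by (simp add: boundary_edge_D[OF kD] boundary_edge_D[OF True])
        next
          case False
          then show ?thesis using True by (simp add: boundary_edge_def)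
        qed
        moreover have "(k, l) \<notin> arcs \<gamma>" using True arc_U by blast
        ultimately show ?thesis using pipe_D[OF True] by simp
      next
        case False
        then have l: "l \<in> U" using mem[of l] kl by auto
        show ?thesis
        proof (cases "k \<in> D")
          case True
          have "VEdge (row k) (row_length (row k)) \<in> pipe T (col l) \<longleftrightarrow> (row k, col l) \<in> arc_boxes"
            using B lam_iff[OF True l] kl by blast
          then show ?thesis using arc_boxes_iff[OF True l] boundary_edge_D[OF True] pipe_U[OF l] by simp
        next
          case kD: False
          then have k: "k \<in> U" using mem[of k] kl by auto
          have "col k \<noteq> col l" using col_eq_iff[OF k l] kl by simp
          then have "boundary_edge q \<gamma> k \<notin> pipe_edges q \<gamma> T l"
            using start boundary_edge_U[OF k] pipe_U[OF l] by simp
          moreover have "(k, l) \<notin> arcs \<gamma>" using kD arc_D by blast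
          ultimately show ?thesis by simp
        qed
      qed
    qed
  qed
  moreover have "bpd_fragment p q \<gamma> T \<longleftrightarrow> fits T \<and>
      (\<forall>l m. 1 \<le> l \<and> l < m \<and> m \<le> p + q \<longrightarrow> card (crossings q \<gamma> T l m) \<le> 1) \<and>
      (\<forall>k l. 1 \<le> k \<and> k < l \<and> l \<le> p + q \<longrightarrow>
        (boundary_edge q \<gamma> k \<in> pipe_edges q \<gamma> T l \<longleftrightarrow> (k, l) \<in> arcs \<gamma>))"
    unfolding bpd_fragment_def fits_def clan_shape_eq by (simp only: conj_assoc)
  moreover have "is_bpd T \<longleftrightarrow> fits T \<and> (\<forall>c c'. 1 \<le> c \<and> c < c' \<and> c' \<le> q \<longrightarrow> card (X c c') \<le> 1) \<and>
      (\<forall>(i, j)\<in>lam. VEdge i (row_length i) \<in> pipe T j \<longleftrightarrow> (i, j) \<in> arc_boxes)"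
    unfolding is_bpd_def X_def by (rule refl)
  ultimately show ?thesis by argo
qed

section \<open>Bad pairs of nodes\<close>

definition bad_pair :: "nat \<Rightarrow> nat \<Rightarrow> bool" where
  "bad_pair c r \<longleftrightarrow> c \<in> D \<and> r \<in> U \<and> c < r \<and> (\<exists>(a, b)\<in>arcs \<gamma>. a < c \<and> r < b) \<and>
     (\<forall>b\<ge>r. (c, b) \<notin> arcs \<gamma>) \<and> (\<forall>a\<le>c. (a, r) \<notin> arcs \<gamma>)"

text \<open>Rows are numbered along the path and columns against it, so that \<open>r < b\<close>
  turns into \<open>col b < col r\<close>.\<close>

lemma bad_box_iff:
  assumes c: "c \<in> D" and r: "r \<in> U"
  shows "bad_box (row c) (col r) \<longleftrightarrow> bad_pair c r"
proof -
  have "(\<exists>(x, y)\<in>arc_boxes. x < row c \<and> y < col r) \<longleftrightarrow> (\<exists>(a, b)\<in>arcs \<gamma>. row a < row c \<and> col b < col r)"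
    unfolding arc_boxes_def by blast
  also have "\<dots> \<longleftrightarrow> (\<exists>(a, b)\<in>arcs \<gamma>. a < c \<and> r < b)"
  proof (rule bex_cong)
    fix x assume x: "x \<in> arcs \<gamma>"
    obtain a b where ab: "x = (a, b)" by (cases x)
    then have "a \<in> D" "b \<in> U" using x arc_D arc_U by blast+
    then show "(case x of (a, b) \<Rightarrow> row a < row c \<and> col b < col r) \<longleftrightarrow> (case x of (a, b) \<Rightarrow> a < c \<and> r < b)"
      using row_le_iff[OF c, of a] col_less_iff[of b r] r by (auto simp: ab)
  qed simp
  finally have 1: "(\<exists>(x, y)\<in>arc_boxes. x < row c \<and> y < col r) \<longleftrightarrow> (\<exists>(a, b)\<in>arcs \<gamma>. a < c \<and> r < b)" .
  have 2: "(\<forall>y\<le>col r. (row c, y) \<notin> arc_boxes) \<longleftrightarrow> (\<forall>b\<ge>r. (c, b) \<notin> arcs \<gamma>)"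
  proof -
    have "(\<exists>y\<le>col r. (row c, y) \<in> arc_boxes) \<longleftrightarrow> (\<exists>b\<ge>r. (c, b) \<in> arcs \<gamma>)"
    proof
      assume "\<exists>y\<le>col r. (row c, y) \<in> arc_boxes"
      then obtain a b where ab: "(a, b) \<in> arcs \<gamma>" "row c = row a" "col b \<le> col r" unfolding arc_boxes_def by blast
      then have "a = c" using row_eq_iff[OF c arc_D[OF ab(1)]] by simp
      moreover have "r \<le> b" using col_less_iff[OF r arc_U[OF ab(1)]] ab(3) by simp
      ultimately show "\<exists>b\<ge>r. (c, b) \<in> arcs \<gamma>" using ab by blast
    next
      assume "\<exists>b\<ge>r. (c, b) \<in> arcs \<gamma>"
      then obtain b where b: "r \<le> b" "(c, b) \<in> arcs \<gamma>" by blast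
      then have "col b \<le> col r" using col_less_iff[OF r arc_U[OF b(2)]] by simp
      then show "\<exists>y\<le>col r. (row c, y) \<in> arc_boxes" using b unfolding arc_boxes_def by blast
    qed
    then show ?thesis by blast
  qed
  have 3: "(\<forall>x\<le>row c. (x, col r) \<notin> arc_boxes) \<longleftrightarrow> (\<forall>a\<le>c. (a, r) \<notin> arcs \<gamma>)"
  proof -
    have "(\<exists>x\<le>row c. (x, col r) \<in> arc_boxes) \<longleftrightarrow> (\<exists>a\<le>c. (a, r) \<in> arcs \<gamma>)"
    proof
      assume "\<exists>x\<le>row c. (x, col r) \<in> arc_boxes"
      then obtain a b where ab: "(a, b) \<in> arcs \<gamma>" "row a \<le> row c" "col r = col b" unfolding arc_boxes_def by blast
      then have "b = r" using col_eq_iff[OF r arc_U[OF ab(1)]] by simp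
      moreover have "a \<le> c" using row_le_iff[OF arc_D[OF ab(1)]] ab(2) by simp
      ultimately show "\<exists>a\<le>c. (a, r) \<in> arcs \<gamma>" using ab by blast
    next
      assume "\<exists>a\<le>c. (a, r) \<in> arcs \<gamma>"
      then obtain a where a: "a \<le> c" "(a, r) \<in> arcs \<gamma>" by blast
      then have "row a \<le> row c" using row_mono by blast
      then show "\<exists>x\<le>row c. (x, col r) \<in> arc_boxes" using a unfolding arc_boxes_def by blast
    qed
    then show ?thesis by blast
  qed
  show ?thesis unfolding bad_box_def bad_pair_def using 1 2 3 c r lam_iff[OF c r] by simp
qed

lemma ex1_bpd_fragment_iff: "(\<exists>!T. bpd_fragment p q \<gamma> T) \<longleftrightarrow> \<not> (\<exists>c r. bad_pair c r)"
proof -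
  have "(\<exists>i j. bad_box i j) \<longleftrightarrow> (\<exists>c r. bad_pair c r)"
  proof
    assume "\<exists>i j. bad_box i j"
    then obtain i j where ij: "bad_box i j" by blast
    then have "(i, j) \<in> lam" by (simp add: bad_box_def)
    then obtain k m where "k \<in> D" "m \<in> U" "i = row k" "j = col m" using lam_cases by metis
    then show "\<exists>c r. bad_pair c r" using ij bad_box_iff by blast
  next
    assume "\<exists>c r. bad_pair c r"
    then obtain c r where cr: "bad_pair c r" by blast
    then have "c \<in> D" "r \<in> U" by (simp_all add: bad_pair_def)
    then show "\<exists>i j. bad_box i j" using cr bad_box_iff by blast
  qed
  then show ?thesis unfolding bpd_fragment_iff ex1_bpd_iff by blast
qed

end

section \<open>Bad pairs and the five patterns\<close>

lemma rank_in_empty: "rank_in {} y = 0"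
  by (simp add: rank_in_def)

lemma rank_in_insert:
  assumes "finite S" "x \<notin> S"
  shows "rank_in (insert x S) y = (if x \<le> y then 1 else 0) + rank_in S y"
proof -
  have "{z \<in> insert x S. z \<le> y} = (if x \<le> y then insert x {z \<in> S. z \<le> y} else {z \<in> S. z \<le> y})" by auto
  then show ?thesis using assms by (simp add: rank_in_def)
qed

text \<open>Transfers the order of the nodes of a pattern to the nodes of the clan that form
  it.\<close>

lemma rank_in_less: "finite S \<Longrightarrow> rank_in S x < rank_in S y \<Longrightarrow> x < y"
proof (rule ccontr)
  assume a: "finite S" "rank_in S x < rank_in S y" "\<not> x < y"
  then have "rank_in S y \<le> rank_in S x" unfolding rank_in_def by (intro card_mono) auto
  then show False using a by simp
qed

context pq_clan
begin

text \<open>A down node whose arc does not reach \<open>r\<close> is a plus or has its arc end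
  before \<open>r\<close>, and dually for \<open>r\<close>. In this form the alternatives match the
  patterns.\<close>

lemma bad_pair_iff: "bad_pair c r \<longleftrightarrow> c < r \<and> (\<exists>(a, b)\<in>arcs \<gamma>. a < c \<and> r < b) \<and>
    (c \<in> pluses \<gamma> \<or> (\<exists>d<r. (c, d) \<in> arcs \<gamma>)) \<and> (r \<in> minuses \<gamma> \<or> (\<exists>e>c. (e, r) \<in> arcs \<gamma>))"
proof -
  have c: "c \<in> D \<and> (\<forall>b\<ge>r. (c, b) \<notin> arcs \<gamma>) \<longleftrightarrow> c \<in> pluses \<gamma> \<or> (\<exists>d<r. (c, d) \<in> arcs \<gamma>)"
  proof
    assume "c \<in> D \<and> (\<forall>b\<ge>r. (c, b) \<notin> arcs \<gamma>)"
    then show "c \<in> pluses \<gamma> \<or> (\<exists>d<r. (c, d) \<in> arcs \<gamma>)"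
      unfolding down_nodes_def Un_iff left_ends_iff not_less[symmetric] by blast
  next
    assume "c \<in> pluses \<gamma> \<or> (\<exists>d<r. (c, d) \<in> arcs \<gamma>)"
    then show "c \<in> D \<and> (\<forall>b\<ge>r. (c, b) \<notin> arcs \<gamma>)"
    proof
      assume p: "c \<in> pluses \<gamma>"
      then have "c \<notin> left_ends \<gamma>" using signs(2) by blast
      then show ?thesis using p unfolding down_nodes_def left_ends_iff by blast
    next
      assume "\<exists>d<r. (c, d) \<in> arcs \<gamma>"
      then obtain d where d: "d < r" "(c, d) \<in> arcs \<gamma>" by blast
      have "(c, b) \<notin> arcs \<gamma>" if "r \<le> b" for b using arcs_left[OF d(2), of b] d(1) that by auto
      then show ?thesis using arc_D[OF d(2)] by blast
    qed
  qed
  have r: "r \<in> U \<and> (\<forall>a\<le>c. (a, r) \<notin> arcs \<gamma>) \<longleftrightarrow> r \<in> minuses \<gamma> \<or> (\<exists>e>c. (e, r) \<in> arcs \<gamma>)"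
  proof
    assume "r \<in> U \<and> (\<forall>a\<le>c. (a, r) \<notin> arcs \<gamma>)"
    then show "r \<in> minuses \<gamma> \<or> (\<exists>e>c. (e, r) \<in> arcs \<gamma>)"
      unfolding U_eq Un_iff right_ends_iff not_less[symmetric] by blast
  next
    assume "r \<in> minuses \<gamma> \<or> (\<exists>e>c. (e, r) \<in> arcs \<gamma>)"
    then show "r \<in> U \<and> (\<forall>a\<le>c. (a, r) \<notin> arcs \<gamma>)"
    proof
      assume p: "r \<in> minuses \<gamma>"
      then have "r \<notin> right_ends \<gamma>" using signs(2) by blast
      then show ?thesis using p unfolding U_eq right_ends_iff by blast
    next
      assume "\<exists>e>c. (e, r) \<in> arcs \<gamma>"
      then obtain e where e: "c < e" "(e, r) \<in> arcs \<gamma>" by blast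
      have "(a, r) \<notin> arcs \<gamma>" if "a \<le> c" for a using arcs_right[OF e(2), of a] e(1) that by auto
      then show ?thesis using arc_U[OF e(2)] by blast
    qed
  qed
  show ?thesis unfolding bad_pair_def using c r by argo
qed

text \<open>With the three lemmas that follow, it decides by rewriting which arcs and signs occur at
  a node of known type.\<close>

lemma left_node: "(x, y) \<in> arcs \<gamma> \<Longrightarrow>
    ((x, j) \<in> arcs \<gamma> \<longleftrightarrow> j = y) \<and> (i, x) \<notin> arcs \<gamma> \<and> x \<notin> pluses \<gamma> \<and> x \<notin> minuses \<gamma>"
proof -
  assume xy: "(x, y) \<in> arcs \<gamma>"
  then have "x \<in> left_ends \<gamma>" unfolding left_ends_iff by blast
  then have "x \<notin> pluses \<gamma> \<and> x \<notin> minuses \<gamma>" using signs(2) by blast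
  then show ?thesis using xy arcs_left[OF xy] arcs_left_right[of i x y] by blast
qed

lemma right_node: "(x, y) \<in> arcs \<gamma> \<Longrightarrow>
    (y, j) \<notin> arcs \<gamma> \<and> ((i, y) \<in> arcs \<gamma> \<longleftrightarrow> i = x) \<and> y \<notin> pluses \<gamma> \<and> y \<notin> minuses \<gamma>"
proof -
  assume xy: "(x, y) \<in> arcs \<gamma>"
  then have "y \<in> right_ends \<gamma>" unfolding right_ends_iff by blast
  then have "y \<notin> pluses \<gamma> \<and> y \<notin> minuses \<gamma>" using signs(2) by blast
  then show ?thesis using xy arcs_right[OF xy] arcs_left_right[OF xy] by blast
qed

lemma plus_node: "x \<in> pluses \<gamma> \<Longrightarrow> (x, j) \<notin> arcs \<gamma> \<and> (i, x) \<notin> arcs \<gamma> \<and> x \<in> pluses \<gamma> \<and> x \<notin> minuses \<gamma>"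
  using signs(1) left_node right_node by blast

lemma minus_node: "x \<in> minuses \<gamma> \<Longrightarrow> (x, j) \<notin> arcs \<gamma> \<and> (i, x) \<notin> arcs \<gamma> \<and> x \<notin> pluses \<gamma> \<and> x \<in> minuses \<gamma>"
  using signs(1) left_node right_node by blast

text \<open>Arcs and signs on \<open>S\<close> enter as explicit finite sets, so that the renumbered
  clan can be evaluated with \<open>rank_in_insert\<close>.\<close>

lemma contains_patternI:
  assumes "S \<subseteq> {1..p + q}" and closed: "\<And>i j. (i, j) \<in> arcs \<gamma> \<Longrightarrow> i \<in> S \<longleftrightarrow> j \<in> S"
    and arcs_on: "{x \<in> arcs \<gamma>. fst x \<in> S} = A" and "pluses \<gamma> \<inter> S = P" "minuses \<gamma> \<inter> S = M"
  shows "contains_pattern \<gamma> \<lparr>nodes = card S, arcs = (\<lambda>(i, j). (rank_in S i, rank_in S j)) ` A,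
    pluses = rank_in S ` P, minuses = rank_in S ` M\<rparr>"
proof -
  have "{(rank_in S i, rank_in S j) | i j. (i, j) \<in> arcs \<gamma> \<and> i \<in> S \<and> j \<in> S} =
      (\<lambda>(i, j). (rank_in S i, rank_in S j)) ` A"
  proof -
    have "(i, j) \<in> arcs \<gamma> \<and> i \<in> S \<and> j \<in> S \<longleftrightarrow> (i, j) \<in> A" for i j
      using closed[of i j] unfolding arcs_on[symmetric] by auto
    then show ?thesis by auto
  qed
  then have "induced_clan \<gamma> S = \<lparr>nodes = card S, arcs = (\<lambda>(i, j). (rank_in S i, rank_in S j)) ` A,
    pluses = rank_in S ` P, minuses = rank_in S ` M\<rparr>"
    unfolding induced_clan_def using assms(4,5) by simp
  then show ?thesis unfolding contains_pattern_def nodes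
    using assms(1) closed by (intro exI[of _ S]) blast
qed

lemma bad_pair_pattern:
  assumes "bad_pair c r"
  shows "\<exists>\<sigma>\<in>five_patterns. contains_pattern \<gamma> \<sigma>"
proof -
  obtain a b where ab: "(a, b) \<in> arcs \<gamma>" "a < c" "r < b" and cr: "c < r"
    and c: "c \<in> pluses \<gamma> \<or> (\<exists>d<r. (c, d) \<in> arcs \<gamma>)" and r: "r \<in> minuses \<gamma> \<or> (\<exists>e>c. (e, r) \<in> arcs \<gamma>)"
    using assms unfolding bad_pair_iff by blast
  have bounds: "1 \<le> a" "b \<le> p + q" using arc_bounds[OF ab(1)] by simp_all
  note outer = left_node[OF ab(1)] right_node[OF ab(1)]
  note ranks = rank_in_insert rank_in_empty
  consider "c \<in> pluses \<gamma>" "r \<in> minuses \<gamma>"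
    | e where "c \<in> pluses \<gamma>" "c < e" "(e, r) \<in> arcs \<gamma>"
    | d where "d < r" "(c, d) \<in> arcs \<gamma>" "r \<in> minuses \<gamma>"
    | d e where "d < r" "(c, d) \<in> arcs \<gamma>" "c < e" "(e, r) \<in> arcs \<gamma>"
    using c r by blast
  then show ?thesis
  proof cases
    case 1
    note n = outer plus_node[OF 1(1)] minus_node[OF 1(2)]
    have "contains_pattern \<gamma> \<lparr>nodes = card {a, c, r, b},
        arcs = (\<lambda>(i, j). (rank_in {a, c, r, b} i, rank_in {a, c, r, b} j)) ` {(a, b)},
        pluses = rank_in {a, c, r, b} ` {c}, minuses = rank_in {a, c, r, b} ` {r}\<rparr>"
    proof (rule contains_patternI)
      show "{x \<in> arcs \<gamma>. fst x \<in> {a, c, r, b}} = {(a, b)}" using n by auto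
    qed (use n ab cr bounds in auto)
    then show ?thesis using ab cr by (simp add: ranks five_patterns_def numeral_eq_Suc)
  next
    case 2
    have er: "e < r" using arc_bounds[OF 2(3)] by simp
    note n = outer plus_node[OF 2(1)] left_node[OF 2(3)] right_node[OF 2(3)]
    have "contains_pattern \<gamma> \<lparr>nodes = card {a, c, e, r, b},
        arcs = (\<lambda>(i, j). (rank_in {a, c, e, r, b} i, rank_in {a, c, e, r, b} j)) ` {(a, b), (e, r)},
        pluses = rank_in {a, c, e, r, b} ` {c}, minuses = rank_in {a, c, e, r, b} ` {}\<rparr>"
    proof (rule contains_patternI)
      show "{x \<in> arcs \<gamma>. fst x \<in> {a, c, e, r, b}} = {(a, b), (e, r)}" using n by auto
    qed (use n ab cr 2 er bounds in auto)
    then show ?thesis using ab cr 2 er by (simp add: ranks five_patterns_def numeral_eq_Suc)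
  next
    case 3
    have cd: "c < d" using arc_bounds[OF 3(2)] by simp
    note n = outer minus_node[OF 3(3)] left_node[OF 3(2)] right_node[OF 3(2)]
    have "contains_pattern \<gamma> \<lparr>nodes = card {a, c, d, r, b},
        arcs = (\<lambda>(i, j). (rank_in {a, c, d, r, b} i, rank_in {a, c, d, r, b} j)) ` {(a, b), (c, d)},
        pluses = rank_in {a, c, d, r, b} ` {}, minuses = rank_in {a, c, d, r, b} ` {r}\<rparr>"
    proof (rule contains_patternI)
      show "{x \<in> arcs \<gamma>. fst x \<in> {a, c, d, r, b}} = {(a, b), (c, d)}" using n by auto
    qed (use n ab cr 3 cd bounds in auto)
    then show ?thesis using ab cr 3 cd by (simp add: ranks five_patterns_def numeral_eq_Suc)
  next
    case 4
    have cd: "c < d" "e < r" using arc_bounds[OF 4(2)] arc_bounds[OF 4(4)] by simp_all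
    \<comment> \<open>No node is both a right and a left endpoint; the order of \<open>d\<close> and
      \<open>e\<close> then distinguishes the two patterns with six nodes.\<close>
    have de: "d \<noteq> e" using arcs_left_right[OF 4(2)] 4(4) by auto
    note n = outer left_node[OF 4(2)] right_node[OF 4(2)] left_node[OF 4(4)] right_node[OF 4(4)]
    have "contains_pattern \<gamma> \<lparr>nodes = card {a, c, d, e, r, b},
        arcs = (\<lambda>(i, j). (rank_in {a, c, d, e, r, b} i, rank_in {a, c, d, e, r, b} j)) ` {(a, b), (c, d), (e, r)},
        pluses = rank_in {a, c, d, e, r, b} ` {}, minuses = rank_in {a, c, d, e, r, b} ` {}\<rparr>"
    proof (rule contains_patternI)
      show "{x \<in> arcs \<gamma>. fst x \<in> {a, c, d, e, r, b}} = {(a, b), (c, d), (e, r)}" using n by auto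
    qed (use n ab cr 4 cd bounds in auto)
    note contained = this
    show ?thesis
    proof (cases "d < e")
      case True
      then show ?thesis using contained ab cr 4 cd by (simp add: ranks five_patterns_def numeral_eq_Suc)
    next
      case False
      then have "e < d" using de by simp
      then show ?thesis using contained ab cr 4 cd by (simp add: ranks five_patterns_def numeral_eq_Suc)
    qed
  qed
qed

text \<open>In every pattern the second node serves as \<open>c\<close> and the last but one as
  \<open>r\<close>, enclosed by the arc from the first to the last node.\<close>

lemma pattern_bad_pair:
  assumes "contains_pattern \<gamma> \<sigma>" "\<sigma> \<in> five_patterns"
  shows "\<exists>c r. bad_pair c r"
proof -
  obtain S where S: "S \<subseteq> {1..p + q}" "induced_clan \<gamma> S = \<sigma>"
    using assms(1) unfolding contains_pattern_def nodes by blast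
  have fin: "finite S" using S(1) finite_subset by blast
  note less = rank_in_less[OF fin]
  have arc: "\<exists>i j. (i, j) \<in> arcs \<gamma> \<and> rank_in S i = x \<and> rank_in S j = y" if "(x, y) \<in> arcs \<sigma>" for x y
    using that unfolding S(2)[symmetric] induced_clan_def by auto
  have plus: "\<exists>i\<in>pluses \<gamma>. rank_in S i = x" if "x \<in> pluses \<sigma>" for x
    using that unfolding S(2)[symmetric] induced_clan_def by auto
  have minus: "\<exists>i\<in>minuses \<gamma>. rank_in S i = x" if "x \<in> minuses \<sigma>" for x
    using that unfolding S(2)[symmetric] induced_clan_def by auto
  consider (1) "\<sigma> = \<lparr> nodes = 4, arcs = {(1, 4)}, pluses = {2}, minuses = {3} \<rparr>"
    | (2) "\<sigma> = \<lparr> nodes = 5, arcs = {(1, 5), (3, 4)}, pluses = {2}, minuses = {} \<rparr>"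
    | (3) "\<sigma> = \<lparr> nodes = 5, arcs = {(1, 5), (2, 3)}, pluses = {}, minuses = {4} \<rparr>"
    | (4) "\<sigma> = \<lparr> nodes = 6, arcs = {(1, 6), (2, 3), (4, 5)}, pluses = {}, minuses = {} \<rparr>"
    | (5) "\<sigma> = \<lparr> nodes = 6, arcs = {(1, 6), (2, 4), (3, 5)}, pluses = {}, minuses = {} \<rparr>"
    using assms(2) unfolding five_patterns_def by (elim insertE emptyE)
  then show ?thesis
  proof cases
    case 1
    have "(1, 4) \<in> arcs \<sigma>" by (simp add: 1)
    then obtain a b where a: "(a, b) \<in> arcs \<gamma>" "rank_in S a = 1" "rank_in S b = 4" using arc by blast
    have "2 \<in> pluses \<sigma>" by (simp add: 1)
    then obtain c where c: "c \<in> pluses \<gamma>" "rank_in S c = 2" using plus by blast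
    have "3 \<in> minuses \<sigma>" by (simp add: 1)
    then obtain r where r: "r \<in> minuses \<gamma>" "rank_in S r = 3" using minus by blast
    have "a < c" "c < r" "r < b" using a(2,3) c(2) r(2) by (simp_all add: less)
    then have "bad_pair c r" unfolding bad_pair_iff using a(1) c(1) r(1) by blast
    then show ?thesis by blast
  next
    case 2
    have "(1, 5) \<in> arcs \<sigma>" by (simp add: 2)
    then obtain a b where a: "(a, b) \<in> arcs \<gamma>" "rank_in S a = 1" "rank_in S b = 5" using arc by blast
    have "(3, 4) \<in> arcs \<sigma>" by (simp add: 2)
    then obtain e r where r: "(e, r) \<in> arcs \<gamma>" "rank_in S e = 3" "rank_in S r = 4" using arc by blast
    have "2 \<in> pluses \<sigma>" by (simp add: 2)
    then obtain c where c: "c \<in> pluses \<gamma>" "rank_in S c = 2" using plus by blast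
    have "a < c" "c < r" "r < b" "c < e" using a(2,3) c(2) r(2,3) by (simp_all add: less)
    then have "bad_pair c r" unfolding bad_pair_iff using a(1) c(1) r(1) by blast
    then show ?thesis by blast
  next
    case 3
    have "(1, 5) \<in> arcs \<sigma>" by (simp add: 3)
    then obtain a b where a: "(a, b) \<in> arcs \<gamma>" "rank_in S a = 1" "rank_in S b = 5" using arc by blast
    have "(2, 3) \<in> arcs \<sigma>" by (simp add: 3)
    then obtain c d where c: "(c, d) \<in> arcs \<gamma>" "rank_in S c = 2" "rank_in S d = 3" using arc by blast
    have "4 \<in> minuses \<sigma>" by (simp add: 3)
    then obtain r where r: "r \<in> minuses \<gamma>" "rank_in S r = 4" using minus by blast
    have "a < c" "c < r" "r < b" "d < r" using a(2,3) c(2,3) r(2) by (simp_all add: less)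
    then have "bad_pair c r" unfolding bad_pair_iff using a(1) c(1) r(1) by blast
    then show ?thesis by blast
  next
    case 4
    have "(1, 6) \<in> arcs \<sigma>" by (simp add: 4)
    then obtain a b where a: "(a, b) \<in> arcs \<gamma>" "rank_in S a = 1" "rank_in S b = 6" using arc by blast
    have "(2, 3) \<in> arcs \<sigma>" by (simp add: 4)
    then obtain c d where c: "(c, d) \<in> arcs \<gamma>" "rank_in S c = 2" "rank_in S d = 3" using arc by blast
    have "(4, 5) \<in> arcs \<sigma>" by (simp add: 4)
    then obtain e r where r: "(e, r) \<in> arcs \<gamma>" "rank_in S e = 4" "rank_in S r = 5" using arc by blast
    have "a < c" "c < r" "r < b" "d < r" "c < e" using a(2,3) c(2,3) r(2,3) by (simp_all add: less)
    then have "bad_pair c r" unfolding bad_pair_iff using a(1) c(1) r(1) by blast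
    then show ?thesis by blast
  next
    case 5
    have "(1, 6) \<in> arcs \<sigma>" by (simp add: 5)
    then obtain a b where a: "(a, b) \<in> arcs \<gamma>" "rank_in S a = 1" "rank_in S b = 6" using arc by blast
    have "(2, 4) \<in> arcs \<sigma>" by (simp add: 5)
    then obtain c d where c: "(c, d) \<in> arcs \<gamma>" "rank_in S c = 2" "rank_in S d = 4" using arc by blast
    have "(3, 5) \<in> arcs \<sigma>" by (simp add: 5)
    then obtain e r where r: "(e, r) \<in> arcs \<gamma>" "rank_in S e = 3" "rank_in S r = 5" using arc by blast
    have "a < c" "c < r" "r < b" "d < r" "c < e" using a(2,3) c(2,3) r(2,3) by (simp_all add: less)
    then have "bad_pair c r" unfolding bad_pair_iff using a(1) c(1) r(1) by blast
    then show ?thesis by blast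
  qed
qed

lemma avoids_iff: "(\<forall>\<sigma>\<in>five_patterns. avoids \<gamma> \<sigma>) \<longleftrightarrow> \<not> (\<exists>c r. bad_pair c r)"
  using bad_pair_pattern pattern_bad_pair by blast

end

section \<open>From clans to charts\<close>

lemma GL_det_iff: "g \<in> GL n \<longleftrightarrow> g \<in> carrier_mat n n \<and> det g \<noteq> 0"
proof
  assume g: "g \<in> GL n"
  then obtain h where h: "h \<in> GL n" "g * h = 1\<^sub>m n" by (rule GL_inverse)
  have "det g * det h = 1"
    using det_mult[OF GL_carrier[OF g] GL_carrier[OF h(1)]] by (simp add: h(2))
  then show "g \<in> carrier_mat n n \<and> det g \<noteq> 0" using GL_carrier[OF g] by auto
qed (use GL_det in blast)

lemma four_block_GL:
  assumes "a \<in> carrier_mat p p" "d \<in> carrier_mat q q"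
  shows "four_block_mat a (0\<^sub>m p q) (0\<^sub>m q p) d \<in> GL (p + q) \<longleftrightarrow> a \<in> GL p \<and> d \<in> GL q"
  using det_four_block_mat_upper_right_zero[OF assms(1) refl _ assms(2), of "0\<^sub>m q p"] assms
  by (simp add: GL_det_iff)

section \<open>The permutation matrix of a clan and the block diagonal group\<close>

context pq_clan
begin

text \<open>In the chart both nodes and coordinates are numbered from \<open>0\<close>, hence the
  successor and the predecessor.\<close>

definition coord :: "nat \<Rightarrow> nat" where
  "coord c = clan_perm p \<gamma> (Suc c) - 1"

lemma clan_perm_eq:
  assumes "i \<le> p + q"
  shows "clan_perm p \<gamma> i = (if i \<in> D then row i else p + count_U i)"
proof -
  have "{k \<in> D. k \<le> i} = {k \<in> {1..i}. k \<in> D}" using D_bounds by auto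
  moreover have "{k \<in> {1..nodes \<gamma>} - D. k \<le> i} = {k \<in> {1..i}. k \<notin> D}"
    using assms unfolding nodes by auto
  ultimately show ?thesis by (simp add: clan_perm_def path_row_def count_U_def)
qed

lemma coord_D: assumes "Suc c \<in> D" shows "coord c = row (Suc c) - 1" "coord c < p"
proof -
  show *: "coord c = row (Suc c) - 1"
    using clan_perm_eq[of "Suc c"] D_le[OF assms] assms by (simp add: coord_def)
  show "coord c < p" using row_pos[OF assms] row_le[of "Suc c"] unfolding * by linarith
qed

lemma coord_U:
  assumes "Suc c \<in> U"
  shows "coord c = p + count_U (Suc c) - 1" "p \<le> coord c" "coord c < p + q"
proof -
  have le: "Suc c \<le> p + q" and D: "Suc c \<notin> D" using assms by auto
  show *: "coord c = p + count_U (Suc c) - 1" using clan_perm_eq[OF le] D by (simp add: coord_def)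
  have "0 < count_U (Suc c)" using count_U_less[OF assms, of 0] by simp
  then show "p \<le> coord c" "coord c < p + q" using count_U_le[OF le] unfolding * by linarith+
qed

lemma node_cases: "c < p + q \<Longrightarrow> Suc c \<in> D \<or> Suc c \<in> U"
  by auto

lemma coord_less: "c < p + q \<Longrightarrow> coord c < p + q"
  using node_cases[of c] coord_D(2)[of c] coord_U(3)[of c] trans_less_add1[of "coord c" p q] by blast

lemma coord_less_p: "c < p + q \<Longrightarrow> coord c < p \<longleftrightarrow> Suc c \<in> D"
  using node_cases[of c] coord_D(2)[of c] coord_U(2)[of c] not_less by blast

lemma inj_coord: "inj_on coord {..<p + q}"
proof (rule inj_onI)
  fix c c' assume "c \<in> {..<p + q}" "c' \<in> {..<p + q}" and eq: "coord c = coord c'"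
  then have c: "c < p + q" "c' < p + q" by simp_all
  show "c = c'"
  proof (cases "Suc c \<in> D")
    case True
    then have D: "Suc c \<in> D" "Suc c' \<in> D" using coord_less_p[OF c(1)] coord_less_p[OF c(2)] eq by simp_all
    then have "row (Suc c) = row (Suc c')"
      using coord_D(1)[OF D(1)] coord_D(1)[OF D(2)] row_pos[OF D(1)] row_pos[OF D(2)] eq by linarith
    then have "Suc c \<le> Suc c'" "Suc c' \<le> Suc c"
      using row_le_iff[OF D(1), of "Suc c'"] row_le_iff[OF D(2), of "Suc c"] by simp_all
    then show ?thesis by simp
  next
    case False
    have "Suc c' \<notin> D" using False coord_less_p[OF c(1)] coord_less_p[OF c(2)] eq by simp
    then have U: "Suc c \<in> U" "Suc c' \<in> U" using False node_cases[OF c(1)] node_cases[OF c(2)] by blast+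
    have "0 < count_U (Suc c)" "0 < count_U (Suc c')"
      using count_U_less[OF U(1), of 0] count_U_less[OF U(2), of 0] by simp_all
    then have "count_U (Suc c) = count_U (Suc c')"
      using coord_U(1)[OF U(1)] coord_U(1)[OF U(2)] eq by linarith
    then have "\<not> Suc c < Suc c'" "\<not> Suc c' < Suc c"
      using count_U_less[OF U(2), of "Suc c"] count_U_less[OF U(1), of "Suc c'"] by linarith+
    then show ?thesis by simp
  qed
qed

lemma coord_eq_iff: "c < p + q \<Longrightarrow> c' < p + q \<Longrightarrow> coord c = coord c' \<longleftrightarrow> c = c'"
  using inj_on_eq_iff[OF inj_coord, of c c'] by simp

lemma coord_surj: assumes "i < p + q" obtains c where "c < p + q" "i = coord c"
proof -
  have "coord ` {..<p + q} = {..<p + q}"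
    by (rule endo_inj_surj[OF _ _ inj_coord]) (auto simp: coord_less)
  then have "i \<in> coord ` {..<p + q}" using assms by simp
  then show thesis using that by blast
qed

definition perm_mat :: "complex mat" where
  "perm_mat = mat (p + q) (p + q) (\<lambda>(i, c). if i = coord c then 1 else 0)"

definition perm_mat_inv :: "complex mat" where
  "perm_mat_inv = mat (p + q) (p + q) (\<lambda>(c, i). if i = coord c then 1 else 0)"

lemma perm_mat_carrier: "perm_mat \<in> carrier_mat (p + q) (p + q)" "perm_mat_inv \<in> carrier_mat (p + q) (p + q)"
  by (simp_all add: perm_mat_def perm_mat_inv_def)

lemma mult_perm_mat:
  assumes k: "k \<in> carrier_mat (p + q) (p + q)" and "i < p + q" "c < p + q"
  shows "(k * perm_mat) $$ (i, c) = k $$ (i, coord c)"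
proof -
  have "(k * perm_mat) $$ (i, c) = (\<Sum>l<p + q. k $$ (i, l) * perm_mat $$ (l, c))"
    by (rule index_mult_mat_sum[OF k perm_mat_carrier(1) assms(2,3)])
  also have "\<dots> = (\<Sum>l<p + q. if l = coord c then k $$ (i, l) else 0)"
    by (rule sum.cong) (use assms(3) in \<open>simp_all add: perm_mat_def\<close>)
  finally show ?thesis using coord_less[OF assms(3)] by simp
qed

lemma perm_mat_mult:
  assumes k: "k \<in> carrier_mat (p + q) (p + q)" and r: "r < p + q" and c: "c < p + q"
  shows "(perm_mat * k) $$ (coord r, c) = k $$ (r, c)"
proof -
  have "(perm_mat * k) $$ (coord r, c) = (\<Sum>l<p + q. perm_mat $$ (coord r, l) * k $$ (l, c))"
    by (rule index_mult_mat_sum[OF perm_mat_carrier(1) k coord_less[OF r] c])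
  also have "\<dots> = (\<Sum>l<p + q. if l = r then k $$ (l, c) else 0)"
    by (rule sum.cong) (use r coord_less in \<open>auto simp: perm_mat_def coord_eq_iff\<close>)
  finally show ?thesis using r by simp
qed

lemma perm_mat_inverse: "perm_mat_inv * perm_mat = 1\<^sub>m (p + q)" "perm_mat * perm_mat_inv = 1\<^sub>m (p + q)"
proof -
  show *: "perm_mat_inv * perm_mat = 1\<^sub>m (p + q)"
  proof (rule eq_matI)
    fix i j assume "i < dim_row (1\<^sub>m (p + q) :: complex mat)" "j < dim_col (1\<^sub>m (p + q) :: complex mat)"
    then have ij: "i < p + q" "j < p + q" by simp_all
    have "(perm_mat_inv * perm_mat) $$ (i, j) = perm_mat_inv $$ (i, coord j)"
      by (rule mult_perm_mat[OF perm_mat_carrier(2) ij])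
    also have "\<dots> = 1\<^sub>m (p + q) $$ (i, j)"
      using ij coord_less coord_eq_iff[OF ij(2,1)] by (auto simp: perm_mat_inv_def)
    finally show "(perm_mat_inv * perm_mat) $$ (i, j) = 1\<^sub>m (p + q) $$ (i, j)" .
  qed (simp_all add: perm_mat_def perm_mat_inv_def)
  show "perm_mat * perm_mat_inv = 1\<^sub>m (p + q)"
    by (rule mat_mult_left_right_inverse[OF perm_mat_carrier(2,1) *])
qed

lemma perm_mat_GL: "perm_mat \<in> GL (p + q)" "perm_mat_inv \<in> GL (p + q)"
  unfolding GL_iff using perm_mat_carrier perm_mat_inverse by blast+

lemma perm_mat_conj:
  assumes "k \<in> carrier_mat (p + q) (p + q)" "k' \<in> carrier_mat (p + q) (p + q)"
    and eq: "\<And>r c. r < p + q \<Longrightarrow> c < p + q \<Longrightarrow> k $$ (coord r, coord c) = k' $$ (r, c)"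
  shows "k * perm_mat = perm_mat * k'"
proof (rule eq_matI)
  fix i c assume "i < dim_row (perm_mat * k')" "c < dim_col (perm_mat * k')"
  then have ic: "i < p + q" "c < p + q" using assms(2) by (simp_all add: perm_mat_def)
  obtain r where r: "r < p + q" "i = coord r" using coord_surj[OF ic(1)] by blast
  have "(k * perm_mat) $$ (i, c) = k $$ (coord r, coord c)" using mult_perm_mat[OF assms(1) ic] r by simp
  also have "\<dots> = (perm_mat * k') $$ (i, c)" using eq[OF r(1) ic(2)] perm_mat_mult[OF assms(2) r(1) ic(2)] r(2) by simp
  finally show "(k * perm_mat) $$ (i, c) = (perm_mat * k') $$ (i, c)" .
qed (use assms(1,2) in \<open>simp_all add: perm_mat_def\<close>)

sublocale chart: clan_chart "p + q" "\<lambda>c. Suc c \<in> D" "{(a, b). (Suc a, Suc b) \<in> arcs \<gamma>}" perm_mat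
proof
  fix a b assume "(a, b) \<in> {(a, b). (Suc a, Suc b) \<in> arcs \<gamma>}"
  then have ab: "(Suc a, Suc b) \<in> arcs \<gamma>" by simp
  show "a < b \<and> b < p + q \<and> Suc a \<in> D \<and> Suc b \<notin> D"
    using arc_bounds[OF ab] arc_D[OF ab] arc_U[OF ab] by auto
next
  fix a b b' assume "(a, b) \<in> {(a, b). (Suc a, Suc b) \<in> arcs \<gamma>}" "(a, b') \<in> {(a, b). (Suc a, Suc b) \<in> arcs \<gamma>}"
  then show "b = b'" using arcs_left[of "Suc a" "Suc b" "Suc b'"] by simp
next
  fix a a' b assume "(a, b) \<in> {(a, b). (Suc a, Suc b) \<in> arcs \<gamma>}" "(a', b) \<in> {(a, b). (Suc a, Suc b) \<in> arcs \<gamma>}"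
  then show "a = a'" using arcs_right[of "Suc a" "Suc b" "Suc a'"] by simp
qed (rule perm_mat_GL)

lemma col_perm_mat: "c < p + q \<Longrightarrow> Matrix.col perm_mat c = unit_vec (p + q) (coord c)"
  by (rule eq_vecI) (auto simp: perm_mat_def unit_vec_def)

lemma perm_flag_eq: "perm_flag (p + q) (clan_perm p \<gamma>) = flag_of (p + q) perm_mat"
proof -
  have "map (\<lambda>i. basis_vec (p + q) (clan_perm p \<gamma> i)) [1..<Suc (p + q)] = cols perm_mat"
  proof (rule nth_equalityI)
    show "length (map (\<lambda>i. basis_vec (p + q) (clan_perm p \<gamma> i)) [1..<Suc (p + q)]) = length (cols perm_mat)"
      by (simp add: perm_mat_def del: upt_Suc)
    fix c assume "c < length (map (\<lambda>i. basis_vec (p + q) (clan_perm p \<gamma> i)) [1..<Suc (p + q)])"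
    then have c: "c < p + q" by (simp del: upt_Suc)
    then show "map (\<lambda>i. basis_vec (p + q) (clan_perm p \<gamma> i)) [1..<Suc (p + q)] ! c = cols perm_mat ! c"
      using col_perm_mat[OF c] perm_mat_carrier(1) by (simp add: basis_vec_def coord_def del: upt_Suc)
  qed
  then show ?thesis by (simp only: perm_flag_def flag_of_def)
qed

lemma clan_matrix_carrier: "chart.clan_matrix \<in> carrier_mat (p + q) (p + q)"
  by (simp add: chart.clan_matrix_def)

text \<open>\<open>clan_matrix\<close> adds to the column of each left endpoint the unit vector of
  its partner, and the permutation matrix renames unit vectors by \<open>coord\<close>.\<close>

lemma clan_vec_eq:
  assumes c: "c < p + q"
  shows "clan_vec p q \<gamma> (Suc c) = Matrix.col (perm_mat * chart.clan_matrix) c"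
proof (rule eq_vecI)
  show "dim_vec (clan_vec p q \<gamma> (Suc c)) = dim_vec (Matrix.col (perm_mat * chart.clan_matrix) c)"
    by (simp add: clan_vec_def basis_vec_def perm_mat_def)
  fix i assume "i < dim_vec (Matrix.col (perm_mat * chart.clan_matrix) c)"
  then have i: "i < p + q" by (simp add: perm_mat_def)
  obtain r where r: "r < p + q" "i = coord r" using coord_surj[OF i] .
  have rhs: "Matrix.col (perm_mat * chart.clan_matrix) c $ i = (if r = c \<or> (Suc c, Suc r) \<in> arcs \<gamma> then 1 else 0)"
  proof -
    have "Matrix.col (perm_mat * chart.clan_matrix) c $ i = (perm_mat * chart.clan_matrix) $$ (i, c)"
      using i c by (simp add: perm_mat_def chart.clan_matrix_def)
    also have "\<dots> = chart.clan_matrix $$ (r, c)"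
      unfolding r(2) by (rule perm_mat_mult[OF clan_matrix_carrier r(1) c])
    finally show ?thesis using r(1) c by (simp add: chart.clan_matrix_def)
  qed
  have basis: "basis_vec (p + q) (clan_perm p \<gamma> (Suc b)) $ i = (if r = b then 1 else 0)" if "b < p + q" for b
    using coord_less[OF that] coord_less[OF r(1)] coord_eq_iff[OF r(1) that]
    unfolding basis_vec_def coord_def[symmetric] r(2) by simp
  show "clan_vec p q \<gamma> (Suc c) $ i = Matrix.col (perm_mat * chart.clan_matrix) c $ i"
  proof (cases "Suc c \<in> left_ends \<gamma>")
    case True
    then obtain b' where b': "(Suc c, b') \<in> arcs \<gamma>" unfolding left_ends_iff by blast
    then obtain b where b: "b' = Suc b" using arc_bounds[OF b'] by (cases b') auto
    have bn: "b < p + q" "c < b" using arc_bounds[OF b'] b by simp_all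
    have the: "(THE j. (Suc c, j) \<in> arcs \<gamma>) = Suc b"
      using b' b arcs_left[OF b'] by (intro the_equality) auto
    have "clan_vec p q \<gamma> (Suc c) $ i = basis_vec (p + q) (clan_perm p \<gamma> (Suc c)) $ i + basis_vec (p + q) (clan_perm p \<gamma> (Suc b)) $ i"
      using True i by (simp add: clan_vec_def the basis_vec_def)
    also have "\<dots> = (if r = c \<or> r = b then 1 else 0)" using bn by (simp add: basis[OF c] basis[OF bn(1)])
    also have "\<dots> = (if r = c \<or> (Suc c, Suc r) \<in> arcs \<gamma> then 1 else 0)"
    proof -
      have "(Suc c, Suc r) \<in> arcs \<gamma> \<longleftrightarrow> r = b"
      proof
        assume "(Suc c, Suc r) \<in> arcs \<gamma>"
        from arcs_left[OF b' this] show "r = b" unfolding b by simp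
      next
        assume "r = b"
        then show "(Suc c, Suc r) \<in> arcs \<gamma>" using b' unfolding b by simp
      qed
      then show ?thesis by simp
    qed
    finally show ?thesis by (simp only: rhs)
  next
    case False
    then have "(Suc c, Suc r) \<notin> arcs \<gamma>" unfolding left_ends_iff by blast
    then show ?thesis using False basis[OF c] by (simp add: clan_vec_def rhs)
  qed
qed

lemma clan_flag_eq: "clan_flag p q \<gamma> = flag_of (p + q) (perm_mat * chart.clan_matrix)"
proof -
  have "map (clan_vec p q \<gamma>) [1..<Suc (p + q)] = cols (perm_mat * chart.clan_matrix)"
  proof (rule nth_equalityI)
    show "length (map (clan_vec p q \<gamma>) [1..<Suc (p + q)]) = length (cols (perm_mat * chart.clan_matrix))"
      by (simp add: chart.clan_matrix_def del: upt_Suc)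
    fix c assume "c < length (map (clan_vec p q \<gamma>) [1..<Suc (p + q)])"
    then have c: "c < p + q" by (simp del: upt_Suc)
    then show "map (clan_vec p q \<gamma>) [1..<Suc (p + q)] ! c = cols (perm_mat * chart.clan_matrix) ! c"
      using clan_vec_eq[OF c] clan_matrix_carrier by (simp del: upt_Suc)
  qed
  then show ?thesis by (simp only: clan_flag_def flag_of_def)
qed

text \<open>\<open>coord\<close> sends the nodes of \<open>D\<close> to the first \<open>p\<close>
  coordinates, so conjugation by the permutation matrix exchanges the block diagonal matrices with
  those that respect the division of the nodes.\<close>

lemma block_diag_group_eq:
  "(\<lambda>k. k * perm_mat) ` block_diag_group p q = (\<lambda>k. perm_mat * k) ` chart.block_group"
proof (rule Set.set_eqI, rule iffI)
  fix x assume "x \<in> (\<lambda>k. k * perm_mat) ` block_diag_group p q"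
  then obtain a d where ad: "a \<in> GL p" "d \<in> GL q"
    and x: "x = four_block_mat a (0\<^sub>m p q) (0\<^sub>m q p) d * perm_mat"
    unfolding block_diag_group_def by blast
  have adc: "a \<in> carrier_mat p p" "d \<in> carrier_mat q q" using ad GL_carrier by blast+
  define k where "k = four_block_mat a (0\<^sub>m p q) (0\<^sub>m q p) d"
  have k: "k \<in> GL (p + q)" unfolding k_def four_block_GL[OF adc] using ad by simp
  define k' where "k' = mat (p + q) (p + q) (\<lambda>(r, c). k $$ (coord r, coord c))"
  have k'c: "k' \<in> carrier_mat (p + q) (p + q)" by (simp add: k'_def)
  have eq: "k * perm_mat = perm_mat * k'"
    by (rule perm_mat_conj[OF GL_carrier[OF k] k'c]) (simp add: k'_def)
  have "perm_mat_inv * (k * perm_mat) = k'"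
    unfolding eq using assoc_mult_mat[OF perm_mat_carrier(2,1) k'c] k'c by (simp add: perm_mat_inverse)
  then have "k' \<in> GL (p + q)" using mult_GL[OF perm_mat_GL(2) mult_GL[OF k perm_mat_GL(1)]] by simp
  moreover have "chart.block k'"
    unfolding chart.block_def
  proof (intro conjI allI impI)
    fix r c assume rc: "r < p + q" "c < p + q" "(Suc r \<in> D) \<noteq> (Suc c \<in> D)"
    then show "k' $$ (r, c) = 0"
      using coord_less_p[OF rc(1)] coord_less_p[OF rc(2)] coord_less[OF rc(1)] coord_less[OF rc(2)] adc
      by (auto simp: k'_def k_def)
  qed (rule k'c)
  ultimately have "k' \<in> chart.block_group" by (simp add: chart.block_group_def)
  then show "x \<in> (\<lambda>k. perm_mat * k) ` chart.block_group" using x eq unfolding k_def by blast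
next
  fix x assume "x \<in> (\<lambda>k. perm_mat * k) ` chart.block_group"
  then obtain k' where k': "k' \<in> GL (p + q)" "chart.block k'" and x: "x = perm_mat * k'"
    unfolding chart.block_group_def by blast
  note k'c = GL_carrier[OF k'(1)]
  define k where "k = perm_mat * k' * perm_mat_inv"
  have k: "k \<in> GL (p + q)" unfolding k_def by (intro mult_GL perm_mat_GL k'(1))
  have Pk: "perm_mat * k' \<in> carrier_mat (p + q) (p + q)" using perm_mat_carrier k'c by simp
  have eq: "k * perm_mat = perm_mat * k'"
    unfolding k_def using assoc_mult_mat[OF Pk perm_mat_carrier(2,1)] right_mult_one_mat[OF Pk] by (simp add: perm_mat_inverse)
  have entry: "k $$ (coord r, coord c) = k' $$ (r, c)" if "r < p + q" "c < p + q" for r c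
    using mult_perm_mat[OF GL_carrier[OF k] coord_less[OF that(1)] that(2)] perm_mat_mult[OF k'c that]
    unfolding eq by simp
  have zero: "k $$ (i, j) = 0" if i: "i < p + q" and j: "j < p + q" and ij: "(i < p) \<noteq> (j < p)" for i j
  proof -
    obtain r where r: "r < p + q" "i = coord r" using coord_surj[OF i] .
    obtain c where c: "c < p + q" "j = coord c" using coord_surj[OF j] .
    have "k' $$ (r, c) = 0"
      using k'(2) ij coord_less_p[OF r(1)] coord_less_p[OF c(1)] r c unfolding chart.block_def by blast
    then show ?thesis using entry[OF r(1) c(1)] r c by simp
  qed
  define a where "a = mat p p (\<lambda>(i, j). k $$ (i, j))"
  define d where "d = mat q q (\<lambda>(i, j). k $$ (p + i, p + j))"
  have adc: "a \<in> carrier_mat p p" "d \<in> carrier_mat q q" by (simp_all add: a_def d_def)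
  have k_eq: "k = four_block_mat a (0\<^sub>m p q) (0\<^sub>m q p) d"
  proof (rule eq_matI)
    fix i j assume "i < dim_row (four_block_mat a (0\<^sub>m p q) (0\<^sub>m q p) d)" "j < dim_col (four_block_mat a (0\<^sub>m p q) (0\<^sub>m q p) d)"
    then have ij: "i < p + q" "j < p + q" using adc by simp_all
    then show "k $$ (i, j) = four_block_mat a (0\<^sub>m p q) (0\<^sub>m q p) d $$ (i, j)"
      using zero[OF ij] by (auto simp: a_def d_def)
  qed (use GL_carrier[OF k] adc in simp_all)
  then have "a \<in> GL p" "d \<in> GL q" using k four_block_GL[OF adc] by simp_all
  then have "k \<in> block_diag_group p q" unfolding block_diag_group_def k_eq by blast
  then show "x \<in> (\<lambda>k. k * perm_mat) ` block_diag_group p q"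
    by (intro image_eqI[of _ _ k]) (simp_all add: x eq)
qed

lemma block_diag_group_carrier: "k \<in> block_diag_group p q \<Longrightarrow> k \<in> carrier_mat (p + q) (p + q)"
  unfolding block_diag_group_def using GL_carrier by fastforce

text \<open>The permutation matrix is moved across the group elements, which identifies the two
  orbits before closures are taken.\<close>

lemma orbit_closure_eq: "orbit_closure p q \<gamma> = chart.clan_closure"
proof -
  have left: "flag_act k (clan_flag p q \<gamma>) = flag_of (p + q) (k * perm_mat * chart.clan_matrix)"
    if "k \<in> block_diag_group p q" for k
  proof -
    note kc = block_diag_group_carrier[OF that]
    have "perm_mat * chart.clan_matrix \<in> carrier_mat (p + q) (p + q)"
      using perm_mat_carrier(1) clan_matrix_carrier by simp
    from flag_act_flag_of[OF kc this] show ?thesis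
      unfolding clan_flag_eq by (simp only: assoc_mult_mat[OF kc perm_mat_carrier(1) clan_matrix_carrier])
  qed
  have right: "flag_of (p + q) (perm_mat * (k * chart.clan_matrix)) = flag_of (p + q) (perm_mat * k * chart.clan_matrix)"
    if "k \<in> chart.block_group" for k
  proof -
    have "k \<in> carrier_mat (p + q) (p + q)" using that GL_carrier by (simp add: chart.block_group_def)
    then show ?thesis by (simp only: assoc_mult_mat[OF perm_mat_carrier(1) _ clan_matrix_carrier])
  qed
  have "{flag_act k (clan_flag p q \<gamma>) | k. k \<in> block_diag_group p q} =
      (\<lambda>x. flag_of (p + q) (x * chart.clan_matrix)) ` (\<lambda>k. k * perm_mat) ` block_diag_group p q"
    unfolding setcompr_eq_image Collect_mem_eq image_image by (rule image_cong[OF refl left])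
  also have "\<dots> = chart.clan_orbit"
    unfolding block_diag_group_eq image_image chart.clan_orbit_def setcompr_eq_image Collect_mem_eq
    by (rule image_cong[OF refl right[symmetric]])
  finally show ?thesis by (simp only: orbit_closure_def chart.clan_closure_def)
qed

text \<open>A shift of the numbering by one; the bound \<open>a \<le> Suc c\<close> also admits
  \<open>a = 0\<close>, which is not a node and starts no arc.\<close>

lemma bad_iff: "chart.bad r c \<longleftrightarrow> bad_pair (Suc c) (Suc r)"
proof -
  have "(\<exists>(a, b)\<in>{(a, b). (Suc a, Suc b) \<in> arcs \<gamma>}. a < c \<and> r < b) \<longleftrightarrow> (\<exists>(a, b)\<in>arcs \<gamma>. a < Suc c \<and> Suc r < b)"
  proof
    assume "\<exists>(a, b)\<in>{(a, b). (Suc a, Suc b) \<in> arcs \<gamma>}. a < c \<and> r < b"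
    then obtain a b where "(Suc a, Suc b) \<in> arcs \<gamma>" "a < c" "r < b" by blast
    then show "\<exists>(a, b)\<in>arcs \<gamma>. a < Suc c \<and> Suc r < b" by (intro bexI[of _ "(Suc a, Suc b)"]) simp_all
  next
    assume "\<exists>(a, b)\<in>arcs \<gamma>. a < Suc c \<and> Suc r < b"
    then obtain a b where ab: "(a, b) \<in> arcs \<gamma>" "a < Suc c" "Suc r < b" by blast
    then have "Suc (a - 1) = a" "Suc (b - 1) = b" using arc_bounds[OF ab(1)] by simp_all
    then show "\<exists>(a, b)\<in>{(a, b). (Suc a, Suc b) \<in> arcs \<gamma>}. a < c \<and> r < b"
      using ab arc_bounds[OF ab(1)] by (intro bexI[of _ "(a - 1, b - 1)"]) auto
  qed
  moreover have "(\<forall>b\<ge>r. (c, b) \<notin> {(a, b). (Suc a, Suc b) \<in> arcs \<gamma>}) \<longleftrightarrow> (\<forall>b\<ge>Suc r. (Suc c, b) \<notin> arcs \<gamma>)"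
    by (auto simp: Suc_le_eq elim!: less_natE dest: Suc_le_D)
  moreover have "(\<forall>a\<le>c. (a, r) \<notin> {(a, b). (Suc a, Suc b) \<in> arcs \<gamma>}) \<longleftrightarrow> (\<forall>a\<le>Suc c. (a, Suc r) \<notin> arcs \<gamma>)"
  proof -
    have "(0, Suc r) \<notin> arcs \<gamma>" using arc_bounds[of 0 "Suc r"] by auto
    then have "(a, Suc r) \<notin> arcs \<gamma>" if "\<forall>a\<le>c. (Suc a, Suc r) \<notin> arcs \<gamma>" "a \<le> Suc c" for a
      using that by (cases a) simp_all
    then show ?thesis by auto
  qed
  moreover have "chart.mixed r c \<longleftrightarrow> Suc c \<in> D \<and> Suc r \<in> U \<and> Suc c < Suc r"
    unfolding chart.mixed_def by auto
  ultimately show ?thesis unfolding chart.bad_def bad_pair_def by argo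
qed

lemma smooth_iff: "smooth_at (p + q) (orbit_closure p q \<gamma>) (perm_flag (p + q) (clan_perm p \<gamma>)) \<longleftrightarrow>
    \<not> (\<exists>c r. bad_pair c r)"
proof -
  have "(\<exists>r c. chart.bad r c) \<longleftrightarrow> (\<exists>c r. bad_pair c r)"
  proof
    assume "\<exists>c r. bad_pair c r"
    then obtain c r where cr: "bad_pair c r" by blast
    then have "c = Suc (c - 1)" "r = Suc (r - 1)" using D_le[of c] by (auto simp: bad_pair_def)
    then have "chart.bad (r - 1) (c - 1)" using cr bad_iff[of "r - 1" "c - 1"] by simp
    then show "\<exists>r c. chart.bad r c" by blast
  qed (use bad_iff in blast)
  then show ?thesis unfolding orbit_closure_eq perm_flag_eq chart.smooth_iff_no_bad by blast
qed

end

theorem theoremD: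
  fixes p q n :: nat and \<gamma> :: clan
  assumes "1 \<le> p" and "1 \<le> q" and "n = p + q" and "is_clan p q \<gamma>"
  shows "(smooth_at n (orbit_closure p q \<gamma>) (perm_flag n (clan_perm p \<gamma>)) \<longleftrightarrow>
            (\<exists>!T. bpd_fragment p q \<gamma> T)) \<and>
         ((\<exists>!T. bpd_fragment p q \<gamma> T) \<longleftrightarrow> (\<forall>\<sigma> \<in> five_patterns. avoids \<gamma> \<sigma>))"
proof -
  interpret pq_clan p q \<gamma>
    by unfold_locales (rule assms)
  show ?thesis
    unfolding \<open>n = p + q\<close> smooth_iff ex1_bpd_fragment_iff avoids_iff by simp
qed

end
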